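(* Let $\Bbbk$ be a commutative ring of characteristic not equal to two, $z\in\Bbbk$, and $r,s\in\mathbb{N}$. There is an isomorphism of associative superalgebras $$\mathrm{BC}_{r,s}(z)\xrightarrow{\cong}\mathrm{End}_{\mathcal{Q}(z)}(\uparrow^{\otimes r}\otimes\downarrow^{\otimes s})$$ given on generators by $t_i\mapsto\, 1_\uparrow^{\otimes(i-1)}\otimes u^+\otimes 1_\uparrow^{\otimes(r-i-1)}\otimes 1_\downarrow^{\otimes s}$ for $1\le i\le r-1$; $t_i^*\mapsto 1_\uparrow^{\otimes r}\otimes1_\downarrow^{\otimes(i-1)}\otimes d^+\otimes1_\downarrow^{\otimes(s-i-1)}$ for $1\le i\le s-1$; $e\mapsto1_\uparrow^{\otimes(r-1)}\otimes(\mathrm{cup}_L\circ\mathrm{cap}_R)\otimes1_\downarrow^{\otimes(s-1)}$ if $r,s>0$; $\pi_i\mapsto1_\uparrow^{\otimes(i-1)}\otimes c\otimes1_\uparrow^{\otimes(r-i)}\otimes1_\downarrow^{\otimes s}$ for $1\le i\le r$; $\pi_i^*\mapsto1_\uparrow^{\otimes r}\otimes1_\downarrow^{\otimes(i-1)}\otimes c^\downarrow\otimes1_\downarrow^{\otimes(s-i)}$ for $1\le i\le s$.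
   Context: $\mathbb{N}$ is the set of nonnegative integers. Everything is $\Bbbk$-linear. A supercategory is a category enriched in vector superspaces ($\mathbb{Z}/2$-graded $\Bbbk$-modules) with parity-preserving maps; $\bar f$ is the parity of a homogeneous $f$. In a strict monoidal supercategory (unit $\mathbb{1}$, identities $1_X$) the super interchange law holds: $(f'\otimes g)\circ(f\otimes g')=(-1)^{\bar f\bar g}(f'\circ f)\otimes(g\circ g')$. **The supercategory $\mathcal{Q}(z)$** (quantum isomeric supercategory). It is the strict monoidal supercategory generated by objects $\uparrow,\downarrow$; even morphisms $u^+,u^-\colon\uparrow\otimes\uparrow\to\uparrow\otimes\uparrow$, $r^-\colon\uparrow\otimes\downarrow\to\downarrow\otimes\uparrow$, $\mathrm{cap}_L\colon\downarrow\otimes\uparrow\to\mathbb{1}$, $\mathrm{cup}_L\colon\mathbb{1}\to\uparrow\otimes\downarrow$; and an odd morphism $c\colon\uparrow\to\uparrow$; subject to: $u^-u^+=1=u^+u^-$; $l^+r^-=1_{\uparrow\otimes\downarrow}$; $r^-l^+=1_{\downarrow\otimes\uparrow}$; $(u^+\otimes1_\uparrow)(1_\uparrow\otimes u^+)(u^+\otimes1_\uparrow)=(1_\uparrow\otimes u^+)(u^+\otimes1_\uparrow)(1_\uparrow\otimes u^+)$; $u^+-u^-=z\,1_{\uparrow\otimes\uparrow}$; $c^2=-1_\uparrow$; $u^+(c\otimes1_\uparrow)=(1_\uparrow\otimes c)u^+$; $\mathrm{cap}_R(c\otimes1_\downarrow)\mathrm{cup}_L=0=\mathrm{cap}_R\,\mathrm{cup}_L$;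 $(1_\uparrow\otimes\mathrm{cap}_L)(\mathrm{cup}_L\otimes1_\uparrow)=1_\uparrow$; $(\mathrm{cap}_L\otimes1_\downarrow)(1_\downarrow\otimes\mathrm{cup}_L)=1_\downarrow$. Here (writing $\Phi(f)=(\mathrm{cap}_L\otimes1)(1_\downarrow\otimes f\otimes1_\downarrow)(1\otimes\mathrm{cup}_L)$): $l^+:=\Phi(u^+)\colon\downarrow\otimes\uparrow\to\uparrow\otimes\downarrow$; $d^+:=\Phi(l^+)\colon\downarrow\otimes\downarrow\to\downarrow\otimes\downarrow$; $\mathrm{cap}_R:=\mathrm{cap}_L\circ r^-\colon\uparrow\otimes\downarrow\to\mathbb{1}$; $c^\downarrow:=\Phi(c)\colon\downarrow\to\downarrow$. **The superalgebra $\mathrm{BC}_{r,s}(z)$** (quantum walled Brauer--Clifford superalgebra). For $r,s>0$ it is the associative superalgebra generated by even elements $t_1,\dots,t_{r-1},t_1^*,\dots,t_{s-1}^*,e$ and odd elements $\pi_1,\dots,\pi_r,\pi_1^*,\dots,\pi_s^*$ subject to (for $i,j$ in the allowable range): - $t_i^2=zt_i+1$; $(t_i^* )^2=zt_i^*+1$; $t_it_{i+1}t_i=t_{i+1}t_it_{i+1}$; $t_i^*t_{i+1}^*t_i^*=t_{i+1}^*t_i^*t_{i+1}^*$; $t_it_j=t_jt_i$ and $t_i^*t_j^*=t_j^*t_i^*$ for $|i-j|>1$; $t_it_j^*=t_j^*t_i$; - $\pi_i^2=-1$; $\pi_i\pi_j=-\pi_j\pi_i$ for $i\ne j$; $(\pi_i^*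 )^2=1$; $\pi_i^*\pi_j^*=-\pi_j^*\pi_i^*$ for $i\ne j$; $\pi_i\pi_j^*=-\pi_j^*\pi_i$; - $t_i\pi_i=\pi_{i+1}t_i$; $t_i^*\pi_i^*=\pi_{i+1}^*t_i^*$; $t_i\pi_j=\pi_jt_i$ and $t_i^*\pi_j^*=\pi_j^*t_i^*$ for $j\ne i,i+1$; $t_i\pi_j^*=\pi_j^*t_i$; $t_i^*\pi_j=\pi_jt_i^*$; - $e^2=0$; $et_{r-1}e=e$; $et_j=t_je$ for $j\ne r-1$; $et_1^*e=e$; $et_j^*=t_j^*e$ for $j\ne1$; - $\pi_re=\pi_1^*e$; $e\pi_r=e\pi_1^*$; $\pi_je=e\pi_j$ for $j\ne r$; $\pi_j^*e=e\pi_j^*$ for $j\ne1$; - $et_{r-1}^{-1}t_1^*et_1^*t_{r-1}^{-1}=t_{r-1}^{-1}t_1^*et_1^*t_{r-1}^{-1}e$; $e\pi_re=0$. (Note $t_i^{-1}=t_i-z$.) For $r>0$, $\mathrm{BC}_{r,0}(z)$ is the associative superalgebra generated by even elements $t_1,\dots,t_{r-1}$ and odd elements $\pi_1,\dots,\pi_r$ subject to the relations (for $i,j$ in the allowable range) $t_i^2=zt_i+1$; $t_it_{i+1}t_i=t_{i+1}t_it_{i+1}$; $t_it_j=t_jt_i$ for $|i-j|>1$; $\pi_i^2=-1$; $\pi_i\pi_j=-\pi_j\pi_i$ for $i\ne j$; $t_i\pi_i=\pi_{i+1}t_i$; $t_i\pi_j=\pi_jt_i$ for $j\ne i,i+1$.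 For $s>0$, $\mathrm{BC}_{0,s}(z)$ is the associative superalgebra generated by even elements $t_1^*,\dots,t_{s-1}^*$ and odd elements $\pi_1^*,\dots,\pi_s^*$ subject to the relations (for $i,j$ in the allowable range) $(t_i^* )^2=zt_i^*+1$; $t_i^*t_{i+1}^*t_i^*=t_{i+1}^*t_i^*t_{i+1}^*$; $t_i^*t_j^*=t_j^*t_i^*$ for $|i-j|>1$; $(\pi_i^* )^2=1$; $\pi_i^*\pi_j^*=-\pi_j^*\pi_i^*$ for $i\ne j$; $t_i^*\pi_i^*=\pi_{i+1}^*t_i^*$; $t_i^*\pi_j^*=\pi_j^*t_i^*$ for $j\ne i,i+1$. Finally, $\mathrm{BC}_{0,0}(z)=\Bbbk$. *)

theory Defs
  imports "HOL-Algebra.QuotRing" "HOL-Library.Z2"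
begin

section \<open>Associative superalgebras\<close>

text \<open>
  The ground ring is the type \<open>'k :: comm_ring_1\<close>; parities live in the two-element field \<open>bit\<close>.
  An algebra is a ring record of HOL-Algebra together with a scalar multiplication and the
  two homogeneous components \<open>part A 0\<close> (even) and \<open>part A 1\<close> (odd).
\<close>

record ('k, 'a) superalg = "'a ring" +
  scal :: "'k \<Rightarrow> 'a \<Rightarrow> 'a"
  part :: "bit \<Rightarrow> 'a set"

locale superalgebra = ring A
  for A :: "('k::comm_ring_1, 'a, 'm) superalg_scheme" (structure) +
  assumes scal_closed: "x \<in> carrier A \<Longrightarrow> scal A c x \<in> carrier A"
    and scal_add: "x \<in> carrier A \<Longrightarrow> y \<in> carrier A \<Longrightarrow>
      scal A c (x \<oplus> y) = scal A c x \<oplus> scal A c y"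
    and add_scal: "x \<in> carrier A \<Longrightarrow> scal A (c + d) x = scal A c x \<oplus> scal A d x"
    and scal_scal: "x \<in> carrier A \<Longrightarrow> scal A c (scal A d x) = scal A (c * d) x"
    and scal_one: "x \<in> carrier A \<Longrightarrow> scal A 1 x = x"
    and scal_mult_left: "x \<in> carrier A \<Longrightarrow> y \<in> carrier A \<Longrightarrow>
      scal A c x \<otimes> y = scal A c (x \<otimes> y)"
    and scal_mult_right: "x \<in> carrier A \<Longrightarrow> y \<in> carrier A \<Longrightarrow>
      x \<otimes> scal A c y = scal A c (x \<otimes> y)"
    and part_carrier: "part A p \<subseteq> carrier A"
    and part_zero: "\<zero> \<in> part A p"
    and part_add: "x \<in> part A p \<Longrightarrow> y \<in> part A p \<Longrightarrow> x \<oplus> y \<in> part A p"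
    and part_scal: "x \<in> part A p \<Longrightarrow> scal A c x \<in> part A p"
    and part_decomp: "x \<in> carrier A \<Longrightarrow>
      \<exists>!(a, b). a \<in> part A 0 \<and> b \<in> part A 1 \<and> x = a \<oplus> b"
    and part_one: "\<one> \<in> part A 0"
    and part_mult: "x \<in> part A p \<Longrightarrow> y \<in> part A q \<Longrightarrow> x \<otimes> y \<in> part A (p + q)"

definition superalgebra_iso ::
  "('k::comm_ring_1, 'a, 'm) superalg_scheme \<Rightarrow> ('k, 'b, 'n) superalg_scheme \<Rightarrow> ('a \<Rightarrow> 'b) set"
  where "superalgebra_iso A B = {h. superalgebra A \<and> superalgebra B \<and> h \<in> ring_iso A B \<and>
    (\<forall>c. \<forall>x\<in>carrier A. h (scal A c x) = scal B c (h x)) \<and>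
    (\<forall>p. h ` part A p = part B p)}"

text \<open>
  Both algebras below are quotients of a set \<open>T\<close> of formal expressions by a congruence \<open>E\<close>, where
  \<open>H p x\<close> says that the expression \<open>x\<close> is homogeneous of parity \<open>p\<close>.
\<close>

definition quotient_superalg ::
  "'t set \<Rightarrow> ('t \<times> 't) set \<Rightarrow> ('t \<Rightarrow> 't \<Rightarrow> 't) \<Rightarrow> 't \<Rightarrow> ('t \<Rightarrow> 't \<Rightarrow> 't) \<Rightarrow> 't \<Rightarrow>
   ('k \<Rightarrow> 't \<Rightarrow> 't) \<Rightarrow> (bit \<Rightarrow> 't \<Rightarrow> bool) \<Rightarrow> ('k, 't set) superalg"
  where "quotient_superalg T E plus0 zero0 times0 one0 scale0 H =
    \<lparr>carrier = T // E,
     mult = (\<lambda>A B. \<Union>a\<in>A. \<Union>b\<in>B. E `` {times0 a b}),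
     one = E `` {one0},
     zero = E `` {zero0},
     add = (\<lambda>A B. \<Union>a\<in>A. \<Union>b\<in>B. E `` {plus0 a b}),
     scal = (\<lambda>c A. \<Union>a\<in>A. E `` {scale0 c a}),
     part = (\<lambda>p. {E `` {x} | x. x \<in> T \<and> H p x})\<rparr>"


section \<open>Superalgebras given by generators and relations\<close>

datatype (agens: 'g, dead 'k) aterm =
    AGen 'g
  | AOne
  | AZero
  | AMul "('g, 'k) aterm" "('g, 'k) aterm"  (infixl \<open>\<cdot>\<close> 70)
  | AAdd "('g, 'k) aterm" "('g, 'k) aterm"  (infixl \<open>\<boxplus>\<close> 65)
  | AScale 'k "('g, 'k) aterm"  (infixr \<open>*\<^sub>a\<close> 75)

inductive ahomog :: "('g \<Rightarrow> bit) \<Rightarrow> bit \<Rightarrow> ('g, 'k) aterm \<Rightarrow> bool"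
  for par :: "'g \<Rightarrow> bit"
  where
    "ahomog par (par g) (AGen g)"
  | "ahomog par 0 AOne"
  | "ahomog par p AZero"
  | "ahomog par p x \<Longrightarrow> ahomog par q y \<Longrightarrow> ahomog par (p + q) (x \<cdot> y)"
  | "ahomog par p x \<Longrightarrow> ahomog par p y \<Longrightarrow> ahomog par p (x \<boxplus> y)"
  | "ahomog par p x \<Longrightarrow> ahomog par p (c *\<^sub>a x)"

definition aterms :: "'g set \<Rightarrow> ('g, 'k) aterm set"
  where "aterms G = {x. agens x \<subseteq> G}"

text \<open>
  The smallest congruence on expressions over the generating set \<open>G\<close> that contains the relations
  \<open>R\<close> and makes the quotient an associative unital algebra. A pair in \<open>R\<close> that mentions an element
  outside \<open>G\<close> is ignored.
\<close>

inductive_set acong ::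
  "'g set \<Rightarrow> (('g, 'k::comm_ring_1) aterm \<times> ('g, 'k) aterm) set \<Rightarrow>
   (('g, 'k) aterm \<times> ('g, 'k) aterm) set"
  for G :: "'g set" and R :: "(('g, 'k::comm_ring_1) aterm \<times> ('g, 'k) aterm) set"
  where
    rel: "(x, y) \<in> R \<Longrightarrow> x \<in> aterms G \<Longrightarrow> y \<in> aterms G \<Longrightarrow> (x, y) \<in> acong G R"
  | refl: "x \<in> aterms G \<Longrightarrow> (x, x) \<in> acong G R"
  | sym: "(x, y) \<in> acong G R \<Longrightarrow> (y, x) \<in> acong G R"
  | trans: "(x, y) \<in> acong G R \<Longrightarrow> (y, w) \<in> acong G R \<Longrightarrow> (x, w) \<in> acong G R"
  | mul_cong: "(x, x') \<in> acong G R \<Longrightarrow> (y, y') \<in> acong G R \<Longrightarrow> (x \<cdot> y, x' \<cdot> y') \<in> acong G R"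
  | add_cong: "(x, x') \<in> acong G R \<Longrightarrow> (y, y') \<in> acong G R \<Longrightarrow> (x \<boxplus> y, x' \<boxplus> y') \<in> acong G R"
  | scale_cong: "(x, x') \<in> acong G R \<Longrightarrow> (c *\<^sub>a x, c *\<^sub>a x') \<in> acong G R"
  | add_assoc: "x \<in> aterms G \<Longrightarrow> y \<in> aterms G \<Longrightarrow> w \<in> aterms G \<Longrightarrow>
      (x \<boxplus> y \<boxplus> w, x \<boxplus> (y \<boxplus> w)) \<in> acong G R"
  | add_comm: "x \<in> aterms G \<Longrightarrow> y \<in> aterms G \<Longrightarrow> (x \<boxplus> y, y \<boxplus> x) \<in> acong G R"
  | add_zero: "x \<in> aterms G \<Longrightarrow> (x \<boxplus> AZero, x) \<in> acong G R"
  | zero_scale: "x \<in> aterms G \<Longrightarrow> (0 *\<^sub>a x, AZero) \<in> acong G R"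
  | one_scale: "x \<in> aterms G \<Longrightarrow> (1 *\<^sub>a x, x) \<in> acong G R"
  | scale_scale: "x \<in> aterms G \<Longrightarrow> (c *\<^sub>a d *\<^sub>a x, (c * d) *\<^sub>a x) \<in> acong G R"
  | scale_add: "x \<in> aterms G \<Longrightarrow> y \<in> aterms G \<Longrightarrow>
      (c *\<^sub>a (x \<boxplus> y), c *\<^sub>a x \<boxplus> c *\<^sub>a y) \<in> acong G R"
  | add_scale: "x \<in> aterms G \<Longrightarrow> ((c + d) *\<^sub>a x, c *\<^sub>a x \<boxplus> d *\<^sub>a x) \<in> acong G R"
  | mul_assoc: "x \<in> aterms G \<Longrightarrow> y \<in> aterms G \<Longrightarrow> w \<in> aterms G \<Longrightarrow>
      (x \<cdot> y \<cdot> w, x \<cdot> (y \<cdot> w)) \<in> acong G R"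
  | one_mul: "x \<in> aterms G \<Longrightarrow> (AOne \<cdot> x, x) \<in> acong G R"
  | mul_one: "x \<in> aterms G \<Longrightarrow> (x \<cdot> AOne, x) \<in> acong G R"
  | add_mul: "x \<in> aterms G \<Longrightarrow> y \<in> aterms G \<Longrightarrow> w \<in> aterms G \<Longrightarrow>
      ((x \<boxplus> y) \<cdot> w, x \<cdot> w \<boxplus> y \<cdot> w) \<in> acong G R"
  | mul_add: "x \<in> aterms G \<Longrightarrow> y \<in> aterms G \<Longrightarrow> w \<in> aterms G \<Longrightarrow>
      (x \<cdot> (y \<boxplus> w), x \<cdot> y \<boxplus> x \<cdot> w) \<in> acong G R"
  | scale_mul: "x \<in> aterms G \<Longrightarrow> y \<in> aterms G \<Longrightarrow> (c *\<^sub>a x \<cdot> y, c *\<^sub>a (x \<cdot> y)) \<in> acong G R"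
  | mul_scale: "x \<in> aterms G \<Longrightarrow> y \<in> aterms G \<Longrightarrow> (x \<cdot> (c *\<^sub>a y), c *\<^sub>a (x \<cdot> y)) \<in> acong G R"

definition presented_superalg ::
  "'g set \<Rightarrow> ('g \<Rightarrow> bit) \<Rightarrow> (('g, 'k::comm_ring_1) aterm \<times> ('g, 'k) aterm) set \<Rightarrow>
   ('k, ('g, 'k) aterm set) superalg"
  where "presented_superalg G par R =
    quotient_superalg (aterms G) (acong G R) (\<boxplus>) AZero (\<cdot>) AOne (*\<^sub>a) (ahomog par)"


section \<open>Strict monoidal supercategories given by generators and relations\<close>

text \<open>
  Objects are words in the generating objects \<open>'o\<close>, with concatenation as tensor product and the
  empty word as unit object. \<open>f \<bullet> g\<close> is the composite that applies \<open>g\<close> first.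
\<close>

record ('o, 'g) signature =
  sdom :: "'g \<Rightarrow> 'o list"
  scod :: "'g \<Rightarrow> 'o list"
  spar :: "'g \<Rightarrow> bit"

datatype ('o, 'g, 'k) mterm =
    MGen 'g
  | MId "'o list"
  | MZero "'o list" "'o list"
  | MComp "('o, 'g, 'k) mterm" "('o, 'g, 'k) mterm"  (infixl \<open>\<bullet>\<close> 68)
  | MTens "('o, 'g, 'k) mterm" "('o, 'g, 'k) mterm"  (infixl \<open>\<boxtimes>\<close> 70)
  | MAdd "('o, 'g, 'k) mterm" "('o, 'g, 'k) mterm"  (infixl \<open>\<uplus>\<close> 65)
  | MScale 'k "('o, 'g, 'k) mterm"  (infixr \<open>*\<^sub>m\<close> 75)

inductive typed ::
  "('o, 'g) signature \<Rightarrow> ('o, 'g, 'k) mterm \<Rightarrow> 'o list \<Rightarrow> 'o list \<Rightarrow> bool"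
  for S :: "('o, 'g) signature"
  where
    "typed S (MGen a) (sdom S a) (scod S a)"
  | "typed S (MId X) X X"
  | "typed S (MZero X Y) X Y"
  | "typed S f Y W \<Longrightarrow> typed S g X Y \<Longrightarrow> typed S (f \<bullet> g) X W"
  | "typed S f X Y \<Longrightarrow> typed S g X' Y' \<Longrightarrow> typed S (f \<boxtimes> g) (X @ X') (Y @ Y')"
  | "typed S f X Y \<Longrightarrow> typed S g X Y \<Longrightarrow> typed S (f \<uplus> g) X Y"
  | "typed S f X Y \<Longrightarrow> typed S (c *\<^sub>m f) X Y"

inductive mhomog :: "('o, 'g) signature \<Rightarrow> bit \<Rightarrow> ('o, 'g, 'k) mterm \<Rightarrow> bool"
  for S :: "('o, 'g) signature"
  where
    "mhomog S (spar S a) (MGen a)"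
  | "mhomog S 0 (MId X)"
  | "mhomog S p (MZero X Y)"
  | "mhomog S p f \<Longrightarrow> mhomog S q g \<Longrightarrow> mhomog S (p + q) (f \<bullet> g)"
  | "mhomog S p f \<Longrightarrow> mhomog S q g \<Longrightarrow> mhomog S (p + q) (f \<boxtimes> g)"
  | "mhomog S p f \<Longrightarrow> mhomog S p g \<Longrightarrow> mhomog S p (f \<uplus> g)"
  | "mhomog S p f \<Longrightarrow> mhomog S p (c *\<^sub>m f)"

definition koszul_sign :: "bit \<Rightarrow> bit \<Rightarrow> 'k::comm_ring_1"
  where "koszul_sign p q = (if p = 1 \<and> q = 1 then - 1 else 1)"

text \<open>
  \<open>mcong S R X Y f g\<close>: the well-typed expressions \<open>f, g : X \<rightarrow> Y\<close> denote the same morphism of the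
  strict monoidal supercategory generated by the signature \<open>S\<close> subject to the relations \<open>R\<close>. The
  interchange law is postulated for homogeneous \<open>f\<close> and \<open>g\<close>, the only parities that occur in its
  sign.
\<close>

inductive mcong ::
  "('o, 'g) signature \<Rightarrow> (('o, 'g, 'k::comm_ring_1) mterm \<times> ('o, 'g, 'k) mterm) set \<Rightarrow>
   'o list \<Rightarrow> 'o list \<Rightarrow> ('o, 'g, 'k) mterm \<Rightarrow> ('o, 'g, 'k) mterm \<Rightarrow> bool"
  for S :: "('o, 'g) signature"
    and R :: "(('o, 'g, 'k::comm_ring_1) mterm \<times> ('o, 'g, 'k) mterm) set"
  where
    rel: "(f, g) \<in> R \<Longrightarrow> typed S f X Y \<Longrightarrow> typed S g X Y \<Longrightarrow> mcong S R X Y f g"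
  | refl: "typed S f X Y \<Longrightarrow> mcong S R X Y f f"
  | sym: "mcong S R X Y f g \<Longrightarrow> mcong S R X Y g f"
  | trans: "mcong S R X Y f g \<Longrightarrow> mcong S R X Y g h \<Longrightarrow> mcong S R X Y f h"
  | comp_cong: "mcong S R Y W f f' \<Longrightarrow> mcong S R X Y g g' \<Longrightarrow>
      mcong S R X W (f \<bullet> g) (f' \<bullet> g')"
  | tens_cong: "mcong S R X Y f f' \<Longrightarrow> mcong S R X' Y' g g' \<Longrightarrow>
      mcong S R (X @ X') (Y @ Y') (f \<boxtimes> g) (f' \<boxtimes> g')"
  | add_cong: "mcong S R X Y f f' \<Longrightarrow> mcong S R X Y g g' \<Longrightarrow>
      mcong S R X Y (f \<uplus> g) (f' \<uplus> g')"
  | scale_cong: "mcong S R X Y f f' \<Longrightarrow> mcong S R X Y (c *\<^sub>m f) (c *\<^sub>m f')"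
  | add_assoc: "typed S f X Y \<Longrightarrow> typed S g X Y \<Longrightarrow> typed S h X Y \<Longrightarrow>
      mcong S R X Y (f \<uplus> g \<uplus> h) (f \<uplus> (g \<uplus> h))"
  | add_comm: "typed S f X Y \<Longrightarrow> typed S g X Y \<Longrightarrow> mcong S R X Y (f \<uplus> g) (g \<uplus> f)"
  | add_zero: "typed S f X Y \<Longrightarrow> mcong S R X Y (f \<uplus> MZero X Y) f"
  | zero_scale: "typed S f X Y \<Longrightarrow> mcong S R X Y (0 *\<^sub>m f) (MZero X Y)"
  | one_scale: "typed S f X Y \<Longrightarrow> mcong S R X Y (1 *\<^sub>m f) f"
  | scale_scale: "typed S f X Y \<Longrightarrow> mcong S R X Y (c *\<^sub>m d *\<^sub>m f) ((c * d) *\<^sub>m f)"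
  | scale_add: "typed S f X Y \<Longrightarrow> typed S g X Y \<Longrightarrow>
      mcong S R X Y (c *\<^sub>m (f \<uplus> g)) (c *\<^sub>m f \<uplus> c *\<^sub>m g)"
  | add_scale: "typed S f X Y \<Longrightarrow> mcong S R X Y ((c + d) *\<^sub>m f) (c *\<^sub>m f \<uplus> d *\<^sub>m f)"
  | comp_assoc: "typed S f W V \<Longrightarrow> typed S g Y W \<Longrightarrow> typed S h X Y \<Longrightarrow>
      mcong S R X V (f \<bullet> g \<bullet> h) (f \<bullet> (g \<bullet> h))"
  | id_comp: "typed S f X Y \<Longrightarrow> mcong S R X Y (MId Y \<bullet> f) f"
  | comp_id: "typed S f X Y \<Longrightarrow> mcong S R X Y (f \<bullet> MId X) f"
  | add_comp: "typed S f Y W \<Longrightarrow> typed S g Y W \<Longrightarrow> typed S h X Y \<Longrightarrow>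
      mcong S R X W ((f \<uplus> g) \<bullet> h) (f \<bullet> h \<uplus> g \<bullet> h)"
  | comp_add: "typed S f Y W \<Longrightarrow> typed S g X Y \<Longrightarrow> typed S h X Y \<Longrightarrow>
      mcong S R X W (f \<bullet> (g \<uplus> h)) (f \<bullet> g \<uplus> f \<bullet> h)"
  | scale_comp: "typed S f Y W \<Longrightarrow> typed S g X Y \<Longrightarrow>
      mcong S R X W (c *\<^sub>m f \<bullet> g) (c *\<^sub>m (f \<bullet> g))"
  | comp_scale: "typed S f Y W \<Longrightarrow> typed S g X Y \<Longrightarrow>
      mcong S R X W (f \<bullet> (c *\<^sub>m g)) (c *\<^sub>m (f \<bullet> g))"
  | tens_assoc: "typed S f X Y \<Longrightarrow> typed S g X' Y' \<Longrightarrow> typed S h X'' Y'' \<Longrightarrow>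
      mcong S R (X @ X' @ X'') (Y @ Y' @ Y'') (f \<boxtimes> g \<boxtimes> h) (f \<boxtimes> (g \<boxtimes> h))"
  | unit_tens: "typed S f X Y \<Longrightarrow> mcong S R X Y (MId [] \<boxtimes> f) f"
  | tens_unit: "typed S f X Y \<Longrightarrow> mcong S R X Y (f \<boxtimes> MId []) f"
  | id_tens_id: "mcong S R (X @ Y) (X @ Y) (MId X \<boxtimes> MId Y) (MId (X @ Y))"
  | add_tens: "typed S f X Y \<Longrightarrow> typed S g X Y \<Longrightarrow> typed S h X' Y' \<Longrightarrow>
      mcong S R (X @ X') (Y @ Y') ((f \<uplus> g) \<boxtimes> h) (f \<boxtimes> h \<uplus> g \<boxtimes> h)"
  | tens_add: "typed S f X Y \<Longrightarrow> typed S g X' Y' \<Longrightarrow> typed S h X' Y' \<Longrightarrow>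
      mcong S R (X @ X') (Y @ Y') (f \<boxtimes> (g \<uplus> h)) (f \<boxtimes> g \<uplus> f \<boxtimes> h)"
  | scale_tens: "typed S f X Y \<Longrightarrow> typed S g X' Y' \<Longrightarrow>
      mcong S R (X @ X') (Y @ Y') (c *\<^sub>m f \<boxtimes> g) (c *\<^sub>m (f \<boxtimes> g))"
  | tens_scale: "typed S f X Y \<Longrightarrow> typed S g X' Y' \<Longrightarrow>
      mcong S R (X @ X') (Y @ Y') (f \<boxtimes> (c *\<^sub>m g)) (c *\<^sub>m (f \<boxtimes> g))"
  | interchange: "typed S f' Y W \<Longrightarrow> typed S f X Y \<Longrightarrow> typed S g Y' W' \<Longrightarrow> typed S g' X' Y' \<Longrightarrow>
      mhomog S p f \<Longrightarrow> mhomog S q g \<Longrightarrow>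
      mcong S R (X @ X') (W @ W')
        ((f' \<boxtimes> g) \<bullet> (f \<boxtimes> g')) (koszul_sign p q *\<^sub>m ((f' \<bullet> f) \<boxtimes> (g \<bullet> g')))"

definition end_superalg ::
  "('o, 'g) signature \<Rightarrow> (('o, 'g, 'k::comm_ring_1) mterm \<times> ('o, 'g, 'k) mterm) set \<Rightarrow>
   'o list \<Rightarrow> ('k, ('o, 'g, 'k) mterm set) superalg"
  where "end_superalg S R X =
    quotient_superalg {f. typed S f X X} {(f, g). mcong S R X X f g}
      (\<uplus>) (MZero X X) (\<bullet>) (MId X) (*\<^sub>m) (mhomog S)"


section \<open>The quantum isomeric supercategory\<close>

datatype updown = Up (\<open>\<up>\<close>) | Down (\<open>\<down>\<close>)

datatype qgen = UPlus | UMinus | RMinus | CapL | CupL | Clif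

type_synonym 'k qterm = "(updown, qgen, 'k) mterm"

fun qdom :: "qgen \<Rightarrow> updown list"
  where
    "qdom UPlus = [\<up>, \<up>]"
  | "qdom UMinus = [\<up>, \<up>]"
  | "qdom RMinus = [\<up>, \<down>]"
  | "qdom CapL = [\<down>, \<up>]"
  | "qdom CupL = []"
  | "qdom Clif = [\<up>]"

fun qcod :: "qgen \<Rightarrow> updown list"
  where
    "qcod UPlus = [\<up>, \<up>]"
  | "qcod UMinus = [\<up>, \<up>]"
  | "qcod RMinus = [\<down>, \<up>]"
  | "qcod CapL = []"
  | "qcod CupL = [\<up>, \<down>]"
  | "qcod Clif = [\<up>]"

definition qsig :: "(updown, qgen) signature"
  where "qsig = \<lparr>sdom = qdom, scod = qcod, spar = (\<lambda>a. if a = Clif then 1 else 0)\<rparr>"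

abbreviation u_plus :: "'k qterm" where "u_plus \<equiv> MGen UPlus"
abbreviation u_minus :: "'k qterm" where "u_minus \<equiv> MGen UMinus"
abbreviation r_minus :: "'k qterm" where "r_minus \<equiv> MGen RMinus"
abbreviation cap_L :: "'k qterm" where "cap_L \<equiv> MGen CapL"
abbreviation cup_L :: "'k qterm" where "cup_L \<equiv> MGen CupL"
abbreviation clif :: "'k qterm" where "clif \<equiv> MGen Clif"

text \<open>For \<open>f : X \<otimes> \<up> \<rightarrow> \<up> \<otimes> Y\<close> this is \<open>\<Phi>(f) : \<down> \<otimes> X \<rightarrow> Y \<otimes> \<down>\<close>.\<close>

definition rot :: "updown list \<Rightarrow> updown list \<Rightarrow> 'k qterm \<Rightarrow> 'k qterm"
  where "rot X Y f =
    (cap_L \<boxtimes> MId (Y @ [\<down>])) \<bullet> (MId [\<down>] \<boxtimes> f \<boxtimes> MId [\<down>]) \<bullet> (MId (\<down> # X) \<boxtimes> cup_L)"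

definition l_plus :: "'k qterm" where "l_plus = rot [\<up>] [\<up>] u_plus"
definition d_plus :: "'k qterm" where "d_plus = rot [\<down>] [\<down>] l_plus"
definition cap_R :: "'k qterm" where "cap_R = cap_L \<bullet> r_minus"
definition clif_down :: "'k qterm" where "clif_down = rot [] [] clif"

definition qrels :: "'k::comm_ring_1 \<Rightarrow> ('k qterm \<times> 'k qterm) set"
  where "qrels z =
   {(u_minus \<bullet> u_plus, MId [\<up>, \<up>]),
    (u_plus \<bullet> u_minus, MId [\<up>, \<up>]),
    (l_plus \<bullet> r_minus, MId [\<up>, \<down>]),
    (r_minus \<bullet> l_plus, MId [\<down>, \<up>]),
    ((u_plus \<boxtimes> MId [\<up>]) \<bullet> (MId [\<up>] \<boxtimes> u_plus) \<bullet> (u_plus \<boxtimes> MId [\<up>]),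
     (MId [\<up>] \<boxtimes> u_plus) \<bullet> (u_plus \<boxtimes> MId [\<up>]) \<bullet> (MId [\<up>] \<boxtimes> u_plus)),
    (u_plus \<uplus> (- 1) *\<^sub>m u_minus, z *\<^sub>m MId [\<up>, \<up>]),
    (clif \<bullet> clif, (- 1) *\<^sub>m MId [\<up>]),
    (u_plus \<bullet> (clif \<boxtimes> MId [\<up>]), (MId [\<up>] \<boxtimes> clif) \<bullet> u_plus),
    (cap_R \<bullet> (clif \<boxtimes> MId [\<down>]) \<bullet> cup_L, MZero [] []),
    (cap_R \<bullet> cup_L, MZero [] []),
    ((MId [\<up>] \<boxtimes> cap_L) \<bullet> (cup_L \<boxtimes> MId [\<up>]), MId [\<up>]),
    ((cap_L \<boxtimes> MId [\<down>]) \<bullet> (MId [\<down>] \<boxtimes> cup_L), MId [\<down>])}"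

definition End_Q :: "'k::comm_ring_1 \<Rightarrow> updown list \<Rightarrow> ('k, 'k qterm set) superalg"
  where "End_Q z X = end_superalg qsig (qrels z) X"

definition q_class :: "'k::comm_ring_1 \<Rightarrow> updown list \<Rightarrow> 'k qterm \<Rightarrow> 'k qterm set"
  where "q_class z X f = {(f, g). mcong qsig (qrels z) X X f g} `` {f}"

abbreviation id_up :: "nat \<Rightarrow> 'k qterm" where "id_up n \<equiv> MId (replicate n \<up>)"
abbreviation id_down :: "nat \<Rightarrow> 'k qterm" where "id_down n \<equiv> MId (replicate n \<down>)"


section \<open>The quantum walled Brauer--Clifford superalgebra\<close>

datatype bcgen = BT nat | BTs nat | BE | BP nat | BPs nat

fun bcpar :: "bcgen \<Rightarrow> bit"
  where
    "bcpar (BT i) = 0"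
  | "bcpar (BTs i) = 0"
  | "bcpar BE = 0"
  | "bcpar (BP i) = 1"
  | "bcpar (BPs i) = 1"

definition bcgens :: "nat \<Rightarrow> nat \<Rightarrow> bcgen set"
  where "bcgens r s = BT ` {1..<r} \<union> BTs ` {1..<s} \<union> (if r > 0 \<and> s > 0 then {BE} else {}) \<union>
    BP ` {1..r} \<union> BPs ` {1..s}"

type_synonym 'k bcterm = "(bcgen, 'k) aterm"

abbreviation bt :: "nat \<Rightarrow> 'k bcterm" where "bt i \<equiv> AGen (BT i)"
abbreviation bts :: "nat \<Rightarrow> 'k bcterm" where "bts i \<equiv> AGen (BTs i)"
abbreviation be :: "'k bcterm" where "be \<equiv> AGen BE"
abbreviation bp :: "nat \<Rightarrow> 'k bcterm" where "bp i \<equiv> AGen (BP i)"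
abbreviation bps :: "nat \<Rightarrow> 'k bcterm" where "bps i \<equiv> AGen (BPs i)"

definition bt_inv :: "'k::comm_ring_1 \<Rightarrow> nat \<Rightarrow> 'k bcterm"
  where "bt_inv z i = bt i \<boxplus> (- z) *\<^sub>a AOne"

text \<open>
  Indices range over all natural numbers here; \<open>acong\<close> keeps exactly the relations between
  elements of \<open>bcgens r s\<close>, that is, those with indices in the allowable range. In particular this
  covers the cases \<open>s = 0\<close> (Hecke--Clifford), \<open>r = 0\<close>, and \<open>r = s = 0\<close>, where there are neither
  generators nor relations and the quotient is the ground ring.
\<close>

inductive_set bcrels :: "nat \<Rightarrow> 'k::comm_ring_1 \<Rightarrow> ('k bcterm \<times> 'k bcterm) set"
  for r :: nat and z :: "'k::comm_ring_1"
  where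
    "(bt i \<cdot> bt i, z *\<^sub>a bt i \<boxplus> AOne) \<in> bcrels r z"
  | "(bts i \<cdot> bts i, z *\<^sub>a bts i \<boxplus> AOne) \<in> bcrels r z"
  | "(bt i \<cdot> bt (i + 1) \<cdot> bt i, bt (i + 1) \<cdot> bt i \<cdot> bt (i + 1)) \<in> bcrels r z"
  | "(bts i \<cdot> bts (i + 1) \<cdot> bts i, bts (i + 1) \<cdot> bts i \<cdot> bts (i + 1)) \<in> bcrels r z"
  | "i + 1 < j \<or> j + 1 < i \<Longrightarrow> (bt i \<cdot> bt j, bt j \<cdot> bt i) \<in> bcrels r z"
  | "i + 1 < j \<or> j + 1 < i \<Longrightarrow> (bts i \<cdot> bts j, bts j \<cdot> bts i) \<in> bcrels r z"
  | "(bt i \<cdot> bts j, bts j \<cdot> bt i) \<in> bcrels r z"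

  | "(bp i \<cdot> bp i, (- 1) *\<^sub>a AOne) \<in> bcrels r z"
  | "i \<noteq> j \<Longrightarrow> (bp i \<cdot> bp j, (- 1) *\<^sub>a (bp j \<cdot> bp i)) \<in> bcrels r z"
  | "(bps i \<cdot> bps i, AOne) \<in> bcrels r z"
  | "i \<noteq> j \<Longrightarrow> (bps i \<cdot> bps j, (- 1) *\<^sub>a (bps j \<cdot> bps i)) \<in> bcrels r z"
  | "(bp i \<cdot> bps j, (- 1) *\<^sub>a (bps j \<cdot> bp i)) \<in> bcrels r z"

  | "(bt i \<cdot> bp i, bp (i + 1) \<cdot> bt i) \<in> bcrels r z"
  | "(bts i \<cdot> bps i, bps (i + 1) \<cdot> bts i) \<in> bcrels r z"
  | "j \<noteq> i \<Longrightarrow> j \<noteq> i + 1 \<Longrightarrow> (bt i \<cdot> bp j, bp j \<cdot> bt i) \<in> bcrels r z"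
  | "j \<noteq> i \<Longrightarrow> j \<noteq> i + 1 \<Longrightarrow> (bts i \<cdot> bps j, bps j \<cdot> bts i) \<in> bcrels r z"
  | "(bt i \<cdot> bps j, bps j \<cdot> bt i) \<in> bcrels r z"
  | "(bts i \<cdot> bp j, bp j \<cdot> bts i) \<in> bcrels r z"

  | "(be \<cdot> be, AZero) \<in> bcrels r z"
  | "(be \<cdot> bt (r - 1) \<cdot> be, be) \<in> bcrels r z"
  | "j \<noteq> r - 1 \<Longrightarrow> (be \<cdot> bt j, bt j \<cdot> be) \<in> bcrels r z"
  | "(be \<cdot> bts 1 \<cdot> be, be) \<in> bcrels r z"
  | "j \<noteq> 1 \<Longrightarrow> (be \<cdot> bts j, bts j \<cdot> be) \<in> bcrels r z"

  | "(bp r \<cdot> be, bps 1 \<cdot> be) \<in> bcrels r z"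
  | "(be \<cdot> bp r, be \<cdot> bps 1) \<in> bcrels r z"
  | "j \<noteq> r \<Longrightarrow> (bp j \<cdot> be, be \<cdot> bp j) \<in> bcrels r z"
  | "j \<noteq> 1 \<Longrightarrow> (bps j \<cdot> be, be \<cdot> bps j) \<in> bcrels r z"

  | "(be \<cdot> bt_inv z (r - 1) \<cdot> bts 1 \<cdot> be \<cdot> bts 1 \<cdot> bt_inv z (r - 1),
      bt_inv z (r - 1) \<cdot> bts 1 \<cdot> be \<cdot> bts 1 \<cdot> bt_inv z (r - 1) \<cdot> be) \<in> bcrels r z"
  | "(be \<cdot> bp r \<cdot> be, AZero) \<in> bcrels r z"

definition BC :: "nat \<Rightarrow> nat \<Rightarrow> 'k::comm_ring_1 \<Rightarrow> ('k, 'k bcterm set) superalg"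
  where "BC r s z = presented_superalg (bcgens r s) bcpar (bcrels r z)"

definition bc_class :: "nat \<Rightarrow> nat \<Rightarrow> 'k::comm_ring_1 \<Rightarrow> 'k bcterm \<Rightarrow> 'k bcterm set"
  where "bc_class r s z x = acong (bcgens r s) (bcrels r z) `` {x}"

section \<open>Well-definedness\<close>

text \<open>
  The remainder proves that the presented superalgebras and the endomorphism superalgebras above
  satisfy the locale \<open>superalgebra\<close>, the grading being a direct sum because the relations are
  homogeneous, and that both sides of every relation of the supercategory have the same type.
\<close>

locale superalg_terms =
  fixes T :: "'t set" and E plus0 zero0 times0 one0
    and scale0 :: "'k::comm_ring_1 \<Rightarrow> 't \<Rightarrow> 't" and H :: "bit \<Rightarrow> 't \<Rightarrow> bool" and pr :: "bit \<Rightarrow> 't \<Rightarrow> 't"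
  assumes eqv: "equiv T E"
    and closed: "zero0 \<in> T" "one0 \<in> T"
    and ac: "(x,x') \<in> E \<Longrightarrow> (y,y') \<in> E \<Longrightarrow> (plus0 x y, plus0 x' y') \<in> E"
    and mc: "(x,x') \<in> E \<Longrightarrow> (y,y') \<in> E \<Longrightarrow> (times0 x y, times0 x' y') \<in> E"
    and sc: "(x,x') \<in> E \<Longrightarrow> (scale0 c x, scale0 c x') \<in> E"
    and a_assoc0: "x \<in> T \<Longrightarrow> y \<in> T \<Longrightarrow> w \<in> T \<Longrightarrow> (plus0 (plus0 x y) w, plus0 x (plus0 y w)) \<in> E"
    and a_comm0: "x \<in> T \<Longrightarrow> y \<in> T \<Longrightarrow> (plus0 x y, plus0 y x) \<in> E"
    and a_zero0: "x \<in> T \<Longrightarrow> (plus0 x zero0, x) \<in> E"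
    and zs: "x \<in> T \<Longrightarrow> (scale0 0 x, zero0) \<in> E"
    and os: "x \<in> T \<Longrightarrow> (scale0 1 x, x) \<in> E"
    and ss: "x \<in> T \<Longrightarrow> (scale0 c (scale0 d x), scale0 (c * d) x) \<in> E"
    and sa: "x \<in> T \<Longrightarrow> y \<in> T \<Longrightarrow> (scale0 c (plus0 x y), plus0 (scale0 c x) (scale0 c y)) \<in> E"
    and as: "x \<in> T \<Longrightarrow> (scale0 (c + d) x, plus0 (scale0 c x) (scale0 d x)) \<in> E"
    and m_assoc0: "x \<in> T \<Longrightarrow> y \<in> T \<Longrightarrow> w \<in> T \<Longrightarrow> (times0 (times0 x y) w, times0 x (times0 y w)) \<in> E"
    and om: "x \<in> T \<Longrightarrow> (times0 one0 x, x) \<in> E"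
    and mo: "x \<in> T \<Longrightarrow> (times0 x one0, x) \<in> E"
    and am: "x \<in> T \<Longrightarrow> y \<in> T \<Longrightarrow> w \<in> T \<Longrightarrow> (times0 (plus0 x y) w, plus0 (times0 x w) (times0 y w)) \<in> E"
    and ma: "x \<in> T \<Longrightarrow> y \<in> T \<Longrightarrow> w \<in> T \<Longrightarrow> (times0 x (plus0 y w), plus0 (times0 x y) (times0 x w)) \<in> E"
    and sm: "x \<in> T \<Longrightarrow> y \<in> T \<Longrightarrow> (times0 (scale0 c x) y, scale0 c (times0 x y)) \<in> E"
    and ms: "x \<in> T \<Longrightarrow> y \<in> T \<Longrightarrow> (times0 x (scale0 c y), scale0 c (times0 x y)) \<in> E"
    and H0: "H p zero0" "H 0 one0"
    and H1: "H p x \<Longrightarrow> H p y \<Longrightarrow> H p (plus0 x y)"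
    and H2: "H p x \<Longrightarrow> H q y \<Longrightarrow> H (p+q) (times0 x y)"
    and H3: "H p x \<Longrightarrow> H p (scale0 c x)"
    and pr_cong: "(x,y) \<in> E \<Longrightarrow> (pr p x, pr p y) \<in> E"
    and pr_H: "H p (pr p x)"
    and pr_plus: "pr p (plus0 x y) = plus0 (pr p x) (pr p y)"
    and pr_sum: "x \<in> T \<Longrightarrow> (plus0 (pr 0 x) (pr 1 x), x) \<in> E"
    and pr_same: "x \<in> T \<Longrightarrow> H p x \<Longrightarrow> (pr p x, x) \<in> E"
    and pr_other: "x \<in> T \<Longrightarrow> H p x \<Longrightarrow> (pr (p+1) x, zero0) \<in> E"
begin

lemma inT: "(x,y) \<in> E \<Longrightarrow> x \<in> T" "(x,y) \<in> E \<Longrightarrow> y \<in> T"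
  using eqv by (auto simp: equiv_def refl_on_def)
lemma er: "x \<in> T \<Longrightarrow> (x,x) \<in> E" using eqv by (auto simp: equiv_def refl_on_def)
lemma es: "(x,y) \<in> E \<Longrightarrow> (y,x) \<in> E" using eqv by (auto simp: equiv_def sym_def)
lemma cl: "x \<in> T \<Longrightarrow> y \<in> T \<Longrightarrow> plus0 x y \<in> T" "x \<in> T \<Longrightarrow> y \<in> T \<Longrightarrow> times0 x y \<in> T" "x \<in> T \<Longrightarrow> scale0 c x \<in> T"
  "x \<in> T \<Longrightarrow> pr p x \<in> T"
  using er inT ac mc sc pr_cong by meson+

abbreviation "Q \<equiv> quotient_superalg T E plus0 zero0 times0 one0 scale0 H"
abbreviation "cls x \<equiv> E `` {x}"

lemma cls_eq: "x \<in> T \<Longrightarrow> y \<in> T \<Longrightarrow> cls x = cls y \<longleftrightarrow> (x,y) \<in> E"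
  using eqv eq_equiv_class_iff by fastforce

lemma ops:
  "x \<in> T \<Longrightarrow> y \<in> T \<Longrightarrow> cls x \<oplus>\<^bsub>Q\<^esub> cls y = cls (plus0 x y)"
  "x \<in> T \<Longrightarrow> y \<in> T \<Longrightarrow> cls x \<otimes>\<^bsub>Q\<^esub> cls y = cls (times0 x y)"
  "x \<in> T \<Longrightarrow> scal Q c (cls x) = cls (scale0 c x)"
  "\<zero>\<^bsub>Q\<^esub> = cls zero0" "\<one>\<^bsub>Q\<^esub> = cls one0"
proof -
  assume x: "x \<in> T"
  have "(\<Union>a\<in>cls x. cls (scale0 c a)) = cls (scale0 c x)"
    by (rule UN_equiv_class[OF eqv _ x])
     (auto simp: congruent_def intro!: equiv_class_eq[OF eqv] sc)
  thus "scal Q c (cls x) = cls (scale0 c x)" by (simp add: quotient_superalg_def)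
next
  assume x: "x \<in> T" and y: "y \<in> T"
  have "(\<Union>a\<in>cls x. \<Union>b\<in>cls y. cls (plus0 a b)) = cls (plus0 x y)"
    by (rule UN_equiv_class2[OF eqv eqv _ x y])
     (auto simp: congruent2_def intro!: equiv_class_eq[OF eqv] ac)
  thus "cls x \<oplus>\<^bsub>Q\<^esub> cls y = cls (plus0 x y)" by (simp add: quotient_superalg_def)
  have "(\<Union>a\<in>cls x. \<Union>b\<in>cls y. cls (times0 a b)) = cls (times0 x y)"
    by (rule UN_equiv_class2[OF eqv eqv _ x y])
     (auto simp: congruent2_def intro!: equiv_class_eq[OF eqv] mc)
  thus "cls x \<otimes>\<^bsub>Q\<^esub> cls y = cls (times0 x y)" by (simp add: quotient_superalg_def)
qed (simp_all add: quotient_superalg_def)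

lemma carr: "carrier Q = cls ` T" by (auto simp: quotient_superalg_def quotient_def)
lemma partQ: "part Q p = cls ` {x \<in> T. H p x}" by (auto simp: quotient_superalg_def)


lemma zero_unique: "x \<in> T \<Longrightarrow> (plus0 zero0 x, x) \<in> E"
  by (meson a_comm0 a_zero0 closed eqv equivE transD)

lemma superalgebra_Q: "superalgebra Q"
proof -
  have ring: "ring Q"
  proof (rule ringI)
    show "abelian_group Q"
    proof (rule abelian_groupI)
      fix x assume "x \<in> carrier Q"
      then obtain a where a: "a \<in> T" "x = cls a" by (auto simp: carr)
      have "(plus0 (scale0 (-1) a) a, zero0) \<in> E"
        using as[OF a(1), of "-1" 1] os[OF a(1)] zs[OF a(1)] ac[OF er[OF cl(3)[OF a(1)]] os[OF a(1)]]
        using eqv unfolding equiv_def by (metis add.left_inverse es transD)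
      thus "\<exists>y\<in>carrier Q. y \<oplus>\<^bsub>Q\<^esub> x = \<zero>\<^bsub>Q\<^esub>"
        using a cl closed by (auto del: equalityI simp: carr ops cls_eq intro!: bexI[of _ "scale0 (-1) a"])
    qed (auto del: equalityI simp: carr ops cls_eq cl closed a_assoc0 a_comm0 zero_unique)
    show "monoid Q"
      by (rule monoidI) (auto del: equalityI simp: carr ops cls_eq cl closed m_assoc0 om mo)
  qed (auto del: equalityI simp: carr ops cls_eq cl closed am ma)
  have dec: "\<exists>!(a, b). a \<in> part Q 0 \<and> b \<in> part Q 1 \<and> X = a \<oplus>\<^bsub>Q\<^esub> b" if "X \<in> carrier Q" for X
  proof -
    from that obtain x where x: "x \<in> T" "X = cls x" by (auto simp: carr)
    have u: "a = cls (pr 0 x) \<and> b = cls (pr 1 x)"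
      if ab: "a \<in> part Q 0" "b \<in> part Q 1" "X = a \<oplus>\<^bsub>Q\<^esub> b" for a b
    proof -
      from ab obtain a' b' where *: "a' \<in> T" "b' \<in> T" "H 0 a'" "H 1 b'" "a = cls a'" "b = cls b'"
        by (auto simp: partQ)
      have E: "(x, plus0 a' b') \<in> E" using ab(3) x * by (simp add: ops cls_eq cl)
      have "cls (pr 0 x) = cls (pr 0 a') \<oplus>\<^bsub>Q\<^esub> cls (pr 0 b')"
        using pr_cong[OF E, of 0] x * by (simp add: pr_plus ops cls_eq cl)
      also have "cls (pr 0 a') = a" using pr_same * cls_eq cl by simp
      also have "cls (pr 0 b') = \<zero>\<^bsub>Q\<^esub>" using pr_other[of b' 1] * cls_eq cl closed ops by simp
      finally have 1: "cls (pr 0 x) = a" using * ring by (simp add: ops cl closed cls_eq a_zero0)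
      have "cls (pr 1 x) = cls (pr 1 a') \<oplus>\<^bsub>Q\<^esub> cls (pr 1 b')"
        using pr_cong[OF E, of 1] x * by (simp add: pr_plus ops cls_eq cl)
      also have "cls (pr 1 b') = b" using pr_same * cls_eq cl by simp
      also have "cls (pr 1 a') = \<zero>\<^bsub>Q\<^esub>" using pr_other[of a' 0] * cls_eq cl closed ops by simp
      finally have 2: "cls (pr 1 x) = b" using * ring by (simp add: ops cl closed cls_eq zero_unique)
      show ?thesis using 1 2 by simp
    qed
    have ex: "cls (pr 0 x) \<in> part Q 0 \<and> cls (pr 1 x) \<in> part Q 1 \<and> X = cls (pr 0 x) \<oplus>\<^bsub>Q\<^esub> cls (pr 1 x)"
      using x by (auto del: equalityI simp: partQ ops cls_eq cl pr_H intro!: es[OF pr_sum])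
    show ?thesis
      by (rule ex1I[of _ "(cls (pr 0 x), cls (pr 1 x))"]) (use ex u in auto)
  qed
  interpret ring Q by (rule ring)
  show ?thesis
  proof (unfold_locales, goal_cases)
    case (12 x) thus ?case by (rule dec)
  next
    case (10 x p y)
    then obtain a b where "a \<in> T" "b \<in> T" "H p a" "H p b" "x = cls a" "y = cls b" by (auto simp: partQ)
    then show ?case unfolding partQ using H1 by (simp add: ops) (metis (mono_tags, lifting) cl(1) image_eqI mem_Collect_eq)
  next
    case (14 x p y q)
    then obtain a b where "a \<in> T" "b \<in> T" "H p a" "H q b" "x = cls a" "y = cls b" by (auto simp: partQ)
    then show ?case unfolding partQ using H2 by (simp only: ops) (metis (mono_tags, lifting) cl(2) image_eqI mem_Collect_eq)
  next
    case (11 x p c)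
    then obtain a where "a \<in> T" "H p a" "x = cls a" by (auto simp: partQ)
    then show ?case unfolding partQ using H3 by (simp add: ops) (metis (mono_tags, lifting) cl(3) image_eqI mem_Collect_eq)
  next case (1 x c) thus ?case by (auto simp: carr ops cl)
  next case (2 x y c) thus ?case by (auto del: equalityI simp: carr ops cls_eq cl sa)
  next case (3 x c d) thus ?case by (auto del: equalityI simp: carr ops cls_eq cl as)
  next case (4 x c d) thus ?case by (auto del: equalityI simp: carr ops cls_eq cl ss)
  next case (5 x) thus ?case by (auto del: equalityI simp: carr ops cls_eq cl os)
  next case (6 x y c) thus ?case by (auto del: equalityI simp: carr ops cls_eq cl sm)
  next case (7 x y c) thus ?case by (auto del: equalityI simp: carr ops cls_eq cl ms)
  qed (auto simp: carr partQ ops closed H0)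
qed
end

definition flip_par :: "bit \<Rightarrow> bit" where "flip_par p = p + 1"
lemma flip_par [simp]: "flip_par (flip_par p) = p" "flip_par 0 = 1" "flip_par 1 = 0" "flip_par p \<noteq> p" "p \<noteq> flip_par p"
  by (cases p; simp add: flip_par_def)+
lemma flip_par_cases: "p = q \<or> p = flip_par q" by (cases p; cases q) auto

lemma acong_aterms: "(x, y) \<in> acong G R \<Longrightarrow> x \<in> aterms G \<and> y \<in> aterms G"
  by (induction rule: acong.induct) (auto simp: aterms_def)

lemma acong_equiv: "equiv (aterms G) (acong G R)"
  by (rule equivI) (auto simp: refl_on_def sym_def trans_def dest: acong_aterms intro: acong.refl acong.sym acong.trans)

fun aproj :: "('g \<Rightarrow> bit) \<Rightarrow> bit \<Rightarrow> ('g, 'k) aterm \<Rightarrow> ('g, 'k) aterm" where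
  "aproj par p (AGen g) = (if par g = p then AGen g else AZero)"
| "aproj par p AOne = (if p = 0 then AOne else AZero)"
| "aproj par p AZero = AZero"
| "aproj par p (x \<cdot> y) = aproj par p x \<cdot> aproj par 0 y \<boxplus> aproj par (flip_par p) x \<cdot> aproj par 1 y"
| "aproj par p (x \<boxplus> y) = aproj par p x \<boxplus> aproj par p y"
| "aproj par p (c *\<^sub>a x) = c *\<^sub>a aproj par p x"

lemma aproj_T: "x \<in> aterms G \<Longrightarrow> aproj par p x \<in> aterms G"
  unfolding aterms_def by (induction x arbitrary: p) auto

lemma aproj_H: "ahomog par p (aproj par p x)"
proof (induction x arbitrary: p)
  case (AMul x y)
  have "ahomog par (flip_par p + 1) (aproj par (flip_par p) x \<cdot> aproj par 1 y)" "ahomog par (p + 0) (aproj par p x \<cdot> aproj par 0 y)"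
    by (rule ahomog.intros AMul)+
  moreover have "flip_par p + 1 = p" "p + 0 = p" by (cases p; simp add: flip_par_def)+
  ultimately show ?case by (simp only: aproj.simps ahomog.intros(5))
next
  case (AGen g) show ?case using ahomog.intros(1)[of par g] by (auto intro: ahomog.intros)
qed (auto intro: ahomog.intros)

context
  fixes G :: "'g set" and R :: "(('g, 'k::comm_ring_1) aterm \<times> ('g, 'k) aterm) set"
begin

private definition cong (infix "\<approx>" 50) where "x \<approx> y \<longleftrightarrow> (x, y) \<in> acong G R"
private lemmas c_rel = acong.rel[where G=G and R=R, folded cong_def]
private lemmas c_refl = acong.refl[where G=G and R=R, folded cong_def]
private lemmas c_sym = acong.sym[where G=G and R=R, folded cong_def]
private lemmas c_trans = acong.trans[where G=G and R=R, folded cong_def]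
private lemmas c_mul_cong = acong.mul_cong[where G=G and R=R, folded cong_def]
private lemmas c_add_cong = acong.add_cong[where G=G and R=R, folded cong_def]
private lemmas c_scale_cong = acong.scale_cong[where G=G and R=R, folded cong_def]
private lemmas c_add_assoc = acong.add_assoc[where G=G and R=R, folded cong_def]
private lemmas c_add_comm = acong.add_comm[where G=G and R=R, folded cong_def]
private lemmas c_add_zero = acong.add_zero[where G=G and R=R, folded cong_def]
private lemmas c_zero_scale = acong.zero_scale[where G=G and R=R, folded cong_def]
private lemmas c_one_scale = acong.one_scale[where G=G and R=R, folded cong_def]
private lemmas c_scale_scale = acong.scale_scale[where G=G and R=R, folded cong_def]
private lemmas c_scale_add = acong.scale_add[where G=G and R=R, folded cong_def]
private lemmas c_add_scale = acong.add_scale[where G=G and R=R, folded cong_def]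
private lemmas c_mul_assoc = acong.mul_assoc[where G=G and R=R, folded cong_def]
private lemmas c_one_mul = acong.one_mul[where G=G and R=R, folded cong_def]
private lemmas c_mul_one = acong.mul_one[where G=G and R=R, folded cong_def]
private lemmas c_add_mul = acong.add_mul[where G=G and R=R, folded cong_def]
private lemmas c_mul_add = acong.mul_add[where G=G and R=R, folded cong_def]
private lemmas c_scale_mul = acong.scale_mul[where G=G and R=R, folded cong_def]
private lemmas c_mul_scale = acong.mul_scale[where G=G and R=R, folded cong_def]
lemmas [trans] = c_trans
private lemmas c_intros = acong.intros[where G=G and R=R, folded cong_def]
private lemmas c_aterms = acong_aterms[where G=G and R=R, folded cong_def]
private lemmas c_induct = acong.induct[where G=G and R=R, folded cong_def, consumes 1, case_names rel refl sym trans mul_cong add_cong scale_cong add_assoc add_comm add_zero zero_scale one_scale scale_scale scale_add add_scale mul_assoc one_mul mul_one add_mul mul_add scale_mul mul_scale]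

private abbreviation "TT \<equiv> aterms G :: ('g, 'k) aterm set"

private lemma TI [simp]: "AZero \<in> TT" "AOne \<in> TT" "x \<cdot> y \<in> TT \<longleftrightarrow> x \<in> TT \<and> y \<in> TT"
  "x \<boxplus> y \<in> TT \<longleftrightarrow> x \<in> TT \<and> y \<in> TT" "c *\<^sub>a x \<in> TT \<longleftrightarrow> x \<in> TT"
  by (auto simp: aterms_def)



private lemma zero_add: "x \<in> TT \<Longrightarrow> AZero \<boxplus> x \<approx> x"
  using c_add_comm[of AZero x] c_add_zero[of x] by (auto intro: c_trans)

private lemma neg: assumes x: "x \<in> TT" shows "x \<boxplus> (-1) *\<^sub>a x \<approx> AZero"
proof -
  have "x \<boxplus> (-1) *\<^sub>a x \<approx> 1 *\<^sub>a x \<boxplus> (-1) *\<^sub>a x"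
    using x by (auto intro!: c_add_cong c_sym[OF c_one_scale] c_refl)
  also have "\<dots> \<approx> (1 + -1) *\<^sub>a x" by (rule c_sym[OF c_add_scale]) fact
  also have "(1 + -1) *\<^sub>a x \<approx> AZero" using c_zero_scale[OF x] by simp
  finally show ?thesis .
qed

private lemma scale_zero: "c *\<^sub>a AZero \<approx> AZero"
proof -
  have "c *\<^sub>a AZero \<approx> c *\<^sub>a 0 *\<^sub>a AZero"
    by (intro c_scale_cong c_sym[OF c_zero_scale]) simp
  also have "\<dots> \<approx> (c * 0) *\<^sub>a AZero" by (rule c_scale_scale) simp
  also have "(c * 0) *\<^sub>a AZero \<approx> AZero" using c_zero_scale[of AZero] by simp
  finally show ?thesis .
qed

private lemma mul_zero: assumes "x \<in> TT" shows "x \<cdot> AZero \<approx> AZero"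
proof -
  have "x \<cdot> AZero \<approx> x \<cdot> (0 *\<^sub>a AZero)"
    by (intro c_mul_cong c_sym[OF c_zero_scale] c_refl assms) simp
  also have "\<dots> \<approx> 0 *\<^sub>a (x \<cdot> AZero)" by (rule c_mul_scale) (use assms in auto)
  also have "\<dots> \<approx> AZero" using assms by (auto intro: c_zero_scale)
  finally show ?thesis .
qed

private lemma zero_mul: assumes "x \<in> TT" shows "AZero \<cdot> x \<approx> AZero"
proof -
  have "AZero \<cdot> x \<approx> 0 *\<^sub>a AZero \<cdot> x"
    by (intro c_mul_cong c_sym[OF c_zero_scale] c_refl assms) simp
  also have "\<dots> \<approx> 0 *\<^sub>a (AZero \<cdot> x)" by (rule c_scale_mul) (use assms in auto)
  also have "\<dots> \<approx> AZero" using assms by (auto intro: c_zero_scale)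
  finally show ?thesis .
qed

private lemma swap4: assumes [simp]: "a \<in> TT" "b \<in> TT" "c \<in> TT" "d \<in> TT"
  shows "(a \<boxplus> b) \<boxplus> (c \<boxplus> d) \<approx> (a \<boxplus> c) \<boxplus> (b \<boxplus> d)"
proof -
  have "(a \<boxplus> b) \<boxplus> (c \<boxplus> d) \<approx> a \<boxplus> (b \<boxplus> (c \<boxplus> d))" by (rule c_add_assoc) auto
  also have "\<dots> \<approx> a \<boxplus> ((b \<boxplus> c) \<boxplus> d)"
    by (intro c_add_cong c_refl c_sym[OF c_add_assoc]) auto
  also have "\<dots> \<approx> a \<boxplus> ((c \<boxplus> b) \<boxplus> d)"
    by (intro c_add_cong c_refl c_add_comm) auto
  also have "\<dots> \<approx> a \<boxplus> (c \<boxplus> (b \<boxplus> d))"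
    by (intro c_add_cong c_refl c_add_assoc) auto
  also have "\<dots> \<approx> (a \<boxplus> c) \<boxplus> (b \<boxplus> d)" by (rule c_sym[OF c_add_assoc]) auto
  finally show ?thesis .
qed

lemma aproj_other: "ahomog par q x \<Longrightarrow> x \<in> TT \<Longrightarrow> (aproj par q x \<approx> x) \<and> (aproj par (flip_par q) x \<approx> AZero)"
proof (induction q x rule: ahomog.induct)
  case (4 p x q y)
  have T: "x \<in> TT" "y \<in> TT" using 4 by auto
  note [simp] = aproj_T[OF T(1)] aproj_T[OF T(2)]
  note IH = 4(3)[OF T(1)] 4(4)[OF T(2)]
  have X: "aproj par p x \<approx> x" "aproj par (flip_par p) x \<approx> AZero" "aproj par q y \<approx> y" "aproj par (flip_par q) y \<approx> AZero"
    using IH by auto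
  note tr = c_trans c_add_cong
  have XY: "aproj par p x \<cdot> aproj par q y \<approx> x \<cdot> y" 
     "\<And>m. aproj par (flip_par p) x \<cdot> aproj par m y \<approx> AZero" "\<And>m. aproj par m x \<cdot> aproj par (flip_par q) y \<approx> AZero"
    apply (intro c_mul_cong X)
    apply (rule c_trans[OF c_mul_cong[OF X(2) c_refl] zero_mul]; simp)
    apply (rule c_trans[OF c_mul_cong[OF c_refl X(4)] mul_zero]; simp)
    done
  have s1: "u \<approx> w \<Longrightarrow> v \<approx> AZero \<Longrightarrow> u \<boxplus> v \<approx> w" for u v w
    by (meson c_add_cong c_add_zero c_trans c_aterms)
  have s2: "v \<approx> w \<Longrightarrow> u \<approx> AZero \<Longrightarrow> u \<boxplus> v \<approx> w" for u v w
    by (meson c_add_cong zero_add c_trans c_aterms)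
  show ?case
  proof (cases "q = 0")
    case 0: True
    show ?thesis using XY 0 by (auto intro!: s1)
  next
    case 1: False
    show ?thesis using XY 1 by (auto intro!: s2)
  qed
next
  case (5 p x y)
  hence X: "aproj par p x \<approx> x" "aproj par (flip_par p) x \<approx> AZero" "aproj par p y \<approx> y" "aproj par (flip_par p) y \<approx> AZero" by auto
  show ?case using c_trans[OF c_add_cong[OF X(2,4)] c_add_zero] X 
    by (auto intro: c_add_cong)
next
  case (6 p x c)
  hence X: "aproj par p x \<approx> x" "aproj par (flip_par p) x \<approx> AZero" by auto
  show ?case using c_trans[OF c_scale_cong[OF X(2)] scale_zero] X 
    by (auto intro: c_scale_cong)
qed (auto intro: c_refl)

lemma aproj_cong:
  assumes hom: "\<And>x y. (x, y) \<in> R \<Longrightarrow> \<exists>q. ahomog par q x \<and> ahomog par q y"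
  shows "x \<approx> y \<Longrightarrow> aproj par p x \<approx> aproj par p y"
proof (induction arbitrary: p rule: c_induct)
  case (rel x y)
  then obtain q where q: "ahomog par q x" "ahomog par q y" using hom by blast
  have "p = q \<or> p = flip_par q" by (rule flip_par_cases)
  thus ?case using aproj_other[OF q(1) rel(2)] aproj_other[OF q(2) rel(3)] rel 
    by (meson c_rel c_sym c_trans)
next
  case (mul_assoc x y w)
  note [simp] = mul_assoc[THEN aproj_T]
  let ?x = "\<lambda>p. aproj par p x" and ?y = "\<lambda>p. aproj par p y" and ?w = "\<lambda>p. aproj par p w"
  have "aproj par p (x \<cdot> y \<cdot> w) = (?x p \<cdot> ?y 0 \<boxplus> ?x (flip_par p) \<cdot> ?y 1) \<cdot> ?w 0 \<boxplus> (?x (flip_par p) \<cdot> ?y 0 \<boxplus> ?x p \<cdot> ?y 1) \<cdot> ?w 1" (is "_ = ?A")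
    by simp
  note L = this
  have "?A \<approx> (?x p \<cdot> ?y 0 \<cdot> ?w 0 \<boxplus> ?x (flip_par p) \<cdot> ?y 1 \<cdot> ?w 0) \<boxplus> (?x (flip_par p) \<cdot> ?y 0 \<cdot> ?w 1 \<boxplus> ?x p \<cdot> ?y 1 \<cdot> ?w 1)"
    by (rule c_add_cong[OF c_add_mul c_add_mul]; simp)
  also have "\<dots> \<approx> (?x p \<cdot> ?y 0 \<cdot> ?w 0 \<boxplus> ?x (flip_par p) \<cdot> ?y 1 \<cdot> ?w 0) \<boxplus> (?x p \<cdot> ?y 1 \<cdot> ?w 1 \<boxplus> ?x (flip_par p) \<cdot> ?y 0 \<cdot> ?w 1)"
    by (rule c_add_cong[OF c_refl c_add_comm]; simp)
  also have "\<dots> \<approx> (?x p \<cdot> ?y 0 \<cdot> ?w 0 \<boxplus> ?x p \<cdot> ?y 1 \<cdot> ?w 1) \<boxplus> (?x (flip_par p) \<cdot> ?y 1 \<cdot> ?w 0 \<boxplus> ?x (flip_par p) \<cdot> ?y 0 \<cdot> ?w 1)"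
    by (rule swap4; simp)
  also have "\<dots> \<approx> (?x p \<cdot> (?y 0 \<cdot> ?w 0) \<boxplus> ?x p \<cdot> (?y 1 \<cdot> ?w 1)) \<boxplus> (?x (flip_par p) \<cdot> (?y 1 \<cdot> ?w 0) \<boxplus> ?x (flip_par p) \<cdot> (?y 0 \<cdot> ?w 1))"
    by (rule c_add_cong[OF c_add_cong c_add_cong]; rule c_mul_assoc; simp)
  also have "\<dots> \<approx> ?x p \<cdot> (?y 0 \<cdot> ?w 0 \<boxplus> ?y 1 \<cdot> ?w 1) \<boxplus> ?x (flip_par p) \<cdot> (?y 1 \<cdot> ?w 0 \<boxplus> ?y 0 \<cdot> ?w 1)"
    by (rule c_add_cong[OF c_sym[OF c_mul_add] c_sym[OF c_mul_add]]; simp)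
  finally show ?case unfolding L by simp
next
  case (one_mul x)
  note T [simp] = one_mul[THEN aproj_T]
  have c: "AOne \<cdot> aproj par p x \<boxplus> AZero \<cdot> u \<approx> aproj par p x" if "u \<in> TT" for u
    by (rule c_trans[OF c_add_cong[OF c_one_mul zero_mul] c_add_zero]) (use that in auto)
  have d: "AZero \<cdot> u \<boxplus> AOne \<cdot> aproj par p x \<approx> aproj par p x" if "u \<in> TT" for u
    by (rule c_trans[OF c_add_cong[OF zero_mul c_one_mul] zero_add]) (use that in auto)
  show ?case by (cases p) (use c d in auto)
next
  case (mul_one x)
  note T [simp] = mul_one[THEN aproj_T]
  show ?case
    by (auto intro!: c_trans[OF c_add_cong[OF c_mul_one mul_zero] c_add_zero])
next
  case (add_mul x y w)
  note [simp] = add_mul[THEN aproj_T]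
  show ?case
    by simp (rule c_trans[OF c_add_cong[OF c_add_mul c_add_mul] swap4]; simp)
next
  case (mul_add x y w)
  note [simp] = mul_add[THEN aproj_T]
  show ?case
    by simp (rule c_trans[OF c_add_cong[OF c_mul_add c_mul_add] swap4]; simp)
next
  case (scale_mul x y c)
  note [simp] = scale_mul[THEN aproj_T]
  show ?case
    by simp (rule c_trans[OF c_add_cong[OF c_scale_mul c_scale_mul] c_sym[OF c_scale_add]]; simp)
next
  case (mul_scale x y c)
  note [simp] = mul_scale[THEN aproj_T]
  show ?case
    by simp (rule c_trans[OF c_add_cong[OF c_mul_scale c_mul_scale] c_sym[OF c_scale_add]]; simp)
next
  case (trans x y w) thus ?case by (blast intro: c_trans)
next
  case (sym x y) thus ?case by (blast intro: c_sym)
next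
  case (mul_cong x x' y y') thus ?case unfolding aproj.simps by (intro c_add_cong c_mul_cong)
next
  case (add_cong x x' y y') thus ?case unfolding aproj.simps by (intro c_add_cong)
next
  case (scale_cong x x' c) thus ?case unfolding aproj.simps by (intro c_scale_cong)
next
  case (refl x) thus ?case by (simp add: c_refl aproj_T)
qed (simp_all add: c_add_assoc c_add_comm c_add_zero c_zero_scale c_one_scale c_scale_scale c_scale_add c_add_scale aproj_T)

lemma aproj_sum: "x \<in> TT \<Longrightarrow> aproj par 0 x \<boxplus> aproj par 1 x \<approx> x"
proof (induction x)
  case (AGen g)
  hence [simp]: "AGen g \<in> TT" by auto
  show ?case by (cases "par g") (auto intro: c_add_zero zero_add)
next
  case (AMul x y)
  hence [simp]: "x \<in> TT" "y \<in> TT" by auto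
  note [simp] = aproj_T[of x] aproj_T[of y]
  let ?x = "\<lambda>p. aproj par p x" and ?y = "\<lambda>p. aproj par p y"
  have "aproj par 0 (x \<cdot> y) \<boxplus> aproj par 1 (x \<cdot> y) = (?x 0 \<cdot> ?y 0 \<boxplus> ?x 1 \<cdot> ?y 1) \<boxplus> (?x 1 \<cdot> ?y 0 \<boxplus> ?x 0 \<cdot> ?y 1)"
    by simp
  also have "\<dots> \<approx> (?x 0 \<cdot> ?y 0 \<boxplus> ?x 1 \<cdot> ?y 0) \<boxplus> (?x 1 \<cdot> ?y 1 \<boxplus> ?x 0 \<cdot> ?y 1)" by (rule swap4; simp)
  also have "\<dots> \<approx> (?x 0 \<cdot> ?y 0 \<boxplus> ?x 1 \<cdot> ?y 0) \<boxplus> (?x 0 \<cdot> ?y 1 \<boxplus> ?x 1 \<cdot> ?y 1)"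
    by (rule c_add_cong[OF c_refl c_add_comm]; simp)
  also have "\<dots> \<approx> (?x 0 \<boxplus> ?x 1) \<cdot> ?y 0 \<boxplus> (?x 0 \<boxplus> ?x 1) \<cdot> ?y 1"
    by (rule c_add_cong[OF c_sym[OF c_add_mul] c_sym[OF c_add_mul]]; simp)
  also have "\<dots> \<approx> (?x 0 \<boxplus> ?x 1) \<cdot> (?y 0 \<boxplus> ?y 1)"
    by (intro c_sym[OF c_mul_add]) auto
  also have "\<dots> \<approx> x \<cdot> y" by (intro c_mul_cong AMul) auto
  finally show ?case .
next
  case (AAdd x y)
  hence [simp]: "x \<in> TT" "y \<in> TT" by auto
  note [simp] = aproj_T[of x] aproj_T[of y]
  show ?case by simp (rule c_trans[OF swap4 c_add_cong]; simp add: AAdd)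
next
  case (AScale c x)
  hence [simp]: "x \<in> TT" by auto
  note [simp] = aproj_T[of x]
  show ?case by simp (rule c_trans[OF c_sym[OF c_scale_add] c_scale_cong]; simp add: AScale)
qed (auto intro: c_add_zero)

lemma presented_superalgebra:
  assumes hom: "\<And>x y. (x, y) \<in> R \<Longrightarrow> \<exists>q. ahomog par q x \<and> ahomog par q y"
  shows "superalgebra (presented_superalg G par R)"
proof -
  interpret superalg_terms TT "acong G R" "(\<boxplus>)" AZero "(\<cdot>)" AOne "(*\<^sub>a)" "ahomog par" "aproj par"
  proof (unfold_locales, goal_cases)
    case (25 p x q y) thus ?case by (rule ahomog.intros(4))
  next
    case (27 x y p) thus ?case using aproj_cong[unfolded cong_def, of par x y p] hom by blast
  next
    case 1 thus ?case by (rule acong_equiv)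
  next
    case (30 x) thus ?case by (rule aproj_sum[unfolded cong_def])
  next
    case (31 x p) thus ?case using aproj_other[unfolded cong_def, of par p x] by blast
  next
    case (32 x p) thus ?case using aproj_other[unfolded cong_def flip_par_def, of par p x] by blast
  next
    case (28 x p) thus ?case by (rule aproj_H)
  next
    case (29 p x y) thus ?case by simp
  next
    case 2 thus ?case by (rule TI(1))
  next
    case 3 thus ?case by (rule TI(2))
  next
    case 4 thus ?case by (rule acong.add_cong)
  next
    case 5 thus ?case by (rule acong.mul_cong)
  next
    case 6 thus ?case by (rule acong.scale_cong)
  next
    case 7 thus ?case by (rule acong.add_assoc)
  next
    case 8 thus ?case by (rule acong.add_comm)
  next
    case 9 thus ?case by (rule acong.add_zero)
  next
    case 10 thus ?case by (rule acong.zero_scale)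
  next
    case 11 thus ?case by (rule acong.one_scale)
  next
    case 12 thus ?case by (rule acong.scale_scale)
  next
    case 13 thus ?case by (rule acong.scale_add)
  next
    case 14 thus ?case by (rule acong.add_scale)
  next
    case 15 thus ?case by (rule acong.mul_assoc)
  next
    case 16 thus ?case by (rule acong.one_mul)
  next
    case 17 thus ?case by (rule acong.mul_one)
  next
    case 18 thus ?case by (rule acong.add_mul)
  next
    case 19 thus ?case by (rule acong.mul_add)
  next
    case 20 thus ?case by (rule acong.scale_mul)
  next
    case 21 thus ?case by (rule acong.mul_scale)
  next
    case 22 thus ?case by (rule ahomog.intros(3))
  next
    case 23 thus ?case by (rule ahomog.intros(2))
  next
    case 24 thus ?case by (rule ahomog.intros(5))
  next
    case 26 thus ?case by (rule ahomog.intros(6))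
  qed
  show ?thesis using superalgebra_Q by (simp add: presented_superalg_def)
qed

end

fun adeg :: "('g \<Rightarrow> bit) \<Rightarrow> ('g, 'k) aterm \<Rightarrow> bit" where
  "adeg par (AGen g) = par g" | "adeg par AOne = 0" | "adeg par AZero = 0" | "adeg par (x \<cdot> y) = adeg par x + adeg par y"
| "adeg par (x \<boxplus> y) = adeg par x" | "adeg par (c *\<^sub>a x) = adeg par x"
fun ahomog_ok :: "('g \<Rightarrow> bit) \<Rightarrow> ('g, 'k) aterm \<Rightarrow> bool" where
  "ahomog_ok par (x \<cdot> y) = (ahomog_ok par x \<and> ahomog_ok par y)"
| "ahomog_ok par (x \<boxplus> y) = (ahomog_ok par x \<and> ahomog_ok par y \<and> adeg par x = adeg par y)" | "ahomog_ok par (c *\<^sub>a x) = ahomog_ok par x"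
| "ahomog_ok par _ = True"

lemma ahomog_ok: "ahomog_ok par x \<Longrightarrow> ahomog par (adeg par x) x"
proof (induction x)
  case (AAdd x y) then show ?case using ahomog.intros(5)[of par "adeg par x" x y] by auto
next
  case (AMul x y) then show ?case unfolding adeg.simps ahomog_ok.simps by (intro ahomog.intros) auto
qed (auto intro: ahomog.intros)

lemma BC_superalgebra: "superalgebra (BC r s z)"
  unfolding BC_def
proof (rule presented_superalgebra)
  fix x y assume "(x, y) \<in> bcrels r z"
  then have "ahomog_ok bcpar x \<and> ahomog_ok bcpar y \<and> (adeg bcpar x = adeg bcpar y \<or> y = AZero)"
    by cases (simp_all add: bt_inv_def)
  thus "\<exists>q. ahomog bcpar q x \<and> ahomog bcpar q y"
    by (metis ahomog_ok ahomog.intros(3))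
qed

fun mproj :: "('o, 'g) signature \<Rightarrow> bit \<Rightarrow> ('o, 'g, 'k) mterm \<Rightarrow> ('o, 'g, 'k) mterm" where
  "mproj S p (MGen a) = (if spar S a = p then MGen a else MZero (sdom S a) (scod S a))"
| "mproj S p (MId X) = (if p = 0 then MId X else MZero X X)"
| "mproj S p (MZero X Y) = MZero X Y"
| "mproj S p (x \<bullet> y) = mproj S p x \<bullet> mproj S 0 y \<uplus> mproj S (flip_par p) x \<bullet> mproj S 1 y"
| "mproj S p (x \<boxtimes> y) = mproj S p x \<boxtimes> mproj S 0 y \<uplus> mproj S (flip_par p) x \<boxtimes> mproj S 1 y"
| "mproj S p (x \<uplus> y) = mproj S p x \<uplus> mproj S p y"
| "mproj S p (c *\<^sub>m x) = c *\<^sub>m mproj S p x"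

lemma mproj_T: "typed S f X Y \<Longrightarrow> typed S (mproj S p f) X Y"
  by (induction arbitrary: p rule: typed.induct) (auto intro: typed.intros)

lemma mproj_H: "mhomog S p (mproj S p x)"
proof (induction x arbitrary: p)
  case (MComp x y)
  have "mhomog S (flip_par p + 1) (mproj S (flip_par p) x \<bullet> mproj S 1 y)" "mhomog S (p + 0) (mproj S p x \<bullet> mproj S 0 y)"
    by (rule mhomog.intros MComp)+
  moreover have "flip_par p + 1 = p" "p + 0 = p" by (cases p; simp add: flip_par_def)+
  ultimately show ?case by (simp only: mproj.simps mhomog.intros(6))
next
  case (MTens x y)
  have "mhomog S (flip_par p + 1) (mproj S (flip_par p) x \<boxtimes> mproj S 1 y)" "mhomog S (p + 0) (mproj S p x \<boxtimes> mproj S 0 y)"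
    by (rule mhomog.intros MTens)+
  moreover have "flip_par p + 1 = p" "p + 0 = p" by (cases p; simp add: flip_par_def)+
  ultimately show ?case by (simp only: mproj.simps mhomog.intros(6))
next
  case (MGen g) show ?case using mhomog.intros(1)[of S g] by (auto intro: mhomog.intros)
qed (auto intro: mhomog.intros)

lemma mcong_typed: "mcong S R X Y f g \<Longrightarrow> typed S f X Y \<and> typed S g X Y"
proof (induction rule: mcong.induct)
  case (tens_assoc f X Y g X' Y' h X'' Y'')
  have "typed S (f \<boxtimes> g \<boxtimes> h) ((X @ X') @ X'') ((Y @ Y') @ Y'')"  "typed S (f \<boxtimes> (g \<boxtimes> h)) (X @ X' @ X'') (Y @ Y' @ Y'')" 
    by (intro typed.intros tens_assoc)+
  thus ?case by simp
next
  case (unit_tens f X Y)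
  show ?case using typed.intros(5)[OF typed.intros(2)[of S "[]"] unit_tens] unit_tens by simp
next
  case (tens_unit f X Y)
  show ?case using typed.intros(5)[OF tens_unit typed.intros(2)[of S "[]"]] tens_unit by simp
qed (auto intro: typed.intros)

context
  fixes S :: "('o, 'g) signature" and R :: "(('o, 'g, 'k::comm_ring_1) mterm \<times> ('o, 'g, 'k) mterm) set"
begin

private abbreviation "C \<equiv> mcong S R"
private abbreviation "ty \<equiv> typed S"

lemmas [trans] = mcong.trans[where S=S and R=R]
private lemmas tI = typed.intros[where S=S]
private lemmas tT = mproj_T[where S=S]

private lemma mzero_add: "ty f X Y \<Longrightarrow> C X Y (MZero X Y \<uplus> f) f"
  by (rule mcong.trans[OF mcong.add_comm mcong.add_zero]) (auto intro: tI)

private lemma mscale_zero: "C X Y (c *\<^sub>m MZero X Y) (MZero X Y)"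
proof -
  have Z: "C X Y (0 *\<^sub>m MZero X Y) (MZero X Y)" by (rule mcong.zero_scale) (rule tI)
  have "C X Y (c *\<^sub>m MZero X Y) (c *\<^sub>m 0 *\<^sub>m MZero X Y)"
    by (rule mcong.scale_cong) (rule mcong.sym[OF Z])
  also have "C X Y (c *\<^sub>m 0 *\<^sub>m MZero X Y) ((c * 0) *\<^sub>m MZero X Y)" by (rule mcong.scale_scale) (rule tI)
  also have "C X Y ((c * 0) *\<^sub>m MZero X Y) (MZero X Y)" using Z by simp
  finally show ?thesis .
qed

private lemma mcomp_zero: assumes "ty f Y W" shows "C X W (f \<bullet> MZero X Y) (MZero X W)"
proof -
  have Z: "C X Y (0 *\<^sub>m MZero X Y) (MZero X Y)" by (rule mcong.zero_scale) (rule tI)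
  have "C X W (f \<bullet> MZero X Y) (f \<bullet> (0 *\<^sub>m MZero X Y))"
    by (rule mcong.comp_cong[OF mcong.refl[OF assms] mcong.sym[OF Z]])
  also have "C X W (f \<bullet> (0 *\<^sub>m MZero X Y)) (0 *\<^sub>m (f \<bullet> MZero X Y))" 
    by (rule mcong.comp_scale[OF assms]) (rule tI)
  also have "C X W \<dots> (MZero X W)" by (rule mcong.zero_scale) (rule tI assms)+
  finally show ?thesis .
qed

private lemma mzero_comp: assumes "ty f X Y" shows "C X W (MZero Y W \<bullet> f) (MZero X W)"
proof -
  have Z: "C Y W (0 *\<^sub>m MZero Y W) (MZero Y W)" by (rule mcong.zero_scale) (rule tI)
  have "C X W (MZero Y W \<bullet> f) (0 *\<^sub>m MZero Y W \<bullet> f)"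
    by (rule mcong.comp_cong[OF mcong.sym[OF Z] mcong.refl[OF assms]])
  also have "C X W (0 *\<^sub>m MZero Y W \<bullet> f) (0 *\<^sub>m (MZero Y W \<bullet> f))" 
    by (rule mcong.scale_comp[OF _ assms]) (rule tI)
  also have "C X W \<dots> (MZero X W)" by (rule mcong.zero_scale) (rule tI assms)+
  finally show ?thesis .
qed

private lemma mtens_zero: assumes "ty f X Y" shows "C (X @ X') (Y @ Y') (f \<boxtimes> MZero X' Y') (MZero (X @ X') (Y @ Y'))"
proof -
  have Z: "C X' Y' (0 *\<^sub>m MZero X' Y') (MZero X' Y')" by (rule mcong.zero_scale) (rule tI)
  have "C (X @ X') (Y @ Y') (f \<boxtimes> MZero X' Y') (f \<boxtimes> (0 *\<^sub>m MZero X' Y'))"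
    by (rule mcong.tens_cong[OF mcong.refl[OF assms] mcong.sym[OF Z]])
  also have "C (X @ X') (Y @ Y') (f \<boxtimes> (0 *\<^sub>m MZero X' Y')) (0 *\<^sub>m (f \<boxtimes> MZero X' Y'))" 
    by (rule mcong.tens_scale[OF assms]) (rule tI)
  also have "C (X @ X') (Y @ Y') \<dots> (MZero (X @ X') (Y @ Y'))" by (rule mcong.zero_scale) (rule tI assms)+
  finally show ?thesis .
qed

private lemma mzero_tens: assumes "ty f X' Y'" shows "C (X @ X') (Y @ Y') (MZero X Y \<boxtimes> f) (MZero (X @ X') (Y @ Y'))"
proof -
  have Z: "C X Y (0 *\<^sub>m MZero X Y) (MZero X Y)" by (rule mcong.zero_scale) (rule tI)
  have "C (X @ X') (Y @ Y') (MZero X Y \<boxtimes> f) (0 *\<^sub>m MZero X Y \<boxtimes> f)"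
    by (rule mcong.tens_cong[OF mcong.sym[OF Z] mcong.refl[OF assms]])
  also have "C (X @ X') (Y @ Y') (0 *\<^sub>m MZero X Y \<boxtimes> f) (0 *\<^sub>m (MZero X Y \<boxtimes> f))" 
    by (rule mcong.scale_tens[OF _ assms]) (rule tI)
  also have "C (X @ X') (Y @ Y') \<dots> (MZero (X @ X') (Y @ Y'))" by (rule mcong.zero_scale) (rule tI assms)+
  finally show ?thesis .
qed

private lemma mswap4: assumes [simp]: "ty a X Y" "ty b X Y" "ty c X Y" "ty d X Y"
  shows "C X Y ((a \<uplus> b) \<uplus> (c \<uplus> d)) ((a \<uplus> c) \<uplus> (b \<uplus> d))"
proof -
  have "C X Y ((a \<uplus> b) \<uplus> (c \<uplus> d)) (a \<uplus> (b \<uplus> (c \<uplus> d)))" by (rule mcong.add_assoc) (auto intro: tI)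
  also have "C X Y \<dots> (a \<uplus> ((b \<uplus> c) \<uplus> d))"
    by (rule mcong.add_cong[OF mcong.refl mcong.sym[OF mcong.add_assoc]]) auto
  also have "C X Y \<dots> (a \<uplus> ((c \<uplus> b) \<uplus> d))"
    by (rule mcong.add_cong[OF mcong.refl mcong.add_cong[OF mcong.add_comm mcong.refl]]) auto
  also have "C X Y \<dots> (a \<uplus> (c \<uplus> (b \<uplus> d)))"
    by (rule mcong.add_cong[OF mcong.refl mcong.add_assoc]) auto
  also have "C X Y \<dots> ((a \<uplus> c) \<uplus> (b \<uplus> d))" by (rule mcong.sym[OF mcong.add_assoc]) (auto intro: tI)
  finally show ?thesis .
qed

private lemma s1: "C X Y u w \<Longrightarrow> C X Y v (MZero X Y) \<Longrightarrow> C X Y (u \<uplus> v) w"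
  by (rule mcong.trans[OF mcong.add_cong mcong.trans[OF mcong.add_zero mcong.refl]]) (auto dest: mcong_typed)
private lemma s2: "C X Y v w \<Longrightarrow> C X Y u (MZero X Y) \<Longrightarrow> C X Y (u \<uplus> v) w"
  by (rule mcong.trans[OF mcong.add_cong mcong.trans[OF mzero_add mcong.refl]]) (auto dest: mcong_typed)

private definition px :: "bit \<Rightarrow> bit \<Rightarrow> bit" where "px p q = (if q = 0 then p else flip_par p)"

private definition hp where "hp X Y q f \<longleftrightarrow> ty f X Y \<and> C X Y (mproj S q f) f \<and> C X Y (mproj S (flip_par q) f) (MZero X Y)"

private lemma hp_ty: "hp X Y q f \<Longrightarrow> ty f X Y" by (simp add: hp_def)

private lemma comp_homR: assumes f: "ty f Y W" and g: "hp X Y q g"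
  shows "C X W (mproj S n (f \<bullet> g)) (mproj S (px n q) f \<bullet> g)"
proof (cases "q = 0")
  case True
  hence "C X Y (mproj S 0 g) g" "C X Y (mproj S 1 g) (MZero X Y)" using g by (auto simp: hp_def)
  thus ?thesis using True unfolding px_def mproj.simps if_P[OF True]
    by (auto intro!: s1 mcong.comp_cong[OF mcong.refl[OF tT[OF f]]] mcong.trans[OF mcong.comp_cong[OF mcong.refl[OF tT[OF f]]] mcomp_zero[OF tT[OF f]]])
next
  case False
  hence "C X Y (mproj S 1 g) g" "C X Y (mproj S 0 g) (MZero X Y)" using g by (auto simp: hp_def)
  thus ?thesis using False unfolding px_def mproj.simps if_not_P[OF False]
    by (auto intro!: s2 mcong.comp_cong[OF mcong.refl[OF tT[OF f]]] mcong.trans[OF mcong.comp_cong[OF mcong.refl[OF tT[OF f]]] mcomp_zero[OF tT[OF f]]])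
qed

private lemma comp_homL: assumes f: "hp Y W p f" and g: "ty g X Y"
  shows "C X W (mproj S n (f \<bullet> g)) (f \<bullet> mproj S (px n p) g)"
proof -
  have "C Y W (mproj S p f) f" "C Y W (mproj S (flip_par p) f) (MZero Y W)" using f by (auto simp: hp_def)
  note * = mcong.comp_cong[OF this(1) mcong.refl[OF tT[OF g]]] mcong.trans[OF mcong.comp_cong[OF this(2) mcong.refl[OF tT[OF g]]] mzero_comp[OF tT[OF g]]]
  have "p = n \<or> p = flip_par n" by (rule flip_par_cases)
  thus ?thesis
  proof
    assume pn: "p = n"
    show ?thesis
    proof (cases "p = 0")
      case True thus ?thesis using pn * by (auto simp: px_def intro!: s1)
    next
      case False hence "p = 1" by simp
      thus ?thesis using pn * by (auto simp: px_def intro!: s1)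
    qed
  next
    assume pn: "p = flip_par n"
    show ?thesis
    proof (cases "p = 0")
      case True hence n: "n = 1" using pn by (cases n) auto
      show ?thesis using n True * by (auto simp: px_def intro!: s2)
    next
      case False hence p: "p = 1" by simp hence n: "n = 0" using pn by (cases n) auto
      show ?thesis using n p * by (auto simp: px_def intro!: s2)
    qed
  qed
qed

private lemma tens_homR: assumes f: "ty f X Y" and g: "hp X' Y' q g"
  shows "C (X @ X') (Y @ Y') (mproj S n (f \<boxtimes> g)) (mproj S (px n q) f \<boxtimes> g)"
proof (cases "q = 0")
  case True
  hence "C X' Y' (mproj S 0 g) g" "C X' Y' (mproj S 1 g) (MZero X' Y')" using g by (auto simp: hp_def)
  thus ?thesis using True unfolding px_def mproj.simps if_P[OF True]
    by (auto intro!: s1 mcong.tens_cong[OF mcong.refl[OF tT[OF f]]] mcong.trans[OF mcong.tens_cong[OF mcong.refl[OF tT[OF f]]] mtens_zero[OF tT[OF f]]])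
next
  case False
  hence "C X' Y' (mproj S 1 g) g" "C X' Y' (mproj S 0 g) (MZero X' Y')" using g by (auto simp: hp_def)
  thus ?thesis using False unfolding px_def mproj.simps if_not_P[OF False]
    by (auto intro!: s2 mcong.tens_cong[OF mcong.refl[OF tT[OF f]]] mcong.trans[OF mcong.tens_cong[OF mcong.refl[OF tT[OF f]]] mtens_zero[OF tT[OF f]]])
qed

private lemma tens_homL: assumes f: "hp X Y p f" and g: "ty g X' Y'"
  shows "C (X @ X') (Y @ Y') (mproj S n (f \<boxtimes> g)) (f \<boxtimes> mproj S (px n p) g)"
proof -
  have "C X Y (mproj S p f) f" "C X Y (mproj S (flip_par p) f) (MZero X Y)" using f by (auto simp: hp_def)
  note * = mcong.tens_cong[OF this(1) mcong.refl[OF tT[OF g]]] mcong.trans[OF mcong.tens_cong[OF this(2) mcong.refl[OF tT[OF g]]] mzero_tens[OF tT[OF g]]]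
  have "p = n \<or> p = flip_par n" by (rule flip_par_cases)
  thus ?thesis
  proof
    assume pn: "p = n"
    show ?thesis
    proof (cases "p = 0")
      case True thus ?thesis using pn * by (auto simp: px_def intro!: s1)
    next
      case False hence "p = 1" by simp
      thus ?thesis using pn * by (auto simp: px_def intro!: s1)
    qed
  next
    assume pn: "p = flip_par n"
    show ?thesis
    proof (cases "p = 0")
      case True hence n: "n = 1" using pn by (cases n) auto
      show ?thesis using n True * by (auto simp: px_def intro!: s2)
    next
      case False hence p: "p = 1" by simp hence n: "n = 0" using pn by (cases n) auto
      show ?thesis using n p * by (auto simp: px_def intro!: s2)
    qed
  qed
qed

private lemma px_add: "px (p + q) q = p" "px (flip_par (p + q)) q = flip_par p"
  by (cases p; cases q; simp add: px_def flip_par_def)+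

private lemma mproj_other: "ty f X Y \<Longrightarrow> mhomog S q f \<Longrightarrow> hp X Y q f"
proof (induction arbitrary: q rule: typed.induct)
  case (4 f Y W g X)
  from 4(5) obtain a b where q: "q = a + b" "mhomog S a f" "mhomog S b g" by (auto elim: mhomog.cases)
  have h: "hp Y W a f" "hp X Y b g" using 4 q by auto
  have f: "C Y W (mproj S a f) f" "C Y W (mproj S (flip_par a) f) (MZero Y W)" using h by (auto simp: hp_def)
  have t: "ty f Y W" "ty g X Y" using h by (auto simp: hp_def)
  have 1: "C X W (mproj S q (f \<bullet> g)) (f \<bullet> g)"
    using comp_homR[OF t(1) h(2), of q] mcong.comp_cong[OF f(1) mcong.refl[OF t(2)]] unfolding q(1) px_add by (rule mcong.trans)
  have 2: "C X W (mproj S (flip_par q) (f \<bullet> g)) (MZero Y W \<bullet> g)"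
    using comp_homR[OF t(1) h(2), of "flip_par q"] mcong.comp_cong[OF f(2) mcong.refl[OF t(2)]] unfolding q(1) px_add by (rule mcong.trans)
  show ?case using 1 mcong.trans[OF 2 mzero_comp[OF t(2)]] tI(4)[OF t] by (simp add: hp_def)
next
  case (5 f X Y g X' Y')
  from 5(5) obtain a b where q: "q = a + b" "mhomog S a f" "mhomog S b g" by (auto elim: mhomog.cases)
  have h: "hp X Y a f" "hp X' Y' b g" using 5 q by auto
  have f: "C X Y (mproj S a f) f" "C X Y (mproj S (flip_par a) f) (MZero X Y)" using h by (auto simp: hp_def)
  have t: "ty f X Y" "ty g X' Y'" using h by (auto simp: hp_def)
  have 1: "C (X@X') (Y@Y') (mproj S q (f \<boxtimes> g)) (f \<boxtimes> g)"
    using tens_homR[OF t(1) h(2), of q] mcong.tens_cong[OF f(1) mcong.refl[OF t(2)]] unfolding q(1) px_add by (rule mcong.trans)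
  have 2: "C (X@X') (Y@Y') (mproj S (flip_par q) (f \<boxtimes> g)) (MZero X Y \<boxtimes> g)"
    using tens_homR[OF t(1) h(2), of "flip_par q"] mcong.tens_cong[OF f(2) mcong.refl[OF t(2)]] unfolding q(1) px_add by (rule mcong.trans)
  show ?case using 1 mcong.trans[OF 2 mzero_tens[OF t(2)]] tI(5)[OF t] by (simp add: hp_def)
next
  case (6 f X Y g)
  from 6(5) have "mhomog S q f" "mhomog S q g" by (auto elim: mhomog.cases)
  with 6 have "hp X Y q f" "hp X Y q g" by auto
  thus ?case unfolding hp_def mproj.simps by (metis tI(6) mcong.add_cong mcong.trans mcong.add_zero mcong_typed)
next
  case (7 f X Y c)
  from 7(3) have "mhomog S q f" by (auto elim: mhomog.cases)
  with 7 have "hp X Y q f" by auto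
  thus ?case by (auto simp: hp_def intro: mcong.scale_cong tI intro!: mcong.trans[OF mcong.scale_cong mscale_zero])
next
  case (1 a)
  from 1 have "q = spar S a" by (auto elim: mhomog.cases)
  thus ?case by (auto simp: hp_def intro: mcong.refl tI)
next
  case (2 X)
  from 2 have "q = 0" by (auto elim: mhomog.cases)
  thus ?case by (auto simp: hp_def intro: mcong.refl tI)
qed (auto simp: hp_def intro: mcong.refl tI)

private lemma mproj_cong:
  assumes hom: "\<And>f g. (f, g) \<in> R \<Longrightarrow> \<exists>q. mhomog S q f \<and> mhomog S q g"
  shows "C X Y f g \<Longrightarrow> C X Y (mproj S p f) (mproj S p g)"
proof (induction arbitrary: p rule: mcong.induct)
  case (rel f g X Y)
  then obtain q where q: "mhomog S q f" "mhomog S q g" using hom by blast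
  have h: "hp X Y q f" "hp X Y q g" using mproj_other q rel by auto
  have r: "C X Y f g" using rel by (rule mcong.rel)
  have "p = q \<or> p = flip_par q" by (rule flip_par_cases)
  thus ?case using h r unfolding hp_def by (meson mcong.sym mcong.trans)
next
  case (comp_assoc f W V g Y h X)
  let ?x = "\<lambda>p. mproj S p f" and ?y = "\<lambda>p. mproj S p g" and ?w = "\<lambda>p. mproj S p h"
  have t: "\<And>p. ty (?x p) W V" "\<And>p. ty (?y p) Y W" "\<And>p. ty (?w p) X Y" using comp_assoc tT by auto
  note [simp] = t tI(4)[OF t(1) t(2)] tI(4)[OF t(2) t(3)] tI(4)[OF tI(4)[OF t(1) t(2)] t(3)]
  have "C X V (mproj S p (f \<bullet> g \<bullet> h)) ((?x p \<bullet> ?y 0 \<bullet> ?w 0 \<uplus> ?x (flip_par p) \<bullet> ?y 1 \<bullet> ?w 0) \<uplus> (?x (flip_par p) \<bullet> ?y 0 \<bullet> ?w 1 \<uplus> ?x p \<bullet> ?y 1 \<bullet> ?w 1))"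
    unfolding mproj.simps flip_par by (rule mcong.add_cong[OF mcong.add_comp mcong.add_comp]) (rule t tI(4)[OF t(1) t(2)] tI(4)[OF t(2) t(3)] tI(6)[OF t(1) t(1)] tI(6)[OF t(2) t(2)])+
  also have "C X V \<dots> ((?x p \<bullet> ?y 0 \<bullet> ?w 0 \<uplus> ?x (flip_par p) \<bullet> ?y 1 \<bullet> ?w 0) \<uplus> (?x p \<bullet> ?y 1 \<bullet> ?w 1 \<uplus> ?x (flip_par p) \<bullet> ?y 0 \<bullet> ?w 1))"
    by (rule mcong.add_cong[OF mcong.refl mcong.add_comm]) (simp_all add: tI(6))
  also have "C X V \<dots> ((?x p \<bullet> ?y 0 \<bullet> ?w 0 \<uplus> ?x p \<bullet> ?y 1 \<bullet> ?w 1) \<uplus> (?x (flip_par p) \<bullet> ?y 1 \<bullet> ?w 0 \<uplus> ?x (flip_par p) \<bullet> ?y 0 \<bullet> ?w 1))"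
    by (rule mswap4) simp_all
  also have "C X V \<dots> ((?x p \<bullet> (?y 0 \<bullet> ?w 0) \<uplus> ?x p \<bullet> (?y 1 \<bullet> ?w 1)) \<uplus> (?x (flip_par p) \<bullet> (?y 1 \<bullet> ?w 0) \<uplus> ?x (flip_par p) \<bullet> (?y 0 \<bullet> ?w 1)))"
    by (rule mcong.add_cong[OF mcong.add_cong mcong.add_cong]; rule mcong.comp_assoc[OF t])
  also have "C X V \<dots> (mproj S p (f \<bullet> (g \<bullet> h)))"
    unfolding mproj.simps flip_par by (rule mcong.add_cong[OF mcong.sym[OF mcong.comp_add] mcong.sym[OF mcong.comp_add]]) (rule t tI(4)[OF t(1) t(2)] tI(4)[OF t(2) t(3)] tI(6)[OF t(1) t(1)] tI(6)[OF t(2) t(2)])+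
  finally show ?case .
next
  case (tens_assoc f X Y g X' Y' h X'' Y'')
  let ?x = "\<lambda>p. mproj S p f" and ?y = "\<lambda>p. mproj S p g" and ?w = "\<lambda>p. mproj S p h"
  let ?C = "C (X @ X' @ X'') (Y @ Y' @ Y'')"
  have t: "\<And>p. ty (?x p) X Y" "\<And>p. ty (?y p) X' Y'" "\<And>p. ty (?w p) X'' Y''" using tens_assoc tT by auto
  note t3 = tI(5)[OF tI(5)[OF t(1) t(2)] t(3), unfolded append_assoc]
  note [simp] = t tI(5)[OF t(1) t(2)] tI(5)[OF t(2) t(3)] t3
  have "?C (mproj S p (f \<boxtimes> g \<boxtimes> h)) ((?x p \<boxtimes> ?y 0 \<boxtimes> ?w 0 \<uplus> ?x (flip_par p) \<boxtimes> ?y 1 \<boxtimes> ?w 0) \<uplus> (?x (flip_par p) \<boxtimes> ?y 0 \<boxtimes> ?w 1 \<uplus> ?x p \<boxtimes> ?y 1 \<boxtimes> ?w 1))"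
    unfolding mproj.simps flip_par append_assoc[symmetric] by (rule mcong.add_cong[OF mcong.add_tens mcong.add_tens]) (rule t tI(5)[OF t(1) t(2)] tI(5)[OF t(2) t(3)] tI(6)[OF t(1) t(1)] tI(6)[OF t(2) t(2)])+
  also have "?C \<dots> ((?x p \<boxtimes> ?y 0 \<boxtimes> ?w 0 \<uplus> ?x (flip_par p) \<boxtimes> ?y 1 \<boxtimes> ?w 0) \<uplus> (?x p \<boxtimes> ?y 1 \<boxtimes> ?w 1 \<uplus> ?x (flip_par p) \<boxtimes> ?y 0 \<boxtimes> ?w 1))"
    by (rule mcong.add_cong[OF mcong.refl mcong.add_comm]) (simp_all add: tI(6))
  also have "?C \<dots> ((?x p \<boxtimes> ?y 0 \<boxtimes> ?w 0 \<uplus> ?x p \<boxtimes> ?y 1 \<boxtimes> ?w 1) \<uplus> (?x (flip_par p) \<boxtimes> ?y 1 \<boxtimes> ?w 0 \<uplus> ?x (flip_par p) \<boxtimes> ?y 0 \<boxtimes> ?w 1))"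
    by (rule mswap4) simp_all
  also have "?C \<dots> ((?x p \<boxtimes> (?y 0 \<boxtimes> ?w 0) \<uplus> ?x p \<boxtimes> (?y 1 \<boxtimes> ?w 1)) \<uplus> (?x (flip_par p) \<boxtimes> (?y 1 \<boxtimes> ?w 0) \<uplus> ?x (flip_par p) \<boxtimes> (?y 0 \<boxtimes> ?w 1)))"
    by (rule mcong.add_cong[OF mcong.add_cong mcong.add_cong]; rule mcong.tens_assoc[OF t])
  also have "?C \<dots> (mproj S p (f \<boxtimes> (g \<boxtimes> h)))"
    unfolding mproj.simps flip_par by (rule mcong.add_cong[OF mcong.sym[OF mcong.tens_add] mcong.sym[OF mcong.tens_add]]) (rule t tI(5)[OF t(1) t(2)] tI(5)[OF t(2) t(3)] tI(6)[OF t(1) t(1)] tI(6)[OF t(2) t(2)])+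
  finally show ?case .
next
  case (id_comp f X Y)
  have h: "hp Y Y 0 (MId Y)" by (rule mproj_other) (rule tI mhomog.intros)+
  show ?case using comp_homL[OF h id_comp, of p] mcong.id_comp[OF tT[OF id_comp]] 
    unfolding px_def by (auto intro: mcong.trans)
next
  case (comp_id f X Y)
  have h: "hp X X 0 (MId X)" by (rule mproj_other) (rule tI mhomog.intros)+
  show ?case using comp_homR[OF comp_id h, of p] mcong.comp_id[OF tT[OF comp_id]] 
    unfolding px_def by (auto intro: mcong.trans)
next
  case (unit_tens f X Y)
  have h: "hp [] [] 0 (MId [])" by (rule mproj_other) (rule tI mhomog.intros)+
  show ?case using tens_homL[OF h unit_tens, of p] mcong.unit_tens[OF tT[OF unit_tens]] 
    unfolding px_def by (auto intro: mcong.trans)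
next
  case (tens_unit f X Y)
  have h: "hp [] [] 0 (MId [])" by (rule mproj_other) (rule tI mhomog.intros)+
  show ?case using tens_homR[OF tens_unit h, of p] mcong.tens_unit[OF tT[OF tens_unit]] 
    unfolding px_def by (auto intro: mcong.trans)
next
  case (id_tens_id X Y)
  have h: "hp (X @ Y) (X @ Y) 0 (MId X \<boxtimes> MId Y)" "hp (X @ Y) (X @ Y) 0 (MId (X @ Y))"
    using mhomog.intros(5)[OF mhomog.intros(2,2), of S X Y] by (auto intro!: mproj_other tI mhomog.intros)
  have "p = 0 \<or> p = flip_par 0" by (rule flip_par_cases)
  thus ?case using h mcong.id_tens_id[of S R X Y] unfolding hp_def by (meson mcong.sym mcong.trans)
next
  case (add_comp f Y W g h X)
  note t = add_comp[THEN tT]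
  show ?case unfolding mproj.simps
    by (rule mcong.trans[OF mcong.add_cong[OF mcong.add_comp mcong.add_comp] mswap4]) (rule t tI(4)[OF t(1) t(3)] tI(4)[OF t(2) t(3)])+
next
  case (comp_add f Y W g X h)
  note t = comp_add[THEN tT]
  show ?case unfolding mproj.simps
    by (rule mcong.trans[OF mcong.add_cong[OF mcong.comp_add mcong.comp_add] mswap4]) (rule t tI(4)[OF t(1) t(3)] tI(4)[OF t(1) t(2)])+
next
  case (scale_comp f Y W g X c)
  note t = scale_comp[THEN tT]
  show ?case unfolding mproj.simps
    by (rule mcong.trans[OF mcong.add_cong[OF mcong.scale_comp mcong.scale_comp] mcong.sym[OF mcong.scale_add]]) (rule t tI(4)[OF t])+
next
  case (comp_scale f Y W g X c)
  note t = comp_scale[THEN tT]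
  show ?case unfolding mproj.simps
    by (rule mcong.trans[OF mcong.add_cong[OF mcong.comp_scale mcong.comp_scale] mcong.sym[OF mcong.scale_add]]) (rule t tI(4)[OF t])+
next
  case (add_tens f X Y g h X' Y')
  note t = add_tens[THEN tT]
  show ?case unfolding mproj.simps
    by (rule mcong.trans[OF mcong.add_cong[OF mcong.add_tens mcong.add_tens] mswap4]) (rule t tI(5)[OF t(1) t(3)] tI(5)[OF t(2) t(3)])+
next
  case (tens_add f X Y g X' Y' h)
  note t = tens_add[THEN tT]
  show ?case unfolding mproj.simps
    by (rule mcong.trans[OF mcong.add_cong[OF mcong.tens_add mcong.tens_add] mswap4]) (rule t tI(5)[OF t(1) t(3)] tI(5)[OF t(1) t(2)])+
next
  case (scale_tens f X Y g X' Y' c)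
  note t = scale_tens[THEN tT]
  show ?case unfolding mproj.simps
    by (rule mcong.trans[OF mcong.add_cong[OF mcong.scale_tens mcong.scale_tens] mcong.sym[OF mcong.scale_add]]) (rule t tI(5)[OF t])+
next
  case (tens_scale f X Y g X' Y' c)
  note t = tens_scale[THEN tT]
  show ?case unfolding mproj.simps
    by (rule mcong.trans[OF mcong.add_cong[OF mcong.tens_scale mcong.tens_scale] mcong.sym[OF mcong.scale_add]]) (rule t tI(5)[OF t])+
next
  case (interchange f' Y W f X g Y' W' g' X' a b)
  note t = interchange(1-4)
  note tp = t[THEN tT]
  have h: "hp X Y a f" "hp Y' W' b g" using interchange mproj_other by auto
  let ?s = "koszul_sign a b :: 'k" and ?CC = "C (X @ X') (W @ W')"
  let ?u = "\<lambda>m n. (mproj S m f' \<bullet> f) \<boxtimes> (g \<bullet> mproj S n g')"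
  have tu: "ty (?u m n) (X @ X') (W @ W')" for m n by (rule tI tp t)+
  have L0: "C (X @ X') (W @ W') (mproj S m (f' \<boxtimes> g) \<bullet> mproj S n (f \<boxtimes> g')) (?s *\<^sub>m ?u (px m b) (px n a))" for m n
    by (rule mcong.trans[OF mcong.comp_cong[OF tens_homR[OF t(1) h(2)] tens_homL[OF h(1) t(4)]]
         mcong.interchange[OF tp(1) t(2) t(3) tp(4) interchange(5,6)]])
  have L: "?CC (mproj S p ((f' \<boxtimes> g) \<bullet> (f \<boxtimes> g'))) (?s *\<^sub>m (?u (px p b) (px 0 a) \<uplus> ?u (px (flip_par p) b) (px 1 a)))"
    unfolding mproj.simps(4)[of S p "f' \<boxtimes> g"]
    by (rule mcong.trans[OF mcong.add_cong[OF L0 L0] mcong.sym[OF mcong.scale_add]]) (rule tu)+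
  have R0: "?CC (mproj S p ((f' \<bullet> f) \<boxtimes> (g \<bullet> g'))) (?u (px p a) (px 0 b) \<uplus> ?u (px (flip_par p) a) (px 1 b))"
    unfolding mproj.simps(5)[of S p "f' \<bullet> f"]
    by (rule mcong.add_cong[OF mcong.tens_cong[OF comp_homR[OF t(1) h(1)] comp_homL[OF h(2) t(4)]]
          mcong.tens_cong[OF comp_homR[OF t(1) h(1)] comp_homL[OF h(2) t(4)]]])
  have E: "?CC (?u (px p b) (px 0 a) \<uplus> ?u (px (flip_par p) b) (px 1 a)) (?u (px p a) (px 0 b) \<uplus> ?u (px (flip_par p) a) (px 1 b))"
  proof (cases "a = b")
    case True thus ?thesis by (auto intro!: mcong.refl tI(6) tu)
  next
    case False
    hence "a = 0 \<and> b = 1 \<or> a = 1 \<and> b = 0" by (cases a; cases b) auto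
    thus ?thesis by (auto simp: px_def intro!: mcong.add_comm tu)
  qed
  show ?case unfolding mproj.simps(7)
    by (rule mcong.trans[OF L mcong.scale_cong[OF mcong.trans[OF E mcong.sym[OF R0]]]])
next
  case (trans X Y x y w) thus ?case by (blast intro: mcong.trans)
next
  case (sym X Y x y) thus ?case by (blast intro: mcong.sym)
next
  case comp_cong thus ?case unfolding mproj.simps by (intro mcong.add_cong mcong.comp_cong)
next
  case tens_cong thus ?case unfolding mproj.simps by (intro mcong.add_cong mcong.tens_cong)
next
  case add_cong thus ?case unfolding mproj.simps by (intro mcong.add_cong)
next
  case scale_cong thus ?case unfolding mproj.simps by (intro mcong.scale_cong)
next
  case refl thus ?case by (simp add: mcong.refl tT)
qed (simp_all add: mcong.add_assoc mcong.add_comm mcong.add_zero mcong.zero_scale mcong.one_scale mcong.scale_scale mcong.scale_add mcong.add_scale tT)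

private lemma mproj_sum: "ty f X Y \<Longrightarrow> C X Y (mproj S 0 f \<uplus> mproj S 1 f) f"
proof (induction rule: typed.induct)
  case (1 g)
  show ?case by (cases "spar S g") (auto intro: mcong.add_zero mzero_add tI)
next
  case (4 f Y W g X)
  let ?x = "\<lambda>p. mproj S p f" and ?y = "\<lambda>p. mproj S p g"
  have t: "\<And>p. ty (?x p) Y W" "\<And>p. ty (?y p) X Y" using 4 tT by auto
  note [simp] = t tI(4)[OF t] tI(6)[OF t(1) t(1)] tI(6)[OF t(2) t(2)]
  have "C X W (mproj S 0 (f \<bullet> g) \<uplus> mproj S 1 (f \<bullet> g)) ((?x 0 \<bullet> ?y 0 \<uplus> ?x 1 \<bullet> ?y 0) \<uplus> (?x 1 \<bullet> ?y 1 \<uplus> ?x 0 \<bullet> ?y 1))"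
    unfolding mproj.simps flip_par by (rule mswap4) simp_all
  also have "C X W \<dots> ((?x 0 \<bullet> ?y 0 \<uplus> ?x 1 \<bullet> ?y 0) \<uplus> (?x 0 \<bullet> ?y 1 \<uplus> ?x 1 \<bullet> ?y 1))"
    by (rule mcong.add_cong[OF mcong.refl mcong.add_comm]) (simp_all add: tI(6))
  also have "C X W \<dots> ((?x 0 \<uplus> ?x 1) \<bullet> ?y 0 \<uplus> (?x 0 \<uplus> ?x 1) \<bullet> ?y 1)"
    by (rule mcong.add_cong[OF mcong.sym[OF mcong.add_comp] mcong.sym[OF mcong.add_comp]]) (rule t tI(4)[OF t(1) t(2)] tI(6)[OF t(1) t(1)] tI(6)[OF t(2) t(2)])+
  also have "C X W \<dots> ((?x 0 \<uplus> ?x 1) \<bullet> (?y 0 \<uplus> ?y 1))"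
    by (rule mcong.sym[OF mcong.comp_add]) (rule t tI(4)[OF t(1) t(2)] tI(6)[OF t(1) t(1)] tI(6)[OF t(2) t(2)])+
  also have "C X W \<dots> (f \<bullet> g)" by (rule mcong.comp_cong[OF 4(3,4)])
  finally show ?case .
next
  case (5 f X Y g X' Y')
  let ?x = "\<lambda>p. mproj S p f" and ?y = "\<lambda>p. mproj S p g" and ?C = "C (X @ X') (Y @ Y')"
  have t: "\<And>p. ty (?x p) X Y" "\<And>p. ty (?y p) X' Y'" using 5 tT by auto
  note [simp] = t tI(5)[OF t] tI(6)[OF t(1) t(1)] tI(6)[OF t(2) t(2)]
  have "?C (mproj S 0 (f \<boxtimes> g) \<uplus> mproj S 1 (f \<boxtimes> g)) ((?x 0 \<boxtimes> ?y 0 \<uplus> ?x 1 \<boxtimes> ?y 0) \<uplus> (?x 1 \<boxtimes> ?y 1 \<uplus> ?x 0 \<boxtimes> ?y 1))"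
    unfolding mproj.simps flip_par by (rule mswap4) simp_all
  also have "?C \<dots> ((?x 0 \<boxtimes> ?y 0 \<uplus> ?x 1 \<boxtimes> ?y 0) \<uplus> (?x 0 \<boxtimes> ?y 1 \<uplus> ?x 1 \<boxtimes> ?y 1))"
    by (rule mcong.add_cong[OF mcong.refl mcong.add_comm]) (simp_all add: tI(6))
  also have "?C \<dots> ((?x 0 \<uplus> ?x 1) \<boxtimes> ?y 0 \<uplus> (?x 0 \<uplus> ?x 1) \<boxtimes> ?y 1)"
    by (rule mcong.add_cong[OF mcong.sym[OF mcong.add_tens] mcong.sym[OF mcong.add_tens]]) (rule t tI(5)[OF t(1) t(2)] tI(6)[OF t(1) t(1)] tI(6)[OF t(2) t(2)])+
  also have "?C \<dots> ((?x 0 \<uplus> ?x 1) \<boxtimes> (?y 0 \<uplus> ?y 1))"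
    by (rule mcong.sym[OF mcong.tens_add]) (rule t tI(5)[OF t(1) t(2)] tI(6)[OF t(1) t(1)] tI(6)[OF t(2) t(2)])+
  also have "?C \<dots> (f \<boxtimes> g)" by (rule mcong.tens_cong[OF 5(3,4)])
  finally show ?case .
next
  case (6 f X Y g)
  show ?case unfolding mproj.simps by (rule mcong.trans[OF mswap4 mcong.add_cong[OF 6(3,4)]]) (rule tT 6)+
next
  case (7 f X Y c)
  show ?case unfolding mproj.simps by (rule mcong.trans[OF mcong.sym[OF mcong.scale_add] mcong.scale_cong[OF 7(2)]]) (rule tT 7)+
qed (auto intro: mcong.add_zero tI)

lemma end_superalgebra:
  assumes hom: "\<And>f g. (f, g) \<in> R \<Longrightarrow> \<exists>q. mhomog S q f \<and> mhomog S q g"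
  shows "superalgebra (end_superalg S R X)"
proof -
  have eq: "equiv {f. ty f X X} {(f, g). C X X f g}"
    by (rule equivI) (auto simp: refl_on_def sym_def trans_def dest: mcong_typed intro: mcong.refl mcong.sym mcong.trans)
  interpret superalg_terms "{f. ty f X X}" "{(f, g). C X X f g}" "(\<uplus>)" "MZero X X" "(\<bullet>)" "MId X" "(*\<^sub>m)" "mhomog S" "mproj S"
  proof (unfold_locales, unfold mem_Collect_eq case_prod_conv, goal_cases)
    case (25 p x q y) thus ?case by (rule mhomog.intros(4))
  next
    case (27 x y p) thus ?case using mproj_cong[of X X x y p] hom by blast
  next
    case 1 thus ?case by (rule eq)
  next
    case (30 x) thus ?case by (rule mproj_sum)
  next
    case (31 x p) thus ?case using mproj_other[of x X X p] by (simp add: hp_def)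
  next
    case (32 x p) thus ?case using mproj_other[of x X X p] unfolding hp_def flip_par_def by blast
  next
    case (28 x p) thus ?case by (rule mproj_H)
  next
    case (29 p x y) thus ?case by simp
  next
    case 2 thus ?case by (rule tI)
  next
    case 3 thus ?case by (rule tI)
  next
    case 4 thus ?case by (rule mcong.add_cong)
  next
    case 5 thus ?case by (rule mcong.comp_cong)
  next
    case 6 thus ?case by (rule mcong.scale_cong)
  next
    case 7 thus ?case by (rule mcong.add_assoc)
  next
    case 8 thus ?case by (rule mcong.add_comm)
  next
    case 9 thus ?case by (rule mcong.add_zero)
  next
    case 10 thus ?case by (rule mcong.zero_scale)
  next
    case 11 thus ?case by (rule mcong.one_scale)
  next
    case 12 thus ?case by (rule mcong.scale_scale)
  next
    case 13 thus ?case by (rule mcong.scale_add)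
  next
    case 14 thus ?case by (rule mcong.add_scale)
  next
    case 15 thus ?case by (rule mcong.comp_assoc)
  next
    case 16 thus ?case by (rule mcong.id_comp)
  next
    case 17 thus ?case by (rule mcong.comp_id)
  next
    case 18 thus ?case by (rule mcong.add_comp)
  next
    case 19 thus ?case by (rule mcong.comp_add)
  next
    case 20 thus ?case by (rule mcong.scale_comp)
  next
    case 21 thus ?case by (rule mcong.comp_scale)
  next
    case 22 thus ?case by (rule mhomog.intros)
  next
    case 23 thus ?case by (rule mhomog.intros)
  next
    case 24 thus ?case by (rule mhomog.intros)
  next
    case 26 thus ?case by (rule mhomog.intros)
  qed
  show ?thesis using superalgebra_Q by (simp add: end_superalg_def)
qed

end

fun mdeg :: "('o,'g) signature \<Rightarrow> ('o,'g, 'k) mterm \<Rightarrow> bit" where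
  "mdeg par (MGen g) = spar par g" | "mdeg par (MId _) = 0" | "mdeg par (MZero _ _) = 0" | "mdeg par (x \<bullet> y) = mdeg par x + mdeg par y"
| "mdeg par (x \<boxtimes> y) = mdeg par x + mdeg par y"
| "mdeg par (x \<uplus> y) = mdeg par x" | "mdeg par (c *\<^sub>m x) = mdeg par x"
fun mhomog_ok :: "('o,'g) signature \<Rightarrow> ('o,'g, 'k) mterm \<Rightarrow> bool" where
  "mhomog_ok par (x \<bullet> y) = (mhomog_ok par x \<and> mhomog_ok par y)"
| "mhomog_ok par (x \<boxtimes> y) = (mhomog_ok par x \<and> mhomog_ok par y)"
| "mhomog_ok par (x \<uplus> y) = (mhomog_ok par x \<and> mhomog_ok par y \<and> mdeg par x = mdeg par y)" | "mhomog_ok par (c *\<^sub>m x) = mhomog_ok par x"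
| "mhomog_ok par _ = True"

lemma mhomog_ok: "mhomog_ok par x \<Longrightarrow> mhomog par (mdeg par x) x"
proof (induction x)
  case (MAdd x y) then show ?case using mhomog.intros(6)[of par "mdeg par x" x y] by auto
next
  case (MComp x y) then show ?case unfolding mdeg.simps mhomog_ok.simps by (intro mhomog.intros) auto
next
  case (MTens x y) then show ?case unfolding mdeg.simps mhomog_ok.simps by (intro mhomog.intros) auto
qed (auto intro: mhomog.intros)

lemma End_Q_superalgebra: "superalgebra (End_Q z X)"
  unfolding End_Q_def
proof (rule end_superalgebra)
  fix f g assume "(f, g) \<in> qrels z"
  then have "mhomog_ok qsig f \<and> mhomog_ok qsig g \<and> (mdeg qsig f = mdeg qsig g \<or> g = MZero [] [])"
    unfolding qrels_def by (auto simp: l_plus_def cap_R_def rot_def qsig_def)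
  thus "\<exists>q. mhomog qsig q f \<and> mhomog qsig q g"
    by (metis mhomog_ok mhomog.intros(3))
qed

fun mdom :: "'k qterm \<Rightarrow> updown list" and mcod :: "'k qterm \<Rightarrow> updown list" where
  "mdom (MGen a) = qdom a" | "mdom (MId X) = X" | "mdom (MZero X Y) = X"
| "mdom (f \<bullet> g) = mdom g" | "mdom (f \<boxtimes> g) = mdom f @ mdom g" | "mdom (f \<uplus> g) = mdom f"
| "mdom (c *\<^sub>m f) = mdom f"
| "mcod (MGen a) = qcod a" | "mcod (MId X) = X" | "mcod (MZero X Y) = Y"
| "mcod (f \<bullet> g) = mcod f" | "mcod (f \<boxtimes> g) = mcod f @ mcod g" | "mcod (f \<uplus> g) = mcod f"
| "mcod (c *\<^sub>m f) = mcod f"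

fun mwt :: "'k qterm \<Rightarrow> bool" where
  "mwt (f \<bullet> g) = (mwt f \<and> mwt g \<and> mdom f = mcod g)"
| "mwt (f \<boxtimes> g) = (mwt f \<and> mwt g)"
| "mwt (f \<uplus> g) = (mwt f \<and> mwt g \<and> mdom f = mdom g \<and> mcod f = mcod g)"
| "mwt (c *\<^sub>m f) = mwt f"
| "mwt _ = True"

lemma mwt_typed: "mwt f \<Longrightarrow> typed qsig f (mdom f) (mcod f)"
proof (induction f)
  case (MGen a) show ?case using typed.intros(1)[of qsig a] by (simp add: qsig_def)
next
  case (MAdd f g) thus ?case using typed.intros(6)[of qsig f "mdom f" "mcod f" g] by simp
next
  case (MComp f g) thus ?case using typed.intros(4)[of qsig f "mcod g" "mcod f" g "mdom g"] by simp
qed (auto intro: typed.intros)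

lemma qrels_typed:
  assumes "(f, g) \<in> qrels z"
  shows "\<exists>X Y. typed qsig f X Y \<and> typed qsig g X Y"
proof -
  have "mwt f \<and> mwt g \<and> mdom f = mdom g \<and> mcod f = mcod g"
    using assms unfolding qrels_def by (auto simp: l_plus_def cap_R_def rot_def)
  thus ?thesis using mwt_typed by metis
qed

end

theory Submission
  imports Defs "HOL-Library.Product_Plus" "HOL-Library.Function_Algebras" "Jordan_Normal_Form.Determinant"
begin

text \<open>
  Let \<open>H\<close> be the Hecke--Clifford algebra on infinitely many strands. A morphism \<open>f\<close> of the supercategory
  acts on \<open>H\<close> by linear maps \<open>mact f i j\<close>, where \<open>i\<close> counts the \<open>\<up>\<close> to the right of \<open>f\<close> and \<open>j\<close> the \<open>\<down>\<close>
  to its left: \<open>u\<^sup>+\<close> and \<open>c\<close> multiply from the left, \<open>d\<^sup>+\<close> and the dual of \<open>c\<close> from the right, \<open>r\<^sup>-\<close> is the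
  identity, a cup is the shift of strands and a cap the partial trace, both up to crossings. In the
  same way \<open>BC r s z\<close> acts on \<open>H\<close>, and \<open>s\<close> nested cups give a vector, the vacuum. Its orbit is the
  subalgebra on \<open>r + s\<close> strands, which is free of rank \<open>(r + s)! 2\<^sup>r\<^sup>+\<^sup>s\<close>, and \<open>BC r s z\<close> is spanned by
  as many elements; a surjective endomorphism of a free module of finite rank being injective, an
  element of \<open>BC r s z\<close> is determined by its value on the vacuum.

  An endomorphism in the supercategory is determined by its value on the vacuum, too: bending the
  \<open>\<down>\<close> of its domain turns it into a morphism from \<open>r\<close> upward strands to \<open>r + s\<close> upward and \<open>s\<close>
  downward ones, and each of these is an element of \<open>BC (r + s) 0 z\<close> applied to nested cups, so that
  the case \<open>s = 0\<close> of the previous statement applies. Hence comparing values on the vacuum shows at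
  once that the assignment on generators respects the relations, is injective and is surjective.

  To keep the parameter out of the types, \<open>H\<close> is an algebra over the functions of \<open>z\<close> and morphisms
  are families indexed by \<open>z\<close>; the idempotents \<open>heps z\<close> and \<open>dlt z\<close> restrict to one parameter.
\<close>

section \<open>The infinite Hecke--Clifford algebra\<close>


text \<open>The obstacle is linear independence: nothing is known about \<open>H\<close> beyond its
  presentation. A basis over the shifted subalgebra is therefore not proved first. Instead the
  matrices by which the generators would act on such a basis define a coinduced module; once the
  relations are checked there, evaluating it yields the coordinates \<open>coord\<close> and the
  partial trace \<open>hE\<close> together. The upper bound for \<open>BC r s z\<close> filters by
  the number k of turnbacks; taking inverse crossings on the upward side makes both sides of the
  wall satisfy the same relations with opposite parameters, so that one argument serves both. In the
  supercategory the delicate generator is the cap: together with a cup it closes the last strand of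
  an arbitrary word in upward crossings and dots, which diagrams evaluate only for words of the form
  a, a c or a s b with a and b on fewer strands. The faithfulness for s = 0 turns the corresponding
  decomposition in \<open>H\<close> into one of words, and so of morphisms.\<close>

definition zeta :: "'k => 'k" where "zeta = (\<lambda>z. z)"

datatype hgen = HS nat | HC nat

text \<open>The quadratic relation is that of \<open>u_minus\<close>: the \<open>HS i\<close> are
  the inverses of the positive crossings, and positions count from the right.\<close>

inductive_set hrels :: "((hgen, 'k::comm_ring_1 => 'k) aterm \<times> (hgen, 'k => 'k) aterm) set"
  where
    "(AGen (HS i) \<cdot> AGen (HS i), (- zeta) *\<^sub>a AGen (HS i) \<boxplus> AOne) \<in> hrels"
  | "(AGen (HS i) \<cdot> AGen (HS (Suc i)) \<cdot> AGen (HS i),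
      AGen (HS (Suc i)) \<cdot> AGen (HS i) \<cdot> AGen (HS (Suc i))) \<in> hrels"
  | "Suc i < j ==> (AGen (HS i) \<cdot> AGen (HS j), AGen (HS j) \<cdot> AGen (HS i)) \<in> hrels"
  | "(AGen (HC i) \<cdot> AGen (HC i), (- 1) *\<^sub>a AOne) \<in> hrels"
  | "i \<noteq> j ==> (AGen (HC i) \<cdot> AGen (HC j), (- 1) *\<^sub>a (AGen (HC j) \<cdot> AGen (HC i))) \<in> hrels"
  | "(AGen (HS i) \<cdot> AGen (HC i), AGen (HC (Suc i)) \<cdot> AGen (HS i)) \<in> hrels"
  | "j \<noteq> i ==> j \<noteq> Suc i ==> (AGen (HS i) \<cdot> AGen (HC j), AGen (HC j) \<cdot> AGen (HS i)) \<in> hrels"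

abbreviation heq :: "(hgen, 'k::comm_ring_1 => 'k) aterm => (hgen, 'k => 'k) aterm => bool"
  where "heq x y \<equiv> (x, y) \<in> acong UNIV hrels"

lemma aterms_UNIV [simp]: "x \<in> aterms UNIV"
  by (simp add: aterms_def)

quotient_type (overloaded) 'k hcl = "(hgen, 'k::comm_ring_1 => 'k) aterm" / heq
  by (rule equivpI) (auto simp: reflp_def symp_def transp_def
      intro: acong.refl acong.sym acong.trans)

instantiation hcl :: (comm_ring_1) "{zero, one, plus, times, uminus, minus}"
begin
lift_definition zero_hcl :: "'a hcl" is AZero .
lift_definition one_hcl :: "'a hcl" is AOne .
lift_definition plus_hcl :: "'a hcl => 'a hcl => 'a hcl" is AAdd by (rule acong.add_cong)
lift_definition times_hcl :: "'a hcl => 'a hcl => 'a hcl" is AMul by (rule acong.mul_cong)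
lift_definition uminus_hcl :: "'a hcl => 'a hcl" is "AScale (- 1)" by (rule acong.scale_cong)
definition minus_hcl :: "'a hcl => 'a hcl => 'a hcl" where "minus_hcl x y = x + - y"
instance ..
end

lift_definition sc :: "('k::comm_ring_1 => 'k) => 'k hcl" is "\<lambda>a. a *\<^sub>a AOne" .
lift_definition hgen :: "hgen => 'k::comm_ring_1 hcl" is AGen .

abbreviation hs :: "nat => 'k::comm_ring_1 hcl" where "hs i \<equiv> hgen (HS i)"
abbreviation hc :: "nat => 'k::comm_ring_1 hcl" where "hc i \<equiv> hgen (HC i)"

lemma acong_neg_add: "((- 1) *\<^sub>a x \<boxplus> x, AZero) \<in> acong UNIV R"
proof -
  have "((- 1) *\<^sub>a x \<boxplus> x, (- 1) *\<^sub>a x \<boxplus> 1 *\<^sub>a x) \<in> acong UNIV R"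
    by (intro acong.add_cong acong.refl acong.sym[OF acong.one_scale]) simp_all
  moreover have "((- 1) *\<^sub>a x \<boxplus> 1 *\<^sub>a x, (- 1 + 1) *\<^sub>a x) \<in> acong UNIV R"
    by (intro acong.sym[OF acong.add_scale]) simp
  moreover have "((- 1 + 1) *\<^sub>a x, AZero) \<in> acong UNIV R"
    using acong.zero_scale[of x UNIV R] by simp
  ultimately show ?thesis by (blast intro: acong.trans)
qed

lemma acong_scale_one_mul: "(a *\<^sub>a AOne \<cdot> x, a *\<^sub>a x) \<in> acong UNIV R"
  by (rule acong.trans[OF acong.scale_mul]) (simp_all add: acong.scale_cong acong.one_mul)

lemma acong_mul_scale_one: "(x \<cdot> (a *\<^sub>a AOne), a *\<^sub>a x) \<in> acong UNIV R"
  by (rule acong.trans[OF acong.mul_scale]) (simp_all add: acong.scale_cong acong.mul_one)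

instance hcl :: (comm_ring_1) ring
proof
  fix a b c :: "'a hcl"
  show "a + b + c = a + (b + c)" by transfer (simp add: acong.add_assoc)
  show "a + b = b + a" by transfer (simp add: acong.add_comm)
  show "0 + a = a"
    by transfer (rule acong.trans[OF acong.add_comm acong.add_zero], simp_all)
  show "- a + a = 0" by transfer (rule acong_neg_add)
  show "a - b = a + - b" by (simp add: minus_hcl_def)
  show "a * b * c = a * (b * c)" by transfer (simp add: acong.mul_assoc)
  show "(a + b) * c = a * c + b * c" by transfer (simp add: acong.add_mul)
  show "a * (b + c) = a * b + a * c" by transfer (simp add: acong.mul_add)
qed

instance hcl :: (comm_ring_1) monoid_mult
  by standard (transfer, simp add: acong.one_mul acong.mul_one)+

lemma sc_comm: "x * sc a = sc a * x"
  by transfer (rule acong.trans[OF acong_mul_scale_one acong.sym[OF acong_scale_one_mul]])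

lemma sc_plus: "sc (a + b) = sc a + sc b"
  by transfer (simp add: acong.add_scale)

lemma sc_times: "sc (a * b) = sc a * sc b"
  by transfer (rule acong.trans[OF acong.sym[OF acong.scale_scale]
        acong.sym[OF acong_scale_one_mul]], simp)

lemma sc_0: "sc 0 = 0"
  by transfer (simp add: acong.zero_scale)

lemma sc_1: "sc 1 = 1"
  by transfer (simp add: acong.one_scale)

lemma hcl_induct [case_names gen sc add mult]:
  assumes "\<And>g. P (hgen g)" and "\<And>a. P (sc a)"
    and "\<And>x y. P x ==> P y ==> P (x + y)" and "\<And>x y. P x ==> P y ==> P (x * y)"
  shows "P x"
proof (induction x rule: hcl.abs_induct)
  case (1 t)
  show ?case
  proof (induction t)
    case (AGen g) then show ?case using assms(1) by (simp add: hgen.abs_eq)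
  next
    case AOne then show ?case using assms(2)[of 1] by (simp add: sc_1 one_hcl.abs_eq)
  next
    case AZero then show ?case using assms(2)[of 0] by (simp add: sc_0 zero_hcl.abs_eq)
  next
    case (AMul x y) then show ?case using assms(4) by (simp flip: times_hcl.abs_eq)
  next
    case (AAdd x y) then show ?case using assms(3) by (simp flip: plus_hcl.abs_eq)
  next
    case (AScale a x)
    have "abs_hcl (a *\<^sub>a x) = sc a * abs_hcl x"
      by (simp add: sc.abs_eq times_hcl.abs_eq hcl.abs_eq_iff acong.sym[OF acong_scale_one_mul])
    then show ?case using AScale assms(2,4) by simp
  qed
qed

section \<open>Modules given by operators, and the spin module\<close>

text \<open>Terms are evaluated to operators on an additive group, with the action of scalars as a
  parameter; the modules over \<open>H\<close> and the action of the walled algebra are both of this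
  form.\<close>

fun opeval :: "('g => 'm => 'm) => ('c => 'm => 'm) => ('g, 'c) aterm => 'm => 'm::ab_group_add"
  where
    "opeval \<rho> \<sigma> (AGen g) m = \<rho> g m"
  | "opeval \<rho> \<sigma> AOne m = m"
  | "opeval \<rho> \<sigma> AZero m = 0"
  | "opeval \<rho> \<sigma> (x \<cdot> y) m = opeval \<rho> \<sigma> x (opeval \<rho> \<sigma> y m)"
  | "opeval \<rho> \<sigma> (x \<boxplus> y) m = opeval \<rho> \<sigma> x m + opeval \<rho> \<sigma> y m"
  | "opeval \<rho> \<sigma> (c *\<^sub>a x) m = \<sigma> c (opeval \<rho> \<sigma> x m)"

locale hmodule =
  fixes \<rho> :: "hgen => 'm => 'm::ab_group_add"
    and \<sigma> :: "('k::comm_ring_1 => 'k) => 'm => 'm"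
  assumes gen_add: "\<rho> g (x + y) = \<rho> g x + \<rho> g y"
    and gen_sc: "\<rho> g (\<sigma> a x) = \<sigma> a (\<rho> g x)"
    and sc_add: "\<sigma> a (x + y) = \<sigma> a x + \<sigma> a y"
    and add_sc: "\<sigma> (a + b) x = \<sigma> a x + \<sigma> b x"
    and sc_sc: "\<sigma> a (\<sigma> b x) = \<sigma> (a * b) x"
    and sc_one: "\<sigma> 1 x = x"
    and sq: "\<rho> (HS i) (\<rho> (HS i) x) = \<sigma> (- zeta) (\<rho> (HS i) x) + x"
    and braid: "\<rho> (HS i) (\<rho> (HS (Suc i)) (\<rho> (HS i) x)) =
      \<rho> (HS (Suc i)) (\<rho> (HS i) (\<rho> (HS (Suc i)) x))"
    and far: "Suc i < j ==> \<rho> (HS i) (\<rho> (HS j) x) = \<rho> (HS j) (\<rho> (HS i) x)"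
    and cc: "\<rho> (HC i) (\<rho> (HC i) x) = - x"
    and anti: "i < j ==> \<rho> (HC i) (\<rho> (HC j) x) = - \<rho> (HC j) (\<rho> (HC i) x)"
    and slide: "\<rho> (HS i) (\<rho> (HC i) x) = \<rho> (HC (Suc i)) (\<rho> (HS i) x)"
    and pass: "j \<noteq> i ==> j \<noteq> Suc i ==> \<rho> (HS i) (\<rho> (HC j) x) = \<rho> (HC j) (\<rho> (HS i) x)"
begin

lemma zero_sc: "\<sigma> 0 x = 0"
  using add_sc[of 0 0 x] by simp

lemma sc_zero: "\<sigma> a 0 = 0"
  using sc_add[of a 0 0] by simp

lemma sc_m1: "\<sigma> (- 1) x = - x"
proof -
  have "\<sigma> (- 1) x + x = \<sigma> (- 1 + 1) x" by (simp only: add_sc sc_one)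
  then show ?thesis by (simp add: zero_sc eq_neg_iff_add_eq_0)
qed

lemma opeval_lin: "opeval \<rho> \<sigma> x (m + n) = opeval \<rho> \<sigma> x m + opeval \<rho> \<sigma> x n"
  "opeval \<rho> \<sigma> x (\<sigma> a m) = \<sigma> a (opeval \<rho> \<sigma> x m)"
proof (induction x arbitrary: m n)
  case (AScale b x)
  { case 1 show ?case by (simp add: AScale sc_add) }
  { case 2 show ?case by (simp add: AScale sc_sc mult.commute) }
qed (simp_all add: gen_add gen_sc sc_zero sc_add)

lemma opeval_heq: "heq x y ==> opeval \<rho> \<sigma> x m = opeval \<rho> \<sigma> y m"
proof (induction arbitrary: m rule: acong.induct)
  case (rel x y)
  from rel(1) show ?case
  proof cases
    case (5 i j)
    then show ?thesis using anti[of i j m] anti[of j i m] by (cases "i < j") (auto simp: sc_m1)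
  next
    case (3 i j)
    then show ?thesis using far[of i j m] by simp
  qed (auto simp: sq braid cc slide pass sc_m1)
qed (simp_all add: opeval_lin gen_add gen_sc sc_zero sc_add zero_sc sc_one sc_sc add_sc ac_simps)

end

text \<open>The basic spin module: the Clifford algebra with \<open>s\<^sub>i\<close> acting on the vacuum by a root \<open>q\<close> of
  \<open>q\<^sup>2 = - \<zeta> q + 1\<close>; \<open>\<phi> a\<close> is the coefficient, a pair \<open>u + v q\<close>, of the ordered monomial in the
  \<open>c\<^sub>k\<close> with \<open>a k\<close>.\<close>

definition qmul :: "('k::comm_ring_1 => 'k) \<times> ('k => 'k) => ('k => 'k) \<times> ('k => 'k)"
  where "qmul p = (snd p, fst p - zeta * snd p)"

definition pscale :: "('k::comm_ring_1 => 'k) => ('k => 'k) \<times> ('k => 'k) => ('k => 'k) \<times> ('k => 'k)"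
  where "pscale a p = (a * fst p, a * snd p)"

text \<open>The sign (-1)^m for the number m of \<open>k < i\<close> with \<open>a k\<close>: the
  cost of moving the i-th Clifford generator past the earlier factors of an ordered
  monomial.\<close>

primrec psign :: "(nat => bool) => nat => 'a => 'a::ab_group_add"
  where
    "psign a 0 x = x"
  | psign_Suc: "psign a (Suc i) x = (if a i then - psign a i x else psign a i x)"

text \<open>The cases of \<open>HS i\<close> come from moving s_i through a monomial with s_i c_i =
  c_(i+1) s_i and s_i c_(i+1) = c_i s_i + zeta (c_i - c_(i+1)); what is left acts on the vacuum by
  q.\<close>

fun spin :: "hgen => ((nat => bool) => ('k::comm_ring_1 => 'k) \<times> ('k => 'k)) =>
   (nat => bool) => ('k => 'k) \<times> ('k => 'k)"
  where
    "spin (HC i) \<phi> a = psign a i (if a i then \<phi> (a(i := False)) else - \<phi> (a(i := True)))"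
  | "spin (HS i) \<phi> a =
      (if a i then
         if a (Suc i) then - pscale zeta (\<phi> a) - qmul (\<phi> a)
         else qmul (\<phi> (a(i := False, Suc i := True)))
           + pscale zeta (\<phi> (a(i := False, Suc i := True)))
       else
         if a (Suc i) then qmul (\<phi> (a(i := True, Suc i := False))) - pscale zeta (\<phi> a)
         else qmul (\<phi> a) + pscale zeta (\<phi> (a(i := True, Suc i := True))))"

lemma psign_add: "psign a i (x + y) = psign a i x + psign a i y"
  by (induction i) auto
lemma psign_minus: "psign a i (- x) = - psign a i x"
  by (induction i) auto
lemma psign_diff: "psign a i (x - y) = psign a i x - psign a i y"
  by (induction i) auto
lemma psign_comm: "psign a i (psign b j x) = psign b j (psign a i x)"
  by (induction i) (auto simp: psign_minus)
lemma psign_idem: "psign a i (psign a i x) = x"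
  by (induction i) (auto simp: psign_minus)
lemma psign_upd: "psign (a(j := b)) i x = (if j < i \<and> a j \<noteq> b then - psign a i x else psign a i x)"
  by (induction i) (auto simp: less_Suc_eq)

lemma qp_simps:
  "qmul (x + y) = qmul x + qmul y" "qmul (x - y) = qmul x - qmul y" "qmul (- x) = - qmul x"
  "pscale c (x + y) = pscale c x + pscale c y" "pscale c (x - y) = pscale c x - pscale c y"
  "pscale c (- x) = - pscale c x" "pscale c (qmul x) = qmul (pscale c x)"
  "pscale c (pscale d x) = pscale (c * d) x"
  "qmul (qmul x) = x - qmul (pscale zeta x)"
  by (auto simp: qmul_def pscale_def prod_eq_iff algebra_simps zeta_def)

lemma qmul_psign: "qmul (psign a i x) = psign a i (qmul x)"
  by (induction i) (auto simp: qp_simps)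
lemma pscale_psign: "pscale c (psign a i x) = psign a i (pscale c x)"
  by (induction i) (auto simp: qp_simps)

lemmas psign_simps = psign_add psign_minus psign_diff psign_comm psign_idem qmul_psign pscale_psign
  qp_simps

lemma pscale_uminus: "pscale (- c) p = - pscale c p"
  by (simp add: pscale_def prod_eq_iff)

lemmas spin_simps = psign_simps psign_upd psign_Suc pscale_uminus fun_upd_idem

lemma spin_sq: "spin (HS i) (spin (HS i) x) a = pscale (- zeta) (spin (HS i) x a) + x a"
  by (cases "a i"; cases "a (Suc i)")
    (simp_all add: spin_simps fun_upd_twist[of "Suc i" i] algebra_simps)

lemma spin_cc: "spin (HC i) (spin (HC i) x) a = - x a"
  by (cases "a i") (simp_all add: spin_simps)

lemma spin_slide: "spin (HS i) (spin (HC i) x) a = spin (HC (Suc i)) (spin (HS i) x) a"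
  by (cases "a i"; cases "a (Suc i)")
    (simp_all add: spin_simps fun_upd_twist[of "Suc i" i] algebra_simps)

lemma spin_anti: "i < j ==> spin (HC i) (spin (HC j) x) a = - spin (HC j) (spin (HC i) x) a"
  by (cases "a i"; cases "a j")
    (simp_all add: spin_simps fun_upd_twist[of j i])

lemma spin_far: "Suc i < j ==> spin (HS i) (spin (HS j) x) a = spin (HS j) (spin (HS i) x) a"
  by (cases "a i"; cases "a (Suc i)"; cases "a j"; cases "a (Suc j)")
    (simp_all add: spin_simps fun_upd_twist[of j i] fun_upd_twist[of "Suc j" i]
      fun_upd_twist[of j "Suc i"] fun_upd_twist[of "Suc j" "Suc i"] algebra_simps)

lemma spin_pass: "j \<noteq> i ==> j \<noteq> Suc i ==>
    spin (HS i) (spin (HC j) x) a = spin (HC j) (spin (HS i) x) a"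
  by (cases "a i"; cases "a (Suc i)"; cases "a j"; cases "Suc i < j")
    (simp_all add: spin_simps fun_upd_twist[of j i] fun_upd_twist[of j "Suc i"] algebra_simps)

lemma spin_braid: "spin (HS i) (spin (HS (Suc i)) (spin (HS i) x)) a =
    spin (HS (Suc i)) (spin (HS i) (spin (HS (Suc i)) x)) a"
  by (cases "a i"; cases "a (Suc i)"; cases "a (Suc (Suc i))")
    (simp_all add: spin_simps fun_upd_twist[of "Suc i" i] fun_upd_twist[of "Suc (Suc i)" i]
       fun_upd_twist[of "Suc (Suc i)" "Suc i"] algebra_simps)

interpretation spin: hmodule spin "\<lambda>a \<phi> b. pscale a (\<phi> b)"
proof
  fix g x y and a :: "'a => 'a"
  show "spin g (x + y) = spin g x + spin g (y :: (nat => bool) => ('a => 'a) \<times> ('a => 'a))"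
    by (cases g) (auto simp: fun_eq_iff psign_simps algebra_simps)
  show "spin g (\<lambda>b. pscale a (x b)) = (\<lambda>b. pscale a (spin g x b))"
    by (cases g) (auto simp: fun_eq_iff psign_simps mult.commute algebra_simps)
qed (auto simp: fun_eq_iff psign_simps pscale_def algebra_simps zeta_def
      spin_sq spin_braid spin_cc spin_anti spin_slide spin_pass intro: spin_far simp del: spin.simps)

text \<open>In the spin module \<open>sc a\<close> scales the vacuum by \<open>a\<close>, so the
  presentation does not collapse the scalars.\<close>

lemma sc_eq_0_iff: "sc a = 0 \<longleftrightarrow> a = 0"
proof
  assume "sc a = 0"
  then have "heq (a *\<^sub>a AOne) AZero" by transfer
  from spin.opeval_heq[OF this, of "\<lambda>_. (1, 0)"] show "a = 0"
    by (simp add: fun_eq_iff pscale_def prod_eq_iff)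
qed (simp add: sc_0)

instance hcl :: (comm_ring_1) ring_1
proof
  show "(0::'a hcl) \<noteq> 1" using sc_eq_0_iff[of "1 :: 'a => 'a"] by (simp add: sc_1)
qed

section \<open>Rewriting rules for words in the generators\<close>

lemma hcl_rel: "(x, y) \<in> hrels ==> abs_hcl x = abs_hcl y"
  by (simp add: hcl.abs_eq_iff acong.rel)

lemma abs_scale: "abs_hcl (a *\<^sub>a x) = sc a * abs_hcl x"
  by (simp add: sc.abs_eq times_hcl.abs_eq hcl.abs_eq_iff acong.sym[OF acong_scale_one_mul])

lemma sc_uminus: "sc (- a) = - sc a"
  using sc_plus[of "- a" a] by (simp add: sc_0 eq_neg_iff_add_eq_0)

lemmas habs = hgen.abs_eq[symmetric] times_hcl.abs_eq[symmetric] plus_hcl.abs_eq[symmetric]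
  one_hcl.abs_eq[symmetric] abs_scale

definition hz :: "'k::comm_ring_1 hcl" where "hz = sc zeta"

lemma hs_sq: "hs i * hs i = 1 - hz * hs i"
  using hcl_rel[OF hrels.intros(1)[of i]] by (simp add: habs hz_def sc_uminus)
lemma hs_braid: "hs i * (hs (Suc i) * hs i) = hs (Suc i) * (hs i * hs (Suc i))"
  using hcl_rel[OF hrels.intros(2)[of i]] by (simp add: habs mult.assoc)
lemma hs_far: "Suc i < j ==> hs j * hs i = hs i * hs j"
  by (metis habs(1,2) hcl_rel hrels.intros(3))
lemma hc_sq: "hc i * hc i = - 1"
  using hcl_rel[OF hrels.intros(4)[of i]] by (simp add: habs sc_uminus sc_1)
lemma hc_anti: "j < i ==> hc i * hc j = - (hc j * hc i)"
  using hcl_rel[OF hrels.intros(5)[of i j]] by (simp add: habs sc_uminus sc_1)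
lemma hs_slide: "hs i * hc i = hc (Suc i) * hs i"
  using hcl_rel[OF hrels.intros(6)[of i]] by (simp add: habs)
lemma hs_pass: "j \<noteq> i ==> j \<noteq> Suc i ==> hs i * hc j = hc j * hs i"
  using hcl_rel[OF hrels.intros(7)[of j i]] by (simp add: habs)
lemma hz_comm: "x * hz = hz * x" by (simp add: hz_def sc_comm)

lemma comp_tail: "a * b = c ==> a * (b * x) = c * (x :: 'a :: semigroup_mult)"
  by (simp flip: mult.assoc)

lemma sc_left_comm: "x * (sc a * y) = sc a * (x * y)"
  by (simp only: mult.assoc[symmetric] sc_comm[of x])
lemma hz_left_comm: "x * (hz * y) = hz * (x * y)"
  by (simp add: hz_def sc_left_comm)

lemma hs_sq': "hs i * (hs i * x) = x - hz * (hs i * x)"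
  by (simp add: comp_tail[OF hs_sq] left_diff_distrib mult.assoc)
lemma hs_braid': "hs i * (hs (Suc i) * (hs i * x)) = hs (Suc i) * (hs i * (hs (Suc i) * x))"
  using arg_cong[OF hs_braid[of i], of "\<lambda>y. y * x"] by (simp add: mult.assoc)
lemma hs_far': "Suc i < j ==> hs j * (hs i * x) = hs i * (hs j * x)"
  by (simp add: comp_tail[OF hs_far] mult.assoc)
lemma hc_sq': "hc i * (hc i * x) = - x"
  by (simp add: comp_tail[OF hc_sq])
lemma hc_anti': "j < i ==> hc i * (hc j * x) = - (hc j * (hc i * x))"
  by (simp add: comp_tail[OF hc_anti] mult.assoc)
lemma hs_slide': "hs i * (hc i * x) = hc (Suc i) * (hs i * x)"
  by (simp add: comp_tail[OF hs_slide] mult.assoc)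
lemma hs_pass': "j \<noteq> i ==> j \<noteq> Suc i ==> hs i * (hc j * x) = hc j * (hs i * x)"
  by (simp add: comp_tail[OF hs_pass] mult.assoc)

text \<open>The positive crossing: it will be the operator of \<open>u_plus\<close> and of the
  generators t of the walled algebra.\<close>

definition ht :: "nat => 'k::comm_ring_1 hcl" where "ht i = hs i + hz"

lemma hs_ht: "hs i * ht i = 1" "ht i * hs i = 1"
  by (simp_all add: ht_def distrib_left distrib_right hs_sq hz_comm)

lemma hs_ht': "hs i * (ht i * x) = x" "ht i * (hs i * x) = x"
  by (simp_all add: comp_tail[OF hs_ht(1)] comp_tail[OF hs_ht(2)])

lemma ht_slide: "ht i * hc (Suc i) = hc i * ht i"
proof -
  have "ht i * (hc (Suc i) * hs i) * ht i = ht i * (hs i * hc i) * ht i"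
    by (simp add: hs_slide)
  then show ?thesis by (simp add: mult.assoc hs_ht hs_ht')
qed

context hmodule
begin

definition act :: "'k hcl => 'm => 'm" where "act X = opeval \<rho> \<sigma> (rep_hcl X)"

lemma act_abs: "act (abs_hcl x) m = opeval \<rho> \<sigma> x m"
proof -
  have "heq (rep_hcl (abs_hcl x)) x"
    using hcl.abs_eq_iff Quotient_hcl by (meson Quotient_rel_abs2 Quotient_abs_rep)
  then show ?thesis unfolding act_def by (rule opeval_heq)
qed

lemma act_gen: "act (hgen g) m = \<rho> g m"
  and act_sc: "act (sc a) m = \<sigma> a m"
  and act_1: "act 1 m = m"
  and act_0: "act 0 m = 0"
  by (simp_all add: hgen.abs_eq sc.abs_eq one_hcl.abs_eq zero_hcl.abs_eq act_abs)

lemma act_mult: "act (X * Y) m = act X (act Y m)"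
  by (induction X rule: hcl.abs_induct, induction Y rule: hcl.abs_induct)
    (simp add: times_hcl.abs_eq act_abs)

lemma act_plus: "act (X + Y) m = act X m + act Y m"
  by (induction X rule: hcl.abs_induct, induction Y rule: hcl.abs_induct)
    (simp add: plus_hcl.abs_eq act_abs)

end

section \<open>Endomorphisms given on generators: shift and parity\<close>

text \<open>An assignment that satisfies the relations makes \<open>H\<close> a module in which a
  generator \<open>g\<close> acts as multiplication by \<open>f g\<close>; the endomorphism is then
  the action on 1, see \<open>hom\<close>.\<close>

locale hhom =
  fixes f :: "hgen => 'k::comm_ring_1 hcl"
  assumes f_sq: "f (HS i) * f (HS i) = 1 - hz * f (HS i)"
    and f_braid: "f (HS i) * (f (HS (Suc i)) * f (HS i)) = f (HS (Suc i)) * (f (HS i) * f (HS (Suc i)))"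
    and f_far: "Suc i < j ==> f (HS i) * f (HS j) = f (HS j) * f (HS i)"
    and f_cc: "f (HC i) * f (HC i) = - 1"
    and f_anti: "i < j ==> f (HC i) * f (HC j) = - (f (HC j) * f (HC i))"
    and f_slide: "f (HS i) * f (HC i) = f (HC (Suc i)) * f (HS i)"
    and f_pass: "j \<noteq> i ==> j \<noteq> Suc i ==> f (HS i) * f (HC j) = f (HC j) * f (HS i)"
begin

sublocale hmodule "\<lambda>g m. f g * m" "\<lambda>a m. sc a * m"
proof
  fix i j :: nat and x :: "'k hcl"
  show "f (HS i) * (f (HS i) * x) = sc (- zeta) * (f (HS i) * x) + x"
    using arg_cong[OF f_sq[of i], of "\<lambda>y. y * x"] by (simp add: algebra_simps hz_def sc_uminus)
  show "f (HS i) * (f (HS (Suc i)) * (f (HS i) * x)) = f (HS (Suc i)) * (f (HS i) * (f (HS (Suc i)) * x))"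
    using arg_cong[OF f_braid[of i], of "\<lambda>y. y * x"] by (simp add: mult.assoc)
  show "Suc i < j ==> f (HS i) * (f (HS j) * x) = f (HS j) * (f (HS i) * x)"
    using arg_cong[OF f_far[of i j], of "\<lambda>y. y * x"] by (simp add: mult.assoc)
  show "f (HC i) * (f (HC i) * x) = - x"
    using arg_cong[OF f_cc[of i], of "\<lambda>y. y * x"] by (simp add: mult.assoc)
  show "i < j ==> f (HC i) * (f (HC j) * x) = - (f (HC j) * (f (HC i) * x))"
    using arg_cong[OF f_anti[of i j], of "\<lambda>y. y * x"] by (simp add: mult.assoc)
  show "f (HS i) * (f (HC i) * x) = f (HC (Suc i)) * (f (HS i) * x)"
    using arg_cong[OF f_slide[of i], of "\<lambda>y. y * x"] by (simp add: mult.assoc)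
  show "j \<noteq> i ==> j \<noteq> Suc i ==> f (HS i) * (f (HC j) * x) = f (HC j) * (f (HS i) * x)"
    using arg_cong[OF f_pass[of j i], of "\<lambda>y. y * x"] by (simp add: mult.assoc)
qed (simp_all add: distrib_left distrib_right mult.assoc sc_times sc_plus sc_1 sc_left_comm[of "f _"])

definition hom :: "'k hcl => 'k hcl" where "hom X = act X 1"

lemma act_hom: "act X m = hom X * m"
proof (induction X arbitrary: m rule: hcl_induct)
  case (add x y)
  then have "act (x + y) m = (hom x + hom y) * m" for m by (simp add: act_plus distrib_right)
  from this this[of 1] show ?case by (simp add: hom_def)
next
  case (mult x y)
  then have "act (x * y) m = (hom x * hom y) * m" for m by (simp add: act_mult mult.assoc)
  from this this[of 1] show ?case by (simp add: hom_def)
qed (simp_all add: hom_def act_gen act_sc)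

lemma hom_mult: "hom (X * Y) = hom X * hom Y"
  by (metis act_hom act_mult hom_def)
lemma hom_add: "hom (X + Y) = hom X + hom Y"
  by (simp add: hom_def act_plus)
lemma hom_gen: "hom (hgen g) = f g"
  and hom_sc: "hom (sc a) = sc a"
  and hom_1: "hom 1 = 1"
  and hom_0: "hom 0 = 0"
  by (simp_all add: hom_def act_gen act_sc act_1 act_0)
lemma hom_minus: "hom (- X) = - hom X"
  using hom_add[of "- X" X] by (simp add: hom_0 eq_neg_iff_add_eq_0)
lemma hom_diff: "hom (X - Y) = hom X - hom Y"
  using hom_add[of X "- Y"] by (simp add: hom_minus)
lemma hom_hz: "hom hz = hz" by (simp add: hz_def hom_sc)

lemmas hom_simps = hom_mult hom_add hom_gen hom_sc hom_1 hom_0 hom_minus hom_diff hom_hz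

end

interpretation shift: hhom "\<lambda>g. case g of HS i => hs (Suc i) | HC i => hc (Suc i)"
  by standard (auto simp: hs_sq hs_braid hs_far hc_sq hc_anti hs_slide hs_pass)

interpretation parity: hhom "\<lambda>g. case g of HS i => hs i | HC i => - hc i"
  by standard (auto simp: hs_sq hs_braid hs_far hc_sq hc_anti hs_slide hs_pass)

abbreviation sh :: "'k::comm_ring_1 hcl => 'k hcl" where "sh \<equiv> shift.hom"
abbreviation hat :: "'k::comm_ring_1 hcl => 'k hcl" where "hat \<equiv> parity.hom"

lemma sh_gens [simp]: "sh (hs i) = hs (Suc i)" "sh (hc i) = hc (Suc i)" "sh (ht i) = ht (Suc i)"
  by (simp_all add: shift.hom_simps ht_def)

lemma hat_gens [simp]: "hat (hs i) = hs i" "hat (hc i) = - hc i" "hat (ht i) = ht i"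
  by (simp_all add: parity.hom_simps ht_def)

lemma hat_hat [simp]: "hat (hat x) = x"
  by (induction x rule: hcl_induct) (auto simp: parity.hom_simps split: hgen.split)

lemma hat_sh: "hat (sh x) = sh (hat x)"
  by (induction x rule: hcl_induct) (auto simp: parity.hom_simps shift.hom_simps split: hgen.split)

lemma hs_sh_sh: "hs 0 * sh (sh x) = sh (sh x) * hs 0"
proof (induction x rule: hcl_induct)
  case (gen g) then show ?case by (cases g) (auto simp: hs_far hs_pass)
next
  case (add x y) then show ?case by (simp add: shift.hom_simps algebra_simps)
next
  case (mult x y)
  show ?case
    by (simp only: shift.hom_mult mult.assoc[symmetric] mult(1)) (simp only: mult.assoc mult(2))
qed (simp add: shift.hom_simps sc_comm)

lemma hc_sh: "hc 0 * sh x = sh (hat x) * hc 0"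
proof (induction x rule: hcl_induct)
  case (gen g) then show ?case by (cases g) (auto simp: hs_pass hc_anti shift.hom_simps)
next
  case (add x y) then show ?case by (simp add: shift.hom_simps parity.hom_simps algebra_simps)
next
  case (mult x y)
  show ?case by (simp only: shift.hom_mult parity.hom_mult mult.assoc[symmetric] mult(1)) (simp only: mult.assoc mult(2))
qed (simp add: shift.hom_simps parity.hom_simps sc_comm)

lemma hs_hc_Suc: "hs i * hc (Suc i) = hc i * hs i + hz * hc i - hz * hc (Suc i)"
  using ht_slide[of i] by (simp add: ht_def algebra_simps hz_comm)

lemma hs_hc_Suc': "hs i * (hc (Suc i) * x) = hc i * (hs i * x) + hz * (hc i * x) - hz * (hc (Suc i) * x)"
  by (simp add: comp_tail[OF hs_hc_Suc] algebra_simps)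

section \<open>Coset representatives of the shifted subalgebra\<close>

text \<open>The product s_0 ... s_(j-1). With or without a further factor \<open>hc j\<close> these
  turn out to be a basis of \<open>H\<close> as a left module over the shifted subalgebra.\<close>

primrec hr :: "nat => 'k::comm_ring_1 hcl" where
  "hr 0 = 1"
| "hr (Suc j) = hr j * hs j"

lemma comm_tail: "a * b = c * a' ==> a * (b * x) = c * (a' * (x :: 'a :: semigroup_mult))"
  by (metis mult.assoc)

lemma hr_comm_hs: "j < i ==> hr j * hs i = hs i * hr j"
proof (induction j)
  case (Suc j)
  have 1: "hs j * hs i = hs i * (hs j :: 'a hcl)" by (rule hs_far[symmetric]) (use Suc in simp)
  have 2: "hr j * hs i = hs i * (hr j :: 'a hcl)" using Suc by simp
  show ?case by (simp add: mult.assoc 1 comm_tail[OF 2])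
qed simp

lemma hr_comm_hc: "j < i ==> hr j * hc i = hc i * hr j"
proof (induction j)
  case (Suc j)
  have 1: "hs j * hc i = hc i * (hs j :: 'a hcl)" by (rule hs_pass) (use Suc in simp_all)
  have 2: "hr j * hc i = hc i * (hr j :: 'a hcl)" using Suc by simp
  show ?case by (simp add: mult.assoc 1 comm_tail[OF 2])
qed simp

lemma hr_hc: "i < j ==> hr j * hc i = hc (Suc i) * hr j"
proof (induction j)
  case (Suc j)
  show ?case
  proof (cases "i = j")
    case True
    then show ?thesis
      by (simp add: mult.assoc hs_slide comm_tail[OF hr_comm_hc[of j "Suc j"]])
  next
    case False
    have 1: "hs j * hc i = hc i * (hs j :: 'a hcl)" by (rule hs_pass) (use Suc False in simp_all)
    have 2: "hr j * hc i = hc (Suc i) * (hr j :: 'a hcl)" using Suc False by simp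
    show ?thesis by (simp add: mult.assoc 1 comm_tail[OF 2])
  qed
qed simp

lemma hr_hs: "Suc i < j ==> hr j * hs i = hs (Suc i) * hr j"
proof (induction j)
  case (Suc j)
  show ?case
  proof (cases "Suc i = j")
    case True
    have "hr (Suc j) * hs i = hr i * (hs (Suc i) * (hs i * hs (Suc i)))"
      using True by (auto simp: mult.assoc hs_braid)
    also have "\<dots> = hs (Suc i) * (hr i * (hs i * hs (Suc i)))"
      by (simp add: comm_tail[OF hr_comm_hs])
    finally show ?thesis using True by (auto simp: mult.assoc)
  next
    case False
    have 1: "hs j * hs i = hs i * (hs j :: 'a hcl)" by (rule hs_far) (use Suc False in simp)
    have 2: "hr j * hs i = hs (Suc i) * (hr j :: 'a hcl)" using Suc False by simp
    show ?thesis by (simp add: mult.assoc 1 comm_tail[OF 2])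
  qed
qed simp

lemma hr_hs_last: "hr (Suc j) * hs j = hr j - hz * hr (Suc j)"
  by (simp add: mult.assoc hs_sq right_diff_distrib hz_left_comm)

text \<open>This and \<open>hr_hc_hs_last\<close> are the exceptional cases of the right action of
  the generators on the representatives; their coefficients reappear in
  \<open>coind\<close>.\<close>

lemma hr_hc_hs_same:
  "hr j * hc j * hs j = hr (Suc j) * hc (Suc j) + hz * (hc (Suc j) * hr j) - hz * (hr j * hc j)"
  by (simp add: mult.assoc hs_hc_Suc algebra_simps hz_left_comm hr_comm_hc)

lemma hr_hc_hs_last:
  "hr (Suc i) * hc (Suc i) * hs i = hr i * hc i - hz * (hc (Suc i) * hr (Suc i))"
proof -
  have "hr (Suc i) * hc (Suc i) * hs i = hr (Suc i) * hs i * (hc i :: 'a hcl)"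
    by (simp only: mult.assoc hs_slide)
  also have "\<dots> = hr i * hc i - hz * (hr (Suc i) * hc i)"
    by (simp only: hr_hs_last left_diff_distrib mult.assoc)
  also have "hr (Suc i) * hc i = hc (Suc i) * (hr (Suc i) :: 'a hcl)" by (rule hr_hc) simp
  finally show ?thesis .
qed

lemma hc_swap: "i \<noteq> j ==> hc i * hc j = - (hc j * hc i)"
  by (metis add.inverse_inverse hc_anti linorder_neqE_nat)

lemma hr_hc_anti: "i \<noteq> j ==> hr j * hc j * hc i = - (hr j * hc i * hc j)"
  by (simp only: mult.assoc hc_swap[of j i]) simp

lemma hr_Suc_left: "hr (Suc j) = hs 0 * sh (hr j)"
proof (induction j)
  case (Suc j)
  have "hr (Suc (Suc j)) = (hr (Suc j) * hs (Suc j) :: 'a hcl)" by (rule hr.simps)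
  also have "\<dots> = hs 0 * sh (hr j * hs j)"
    by (simp only: Suc shift.hom_mult sh_gens mult.assoc)
  finally show ?case by simp
qed (simp add: shift.hom_1)

section \<open>Subalgebras on finitely many strands and the Mackey decomposition\<close>

inductive_set hsub :: "nat => 'k::comm_ring_1 hcl set" for n where
  hs: "Suc i < n ==> hs i \<in> hsub n"
| hc: "i < n ==> hc i \<in> hsub n"
| sc: "sc a \<in> hsub n"
| add: "x \<in> hsub n ==> y \<in> hsub n ==> x + y \<in> hsub n"
| mult: "x \<in> hsub n ==> y \<in> hsub n ==> x * y \<in> hsub n"

lemma hsub_1: "1 \<in> hsub n" using hsub.sc[of 1 n] by (simp add: sc_1)
lemma hsub_0: "0 \<in> hsub n" using hsub.sc[of 0 n] by (simp add: sc_0)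
lemma hsub_hz: "hz \<in> hsub n" by (simp add: hz_def hsub.sc)
lemma hsub_minus: "x \<in> hsub n ==> - x \<in> hsub n"
  using hsub.mult[OF hsub.sc[of "- 1" n], of x] by (simp add: sc_uminus sc_1)
lemma hsub_ht: "Suc i < n ==> ht i \<in> hsub n"
  by (simp add: ht_def hsub.add hsub.hs hsub_hz)

lemma hsub_mono: "x \<in> hsub m ==> m \<le> n ==> x \<in> hsub n"
  by (induction rule: hsub.induct) (auto intro: hsub.intros)

lemma hsub_sh: "x \<in> hsub n ==> sh x \<in> hsub (Suc n)"
  by (induction rule: hsub.induct) (auto simp: shift.hom_simps intro: hsub.intros)

lemma hsub_hat: "x \<in> hsub n ==> hat x \<in> hsub n"
  by (induction rule: hsub.induct) (auto simp: parity.hom_simps intro: hsub.intros hsub_minus)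

lemma hsub_all: "\<exists>n. x \<in> hsub n"
proof (induction x rule: hcl_induct)
  case (gen g)
  show ?case by (cases g) (auto intro: hsub.hs[OF lessI] hsub.hc[OF lessI])
next
  case (add x y)
  then show ?case by (meson hsub.add hsub_mono nat_le_linear)
next
  case (mult x y)
  then show ?case by (meson hsub.mult hsub_mono nat_le_linear)
qed (auto intro: hsub.sc)

lemma hr_hsub: "j \<le> n ==> hr j \<in> hsub (Suc n)"
  by (induction j) (auto intro!: hsub.mult hsub.hs hsub_1)

inductive_set coset_span :: "nat => 'k::comm_ring_1 hcl set" for n where
  "a \<in> hsub n ==> j \<le> n ==> sh a * hr j \<in> coset_span n"
| "a \<in> hsub n ==> j \<le> n ==> sh a * hr j * hc j \<in> coset_span n"
| "x \<in> coset_span n ==> y \<in> coset_span n ==> x + y \<in> coset_span n"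

lemma coset_span_left: "x \<in> coset_span n ==> a \<in> hsub n ==> sh a * x \<in> coset_span n"
  by (induction rule: coset_span.induct)
    (auto simp: distrib_left mult.assoc[symmetric] shift.hom_mult[symmetric]
      intro: coset_span.intros hsub.intros)

lemma coset_span_minus: "x \<in> coset_span n ==> - x \<in> coset_span n"
  using coset_span_left[of x n "- 1"] by (simp add: shift.hom_simps hsub_minus hsub_1)

lemma coset_span_diff: "x \<in> coset_span n ==> y \<in> coset_span n ==> x - y \<in> coset_span n"
  using coset_span.intros(3)[OF _ coset_span_minus, of x n y] by simp

lemma coset_span_hr: "j \<le> n ==> hr j \<in> coset_span n" "j \<le> n ==> hr j * hc j \<in> coset_span n"
  using coset_span.intros(1)[of 1 n j] coset_span.intros(2)[of 1 n j] by (simp_all add: shift.hom_1 hsub_1)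

lemma hr_hc_all: "i \<noteq> j ==> hr j * hc i = sh (hc (if i < j then i else i - 1)) * hr j"
  by (auto simp: hr_hc hr_comm_hc)
lemma hr_hs_all: "i \<noteq> j ==> Suc i \<noteq> j ==> hr j * hs i = sh (hs (if i < j then i else i - 1)) * hr j"
  by (auto simp: hr_hs hr_comm_hs)

lemma coset_span_hs:
  fixes x :: "'k::comm_ring_1 hcl"
  assumes "x \<in> coset_span n" "i < n" shows "x * hs i \<in> coset_span n"
  using assms
proof (induction)
  case (1 a j)
  have "hr j * hs i \<in> (coset_span n :: 'k hcl set)"
  proof -
    consider "i = j" | "Suc i = j" | "i \<noteq> j" "Suc i \<noteq> j" by blast
    then show ?thesis
    proof cases
      case 1 then show ?thesis using assms(2) by (simp add: coset_span_hr(1)[of "Suc j", simplified])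
    next
      case 2
      have "hr (Suc i) * hs i = hr i - sh hz * (hr (Suc i) :: 'k hcl)"
        by (simp add: hr_hs_last shift.hom_hz del: hr.simps)
      also have "\<dots> \<in> coset_span n"
        by (intro coset_span_diff coset_span_left coset_span_hr hsub_hz) (use 1 2 in auto)
      finally show ?thesis using 2 by (simp del: hr.simps)
    next
      case 3
      show ?thesis unfolding hr_hs_all[OF 3]
        by (rule coset_span_left[OF coset_span_hr(1)]) (use 1 3 assms(2) in \<open>auto intro!: hsub.hs\<close>)
    qed
  qed
  then show ?case by (simp add: mult.assoc coset_span_left 1)
next
  case (2 a j)
  have "hr j * hc j * hs i \<in> (coset_span n :: 'k hcl set)"
  proof -
    consider "i = j" | "Suc i = j" | "i \<noteq> j" "Suc i \<noteq> j" by blast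
    then show ?thesis
    proof cases
      case 1
      have "hr j * hc j * hs j
        = hr (Suc j) * hc (Suc j) + sh hz * (sh (hc j) * hr j) - sh hz * (hr j * (hc j :: 'k hcl))"
        by (simp add: hr_hc_hs_same shift.hom_hz del: hr.simps)
      also have "\<dots> \<in> coset_span n"
        by (intro coset_span.intros(3) coset_span_diff coset_span_left coset_span_hr hsub_hz hsub.hc)
          (use 1 2 assms(2) in auto)
      finally show ?thesis using 1 by simp
    next
      case 2
      have "hr (Suc i) * hc (Suc i) * hs i = hr i * hc i - sh hz * (sh (hc i) * (hr (Suc i) :: 'k hcl))"
        by (simp add: hr_hc_hs_last shift.hom_hz del: hr.simps)
      also have "\<dots> \<in> coset_span n"
        by (intro coset_span_diff coset_span_left coset_span_hr hsub_hz hsub.hc) (use 2 assms(2) in auto)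
      finally show ?thesis using 2 by auto
    next
      case 3
      then have "hr j * hc j * hs i = hr j * hs i * (hc j :: 'k hcl)"
        by (simp add: mult.assoc hs_pass[of j i, symmetric])
      also have "\<dots> \<in> coset_span n"
        unfolding hr_hs_all[OF 3] mult.assoc
        by (rule coset_span_left[OF coset_span_hr(2)]) (use 2 3 assms(2) in \<open>auto intro!: hsub.hs\<close>)
      finally show ?thesis .
    qed
  qed
  then show ?case by (simp add: mult.assoc coset_span_left 2)
qed (simp add: distrib_right coset_span.intros)

lemma coset_span_hc:
  fixes x :: "'k::comm_ring_1 hcl"
  assumes "x \<in> coset_span n" "i \<le> n" shows "x * hc i \<in> coset_span n"
  using assms
proof (induction)
  case (1 a j)
  have "hr j * hc i \<in> (coset_span n :: 'k hcl set)"
  proof (cases "i = j")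
    case True then show ?thesis using coset_span_hr(2) 1 by simp
  next
    case False
    show ?thesis unfolding hr_hc_all[OF False]
      by (rule coset_span_left[OF coset_span_hr(1)]) (use False 1 assms(2) in \<open>auto intro!: hsub.hc\<close>)
  qed
  then show ?case by (simp add: mult.assoc coset_span_left 1)
next
  case (2 a j)
  have "hr j * hc j * hc i \<in> (coset_span n :: 'k hcl set)"
  proof (cases "i = j")
    case True
    then show ?thesis using coset_span_minus[OF coset_span_hr(1)] 2 by (simp add: mult.assoc hc_sq)
  next
    case False
    then have "hr j * hc j * hc i = - (hr j * hc i * (hc j :: 'k hcl))" by (rule hr_hc_anti)
    also have "\<dots> \<in> coset_span n"
      unfolding hr_hc_all[OF False] mult.assoc
      by (rule coset_span_minus[OF coset_span_left[OF coset_span_hr(2)]])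
        (use False 2 assms(2) in \<open>auto intro!: hsub.hc\<close>)
    finally show ?thesis .
  qed
  then show ?case by (simp add: mult.assoc coset_span_left 2)
qed (simp add: distrib_right coset_span.intros)

text \<open>The span contains 1 and is stable under right multiplication by the generators.\<close>

lemma hsub_coset_span: "x \<in> hsub (Suc n) ==> x \<in> coset_span n"
proof -
  assume "x \<in> hsub (Suc n)"
  then have "y \<in> coset_span n ==> y * x \<in> coset_span n" for y
  proof (induction arbitrary: y rule: hsub.induct)
    case (sc a)
    then show ?case using coset_span_left[of y n "sc a"] by (simp add: sc_comm shift.hom_sc hsub.sc)
  next
    case (mult x x')
    then show ?case by (simp flip: mult.assoc)
  qed (auto simp: distrib_left coset_span_hs coset_span_hc intro: coset_span.intros)
  from this[of 1] show ?thesis using coset_span_hr(1)[of 0 n] by simp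
qed

text \<open>For j > 0 the representative \<open>hr j\<close> is \<open>hs 0\<close> times a shifted
  element. Hence, up to the dot on strand 0, the shifted subalgebra has only the double cosets of 1
  and of \<open>hs 0\<close>.\<close>

lemma hsub_mackey_induct [consumes 1, case_names sh hc hs add]:
  assumes "x \<in> hsub (Suc n)"
    and "\<And>a. a \<in> hsub n ==> P (sh a)" "\<And>a. a \<in> hsub n ==> P (sh a * hc 0)"
    and "\<And>a b. a \<in> hsub n ==> b \<in> hsub n ==> 0 < n ==> P (sh a * (hs 0 * sh b))"
    and "\<And>x y. P x ==> P y ==> P (x + y)"
  shows "P x"
  using hsub_coset_span[OF assms(1)]
proof induction
  case (1 a j)
  show ?case
  proof (cases j)
    case 0 then show ?thesis using 1 assms(2) by simp
  next
    case (Suc i)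
    obtain m where m: "n = Suc m" using Suc 1 by (cases n) auto
    then show ?thesis using 1 Suc assms(4)[of a "hr i"] hr_hsub[of i m]
      by (simp add: hr_Suc_left mult.assoc del: hr.simps(2))
  qed
next
  case (2 a j)
  show ?case
  proof (cases j)
    case 0 then show ?thesis using 2 assms(3) by simp
  next
    case (Suc i)
    obtain m where m: "n = Suc m" using Suc 2 by (cases n) auto
    have "sh a * hr j * hc j = sh a * (hs 0 * sh (hr i * hc i))"
      using Suc by (simp add: hr_Suc_left shift.hom_mult mult.assoc del: hr.simps(2))
    moreover have "hr i * hc i \<in> hsub n"
      using hr_hsub[of i m] m 2 Suc by (auto intro!: hsub.mult hsub.hc)
    ultimately show ?thesis using 2 Suc assms(4) by simp
  qed
qed (rule assms(5))

lemma hcl_mackey_induct [case_names sh hc hs add]: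
  assumes "\<And>a. P (sh a)" "\<And>a. P (sh a * hc 0)" "\<And>a b. P (sh a * (hs 0 * sh b))"
    "\<And>x y. P x ==> P y ==> P (x + y)"
  shows "P x"
proof -
  obtain n where "x \<in> hsub (Suc n)" using hsub_all hsub_mono by (meson le_SucI order_refl)
  then show ?thesis by (induction rule: hsub_mackey_induct) (use assms in auto)
qed

section \<open>The partial trace\<close>

text \<open>The coinduced left module of functions \<open>\<phi>\<close> with \<open>\<phi> j \<epsilon>\<close> the value at \<open>hr j * hc j ^ \<epsilon>\<close>
  of a map that is linear over the shifted subalgebra.\<close>

fun coind :: "hgen => (nat => bool => 'k::comm_ring_1 hcl) => nat => bool => 'k hcl"
  where
    "coind (HS i) \<phi> j False =
      (if Suc i < j then hs i * \<phi> j False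
       else if Suc i = j then \<phi> i False - hz * \<phi> j False
       else if i = j then \<phi> (Suc j) False
       else hs (i - 1) * \<phi> j False)"
  | "coind (HS i) \<phi> j True =
      (if Suc i < j then hs i * \<phi> j True
       else if Suc i = j then \<phi> i True - hz * (hc i * \<phi> j False)
       else if i = j then \<phi> (Suc j) True + hz * (hc j * \<phi> j False) - hz * \<phi> j True
       else hs (i - 1) * \<phi> j True)"
  | "coind (HC i) \<phi> j False =
      (if i = j then \<phi> j True else if i < j then hc i * \<phi> j False else hc (i - 1) * \<phi> j False)"
  | "coind (HC i) \<phi> j True =
      (if i = j then - \<phi> j False else if i < j then - (hc i * \<phi> j True) else - (hc (i - 1) * \<phi> j True))"

lemma hgen_hz: "hgen g * hz = hz * hgen g" "hgen g * (hz * x) = hz * (hgen g * x)"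
  by (simp_all only: hz_comm[of "hgen g"] hz_left_comm[of "hgen g"])

lemmas hz_simps = distrib_left distrib_right left_diff_distrib right_diff_distrib hgen_hz

lemma coind_sq: "coind (HS i) (coind (HS i) \<phi>) j e = \<phi> j e - hz * coind (HS i) \<phi> j e"
  by (cases e; cases "Suc i < j"; cases "Suc i = j"; cases "i = j")
    (auto simp: hs_sq' hz_simps)

lemma coind_cc: "coind (HC i) (coind (HC i) \<phi>) j e = - \<phi> j e"
  by (cases e; cases "i = j") (auto simp: hc_sq')

lemma coind_anti: "i < k ==> coind (HC i) (coind (HC k) \<phi>) j e = - coind (HC k) (coind (HC i) \<phi>) j e"
  by (cases e; cases "i = j"; cases "k = j"; cases "k < j"; cases "i < j") (auto simp: hc_anti')

lemma coind_slide: "coind (HS i) (coind (HC i) \<phi>) j e = coind (HC (Suc i)) (coind (HS i) \<phi>) j e"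
proof -
  have "Suc i < j \<or> Suc i = j \<or> i = j \<or> j < i" by linarith
  then show ?thesis
  proof (elim disjE)
    assume "j < i"
    then obtain l where "i = Suc l" by (cases i) auto
    then show ?thesis using \<open>j < i\<close> by (cases e) (auto simp: hs_slide')
  qed (cases e; auto simp: hz_simps hs_slide' hc_sq')+
qed

lemma coind_pass:
  assumes "k \<noteq> i" "k \<noteq> Suc i"
  shows "coind (HS i) (coind (HC k) \<phi>) j e = coind (HC k) (coind (HS i) \<phi>) j e"
proof -
  have "Suc i < j \<or> Suc i = j \<or> i = j \<or> j < i" by linarith
  moreover have "k < j \<or> k = j \<or> j < k" by linarith
  ultimately show ?thesis using assms
    by (elim disjE; cases e; auto simp: hz_simps hs_pass' hc_anti')
qed

lemma coind_far:
  assumes "Suc i < k"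
  shows "coind (HS i) (coind (HS k) \<phi>) j e = coind (HS k) (coind (HS i) \<phi>) j e"
proof -
  have "Suc i < j \<or> Suc i = j \<or> i = j \<or> j < i" by linarith
  moreover have "Suc k < j \<or> Suc k = j \<or> k = j \<or> j < k" by linarith
  ultimately show ?thesis using assms
    by (elim disjE; cases e; auto simp: hz_simps hs_far' hs_pass')
qed

lemma coind_braid: "coind (HS i) (coind (HS (Suc i)) (coind (HS i) \<phi>)) j e =
    coind (HS (Suc i)) (coind (HS i) (coind (HS (Suc i)) \<phi>)) j e"
proof -
  have "Suc (Suc i) < j \<or> Suc (Suc i) = j \<or> Suc i = j \<or> i = j \<or> j < i" by linarith
  then show ?thesis
  proof (elim disjE)
    assume "j < i"
    then obtain l where "i = Suc l" by (cases i) auto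
    then show ?thesis using \<open>j < i\<close> by (cases e) (auto simp: hs_braid')
  qed (cases e; auto simp: hz_simps hs_braid' hs_slide' hs_hc_Suc' hs_pass' hs_sq')+
qed

interpretation coind: hmodule coind "\<lambda>a \<phi> j e. sc a * \<phi> j e"
proof
  fix g and \<phi> \<psi> :: "nat => bool => 'a hcl" and a :: "'a => 'a"
  show "coind g (\<phi> + \<psi>) = coind g \<phi> + coind g \<psi>"
  proof (intro ext)
    fix j e show "coind g (\<phi> + \<psi>) j e = (coind g \<phi> + coind g \<psi>) j e"
      by (cases g; cases e) (auto simp: distrib_left)
  qed
  show "coind g (\<lambda>j e. sc a * \<phi> j e) = (\<lambda>j e. sc a * coind g \<phi> j e)"
  proof (intro ext)
    fix j e show "coind g (\<lambda>j e. sc a * \<phi> j e) j e = sc a * coind g \<phi> j e"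
      by (cases g; cases e)
        (auto simp: distrib_left right_diff_distrib sc_left_comm[of hz] sc_left_comm[of "hgen _"])
  qed
qed (auto simp: fun_eq_iff sc_plus sc_times sc_1 distrib_left distrib_right mult.assoc
    coind_sq coind_braid coind_cc coind_anti coind_slide coind_pass hz_def sc_uminus
    intro: coind_far simp del: coind.simps)

abbreviation coact :: "'k::comm_ring_1 hcl => (nat => bool => 'k hcl) => nat => bool => 'k hcl"
  where "coact \<equiv> coind.act"

text \<open>The entry \<open>0 False\<close> is the value at 1 of the map that a family stands for;
  linearity over the shifted subalgebra takes this form.\<close>

lemma coact_sh: "coact (sh a) \<phi> 0 False = a * \<phi> 0 False"
proof (induction a arbitrary: \<phi> rule: hcl_induct)
  case (gen g) then show ?case by (cases g) (auto simp: coind.act_gen)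
qed (simp_all add: shift.hom_simps coind.act_sc coind.act_plus coind.act_mult distrib_right mult.assoc)

lemma coact_right: "coact x (\<lambda>j e. \<phi> j e * b) = (\<lambda>j e. coact x \<phi> j e * b)"
proof (induction x arbitrary: \<phi> rule: hcl_induct)
  case (gen g)
  show ?case
  proof (intro ext)
    fix j e show "coact (hgen g) (\<lambda>j e. \<phi> j e * b) j e = coact (hgen g) \<phi> j e * b"
      by (cases g; cases e) (auto simp: coind.act_gen mult.assoc distrib_right left_diff_distrib)
  qed
next
  case (mult x y)
  then show ?case by (simp add: coind.act_mult)
qed (simp_all add: coind.act_sc coind.act_plus fun_eq_iff distrib_right mult.assoc)

lemma coact_hr: "coact (hr j) \<phi> 0 False = \<phi> j False"
proof (induction j arbitrary: \<phi>)
  case 0 then show ?case by (simp add: coind.act_1)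
next
  case (Suc j) then show ?case by (simp add: coind.act_mult coind.act_gen)
qed

lemma coact_hr_hc: "coact (hr j * hc j) \<phi> 0 False = \<phi> j True"
  by (simp add: coind.act_mult coact_hr coind.act_gen)

section \<open>Coordinates and the partial trace\<close>

text \<open>Acting by \<open>x\<close> and then evaluating at 1 amounts to evaluating at
  \<open>x\<close>. For the dual basis functions this reads off coordinates, so the representatives
  are linearly independent.\<close>

definition coord :: "nat => bool => 'k::comm_ring_1 hcl => 'k hcl"
  where "coord j e x = coact x (\<lambda>k f. if k = j \<and> f = e then 1 else 0) 0 False"

text \<open>The same evaluation for the map that kills 1 and \<open>hc 0\<close> and lowers the
  index of every other representative by one. The values 0, 0 and 1 at 1, \<open>hc 0\<close> and
  \<open>hs 0\<close> are those of a circle, a dotted circle and a curl in the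
  supercategory.\<close>

definition hE :: "'k::comm_ring_1 hcl => 'k hcl"
  where "hE x = coact x (\<lambda>j e. case j of 0 => 0 | Suc i => hr i * (if e then hc i else 1)) 0 False"

lemma coord_add: "coord j e (x + y) = coord j e x + coord j e y"
  by (simp add: coord_def coind.act_plus)
lemma coord_sh: "coord j e (sh a * x) = a * coord j e x"
  by (simp add: coord_def coind.act_mult coact_sh)
lemma coord_hr: "coord j e (hr k) = (if k = j \<and> \<not> e then 1 else 0)"
  "coord j e (hr k * hc k) = (if k = j \<and> e then 1 else 0)"
  by (simp_all add: coord_def coact_hr coact_hr_hc)

lemma hE_add: "hE (x + y) = hE x + hE y"
  by (simp add: hE_def coind.act_plus)
lemma hE_0: "hE 0 = 0"
  by (simp add: hE_def coind.act_0)
lemma hE_minus: "hE (- x) = - hE x"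
  using hE_add[of "- x" x] by (simp add: hE_0 eq_neg_iff_add_eq_0)
lemma hE_diff: "hE (x - y) = hE x - hE y"
  using hE_add[of x "- y"] by (simp add: hE_minus)

lemma hE_left: "hE (sh a * x) = a * hE x"
  by (simp add: hE_def coind.act_mult coact_sh)

text \<open>The left action of \<open>sh b\<close> on the family that defines \<open>hE\<close>
  equals right multiplication of its entries by \<open>b\<close>. On generators this compares
  \<open>coind\<close> with the right action on \<open>hr i\<close> and
  \<open>hr i * hc i\<close>.\<close>

lemma hE_right:
  fixes x b :: "'k::comm_ring_1 hcl"
  shows "hE (x * sh b) = hE x * b"
proof -
  let ?w = "\<lambda>j e. case j of 0 => 0 :: 'k hcl | Suc i => hr i * (if e then hc i else 1)"
  have "coact (sh b) ?w = (\<lambda>j e. ?w j e * b)"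
  proof (induction b rule: hcl_induct)
    case (gen g)
    show ?case
    proof (intro ext)
      fix j e
      show "coact (sh (hgen g)) ?w j e = ?w j e * hgen g"
      proof (cases j)
        case 0
        then show ?thesis by (cases g; cases e) (auto simp: coind.act_gen)
      next
        case (Suc k)
        show ?thesis
        proof (cases g)
          case (HS i)
          have "Suc i < k \<or> Suc i = k \<or> i = k \<or> k < i" by linarith
          then show ?thesis
          proof (elim disjE)
            assume k: "Suc i < k"
            then have "hr k * (hc k * hs i) = hs (Suc i) * (hr k * (hc k :: 'k hcl))"
              by (simp add: hs_pass[of k i, symmetric] comm_tail[OF hr_hs])
            then show ?thesis using Suc HS k by (cases e) (simp_all add: coind.act_gen mult.assoc hr_hs)
          next
            assume k: "k < i"
            then have "hr k * (hc k * hs i) = hs i * (hr k * (hc k :: 'k hcl))"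
              by (simp add: hs_pass[of k i, symmetric] comm_tail[OF hr_comm_hs])
            then show ?thesis using Suc HS k by (cases e) (simp_all add: coind.act_gen mult.assoc hr_comm_hs)
          next
            assume k: "Suc i = k"
            show ?thesis unfolding Suc HS k[symmetric] 
              by (cases e) (simp_all add: coind.act_gen hr_hc_hs_last hr_hs_last mult_1_right del: hr.simps)
          next
            assume k: "i = k"
            show ?thesis unfolding Suc HS k
              by (cases e) (simp_all add: coind.act_gen hr_hc_hs_same del: hr.simps, simp)
          qed
        next
          case (HC i)
          have "i < k \<or> i = k \<or> k < i" by linarith
          then show ?thesis using Suc HC
            by (elim disjE; cases e)
              (simp_all add: coind.act_gen hr_hc_anti hr_hc hr_comm_hc, simp_all add: mult.assoc hc_sq)
        qed
      qed
    qed
  next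
    case (mult x y)
    show ?case
      by (simp only: shift.hom_mult coind.act_mult[abs_def] mult(2) coact_right mult(1) mult.assoc)
  qed (simp_all add: shift.hom_simps coind.act_sc coind.act_plus fun_eq_iff distrib_left sc_comm)
  then show ?thesis by (simp add: hE_def coind.act_mult coact_right)
qed

lemma hE_hr: "hE (hr j) = (case j of 0 => 0 | Suc i => hr i)"
  "hE (hr j * hc j) = (case j of 0 => 0 | Suc i => hr i * hc i)"
  by (simp_all add: hE_def coact_hr coact_hr_hc split: nat.split)

lemma hE_1: "hE 1 = 0"
  by (rule hE_hr(1)[of 0, simplified])
lemma hE_sh: "hE (sh a) = 0"
  using hE_left[of a 1] by (simp add: hE_1)
lemma hE_hz: "hE (hz * x) = hz * hE x"
  using hE_left[of hz x] by (simp add: shift.hom_hz)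
lemma hE_hz0: "hE hz = 0"
  by (rule hE_hz[of 1, simplified hE_1, simplified])
lemma hE_sc: "hE (sc a * x) = sc a * hE x"
  using hE_left[of "sc a" x] by (simp add: shift.hom_sc)
lemma hE_hc0: "hE (hc 0) = 0"
  by (rule hE_hr(2)[of 0, simplified])
lemma hE_hs0: "hE (hs 0) = 1"
  by (rule hE_hr(1)[of "Suc 0", simplified])
lemma hE_ht0: "hE (ht 0) = 1"
  by (simp add: ht_def hE_add hE_hs0 hE_hz[of 1, simplified] hE_1)

lemmas hE_simps = hE_add hE_0 hE_hz0 hE_minus hE_diff hE_left hE_right hE_1 hE_sh hE_hz hE_sc hE_hc0 hE_hs0 hE_ht0

lemma hE_left': "hE (hs (Suc i) * x) = hs i * hE x" "hE (ht (Suc i) * x) = ht i * hE x"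
  "hE (hc (Suc i) * x) = hc i * hE x"
  using hE_left[of "hs i" x] hE_left[of "ht i" x] hE_left[of "hc i" x] by simp_all

lemma hE_right': "hE (x * hs (Suc i)) = hE x * hs i" "hE (x * ht (Suc i)) = hE x * ht i"
  "hE (x * hc (Suc i)) = hE x * hc i"
  using hE_right[of x "hs i"] hE_right[of x "ht i"] hE_right[of x "hc i"] by simp_all

lemma hE_mid: "hE (sh a * (x * sh b)) = a * (hE x * b)"
  by (simp add: hE_left hE_right)

lemma hE_hs_sh: "hE (hs 0 * sh a) = a" "hE (sh a * hs 0) = a" "hE (ht 0 * sh a) = a" "hE (sh a * ht 0) = a"
  "hE (hc 0 * sh a) = 0" "hE (sh a * hc 0) = 0"
  by (simp_all add: hE_simps)

lemma hE_hc_hs: "hE (hc 0 * hs 0) = (hc 0 :: 'a::comm_ring_1 hcl)"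
  "hE (hs 0 * hc 0) = (hc 0 :: 'a hcl)" "hE (hc 0 * ht 0) = (hc 0 :: 'a hcl)"
proof -
  have "hc 0 * hs 0 = hs 0 * sh (hc 0) - hz * hc 0 + hz * (sh (hc 0) * (1 :: 'a hcl))"
    by (simp add: hs_hc_Suc)
  then show "hE (hc 0 * hs 0) = (hc 0 :: 'a hcl)" by (simp only: hE_simps) simp
  show "hE (hs 0 * hc 0) = (hc 0 :: 'a hcl)"
    using hE_left[of "hc 0 :: 'a hcl" "hs 0"] by (simp add: hs_slide hE_hs0)
  show "hE (hc 0 * ht 0) = (hc 0 :: 'a hcl)"
    using hE_right[of "ht 0 :: 'a hcl" "hc 0"] by (simp add: ht_slide[symmetric] hE_ht0)
qed

section \<open>Isotopy invariance of the partial trace\<close>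

lemma hs_sh2: "hs 0 * (sh (sh a) * x) = sh (sh a) * (hs 0 * x)" "ht 0 * (sh (sh a) * x) = sh (sh a) * (ht 0 * x)"
  "ht 0 * sh (sh a) = sh (sh a) * ht 0"
  by (simp_all add: ht_def distrib_left distrib_right hs_sh_sh comm_tail[OF hs_sh_sh]
     hz_comm[of "sh (sh a)"] hz_left_comm[of "sh (sh a)"])

lemma hc_sh': "hc 0 * (sh a * x) = sh (hat a) * (hc 0 * x)"
  by (rule comm_tail[OF hc_sh])

text \<open>A dot slides around the closed strand; \<open>hat\<close> is the cost of passing
  \<open>x\<close>. The three Mackey forms are checked separately.\<close>

lemma hE_hc: "hE (hc 0 * x) = hE (hat x * hc 0)"
proof (induction x rule: hcl_mackey_induct)
  case (sh a)
  then show ?case by (simp add: hc_sh hat_sh)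
next
  case (hc a)
  then show ?case
    by (simp add: parity.hom_simps hat_sh hc_sh' hc_sq hE_simps mult.assoc)
next
  case (hs a b)
  have "hc 0 * (sh a * (hs 0 * sh b)) = sh (hat a) * ((hc 0 * hs 0) * sh b)"
    by (simp add: hc_sh' mult.assoc)
  moreover have "hat (sh a * (hs 0 * sh b)) * hc 0 = sh (hat a) * ((hs 0 * hc 0) * sh b)"
    by (simp add: parity.hom_simps hat_sh mult.assoc hc_sh)
  ultimately show ?case by (simp only: hE_mid hE_hc_hs)
next
  case (add x y)
  then show ?case by (simp add: parity.hom_simps distrib_left distrib_right hE_add)
qed

lemma hs_hs_ht: "hs 0 * (hs (Suc 0) * ht 0) = ht (Suc 0) * (hs 0 * (hs (Suc 0) :: 'a::comm_ring_1 hcl))"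
proof -
  have "hs (Suc 0) * (hs 0 * (hs (Suc 0) * ht 0)) = hs 0 * (hs (Suc 0) :: 'a hcl)"
    by (simp add: hs_braid'[symmetric] hs_ht)
  then have "ht (Suc 0) * (hs (Suc 0) * (hs 0 * (hs (Suc 0) * ht 0))) = ht (Suc 0) * (hs 0 * (hs (Suc 0) :: 'a hcl))"
    by simp
  then show ?thesis by (simp only: hs_ht')
qed

text \<open>The crossing exchanges the strand to be closed with one that \<open>x\<close> does not
  touch, and the latter can be pulled off.\<close>

lemma hE_conj: "hE (hs 0 * (sh x * ht 0)) = sh (hE x)"
proof (induction x rule: hcl_mackey_induct)
  case (sh a)
  then show ?case by (simp add: hs_sh2 hs_ht hE_simps shift.hom_simps)
next
  case (hc a)
  show ?case
    by (simp add: shift.hom_simps hs_sh2 mult.assoc hE_left hs_hc_Suc' hs_ht hE_simps hE_hc_hs hE_left')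
next
  case (hs a b)
  have "hs 0 * (sh (sh a * (hs 0 * sh b)) * ht 0) = sh (sh a) * ((hs 0 * (hs (Suc 0) * ht 0)) * sh (sh b))"
    by (simp add: shift.hom_simps hs_sh2 mult.assoc)
  also have "hE \<dots> = sh a * sh b"
    by (simp only: hs_hs_ht hE_mid) (simp add: hE_left' hE_right' hE_hs0 hs_ht mult.assoc[symmetric])
  finally show ?case by (simp add: shift.hom_simps hE_left hE_hs_sh)
next
  case (add x y)
  then show ?case by (simp add: shift.hom_simps distrib_left distrib_right hE_add)
qed

text \<open>The crossings of the other sign differ by the skein relation, and the two correction
  terms cancel by \<open>hE_hs_sh\<close>.\<close>

lemma hE_conj': "hE (ht 0 * (sh x * hs 0)) = sh (hE x)"
proof -
  have "ht 0 * (sh x * hs 0) = hs 0 * (sh x * ht 0) + hz * (sh x * ht 0) - hz * (ht 0 * sh x)"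
    by (simp add: ht_def algebra_simps hgen_hz hz_comm[of "sh _"] hz_left_comm[of "sh _"])
  then show ?thesis by (simp add: hE_simps hE_conj hE_hs_sh)
qed

text \<open>Two closed strands may be interchanged. The Mackey form of \<open>x\<close> only
  isolates strand 0, so its left factor is decomposed once more to reach strand 1.\<close>

lemma hE_hE_conj: "hE (hE (hs 0 * (x * ht 0))) = hE (hE x)"
proof (induction x rule: hcl_mackey_induct)
  case (sh a)
  then show ?case by (simp add: hE_conj hE_simps)
next
  case (hc a)
  have "hs 0 * (sh a * hc 0 * ht 0) = (hs 0 * (sh a * ht 0)) * sh (hc 0)"
    by (simp add: mult.assoc ht_slide)
  then show ?case by (simp only: hE_right hE_conj hE_left hE_hc0) (simp add: hE_simps)
next
  case (hs a b)
  show ?case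
  proof (induction a rule: hcl_mackey_induct)
    case (sh c)
    have "hs 0 * (sh (sh c) * (hs 0 * sh b) * ht 0) = sh (sh c) * (sh b * ht 0 - hz * (hs 0 * (sh b * ht 0)))"
      by (simp add: hs_sh2 mult.assoc hs_sq')
    then show ?case by (simp add: hE_left hE_diff hE_hz hE_hs_sh hE_conj hE_sh hE_simps)
  next
    case (hc c)
    have "hs 0 * (sh (sh c * hc 0) * (hs 0 * sh b) * ht 0)
        = sh (sh c) * (sh (hat b) * (ht 0 * sh (hc 0)) - hz * (sh (hc 0) * (hs 0 * (sh b * ht 0))))"
      by (simp add: shift.hom_simps hs_sh2 mult.assoc hs_slide'[symmetric] hs_sq' hc_sh' ht_slide
          hz_left_comm[of "sh _"] right_diff_distrib)
    then have *: "hE (hE (hs 0 * (sh (sh c * hc 0) * (hs 0 * sh b) * ht 0)))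
        = c * (hE (hat b * hc 0) - hz * hE (hc 0 * sh (hE b)))"
      by (simp add: hE_left hE_diff hE_hz hE_conj hE_left' hE_right' hE_simps)
    have "hE (hE (sh (sh c * hc 0) * (hs 0 * sh b))) = c * hE (hat b * hc 0)"
      by (simp only: hE_left hE_hs_sh hE_hc mult.assoc)
    then show ?case unfolding * by (simp only: hE_hs_sh mult_zero_right diff_0_right)
  next
    case (hs c d)
    \<comment> \<open>The braid relation leaves a conjugate of a shifted element, to which
      \<open>hE_conj\<close> applies.\<close>
    have "hs 0 * (sh (sh c * (hs 0 * sh d)) * (hs 0 * sh b) * ht 0)
        = sh (sh c) * (sh (hs 0) * (hs 0 * (sh (hs 0 * (sh d * b)) * ht 0)))"
      by (simp add: shift.hom_simps mult.assoc hs_sh2(1)[of c] hs_sh2(1)[of d, symmetric] hs_braid')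
    then have "hE (hE (hs 0 * (sh (sh c * (hs 0 * sh d)) * (hs 0 * sh b) * ht 0)))
        = c * hE (hs 0 * (sh d * b))"
      by (simp only: hE_left hE_conj hE_hs_sh)
    then show ?case by (simp add: hE_left hE_hs_sh mult.assoc)
  next
    case (add x y)
    then show ?case by (simp add: shift.hom_simps distrib_left distrib_right hE_add)
  qed
next
  case (add x y)
  then show ?case by (simp add: shift.hom_simps distrib_left distrib_right hE_add)
qed

lemma ht_sq: "ht i * ht i = 1 + hz * ht i"
  by (simp add: ht_def algebra_simps hs_sq hgen_hz)
lemma ht_braid: "ht i * (ht (Suc i) * ht i) = ht (Suc i) * (ht i * ht (Suc i))"
  by (simp add: ht_def distrib_left distrib_right mult.assoc hgen_hz hs_braid hs_sq
      right_diff_distrib left_diff_distrib)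
lemma ht_far: "Suc i < j ==> ht j * ht i = ht i * ht j"
  by (simp add: ht_def algebra_simps hs_far hgen_hz)
lemma ht_pass: "j \<noteq> i ==> j \<noteq> Suc i ==> ht i * hc j = hc j * ht i"
  by (simp add: ht_def algebra_simps hs_pass hgen_hz)

lemma ht_braid': "ht i * (ht (Suc i) * (ht i * x)) = ht (Suc i) * (ht i * (ht (Suc i) * x))"
  by (simp only: mult.assoc[symmetric] ht_braid[unfolded mult.assoc[symmetric]])
lemma ht_far': "Suc i < j ==> ht j * (ht i * x) = ht i * (ht j * x)"
  by (rule comm_tail[OF ht_far])
lemma ht_pass': "j \<noteq> i ==> j \<noteq> Suc i ==> ht i * (hc j * x) = hc j * (ht i * x)"
  by (rule comm_tail[OF ht_pass])
lemma ht_sq': "ht i * (ht i * x) = x + hz * (ht i * x)"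
  by (simp add: comp_tail[OF ht_sq] distrib_right mult.assoc)

lemma hE_hat: "hE (hat x) = hat (hE x)"
proof (induction x rule: hcl_mackey_induct)
  case (hs a b)
  then show ?case by (simp add: parity.hom_simps hat_sh hE_mid hE_hs0 hE_left hE_hs_sh)
qed (simp_all add: parity.hom_simps hat_sh hE_simps)

section \<open>The action of the walled algebra\<close>

text \<open>\<open>heps z\<close> is a central idempotent on whose image the parameter \<open>hz\<close> acts as the scalar \<open>z\<close>.\<close>

definition heps :: "'k => 'k::comm_ring_1 hcl"
  where "heps z = sc (\<lambda>w. if w = z then 1 else 0)"

abbreviation ksc :: "'k => 'k::comm_ring_1 hcl" where "ksc c \<equiv> sc (\<lambda>_. c)"

lemma heps_idem: fixes x :: "'k::comm_ring_1 hcl" shows "heps z * (heps z * x) = heps z * x"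
proof -
  have "(\<lambda>w. if w = z then 1 else 0) * (\<lambda>w. if w = z then 1 else 0)
    = (\<lambda>w. if w = z then 1 else 0 :: 'k)" by auto
  then show ?thesis by (simp add: heps_def sc_times[symmetric] mult.assoc[symmetric])
qed
text \<open>The coordinate function \<open>zeta\<close> and the constant function z agree wherever
  the indicator of z is nonzero.\<close>

lemma heps_hz: "heps z * x = x ==> hz * x = ksc z * x"
proof -
  assume x: "heps z * x = x"
  have "hz * (heps z * x) = ksc z * (heps z * x)"
    by (simp add: heps_def hz_def zeta_def sc_times[symmetric] mult.assoc[symmetric])
      (simp add: times_fun_def if_distrib cong: if_cong)
  then show ?thesis by (simp add: x)
qed

abbreviation bcterms :: "nat => nat => 'k bcterm set" where "bcterms r s \<equiv> aterms (bcgens r s)"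

abbreviation bccong :: "nat => nat => 'k::comm_ring_1 => ('k bcterm \<times> 'k bcterm) set"
  where "bccong r s z \<equiv> acong (bcgens r s) (bcrels r z)"

text \<open>The relations of \<open>BC r s z\<close> mention z whereas \<open>H\<close> only knows
  \<open>hz\<close>; they hold on this two-sided ideal, where the two act alike.\<close>

definition corner :: "'k::comm_ring_1 => 'k hcl set" where "corner z = {x. heps z * x = x}"

lemma corner_hz: "x \<in> corner z ==> hz * x = ksc z * x"
  by (simp add: corner_def heps_hz)

lemma corner_eps: "heps z \<in> corner z"
  using heps_idem[of z 1] by (simp add: corner_def)

lemma corner_closed:
  assumes "x \<in> corner z"
  shows "y * x \<in> corner z" "x * y \<in> corner z" "hat x \<in> corner z" "sh x \<in> corner z" "hE x \<in> corner z"
    "- x \<in> corner z" "0 \<in> corner z"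
proof -
  have x: "heps z * x = x" using assms by (simp add: corner_def)
  have "heps z * (y * x) = y * (heps z * x)" unfolding heps_def by (rule sc_left_comm[symmetric])
  then show "y * x \<in> corner z" by (simp add: corner_def x)
  show "x * y \<in> corner z" by (simp add: corner_def x mult.assoc[symmetric])
  have "heps z * hat x = hat (heps z * x)" by (simp add: parity.hom_simps heps_def)
  then show "hat x \<in> corner z" by (simp add: corner_def x)
  have "heps z * sh x = sh (heps z * x)" by (simp add: shift.hom_simps heps_def)
  then show "sh x \<in> corner z" by (simp add: corner_def x)
  have "heps z * hE x = hE (heps z * x)" by (simp add: hE_sc heps_def)
  then show "hE x \<in> corner z" by (simp add: corner_def x)
qed (use assms in \<open>simp_all add: corner_def\<close>)

lemma corner_add: "x \<in> corner z ==> y \<in> corner z ==> x + y \<in> corner z"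
  by (simp add: corner_def distrib_left)

text \<open>Indices on the upward side are reversed because strands count from the right. The twist
  by \<open>hat\<close> makes \<open>BPs\<close> anticommute with \<open>BP\<close> and turns the
  square -1 of a dot into 1. \<open>BE\<close> is a cap followed by a cup.\<close>

fun bcop :: "nat => bcgen => 'k::comm_ring_1 hcl => 'k hcl" where
  "bcop r (BT k) x = ht (r - 1 - k) * x"
| "bcop r (BTs k) x = x * ht (k - 1)"
| "bcop r BE x = sh (hE x)"
| "bcop r (BP k) x = hc (r - k) * x"
| "bcop r (BPs k) x = hat x * hc (k - 1)"

abbreviation bcact :: "nat => (bcgen, 'k::comm_ring_1) aterm => 'k hcl => 'k hcl"
  where "bcact r \<equiv> opeval (bcop r) (\<lambda>c x. ksc c * x)"

lemma ksc_simps: "ksc (c + d) = ksc c + ksc d" "ksc (c * d) = ksc c * ksc d" "ksc (- c) = - ksc c"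
  "ksc 0 = 0" "ksc 1 = 1"
  using sc_plus[of "\<lambda>_. c" "\<lambda>_. d"] sc_times[of "\<lambda>_. c" "\<lambda>_. d"] sc_uminus[of "\<lambda>_. c"]
    sc_0[unfolded zero_fun_def] sc_1[unfolded one_fun_def]
  by (simp_all add: plus_fun_def times_fun_def fun_Compl_def)

lemma bcgens_iff [simp]:
  "BT i \<in> bcgens r s \<longleftrightarrow> 0 < i \<and> i < r" "BTs i \<in> bcgens r s \<longleftrightarrow> 0 < i \<and> i < s"
  "BE \<in> bcgens r s \<longleftrightarrow> 0 < r \<and> 0 < s"
  "BP i \<in> bcgens r s \<longleftrightarrow> 0 < i \<and> i \<le> r" "BPs i \<in> bcgens r s \<longleftrightarrow> 0 < i \<and> i \<le> s"
  by (auto simp: bcgens_def)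

lemma aterms_iff [simp]: "AZero \<in> aterms G" "AOne \<in> aterms G" "x \<cdot> y \<in> aterms G \<longleftrightarrow> x \<in> aterms G \<and> y \<in> aterms G"
  "x \<boxplus> y \<in> aterms G \<longleftrightarrow> x \<in> aterms G \<and> y \<in> aterms G" "c *\<^sub>a x \<in> aterms G \<longleftrightarrow> x \<in> aterms G"
  "AGen g \<in> aterms G \<longleftrightarrow> g \<in> G"
  by (auto simp: aterms_def)

lemma ksc_left_comm: "x * (ksc c * y) = ksc c * (x * y)" by (rule sc_left_comm)

lemma bcop_lin: "bcop r g (x + y) = bcop r g x + bcop r g y" "bcop r g (sc a * x) = sc a * bcop r g x"
  by (cases g; simp add: distrib_left distrib_right parity.hom_simps shift.hom_simps hE_simps
      sc_left_comm[of "hc _"] sc_left_comm[of "ht _"] mult.assoc)+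

lemma bcact_lin: "bcact r x (m + n) = bcact r x m + bcact r x n"
  "bcact r x (sc a * m) = sc a * bcact r x m"
  by (induction x arbitrary: m n) (simp_all add: bcop_lin distrib_left sc_left_comm[of "ksc _"])

lemma bcact_corner: "m \<in> corner z ==> bcact r x m \<in> corner z"
proof (induction x arbitrary: m)
  case (AGen g)
  then show ?case by (cases g) (simp_all add: corner_closed)
qed (simp_all add: corner_closed corner_add)

text \<open>On the corner \<open>bt_inv z (r - 1)\<close> is multiplication by \<open>hs 0\<close>.
  Both sides then close two strands and shift twice: the left one by \<open>hE_conj\<close> and
  \<open>hE_hE_conj\<close>, the right one because a double shift commutes with the
  crossing.\<close>

lemma bcact_be_conj:
  assumes "m \<in> corner z"
  shows "bcact r (be \<cdot> bt_inv z (r - 1) \<cdot> bts 1 \<cdot> be \<cdot> bts 1 \<cdot> bt_inv z (r - 1)) m =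
    bcact r (bt_inv z (r - 1) \<cdot> bts 1 \<cdot> be \<cdot> bts 1 \<cdot> bt_inv z (r - 1) \<cdot> be) m"
proof -
  have inv: "bcact r (bt_inv z (r - Suc 0)) y = hs 0 * y" if "y \<in> corner z" for y
  proof -
    have "ht 0 * y + ksc (- z) * y = hs 0 * y"
      using corner_hz[OF that] by (simp add: ht_def distrib_right ksc_simps)
    then show ?thesis by (simp add: bt_inv_def)
  qed
  note cl = corner_closed assms
  show ?thesis
    by (simp add: inv cl mult.assoc hE_conj hE_conj' hs_sh2 hE_hE_conj hs_ht)
qed

lemma bcact_rel:
  assumes "(x, y) \<in> bcrels r z" "x \<in> bcterms r s" "y \<in> bcterms r s" "m \<in> corner z"
  shows "bcact r x m = bcact r y m"
  using assms(1)
proof cases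
  case (1 i)
  then show ?thesis using corner_hz[of "ht _ * m" z] assms(4)
    by (simp add: ht_sq' corner_closed)
next
  case (2 i)
  then show ?thesis using corner_hz[of "m * ht _" z] assms(4)
    by (simp add: mult.assoc ht_sq distrib_left corner_closed hz_left_comm)
next
  case (3 i)
  then have "r - Suc i = Suc (r - Suc (Suc i))" using assms(2) by auto
  with 3 show ?thesis by (simp add: ht_braid')
next
  case (4 i)
  then obtain l where "i = Suc l" using assms(2) by (cases i) auto
  with 4 show ?thesis by (simp add: ht_braid mult.assoc)
next
  case (5 i j)
  then have "Suc (r - 1 - i) < r - 1 - j \<or> Suc (r - 1 - j) < r - 1 - i"
    using assms(2) by auto
  with 5 show ?thesis using ht_far'[of "r - 1 - i" "r - 1 - j" m] ht_far'[of "r - 1 - j" "r - 1 - i" m]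
    by auto
next
  case (6 i j)
  then obtain a b where "i = Suc a" "j = Suc b" using assms(2) by (cases i; cases j) auto
  with 6 show ?thesis by (auto simp: mult.assoc ht_far[of a b] ht_far[of b a])
next
  case (9 i j)
  then have "r - i \<noteq> r - j" using assms(2) by auto
  with 9 show ?thesis by (simp add: mult.assoc[symmetric] hc_swap[of "r - i" "r - j"] ksc_simps)
next
  case (11 i j)
  then obtain a b where "i = Suc a" "j = Suc b" using assms(2) by (cases i; cases j) auto
  with 11 show ?thesis
    by (simp add: mult.assoc parity.hom_simps hc_swap[of b a] ksc_simps)
next
  case (13 i)
  then have "r - i = Suc (r - 1 - i)" using assms(2) by auto
  with 13 show ?thesis by (simp add: comm_tail[OF ht_slide])
next
  case (14 i)
  then obtain l where "i = Suc l" using assms(2) by (cases i) auto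
  with 14 show ?thesis by (simp add: ht_slide parity.hom_simps mult.assoc)
next
  case (15 j i)
  then have "r - j \<noteq> r - 1 - i" "r - j \<noteq> Suc (r - 1 - i)" using assms(2) by auto
  with 15 show ?thesis by (simp add: ht_pass')
next
  case (16 j i)
  then have "j - 1 \<noteq> i - 1" "j - 1 \<noteq> Suc (i - 1)" using assms(2) by auto
  with 16 show ?thesis by (simp add: mult.assoc parity.hom_simps ht_pass)
next
  case 20
  then show ?thesis by (simp add: hE_hs_sh)
next
  case (21 j)
  then obtain l where "r - 1 - j = Suc l" using assms(2) by (cases "r - 1 - j") auto
  with 21 show ?thesis by (simp add: hE_left' shift.hom_simps)
next
  case (23 j)
  then obtain l where "j - 1 = Suc l" using assms(2) by (cases "j - 1") auto
  with 23 show ?thesis by (simp add: hE_right' shift.hom_simps)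
next
  case 24
  then show ?thesis by (simp add: hc_sh hat_sh)
next
  case 25
  then show ?thesis by (simp add: hE_hc)
next
  case (26 j)
  then obtain l where "r - j = Suc l" using assms(2) by (cases "r - j") auto
  with 26 show ?thesis by (simp add: hE_left' shift.hom_simps)
next
  case (27 j)
  then obtain l where "j - 1 = Suc l" using assms(2) by (cases "j - 1") auto
  with 27 show ?thesis by (simp add: hE_right' shift.hom_simps hat_sh hE_hat)
next
  case 28
  then show ?thesis using bcact_be_conj[OF assms(4), of r] by simp
qed (auto simp: hc_sq' hc_sq mult.assoc parity.hom_simps hE_simps hE_hs_sh ksc_simps shift.hom_0)

lemma bcact_acong:
  assumes "(x, y) \<in> bccong r s z" "m \<in> corner z"
  shows "bcact r x m = bcact r y m"
  using assms
proof (induction arbitrary: m rule: acong.induct)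
  case (rel x y)
  then show ?case by (rule bcact_rel)
qed (auto simp: bcact_lin bcact_corner ksc_simps distrib_left distrib_right bcop_lin mult.assoc ac_simps)

section \<open>Long crossings and block crossings\<close>

text \<open>The product t_(i-1) ... t_0, in which one strand crosses i others; it is the inverse of
  \<open>hr i\<close>, which \<open>hli\<close> restates.\<close>

primrec hl :: "nat => 'k::comm_ring_1 hcl" where
  "hl 0 = 1"
| "hl (Suc i) = ht i * hl i"

primrec hli :: "nat => 'k::comm_ring_1 hcl" where
  "hli 0 = 1"
| "hli (Suc i) = hli i * hs i"

lemma hli_hl: "hli i * (hl i * x) = x" "hl i * (hli i * x) = x" "hl i * hli i = 1" "hli i * hl i = 1"
proof -
  show *: "hli i * (hl i * x) = x" "hl i * (hli i * x) = x" for x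
    by (induction i arbitrary: x) (simp_all add: mult.assoc hs_ht')
  show "hl i * hli i = 1" "hli i * hl i = 1" using *[of 1] by simp_all
qed

lemma hl_ht_far: "i < k ==> ht k * hl i = hl i * ht k"
  by (induction i) (simp_all add: comm_tail[OF ht_far] mult.assoc)

lemma hl_hc_far: "i < k ==> hc k * hl i = hl i * hc k"
  by (induction i) (simp_all add: comm_tail[OF ht_pass[symmetric]] mult.assoc)

lemma hl_ht: "Suc k < i ==> ht k * hl i = hl i * ht (Suc k)"
proof (induction i)
  case (Suc i)
  show ?case
  proof (cases "Suc k = i")
    case True
    then have "ht k * hl (Suc i) = ht k * (ht (Suc k) * (ht k * (hl k :: 'a hcl)))" by auto
    also have "\<dots> = hl (Suc i) * ht (Suc k)"
      using True by (auto simp: ht_braid' mult.assoc hl_ht_far[of k "Suc k"])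
    finally show ?thesis .
  next
    case False
    then show ?thesis using Suc by (simp add: comm_tail[OF ht_far[symmetric]] mult.assoc)
  qed
qed simp

lemma hl_hc: "k < i ==> hc k * hl i = hl i * hc (Suc k)"
proof (induction i)
  case (Suc i)
  then show ?case
    by (cases "k = i")
      (simp_all add: comm_tail[OF ht_slide[symmetric]] comm_tail[OF ht_pass[symmetric]] hl_hc_far mult.assoc)
qed simp

lemma hl_Suc_right: "hl (Suc i) = sh (hl i) * ht 0"
proof (induction i)
  case (Suc i)
  have "hl (Suc (Suc i)) = ht (Suc i) * (hl (Suc i) :: 'a hcl)" by (rule hl.simps)
  also have "\<dots> = sh (ht i * hl i) * ht 0"
    by (simp only: Suc shift.hom_mult sh_gens mult.assoc)
  finally show ?case by simp
qed (simp add: shift.hom_1)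

inductive_set hk :: "nat => 'k::comm_ring_1 hcl set" for n where
  ht: "Suc i < n ==> ht i \<in> hk n"
| sc: "sc a \<in> hk n"
| add: "x \<in> hk n ==> y \<in> hk n ==> x + y \<in> hk n"
| mult: "x \<in> hk n ==> y \<in> hk n ==> x * y \<in> hk n"

lemma hk_1: "1 \<in> hk n" using hk.sc[of 1 n] by (simp add: sc_1)
lemma hk_hz: "hz \<in> hk n" by (simp add: hz_def hk.sc)
lemma hk_minus: "x \<in> hk n ==> - x \<in> hk n"
  using hk.mult[OF hk.sc[of "- 1" n], of x] by (simp add: sc_uminus sc_1)
lemma hk_hs: "Suc i < n ==> hs i \<in> hk n"
  using hk.add[OF hk.ht[of i n] hk_minus[OF hk_hz]] by (simp add: ht_def)
lemma hk_mono: "x \<in> hk m ==> m \<le> n ==> x \<in> hk n"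
  by (induction rule: hk.induct) (auto intro: hk.intros)
lemma hk_hsub: "x \<in> hk n ==> x \<in> hsub n"
  by (induction rule: hk.induct) (auto intro: hsub.intros hsub_ht)
lemma hk_sh: "x \<in> hk n ==> sh x \<in> hk (Suc n)"
  by (induction rule: hk.induct) (auto simp: shift.hom_simps intro: hk.intros)
lemma hk_hat: "x \<in> hk n ==> hat x = x"
  by (induction rule: hk.induct) (auto simp: parity.hom_simps)
lemma hl_hk: "hl i \<in> hk (Suc i)" "hli i \<in> hk (Suc i)"
  by (induction i) (auto intro!: hk.mult hk.ht hk_hs hk_1 elim: hk_mono)

abbreviation shn :: "nat => 'k::comm_ring_1 hcl => 'k hcl" where "shn p \<equiv> (sh ^^ p)"

lemma shn_hom: "shn p (x * y) = shn p x * shn p y" "shn p (x + y) = shn p x + shn p y"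
  "shn p 1 = 1" "shn p (sc a) = sc a" "shn p (ht i) = ht (i + p)" "shn p (hs i) = hs (i + p)"
  "shn p (hc i) = hc (i + p)" "shn p hz = hz" "shn p (sh x) = sh (shn p x)" "shn p (- x) = - shn p x"
  "shn (Suc p) x = sh (shn p x)"
  by (induction p) (simp_all add: shift.hom_simps)

text \<open>The positive crossing of a block of p strands with a block of q strands. Opening a cup
  to the left of p upward strands multiplies by \<open>hl p\<close>, so this is what q nested cups
  produce.\<close>

primrec hv :: "nat => nat => 'k::comm_ring_1 hcl" where
  "hv p 0 = 1"
| "hv p (Suc q) = hl p * sh (hv p q)"

lemma hv_hk: "hv p q \<in> hk (p + q)"
proof (induction q)
  case (Suc q)
  then show ?case using hk_mono[OF hl_hk(1)[of p], of "Suc (p + q)"] by (auto intro: hk.mult hk_sh)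
qed (simp add: hk_1)

lemma hv_ht: "Suc k < p ==> ht k * hv p q = hv p q * ht (q + k)"
proof (induction q)
  case (Suc q)
  have "ht k * hv p (Suc q) = hl p * sh (ht k * (hv p q :: 'a hcl))"
    using Suc(2) by (simp add: comm_tail[OF hl_ht] shift.hom_mult)
  then show ?case by (simp add: Suc shift.hom_mult mult.assoc)
qed simp

lemma hv_hc: "k < p ==> hc k * hv p q = hv p q * hc (q + k)"
proof (induction q)
  case (Suc q)
  have "hc k * hv p (Suc q) = hl p * sh (hc k * (hv p q :: 'a hcl))"
    using Suc(2) by (simp add: comm_tail[OF hl_hc] shift.hom_mult)
  then show ?case by (simp add: Suc shift.hom_mult mult.assoc)
qed simp

lemma hl_sh_hk: "x \<in> hk p ==> hl p * sh x = x * hl p"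
proof (induction rule: hk.induct)
  case (mult x y)
  show ?case by (simp only: shift.hom_mult mult.assoc[symmetric] mult(3)) (simp only: mult.assoc mult(4))
qed (simp_all add: hl_ht shift.hom_simps sc_comm distrib_left distrib_right)

lemma hl_hl: "hl (Suc p) * sh (hl p) = hl p * (sh (hl p) * ht 0)"
  using hl_sh_hk[OF hl_hk(1), of p] by (simp add: hl_Suc_right[symmetric] del: hl.simps)

lemma hv_ht_extra: "Suc j < q ==> ht (p + j) * hv p q = hv p q * ht j"
proof (induction q arbitrary: j)
  case (Suc q)
  show ?case
  proof (cases j)
    case 0
    then obtain m where "q = Suc m" using Suc by (cases q) auto
    then have "ht (p + j) * hv p (Suc q) = (hl (Suc p) * sh (hl p)) * sh (sh (hv p m :: 'a hcl))"
      using 0 by (simp add: shift.hom_mult mult.assoc)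
    also have "\<dots> = hv p (Suc q) * ht j" unfolding hl_hl
      using 0 \<open>q = Suc m\<close> by (simp add: shift.hom_mult mult.assoc hs_sh2)
    finally show ?thesis .
  next
    case (Suc i)
    have "ht (p + j) * hv p (Suc q) = hl p * sh (ht (p + i) * (hv p q :: 'a hcl))"
      using Suc by (simp add: comm_tail[OF hl_ht_far] shift.hom_mult)
    then show ?thesis using Suc Suc.IH[of i] Suc.prems by (simp add: shift.hom_mult mult.assoc)
  qed
qed simp

text \<open>The product t_0 ... t_(q-1): the counterpart of \<open>hl\<close> for crossings that act
  from the right.\<close>

primrec ha :: "nat => 'k::comm_ring_1 hcl" where
  "ha 0 = 1"
| "ha (Suc q) = ht 0 * sh (ha q)"
primrec hai :: "nat => 'k::comm_ring_1 hcl" where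
  "hai 0 = 1"
| "hai (Suc q) = sh (hai q) * hs 0"

lemma ha_hk: "ha q \<in> hk (Suc q)" "hai q \<in> hk (Suc q)"
  by (induction q) (auto intro!: hk.mult hk.ht hk_hs hk_1 hk_sh)

lemma hai_ha: "hai q * ha q = 1"
proof (induction q)
  case (Suc q)
  have "hai (Suc q) * ha (Suc q) = sh (hai q * (ha q :: 'a hcl))"
    by (simp add: mult.assoc hs_ht' shift.hom_mult)
  then show ?case by (simp add: Suc shift.hom_1)
qed simp

lemma hl_sh_shn: "x \<in> hk n ==> hl p * sh (shn p x) = sh (shn p x) * hl p"
proof (induction rule: hk.induct)
  case (mult x y)
  show ?case by (simp only: shn_hom shift.hom_mult mult.assoc[symmetric] mult(3)) (simp only: mult.assoc mult(4))
qed (simp_all add: hl_ht_far shn_hom shift.hom_simps sc_comm distrib_left distrib_right)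

lemma hl_hv: "hl p * hv (Suc p) q = shn p (ha q) * (hv p q * shn q (hl p))"
proof (induction q)
  case (Suc q)
  have "hl p * hv (Suc p) (Suc q) = (hl p * hl (Suc p)) * sh (hv (Suc p) q :: 'a hcl)"
    by (simp add: mult.assoc del: hl.simps)
  also have "hl p * hl (Suc p) = hl (Suc p) * sh (hl p :: 'a hcl)"
    by (rule hl_sh_hk[OF hl_hk(1), symmetric])
  also have "\<dots> * sh (hv (Suc p) q) = hl (Suc p) * sh (hl p * hv (Suc p) q)"
    by (simp only: shift.hom_mult mult.assoc)
  also have "\<dots> = ht p * (hl p * sh (shn p (ha q))) * sh (hv p q * shn q (hl p))"
    by (simp add: Suc shift.hom_mult mult.assoc)
  also have "\<dots> = shn p (ha (Suc q)) * (hv p (Suc q) * shn (Suc q) (hl p))"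
    by (simp add: hl_sh_shn[OF ha_hk(1)] shn_hom shift.hom_mult mult.assoc)
  finally show ?case .
qed (simp add: shn_hom)

text \<open>Closing a strand of the block crossing yields the smaller block crossing up to the
  invertible factors \<open>ha q\<close> and \<open>hl p\<close>; this is how \<open>BE\<close>
  reaches it.\<close>

lemma hE_hv: "hE (hv (Suc p) (Suc q)) = shn p (ha q) * (hv p q * shn q (hl p))"
  by (simp add: hl_Suc_right mult.assoc hE_left hE_hs_sh hl_hv[symmetric] del: hl.simps)

text \<open>The parabolic subalgebra of type (p, n - p): the crossing with index p - 1 is left out.
  For p = 0 nothing is left out, whence \<open>hk_hsplit\<close>.\<close>

inductive_set hsplit :: "nat => nat => 'k::comm_ring_1 hcl set" for p n where
  ht: "Suc i < n ==> Suc i \<noteq> p ==> ht i \<in> hsplit p n"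
| sc: "sc a \<in> hsplit p n"
| add: "x \<in> hsplit p n ==> y \<in> hsplit p n ==> x + y \<in> hsplit p n"
| mult: "x \<in> hsplit p n ==> y \<in> hsplit p n ==> x * y \<in> hsplit p n"

lemma hsplit_1: "1 \<in> hsplit p n" using hsplit.sc[of 1 p n] by (simp add: sc_1)

lemma hk_hsplit: "x \<in> hk n ==> x \<in> hsplit 0 n"
  by (induction rule: hk.induct) (auto intro: hsplit.intros)

lemma hsplit_sh: "x \<in> hsplit p n ==> sh x \<in> hsplit (Suc p) (Suc n)"
  by (induction rule: hsplit.induct) (auto simp: shift.hom_simps intro: hsplit.intros)

lemma hk_sh_hsplit: "x \<in> hk n ==> sh x \<in> hsplit 1 (Suc n)"
  using hsplit_sh[OF hk_hsplit] by simp

inductive_set left_span :: "nat => 'k::comm_ring_1 hcl set" for n where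
  "i \<le> n ==> a \<in> hk n ==> hl i * sh a \<in> left_span n"
| "x \<in> left_span n ==> y \<in> left_span n ==> x + y \<in> left_span n"

lemma left_span_right: "x \<in> left_span n ==> a \<in> hk n ==> x * sh a \<in> left_span n"
  by (induction rule: left_span.induct)
    (auto simp: distrib_right mult.assoc shift.hom_mult[symmetric] intro: left_span.intros hk.mult)

lemma left_span_hl: "i \<le> n ==> hl i \<in> left_span n"
  using left_span.intros(1)[of i n 1] by (simp add: shift.hom_1 hk_1)

lemma left_span_ht:
  fixes x :: "'k::comm_ring_1 hcl"
  assumes "x \<in> left_span n" "k < n" shows "ht k * x \<in> left_span n"
  using assms
proof (induction)
  case (1 i a)
  have "ht k * hl i \<in> (left_span n :: 'k hcl set)"
  proof -
    consider "k = i" | "Suc k = i" | "Suc k < i" | "i < k" by linarith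
    then show ?thesis
    proof cases
      case 1 then show ?thesis using assms(2) left_span_hl[of "Suc i" n, simplified] by auto
    next
      case 2
      have "ht k * hl i = hl k + hl i * sh (hz :: 'k hcl)"
        unfolding 2[symmetric] by (simp add: ht_sq' shift.hom_hz hz_comm)
      also have "\<dots> \<in> left_span n"
        by (intro left_span.intros(2) left_span_hl left_span_right hk_hz) (use 1 2 in auto)
      finally show ?thesis .
    next
      case 3
      have "ht k * hl i = hl i * (sh (ht k) :: 'k hcl)" using hl_ht[OF 3] by simp
      also have "\<dots> \<in> left_span n"
        by (intro left_span_right left_span_hl hk.ht) (use 1 3 in auto)
      finally show ?thesis .
    next
      case 4
      then obtain m where m: "k = Suc m" by (cases k) auto
      have "ht k * hl i = hl i * (sh (ht m) :: 'k hcl)" using hl_ht_far[OF 4] m by simp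
      also have "\<dots> \<in> left_span n"
        by (intro left_span_right left_span_hl hk.ht) (use 1 m assms(2) in auto)
      finally show ?thesis .
    qed
  qed
  then show ?case by (simp add: mult.assoc[symmetric] left_span_right 1)
qed (simp add: distrib_left left_span.intros)

lemma hk_left_span: "x \<in> hk (Suc n) ==> x \<in> left_span n"
proof -
  assume "x \<in> hk (Suc n)"
  then have "y \<in> left_span n ==> x * y \<in> left_span n" for y
  proof (induction arbitrary: y rule: hk.induct)
    case (sc a)
    then show ?case using left_span_right[of y n "sc a"] by (simp add: sc_comm shift.hom_sc hk.sc)
  qed (auto simp: distrib_right mult.assoc left_span_ht intro: left_span.intros)
  from this[of 1] show ?thesis using left_span_hl[of 0 n] by simp
qed

section \<open>The orbit of the vacuum\<close>

text \<open>The double coset decomposition of the Hecke algebra with respect to the parabolic subalgebras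
  of type \<open>(p, n - p)\<close> and \<open>(q, n - q)\<close>: a representative either is \<open>hv p q\<close> or can be chosen in the
  shifted subalgebra.\<close>

inductive_set dcoset :: "nat => nat => nat => 'k::comm_ring_1 hcl set" for p q n where
  "x \<in> hsplit p n ==> b \<in> hsplit q n ==> x * (hv p q * b) \<in> dcoset p q n"
| "x \<in> hsplit p n ==> b \<in> hsplit q n ==> y \<in> hk (n - 1) ==> x * (sh y * b) \<in> dcoset p q n"
| "x \<in> dcoset p q n ==> y \<in> dcoset p q n ==> x + y \<in> dcoset p q n"

lemma dcoset_left: "x \<in> dcoset p q n ==> a \<in> hsplit p n ==> a * x \<in> dcoset p q n"
  by (induction rule: dcoset.induct)
    (auto simp: distrib_left mult.assoc[symmetric] intro: dcoset.intros[simplified mult.assoc[symmetric]] hsplit.mult)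

lemma hl_hsplit: "x \<in> hsplit p n ==> \<exists>y \<in> hsplit p (Suc n). hl p * sh x = y * hl p"
proof (induction rule: hsplit.induct)
  case (ht i)
  show ?case
  proof (cases "Suc i < p")
    case True
    then show ?thesis using ht by (intro bexI[of _ "ht i"]) (auto simp: hl_ht intro: hsplit.ht)
  next
    case False
    then show ?thesis using ht by (intro bexI[of _ "ht (Suc i)"]) (auto simp: hl_ht_far intro: hsplit.ht)
  qed
next
  case (sc a)
  show ?case by (rule bexI[OF _ hsplit.sc[of a]]) (simp only: shift.hom_sc sc_comm[of "hl p"])
next
  case (add x y)
  then obtain x' y' where "x' \<in> hsplit p (Suc n)" "hl p * sh x = x' * hl p"
    "y' \<in> hsplit p (Suc n)" "hl p * sh y = y' * hl p" by blast
  then show ?case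
    by (intro bexI[of _ "x' + y'"] hsplit.add) (simp_all add: shift.hom_add distrib_left distrib_right)
next
  case (mult x y)
  then obtain x' y' where 1: "x' \<in> hsplit p (Suc n)" "hl p * sh x = x' * hl p"
    "y' \<in> hsplit p (Suc n)" "hl p * sh y = y' * hl p" by blast
  have "hl p * sh (x * y) = x' * y' * hl p"
    by (simp add: shift.hom_mult comp_tail[OF 1(2)] mult.assoc 1(4))
  then show ?case using 1 by (intro bexI[of _ "x' * y'"] hsplit.mult)
qed

lemma hl_split: "p \<le> i ==> i \<le> n ==> \<exists>y \<in> hsplit p (Suc n). hl i = y * (hl p :: 'k::comm_ring_1 hcl)"
proof (induction i)
  case (Suc i)
  show ?case
  proof (cases "p = Suc i")
    case True then show ?thesis using hsplit_1 by (intro bexI[of _ 1]) (auto simp del: hl.simps)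
  next
    case False
    then obtain y :: "'k hcl" where "y \<in> hsplit p (Suc n)" "hl i = y * hl p" using Suc by auto
    then show ?thesis using False Suc
      by (intro bexI[of _ "ht i * y"]) (auto simp: mult.assoc intro!: hsplit.mult hsplit.ht)
  qed
qed (auto intro!: bexI[of _ 1] hsplit_1)

lemma hl_hsplit_small: "i < p ==> i \<le> n ==> hl i \<in> hsplit p (Suc n)"
  by (induction i) (auto intro!: hsplit.mult hsplit.ht hsplit_1)

text \<open>Induction on q along the cosets \<open>hl i * sh h\<close>. For i < p the representative
  lies in the parabolic subalgebra; otherwise it factors through \<open>hl p\<close>, and the
  decomposition of \<open>h\<close> for the smaller q is pushed through \<open>hl p\<close>.\<close>

lemma hk_dcoset:
  fixes x :: "'k::comm_ring_1 hcl"
  shows "x \<in> hk n ==> p + q \<le> n ==> x \<in> dcoset p q n"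
proof (induction q arbitrary: n x)
  case 0
  then show ?case using dcoset.intros(1)[of 1 p n x 0] by (auto simp: hsplit_1 hk_hsplit)
next
  case (Suc q)
  then obtain m where n: "n = Suc m" by (cases n) auto
  have "x \<in> left_span m" using Suc n hk_left_span by auto
  then show ?case
  proof induction
    case (1 i h)
    show ?case
    proof (cases "i < p")
      case True
      then show ?thesis using dcoset.intros(2)[of "hl i" p n 1 "Suc q" h] 1 n
        by (auto simp: hl_hsplit_small hsplit_1)
    next
      case False
      then obtain y :: "'k hcl" where y: "y \<in> hsplit p n" "hl i = y * hl p" using hl_split 1 n by (meson not_less)
      show ?thesis
      proof (cases q)
        case 0
        have "y * (hv p 1 * sh h) \<in> dcoset p 1 n"
          by (rule dcoset.intros(1)[OF y(1)]) (use 1 n hk_sh_hsplit[of h m] in simp)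
        then show ?thesis using 0 y by (simp add: mult.assoc shift.hom_1)
      next
        case (Suc Q)
        have main: "hl p * sh g \<in> dcoset p (Suc q) n" if "g \<in> dcoset p q m" for g :: "'k hcl"
          using that
        proof induction
          case (1 x b)
          then obtain x' where x': "x' \<in> hsplit p n" "hl p * sh x = x' * hl p" using hl_hsplit n by blast
          have "hl p * sh (x * (hv p q * b)) = x' * (hv p (Suc q) * sh b)"
            by (simp add: shift.hom_mult mult.assoc[symmetric] x')
          then show ?case using dcoset.intros(1)[OF x'(1), of "sh b" "Suc q"] hsplit_sh[OF 1(2)] n by simp
        next
          case (2 x b y)
          then obtain x' where x': "x' \<in> hsplit p n" "hl p * sh x = x' * hl p" using hl_hsplit n by blast
          have eq: "hl p * sh (x * (sh y * b)) = x' * (hl p * (sh (sh y) * sh b))"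
            by (simp add: shift.hom_mult mult.assoc[symmetric] x')
          obtain l where l: "m = Suc l" using Suc Suc.prems n by (cases m) auto
          have y: "sh y \<in> hk m" using hk_sh[OF 2(3)] l by simp
          show ?case
          proof (cases p)
            case 0
            then show ?thesis unfolding eq using dcoset.intros(2)[OF x'(1), of "sh b" "Suc q" "sh y"] hsplit_sh[OF 2(2)] y n
              by auto
          next
            case (Suc P)
            \<comment> \<open>The last factor \<open>ht 0\<close> of \<open>hl p\<close> moves past
              the double shift into the right parabolic factor, which contains it because
              \<open>q > 0\<close>.\<close>
            have "x' * (hl p * (sh (sh y) * sh b)) = x' * (sh (hl P * sh y) * (ht 0 * sh b))"
              using Suc by (simp add: hl_Suc_right mult.assoc hs_sh2 shift.hom_mult del: hl.simps)
            moreover have "ht 0 * sh b \<in> hsplit (Suc q) n"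
              using \<open>q = Suc Q\<close> n hsplit_sh[OF 2(2)] Suc.prems l by (auto intro!: hsplit.mult hsplit.ht)
            moreover have "hl P * sh y \<in> hk m"
              using y Suc.prems Suc n by (auto intro!: hk.mult hk_mono[OF hl_hk(1)])
            ultimately show ?thesis unfolding eq using dcoset.intros(2)[OF x'(1)] n by simp
          qed
        next
          case (3 x y)
          then show ?case by (simp add: shift.hom_add distrib_left dcoset.intros)
        qed
        have "h \<in> dcoset p q m" using Suc.IH[of h m] 1 Suc.prems n by auto
        then have "y * (hl p * sh h) \<in> dcoset p (Suc q) n" using dcoset_left[OF main y(1)] by simp
        then show ?thesis using y by (simp add: mult.assoc)
      qed
    qed
  qed (rule dcoset.intros)
qed

text \<open>\<open>hU p q n\<close> is the span of what the algebra acting on \<open>p\<close> upward and \<open>q\<close> downward strands makes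
  out of \<open>hv p q\<close> and the commuting actions on the remaining strands.\<close>

inductive_set hU :: "nat => nat => nat => 'k::comm_ring_1 hcl set" for p q n where
  base: "l \<in> hk (n - p) ==> r \<in> hsub (n - q) ==> shn p l * (hv p q * shn q r) \<in> hU p q n"
| add: "x \<in> hU p q n ==> y \<in> hU p q n ==> x + y \<in> hU p q n"
| sc: "x \<in> hU p q n ==> sc a * x \<in> hU p q n"
| lt: "x \<in> hU p q n ==> Suc i < p ==> ht i * x \<in> hU p q n"
| lc: "x \<in> hU p q n ==> i < p ==> hc i * x \<in> hU p q n"
| rt: "x \<in> hU p q n ==> Suc i < q ==> x * ht i \<in> hU p q n"
| rc: "x \<in> hU p q n ==> i < q ==> x * hc i \<in> hU p q n"
| e: "x \<in> hU p q n ==> 0 < p ==> 0 < q ==> sh (hE x) \<in> hU p q n"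

lemma hk_shn_ht: "l \<in> hk m ==> Suc i < p ==> ht i * shn p l = shn p l * ht i"
proof (induction rule: hk.induct)
  case (mult x y)
  have 1: "ht i * shn p x = shn p x * ht i" and 2: "ht i * shn p y = shn p y * ht i" using mult by auto
  show ?case by (simp add: shn_hom(1) mult.assoc 2 comm_tail[OF 1])
qed (auto simp: shn_hom ht_far[of i] sc_comm distrib_left distrib_right)

lemma hk_shn_hc: "l \<in> hk m ==> i < p ==> hc i * shn p l = shn p l * hc i"
proof (induction rule: hk.induct)
  case (mult x y)
  have 1: "hc i * shn p x = shn p x * hc i" and 2: "hc i * shn p y = shn p y * hc i" using mult by auto
  show ?case by (simp add: shn_hom(1) mult.assoc 2 comm_tail[OF 1])
qed (auto simp: shn_hom ht_pass[of i] sc_comm distrib_left distrib_right)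

lemma hsub_shn_ht: "r \<in> hsub m ==> Suc i < q ==> shn q r * ht i = ht i * shn q r"
proof (induction rule: hsub.induct)
  case (mult x y)
  have 1: "shn q x * ht i = ht i * shn q x" and 2: "shn q y * ht i = ht i * shn q y" using mult by auto
  show ?case by (simp add: shn_hom(1) mult.assoc 2 comm_tail[OF 1])
next
  case (hs j)
  then show ?case by (simp add: shn_hom ht_def distrib_left distrib_right hs_far[of i] hgen_hz)
qed (auto simp: shn_hom ht_pass[of _ i] sc_comm distrib_left distrib_right)

lemma hsub_shn_hc: "r \<in> hsub m ==> i < q ==> shn q r * hc i = hc i * shn q (hat r)"
proof (induction rule: hsub.induct)
  case (mult x y)
  have 1: "shn q x * hc i = hc i * shn q (hat x)" and 2: "shn q y * hc i = hc i * shn q (hat y)"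
    using mult by auto
  show ?case by (simp add: parity.hom_mult shn_hom(1) mult.assoc 2 comm_tail[OF 1])
qed (auto simp: shn_hom parity.hom_simps hs_pass hc_anti sc_comm distrib_left distrib_right)

lemma hU_left_extra: "x \<in> hU p q n ==> l \<in> hk (n - p) ==> shn p l * x \<in> hU p q n"
proof (induction rule: hU.induct)
  case (base l' r)
  then show ?case using hU.base[OF hk.mult[of l "n - p" l'], of r] by (simp add: shn_hom(1) mult.assoc)
next
  case (e x)
  then obtain P where "p = Suc P" by (cases p) auto
  then have "shn p l * sh (hE x) = sh (hE (shn p l * x))"
    by (simp add: hE_left shift.hom_mult)
  then show ?case using e hU.e by metis
next
  case (sc x a)
  then show ?case unfolding sc_left_comm[of "shn p l"] by (intro hU.sc)
next
  case (lt x i)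
  show ?case unfolding comm_tail[OF hk_shn_ht[OF lt(4,2)], symmetric]
    by (intro hU.lt lt)
next
  case (lc x i)
  show ?case unfolding comm_tail[OF hk_shn_hc[OF lc(4,2)], symmetric]
    by (intro hU.lc lc)
qed (auto simp: distrib_left mult.assoc[symmetric] intro: hU.intros)

text \<open>The induction is over all \<open>r\<close> at once, since passing a dot replaces
  \<open>r\<close> by \<open>hat r\<close>.\<close>

lemma hU_right_extra: "x \<in> hU p q n ==> r \<in> hsub (n - q) ==> x * shn q r \<in> hU p q n"
proof (induction arbitrary: r rule: hU.induct)
  case (base l r')
  then show ?case using hU.base[OF base(1) hsub.mult[OF base(2,3)]] by (simp add: shn_hom(1) mult.assoc)
next
  case (e x)
  then obtain Q where "q = Suc Q" by (cases q) auto
  then have "sh (hE x) * shn q r = sh (hE (x * shn q r))"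
    by (simp add: hE_right shift.hom_mult)
  then show ?case using e hU.e by metis
next
  case (rt x i)
  show ?case using hU.rt[OF rt.IH[OF rt.prems] rt.hyps(2)]
    by (simp add: mult.assoc hsub_shn_ht[OF rt.prems rt.hyps(2)])
next
  case (rc x i)
  show ?case using hU.rc[OF rc.IH[OF hsub_hat[OF rc.prems]] rc.hyps(2)]
    by (simp add: mult.assoc hsub_shn_hc[OF hsub_hat[OF rc.prems] rc.hyps(2)])
qed (auto simp: distrib_right mult.assoc intro: hU.intros)

text \<open>Generators with index below p - 1 are operations of \<open>hU\<close>, those from p on
  are extra factors, and the one in between is absent from the parabolic subalgebra.\<close>

lemma hsplit_left_hU:
  "x \<in> hsplit p n ==> y \<in> hU p q n ==> x * y \<in> hU p q n"
proof (induction arbitrary: y rule: hsplit.induct)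
  case (ht i)
  show ?case
  proof (cases "Suc i < p")
    case True then show ?thesis using ht by (intro hU.lt) auto
  next
    case False
    then have "ht (i - p) \<in> hk (n - p)" "shn p (ht (i - p)) = ht i"
      using ht by (auto intro!: hk.ht simp: shn_hom)
    then show ?thesis using hU_left_extra[OF ht(3)] by metis
  qed
qed (auto simp: distrib_right mult.assoc intro: hU.intros)

lemma hsplit_right_hU:
  "x \<in> hsplit q n ==> y \<in> hU p q n ==> y * x \<in> hU p q n"
proof (induction arbitrary: y rule: hsplit.induct)
  case (ht i)
  show ?case
  proof (cases "Suc i < q")
    case True then show ?thesis using ht by (intro hU.rt) auto
  next
    case False
    then have "ht (i - q) \<in> hsub (n - q)" "shn q (ht (i - q)) = ht i"
      using ht by (auto intro!: hsub_ht simp: shn_hom)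
    then show ?thesis using hU_right_extra[OF ht(3)] by metis
  qed
qed (auto simp: distrib_left mult.assoc[symmetric] sc_comm intro: hU.intros)

lemma hv_hU: "hv p q \<in> hU p q n"
  using hU.base[OF hk_1 hsub_1, of p q n] by (simp add: shn_hom)

lemma hU_hc: "x \<in> hU p q n ==> i < n ==> x * hc i \<in> hU p q n"
proof (cases "i < q")
  case False
  assume "x \<in> hU p q n" "i < n"
  moreover from this have "hc (i - q) \<in> hsub (n - q)" using False by (intro hsub.hc) auto
  ultimately show ?thesis using hU_right_extra[of x p q n "hc (i - q)"] False
    by (auto simp: shn_hom)
qed (rule hU.rc)

lemma hv_0: "hv 0 q = 1"
  by (induction q) (simp_all add: shift.hom_1)

text \<open>One more strand on both sides makes the operation \<open>e\<close> available, and
  \<open>sh\<close> is the second half of it: shifted elements are obtained by exhibiting them as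
  values of \<open>sh\<close> after \<open>hE\<close>.\<close>

lemma sh_hU:
  fixes y :: "'k::comm_ring_1 hcl"
  assumes "y \<in> hU p q n" "Suc p + Suc q \<le> Suc n"
  shows "sh y \<in> hU (Suc p) (Suc q) (Suc n)"
  using assms(1)
proof induction
  case (base l r)
  \<comment> \<open>\<open>hai q\<close> and \<open>hli p\<close> cancel the factors
    \<open>ha q\<close> and \<open>hl p\<close> that \<open>hE_hv\<close> produces.\<close>
  have "hai q \<in> (hk (n - p) :: 'k hcl set)"
    by (rule hk_mono[OF ha_hk(2)]) (use assms(2) in simp)
  moreover have "hli p \<in> (hsub (n - q) :: 'k hcl set)"
    by (rule hk_hsub, rule hk_mono[OF hl_hk(2)]) (use assms(2) in simp)
  ultimately have "shn (Suc p) (l * hai q) * (hv (Suc p) (Suc q) * shn (Suc q) (hli p * r)) \<in> hU (Suc p) (Suc q) (Suc n)"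
    (is "?u \<in> _")
    using base by (intro hU.base) (auto intro: hk.mult hsub.mult)
  then have "sh (hE ?u) \<in> hU (Suc p) (Suc q) (Suc n)" by (intro hU.e) auto
  moreover have "hE ?u = shn p (l * hai q) * ((shn p (ha q) * (hv p q * shn q (hl p))) * shn q (hli p * r))"
    by (simp only: shn_hom(11) hE_left hE_right hE_hv)
  moreover have "\<dots> = shn p (l * (hai q * ha q)) * (hv p q * shn q (hl p * (hli p * r)))"
    by (simp only: shn_hom(1) mult.assoc)
  ultimately show ?case by (simp only: hai_ha hli_hl mult_1_right)
next
  case (e x)
  then obtain P Q where "p = Suc P" "q = Suc Q" by (cases p; cases q) auto
  \<comment> \<open>By \<open>hE_conj\<close> the element \<open>sh (sh (hE x))\<close> arises from
    \<open>e\<close> applied to the conjugate of \<open>sh x\<close> by the crossing, which is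
    available on p + 1 and q + 1 strands.\<close>
  have "hs 0 * sh x = ht 0 * sh x + sc (- zeta) * sh x"
    by (simp add: ht_def distrib_right hz_def sc_uminus)
  then have "hs 0 * sh x \<in> hU (Suc p) (Suc q) (Suc n)"
    using e hU.lt[OF e.IH, of 0] hU.sc[OF e.IH] by (simp add: hU.add)
  then have "hs 0 * sh x * ht 0 \<in> hU (Suc p) (Suc q) (Suc n)"
    by (rule hU.rt) (use e in simp)
  then have "sh (hE (hs 0 * sh x * ht 0)) \<in> hU (Suc p) (Suc q) (Suc n)"
    by (rule hU.e) auto
  then show ?case by (simp add: mult.assoc hE_conj)
next
  case (lt x i)
  then show ?case using hU.lt[OF lt.IH, of "Suc i"] by (simp add: shift.hom_mult)
next
  case (lc x i)
  then show ?case using hU.lc[OF lc.IH, of "Suc i"] by (simp add: shift.hom_mult)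
next
  case (rt x i)
  then show ?case using hU.rt[OF rt.IH, of "Suc i"] by (simp add: shift.hom_mult)
next
  case (rc x i)
  then show ?case using hU.rc[OF rc.IH, of "Suc i"] by (simp add: shift.hom_mult)
qed (auto simp: shift.hom_simps intro: hU.intros)

text \<open>Double cosets with a representative in the shifted subalgebra reduce to p - 1 and q - 1
  by \<open>sh_hU\<close>; the remaining one is that of \<open>hv p q\<close>.\<close>

lemma hU_hk: "x \<in> hk n ==> p + q \<le> n ==> x \<in> hU p q n"
proof (induction p arbitrary: q n x)
  case 0
  then show ?case using hU.base[of x n 0 1 q] by (auto simp: hv_0 hsub_1 shn_hom(3))
next
  case (Suc p)
  show ?case
  proof (cases q)
    case 0
    have "shn (Suc p) 1 * (hv (Suc p) 0 * shn 0 x) \<in> hU (Suc p) 0 n"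
      by (rule hU.base[OF hk_1]) (use Suc.prems hk_hsub in simp)
    then show ?thesis using 0 by (simp add: shn_hom(3) shift.hom_1)
  next
    case (Suc Q)
    obtain m where n: "n = Suc m" using Suc.prems by (cases n) auto
    have "x \<in> dcoset (Suc p) q n" using hk_dcoset Suc.prems by blast
    then show ?thesis
    proof induction
      case (1 a b)
      then show ?case using hsplit_left_hU hsplit_right_hU hv_hU by blast
    next
      case (2 a b y)
      have "sh y \<in> hU (Suc p) q n" unfolding n Suc
        by (rule sh_hU, rule Suc.IH) (use 2 Suc.prems n Suc in auto)
      then show ?case using 2 hsplit_left_hU hsplit_right_hU by blast
    qed (rule hU.add)
  qed
qed

text \<open>The dots stand on the right because \<open>hU\<close> is stable under right
  multiplication by all \<open>hc i\<close> with i < n (\<open>hU_hc\<close>).\<close>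

inductive_set hkc :: "nat => 'k::comm_ring_1 hcl set" for n where
  "x \<in> hk n ==> x \<in> hkc n"
| "x \<in> hkc n ==> i < n ==> x * hc i \<in> hkc n"
| "x \<in> hkc n ==> y \<in> hkc n ==> x + y \<in> hkc n"
| "x \<in> hkc n ==> sc a * x \<in> hkc n"

lemma ht_hc_swap: "hc (Suc i) * ht i = ht i * hc i + hz * hc (Suc i) - hz * hc i"
  by (simp add: ht_def algebra_simps hs_slide hgen_hz)

lemma hkc_ht:
  fixes x :: "'k::comm_ring_1 hcl"
  shows "x \<in> hkc n ==> Suc i < n ==> x * ht i \<in> hkc n"
proof (induction rule: hkc.induct)
  case (2 x j)
  note I = hkc.intros
  consider "j = i" | "j = Suc i" | "j \<noteq> i" "j \<noteq> Suc i" by blast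
  then show ?case
  proof cases
    case 1
    then show ?thesis using I(2)[OF 2(3)[OF 2(4)], of "Suc i"] 2(4) by (simp add: mult.assoc ht_slide)
  next
    case 2
    have "x * hc j * ht i = x * ht i * hc i + hz * (x * hc (Suc i)) + sc (- zeta) * (x * hc i)"
      using 2 by (simp add: mult.assoc ht_hc_swap algebra_simps hz_left_comm hz_def[symmetric] sc_uminus)
    also have "\<dots> \<in> hkc n" unfolding hz_def
      by (intro I(2) I(3) I(4)) (use \<open>x \<in> hkc n\<close> \<open>Suc i < n ==> x * ht i \<in> hkc n\<close> \<open>Suc i < n\<close> in auto)
    finally show ?thesis .
  next
    case 3
    then show ?thesis using I(2)[OF 2(3)[OF 2(4)] 2(2)] by (simp add: mult.assoc ht_pass[of j i])
  qed
qed (auto simp: distrib_right mult.assoc intro: hkc.intros hk.intros)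

lemma hsub_hkc: "x \<in> hsub n ==> x \<in> hkc n"
proof -
  assume "x \<in> hsub n"
  then have "y \<in> hkc n ==> y * x \<in> hkc n" for y
  proof (induction arbitrary: y rule: hsub.induct)
    case (hs i)
    have "y * hs i = y * ht i + sc (- zeta) * y"
      by (simp add: ht_def distrib_left hz_def sc_uminus sc_comm)
    then show ?case using hs hkc_ht by (auto intro: hkc.intros)
  qed (auto simp: distrib_left mult.assoc[symmetric] sc_comm intro: hkc.intros)
  from this[OF hkc.intros(1)[OF hk_1]] show ?thesis by simp
qed

lemma hsub_hU:
  assumes "x \<in> hsub n" "p + q \<le> n" shows "x \<in> hU p q n"
  using hsub_hkc[OF assms(1)]
  by induction (auto intro: hU_hk hU_hc hU.intros assms(2))

section \<open>The orbit of the vacuum under the walled algebra\<close>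

text \<open>Negates every odd generator, which applies \<open>hat\<close> to the value on the
  vacuum. As \<open>BPs\<close> acts through \<open>hat\<close>, stability under \<open>hat\<close>
  is what makes plain right multiplication by dots preserve the orbit.\<close>

fun twist :: "'k::comm_ring_1 bcterm => 'k bcterm" where
  "twist (AGen g) = (if bcpar g = 1 then (- 1) *\<^sub>a AGen g else AGen g)"
| "twist AOne = AOne"
| "twist AZero = AZero"
| "twist (x \<cdot> y) = twist x \<cdot> twist y"
| "twist (x \<boxplus> y) = twist x \<boxplus> twist y"
| "twist (c *\<^sub>a x) = c *\<^sub>a twist x"

lemma twist_aterms: "x \<in> aterms G ==> twist x \<in> aterms G"
  by (induction x) auto

lemma bcact_twist: "bcact r (twist x) (hat m) = hat (bcact r x m)"
proof (induction x arbitrary: m)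
  case (AGen g)
  show ?case
    by (cases g) (simp_all add: parity.hom_simps ksc_simps hat_sh hE_hat)
qed (simp_all add: parity.hom_simps)

definition vacuum :: "nat => nat => 'k => 'k::comm_ring_1 hcl"
  where "vacuum r s z = heps z * hv r s"

lemma vacuum_corner: "vacuum r s z \<in> corner z"
  unfolding vacuum_def by (rule corner_closed[OF corner_eps])

lemma vacuum_hat: "hat (vacuum r s z) = vacuum r s z"
  by (simp add: vacuum_def parity.hom_simps hk_hat[OF hv_hk] heps_def)

definition orbit :: "nat => nat => 'k => 'k::comm_ring_1 hcl set"
  where "orbit r s z = {y. \<exists>x \<in> bcterms r s. y = bcact r x (vacuum r s z)}"

lemma orbitI: "x \<in> bcterms r s ==> bcact r x (vacuum r s z) \<in> orbit r s z"
  by (auto simp: orbit_def)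

lemma orbit_vacuum: "vacuum r s z \<in> orbit r s z"
  using orbitI[of AOne r s z] by simp

lemma orbit_gen: "y \<in> orbit r s z ==> g \<in> bcgens r s ==> bcop r g y \<in> orbit r s z"
  unfolding orbit_def by (auto intro!: bexI[of _ "AGen g \<cdot> _"])

lemma orbit_add: "x \<in> orbit r s z ==> y \<in> orbit r s z ==> x + y \<in> orbit r s z"
  unfolding orbit_def by (auto intro!: bexI[of _ "_ \<boxplus> _"])

lemma orbit_ksc: "x \<in> orbit r s z ==> ksc c * x \<in> orbit r s z"
  unfolding orbit_def by (auto intro!: bexI[of _ "c *\<^sub>a _"])

lemma orbit_corner: "x \<in> orbit r s z ==> x \<in> corner z"
  unfolding orbit_def by (auto intro: bcact_corner vacuum_corner)

lemma orbit_hat: "x \<in> orbit r s z ==> hat x \<in> orbit r s z"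
  unfolding orbit_def
  by (auto intro!: bexI[of _ "twist _"] simp: twist_aterms bcact_twist[symmetric] vacuum_hat)

text \<open>Multiplied with the indicator function of z, a function becomes a constant multiple of
  it; hence the orbit, closed under constants, is closed under functions.\<close>

lemma corner_sc: "x \<in> corner z ==> sc a * x = ksc (a z) * x"
proof -
  assume x: "x \<in> corner z"
  have "a * (\<lambda>w. if w = z then 1 else 0) = (\<lambda>_. a z) * (\<lambda>w. if w = z then 1 else 0)" by auto
  then have "sc a * (heps z * x) = ksc (a z) * (heps z * x)"
    by (simp add: heps_def sc_times[symmetric] mult.assoc[symmetric])
  then show ?thesis using x by (simp add: corner_def)
qed

lemma orbit_sc: "x \<in> orbit r s z ==> sc a * x \<in> orbit r s z"
  using orbit_ksc[of x r s z "a z"] corner_sc[OF orbit_corner, of x r s z a] by argo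

lemma orbit_left:
  "x \<in> orbit r s z ==> Suc i < r ==> ht i * x \<in> orbit r s z"
  "x \<in> orbit r s z ==> i < r ==> hc i * x \<in> orbit r s z"
  using orbit_gen[of x r s z "BT (r - 1 - i)"] orbit_gen[of x r s z "BP (r - i)"] by auto

lemma orbit_right:
  "x \<in> orbit r s z ==> Suc i < s ==> x * ht i \<in> orbit r s z"
  "x \<in> orbit r s z ==> i < s ==> x * hc i \<in> orbit r s z"
  using orbit_gen[of x r s z "BTs (Suc i)"] orbit_gen[OF orbit_hat, of x r s z "BPs (Suc i)"] by auto

lemma orbit_e: "x \<in> orbit r s z ==> 0 < r ==> 0 < s ==> sh (hE x) \<in> orbit r s z"
  using orbit_gen[of x r s z BE] by auto

lemma orbit_left_hsub: "h \<in> hsub r ==> x \<in> orbit r s z ==> h * x \<in> orbit r s z"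
proof (induction arbitrary: x rule: hsub.induct)
  case (hs i)
  have "hs i * x = ht i * x + sc (- zeta) * x"
    by (simp add: ht_def distrib_right hz_def sc_uminus)
  also have "\<dots> \<in> orbit r s z" using hs by (intro orbit_add orbit_left orbit_sc) auto
  finally show ?case .
qed (auto simp: distrib_right mult.assoc intro: orbit_add orbit_left orbit_sc)

lemma orbit_right_hk: "h \<in> hk s ==> x \<in> orbit r s z ==> x * h \<in> orbit r s z"
  by (induction arbitrary: x rule: hk.induct)
    (auto simp: distrib_left mult.assoc[symmetric] sc_comm intro: orbit_add orbit_right orbit_sc)

text \<open>A positive crossing lets dots slide freely along one of its two strands only: the block
  crossing transports the whole subalgebra on one block, while for the other block
  \<open>hv_hk_extra\<close> treats Hecke elements.\<close>

lemma hv_hsub: "x \<in> hsub p ==> hv p q * shn q x = x * hv p q"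
proof (induction rule: hsub.induct)
  case (mult x y)
  show ?case by (simp only: shn_hom(1) mult.assoc[symmetric] mult(3)) (simp only: mult.assoc mult(4))
next
  case (hs i)
  then have "hs i * hv p q = hv p q * (hs (i + q) :: 'a hcl)" using hv_ht[of i p q]
    by (simp add: add.commute[of q] ht_def distrib_left distrib_right hz_comm[of "hv p q"])
  then show ?case
    by (simp add: shn_hom)
qed (simp_all add: shn_hom hv_hc add.commute sc_comm distrib_left distrib_right)

lemma hv_hk_extra: "x \<in> hk q ==> shn p x * hv p q = hv p q * x"
proof (induction rule: hk.induct)
  case (mult x y)
  show ?case by (simp only: shn_hom(1) mult.assoc mult(4)) (simp only: mult.assoc[symmetric] mult(3))
next
  case (ht i)
  then show ?case using hv_ht_extra[of i q p] by (simp add: shn_hom add.commute)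
qed (simp_all add: shn_hom sc_comm distrib_left distrib_right)

lemma hk_hsub_commute: "l \<in> hk q ==> x \<in> hsub m ==> l * shn q x = shn q x * l"
proof (induction rule: hk.induct)
  case (mult a b)
  show ?case by (simp only: mult.assoc mult) (simp only: mult.assoc[symmetric] mult)
qed (simp_all add: hsub_shn_ht sc_comm distrib_left distrib_right)

lemma hU_orbit: "x \<in> hU r s (r + s) ==> heps z * x \<in> orbit r s z"
proof (induction rule: hU.induct)
  case (base l x)
  then have l: "l \<in> hk s" and x: "x \<in> hsub r" by auto
  \<comment> \<open>With n = r + s the extra factors slide through the block crossing and become
    actions of the downward and the upward strands.\<close>
  have "shn r l * (hv r s * shn s x) = hv r s * (l * shn s x)"
    by (simp add: hv_hk_extra[OF l] mult.assoc[symmetric])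
  also have "\<dots> = x * hv r s * l"
    by (simp add: hk_hsub_commute[OF l x] hv_hsub[OF x] mult.assoc[symmetric])
  finally have "heps z * (shn r l * (hv r s * shn s x)) = x * vacuum r s z * l"
    by (simp add: vacuum_def mult.assoc heps_def sc_left_comm[of x])
  also have "\<dots> \<in> orbit r s z"
    by (intro orbit_right_hk[OF l] orbit_left_hsub[OF x] orbit_vacuum)
  finally show ?case .
next
  case (sc x a)
  have "heps z * (sc a * x) = sc a * (heps z * x)" by (rule sc_left_comm)
  then show ?case using orbit_sc sc by simp
next
  case (lt x i)
  have "heps z * (ht i * x) = ht i * (heps z * x)" unfolding heps_def by (rule sc_left_comm[symmetric])
  then show ?case using orbit_left lt by simp
next
  case (lc x i)
  have "heps z * (hc i * x) = hc i * (heps z * x)" unfolding heps_def by (rule sc_left_comm[symmetric])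
  then show ?case using orbit_left lc by simp
next
  case (e x)
  have "heps z * sh (hE x) = sh (hE (heps z * x))"
    by (simp add: heps_def hE_simps shift.hom_simps)
  then show ?case using orbit_e e by simp
qed (auto simp: distrib_left mult.assoc[symmetric] intro: orbit_add orbit_right)

lemma hsub_orbit: "x \<in> hsub (r + s) ==> heps z * x \<in> orbit r s z"
  by (rule hU_orbit[OF hsub_hU]) auto

section \<open>Spanning sets of the walled algebra\<close>

text \<open>\<open>sm 1\<close> is not the identity in general: in the ring of sections used below
  it projects to one triple of parameters. Submodules in the sense of \<open>sub\<close> consist of
  vectors fixed by it.\<close>

locale kmod =
  fixes sm :: "'k::comm_ring_1 => 'a::ab_group_add => 'a"
  assumes sm_add: "sm c (x + y) = sm c x + sm c y"
    and add_sm: "sm (c + d) x = sm c x + sm d x"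
    and sm_sm: "sm c (sm d x) = sm (c * d) x"
begin

lemma sm_0: "sm c 0 = 0" "sm 0 x = 0"
  using sm_add[of c 0 0] add_sm[of 0 0 x] by simp_all

lemma sm_minus: "sm (- c) x = - sm c x"
  using add_sm[of "- c" c x] by (simp add: sm_0 eq_neg_iff_add_eq_0)

definition lin :: "('a => 'a) => bool"
  where "lin f \<longleftrightarrow> (\<forall>x y. f (x + y) = f x + f y) \<and> (\<forall>c x. f (sm c x) = sm c (f x))"

lemma linD: "lin f ==> f (x + y) = f x + f y" "lin f ==> f (sm c x) = sm c (f x)"
  by (simp_all add: lin_def)

lemma lin_0: "lin f ==> f 0 = 0"
  using linD(1)[of f 0 0] by simp

lemma lin_comp: "lin f ==> lin g ==> lin (\<lambda>x. f (g x))"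
  by (simp add: lin_def)

lemma lin_id: "lin (\<lambda>x. x)"
  by (simp add: lin_def)

definition sub :: "'a set => bool"
  where "sub V \<longleftrightarrow> 0 \<in> V \<and> (\<forall>x\<in>V. \<forall>y\<in>V. x + y \<in> V) \<and> (\<forall>c. \<forall>x\<in>V. sm c x \<in> V) \<and> (\<forall>x\<in>V. sm 1 x = x)"

lemma subD: "sub V ==> 0 \<in> V" "sub V ==> x \<in> V ==> y \<in> V ==> x + y \<in> V"
  "sub V ==> x \<in> V ==> sm c x \<in> V" "sub V ==> x \<in> V ==> sm 1 x = x"
  by (auto simp: sub_def)

lemma sub_uminus: "sub V ==> x \<in> V ==> - x \<in> V"
  using subD(3)[of V x "- 1"] subD(4)[of V x] by (simp add: sm_minus)

lemma sub_diff: "sub V ==> x \<in> V ==> y \<in> V ==> x - y \<in> V"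
  using subD(2)[of V x "- y"] sub_uminus[of V y] by simp

lemma sub_image: "lin f ==> sub V ==> sub (f ` V)"
proof -
  assume f: "lin f" and V: "sub V"
  have "0 \<in> f ` V" using lin_0[OF f] subD(1)[OF V] by force
  then show ?thesis using V unfolding sub_def by (auto simp: linD[OF f, symmetric])
qed

definition splus :: "'a set => 'a set => 'a set"  (infixl \<open>\<oplus>\<^sub>s\<close> 65)
  where "V \<oplus>\<^sub>s W = {x + y | x y. x \<in> V \<and> y \<in> W}"

lemma splusI: "x \<in> V ==> y \<in> W ==> x + y \<in> V \<oplus>\<^sub>s W"
  by (auto simp: splus_def)

lemma splusE: "w \<in> V \<oplus>\<^sub>s W ==> (\<And>x y. x \<in> V ==> y \<in> W ==> w = x + y ==> P) ==> P"
  by (auto simp: splus_def)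

lemma splusD: "w \<in> V \<oplus>\<^sub>s W ==> \<exists>x y. x \<in> V \<and> y \<in> W \<and> w = x + y"
  by (auto simp: splus_def)

lemma sub_splus: "sub V ==> sub W ==> sub (V \<oplus>\<^sub>s W)"
  unfolding sub_def
proof (safe, goal_cases)
  case 1 then show ?case using splusI[of 0 V 0 W] by simp
next
  case (2 x y)
  from 2(9) obtain a b where "a \<in> V" "b \<in> W" "x = a + b" by (rule splusE)
  moreover from 2(10) obtain a' b' where "a' \<in> V" "b' \<in> W" "y = a' + b'" by (rule splusE)
  ultimately show ?case using 2 splusI[of "a + a'" V "b + b'" W] by (simp add: ac_simps)
next
  case (3 c x)
  from 3(9) obtain a b where "a \<in> V" "b \<in> W" "x = a + b" by (rule splusE)
  then show ?case using 3 splusI[of "sm c a" V "sm c b" W] by (simp add: sm_add)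
next
  case (4 x)
  then show ?case by (auto elim!: splusE simp: sm_add)
qed

lemma splus_left: "sub W ==> x \<in> V ==> x \<in> V \<oplus>\<^sub>s W"
  using splusI[of x V 0 W] subD(1)[of W] by simp

lemma splus_right: "sub V ==> x \<in> W ==> x \<in> V \<oplus>\<^sub>s W"
  using splusI[of 0 V x W] subD(1)[of V] by simp

text \<open>Closure under scalars is inherited from \<open>V\<close> when the operators are linear,
  see \<open>sub_clo\<close>.\<close>

inductive_set clo :: "('a => 'a) set => 'a set => 'a set" for F V where
  base: "x \<in> V ==> x \<in> clo F V"
| add: "x \<in> clo F V ==> y \<in> clo F V ==> x + y \<in> clo F V"
| op: "x \<in> clo F V ==> f \<in> F ==> f x \<in> clo F V"

lemma clo_least:
  assumes "sub W" "V \<subseteq> W" "\<And>f x. f \<in> F ==> x \<in> W ==> f x \<in> W"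
  shows "clo F V \<subseteq> W"
proof
  fix x assume "x \<in> clo F V"
  then show "x \<in> W" by induction (use assms(2,3) in \<open>auto intro: subD(2)[OF assms(1)]\<close>)
qed

lemma sub_clo: "sub V ==> (\<And>f. f \<in> F ==> lin f) ==> sub (clo F V)"
proof -
  assume V: "sub V" and F: "\<And>f. f \<in> F ==> lin f"
  have "sm c x \<in> clo F V" if "x \<in> clo F V" for c x
    using that
  proof induction
    case (op x f)
    then show ?case using clo.op[of "sm c x" F V f] linD(2)[OF F[OF op(2)], of c x] by simp
  qed (auto simp: sm_add intro: clo.add clo.base subD(3)[OF V])
  moreover have "sm 1 x = x" if "x \<in> clo F V" for x
    using that by induction (auto simp: sm_add linD[OF F, symmetric] subD(4)[OF V])
  ultimately show ?thesis using clo.base[OF subD(1)[OF V]] clo.add unfolding sub_def[of "clo F V"] by blast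
qed

lemma clo_mono: "x \<in> clo F V ==> V \<subseteq> W ==> F \<subseteq> G ==> x \<in> clo G W"
proof (induction rule: clo.induct)
  case (op x f)
  then show ?case using clo.op[of x G W f] by blast
qed (auto intro: clo.add clo.base)

lemma clo_image:
  assumes "lin g" "\<And>f x. f \<in> F ==> g (f x) = f (g x)" "x \<in> clo F V"
  shows "g x \<in> clo F (g ` V)"
  using assms(3)
proof induction
  case (op x f)
  then show ?case using clo.op[of "g x" F "g ` V" f] assms(2) by simp
qed (auto simp: linD(1)[OF assms(1)] intro: clo.add clo.base)

definition lspan :: "'a list => 'a set"
  where "lspan xs = {\<Sum>i<length xs. sm (c i) (xs ! i) | c. True}"

text \<open>The spanning list may lie outside \<open>V\<close>, so that a bound passes to every
  subset.\<close>

definition fsp :: "nat => 'a set => bool"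
  where "fsp N V \<longleftrightarrow> (\<exists>xs. length xs = N \<and> V \<subseteq> lspan xs)"

lemma fsp_subset: "fsp N V ==> W \<subseteq> V ==> fsp N W"
  by (auto simp: fsp_def)

lemma lspan_image: "lin f ==> x \<in> lspan xs ==> f x \<in> lspan (map f xs)"
proof -
  assume f: "lin f" and "x \<in> lspan xs"
  then obtain c where x: "x = (\<Sum>i<length xs. sm (c i) (xs ! i))" by (auto simp: lspan_def)
  have "f (\<Sum>i\<in>I. g i) = (\<Sum>i\<in>I. f (g i))" for I :: "nat set" and g
    by (induction I rule: infinite_finite_induct) (simp_all add: f linD lin_0)
  then show ?thesis by (auto simp: x lspan_def linD[OF f] intro!: exI[of _ c])
qed

lemma fsp_image: "lin f ==> fsp N V ==> fsp N (f ` V)"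
  unfolding fsp_def
proof (elim exE conjE)
  fix xs assume f: "lin f" and xs: "length xs = N" "V \<subseteq> lspan xs"
  show "\<exists>xs. length xs = N \<and> f ` V \<subseteq> lspan xs"
    by (rule exI[of _ "map f xs"]) (use xs lspan_image[OF f] in auto)
qed

lemma sum_add_split: "(\<Sum>i<M + (N :: nat). f i :: 'a) = (\<Sum>i<M. f i) + (\<Sum>i<N. f (M + i))"
  by (induction N) (simp_all add: add.assoc)

lemma fsp_splus: "fsp M V ==> fsp N W ==> fsp (M + N) (V \<oplus>\<^sub>s W)"
proof -
  assume "fsp M V" "fsp N W"
  then obtain xs ys where xs: "length xs = M" "V \<subseteq> lspan xs" and ys: "length ys = N" "W \<subseteq> lspan ys"
    by (auto simp: fsp_def)
  have "x + y \<in> lspan (xs @ ys)" if "x \<in> V" "y \<in> W" for x y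
  proof -
    obtain c d where c: "x = (\<Sum>i<M. sm (c i) (xs ! i))" "y = (\<Sum>i<N. sm (d i) (ys ! i))"
      using xs ys \<open>x \<in> V\<close> \<open>y \<in> W\<close> unfolding lspan_def by blast
    have "(\<Sum>i<M + N. sm (if i < M then c i else d (i - M)) ((xs @ ys) ! i)) = x + y"
      unfolding c sum_add_split by (simp add: nth_append xs(1))
    then show ?thesis using xs ys by (auto simp: lspan_def intro!: exI[of _ "\<lambda>i. if i < M then c i else d (i - M)"])
  qed
  then show ?thesis unfolding fsp_def using xs ys by (intro exI[of _ "xs @ ys"]) (auto elim!: splusE)
qed

end

section \<open>Closure under Hecke operators\<close>

text \<open>Operators rather than elements, because left and right multiplication in the walled
  algebra both become instances.\<close>

locale hecke_ops = kmod +
  fixes T :: "nat => 'b => 'b" and n :: nat and w :: 'a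
  assumes lin_T: "i < n ==> lin (T i)"
    and T_sq: "i < n ==> sm 1 x = x ==> T i (T i x) = sm w (T i x) + x"
    and T_braid: "Suc i < n ==> T i (T (Suc i) (T i x)) = T (Suc i) (T i (T (Suc i) x))"
    and T_far: "Suc i < j ==> j < n ==> T i (T j x) = T j (T i x)"
begin

abbreviation U :: "nat => 'b set => 'b set" where "U a \<equiv> clo (T ` {a..<n})"

primrec sT :: "nat => nat => 'b => 'b" where
  "sT a 0 x = x"
| "sT a (Suc p) x = T a (sT (Suc a) p x)"

lemma lin_sT: "a + p \<le> n ==> lin (sT a p)"
proof (induction p arbitrary: a)
  case (Suc p)
  then show ?case using lin_comp[OF lin_T[of a] Suc.IH[of "Suc a"]] by simp
qed (simp add: lin_def)

lemma sT_far: "a + p < j ==> j < n ==> T j (sT a p x) = sT a p (T j x)"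
proof (induction p arbitrary: a)
  case (Suc p)
  then show ?case using T_far[of a j "sT (Suc a) p x"] by simp
qed simp

lemma sT_far': "Suc i < a ==> a + p \<le> n ==> T i (sT a p x) = sT a p (T i x)"
proof (induction p arbitrary: a)
  case (Suc p)
  then show ?case using T_far[of i a "sT (Suc a) p x"] by simp
qed simp

lemma sT_slide: "a \<le> i ==> Suc i < a + p ==> a + p \<le> n ==> T (Suc i) (sT a p x) = sT a p (T i x)"
proof (induction p arbitrary: a)
  case (Suc p)
  show ?case
  proof (cases "a = i")
    case True
    then obtain q where q: "p = Suc q" using Suc.prems by (cases p) auto
    show ?thesis using True Suc.prems T_braid[of a "sT (Suc (Suc a)) q x"]
        sT_far'[of a "Suc (Suc a)" q x] by (simp add: q)
  next
    case False
    then show ?thesis using Suc.IH[of "Suc a"] Suc.prems T_far[of a "Suc i" "sT (Suc a) p x"] by simp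
  qed
qed simp

lemma sT_sT: "a + p < n ==> sT a (Suc p) (sT a p x) = sT (Suc a) p (sT a (Suc p) x)"
proof -
  have "sT (Suc b) m (sT a (Suc p) x) = sT a (Suc p) (sT b m x)" if "a \<le> b" "b + m \<le> a + p" "a + p < n" for b m
    using that
  proof (induction m arbitrary: b)
    case (Suc m)
    then show ?case using sT_slide[of a b "Suc p" "sT (Suc b) m x"] by simp
  qed simp
  from this[of a p] show "a + p < n ==> ?thesis" by simp
qed

lemma sT_last: "sT a (Suc p) x = sT a p (T (a + p) x)"
  by (induction p arbitrary: a) simp_all

lemma sub_U: "sub V ==> sub (U a V)"
  using lin_T by (intro sub_clo) auto

lemma U_T: "x \<in> U a V ==> a \<le> i ==> i < n ==> T i x \<in> U a V"
  using clo.op[of x _ _ "T i"] by auto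

lemma U_trivial:
  assumes "sub V" "\<And>i x. a \<le> i ==> i < n ==> x \<in> V ==> T i x \<in> V"
  shows "U a V = V"
proof
  show "U a V \<subseteq> V" by (rule clo_least) (use assms in auto)
qed (auto intro: clo.base)

lemma U_comm: "x \<in> U (Suc (Suc a)) V ==> a < n ==> T a x \<in> U (Suc (Suc a)) (T a ` V)"
  by (rule clo_image) (auto simp: lin_T T_far)

text \<open>The cosets of the parabolic subgroup correspond to the p-subsets of n - a + 1 positions,
  and the two summands are the two cases of Pascal's rule for the first position.
  \<open>sT a p\<close> brings a strand of the second block to the front; the image of
  \<open>V\<close> under it is stable under the generators above a other than
  \<open>T (a + p)\<close>.\<close>

lemma U_structure:
  assumes "sub V" "\<And>i x. a \<le> i ==> i < n ==> Suc i \<noteq> a + p ==> x \<in> V ==> T i x \<in> V"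
    and "0 < p" "a + p \<le> n"
  shows "U a V \<subseteq> U (Suc a) V \<oplus>\<^sub>s U (Suc a) (sT a p ` V)"
  using assms
proof (induction "n - a" arbitrary: a p V)
  case 0
  then show ?case by simp
next
  case (Suc m)
  let ?V1 = "U (Suc a) V" and ?V2 = "U (Suc a) (sT a p ` V)"
  let ?W = "?V1 \<oplus>\<^sub>s ?V2"
  note sV = \<open>sub V\<close>
  have sV2: "sub (sT a p ` V)" using lin_sT Suc.prems by (intro sub_image) auto
  have s1: "sub ?V1" and s2: "sub ?V2" by (intro sub_U sV sV2)+
  have W: "sub ?W" using s1 s2 by (rule sub_splus)
  have I1: "x \<in> ?V1 ==> x \<in> ?W" and I2: "x \<in> ?V2 ==> x \<in> ?W" for x
    using s1 s2 by (auto intro: splus_left splus_right)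
  obtain q where p: "p = Suc q" using \<open>0 < p\<close> by (cases p) auto
  have an: "a < n" using Suc by linarith
  have mono: "x \<in> U (Suc (Suc a)) B ==> B \<subseteq> ?W ==> x \<in> ?W" for x B
  proof -
    assume "B \<subseteq> ?W" "x \<in> U (Suc (Suc a)) B"
    moreover have "U (Suc (Suc a)) B \<subseteq> ?W"
    proof (rule clo_least[OF W \<open>B \<subseteq> ?W\<close>])
      fix f x assume "f \<in> T ` {Suc (Suc a)..<n}" and x: "x \<in> ?W"
      then obtain i where i: "f = T i" "Suc (Suc a) \<le> i" "i < n" by auto
      obtain y w where yw: "y \<in> ?V1" "w \<in> ?V2" "x = y + w" using splusD[OF x] by blast
      have "T i y \<in> ?V1" "T i w \<in> ?V2" using i yw by (auto intro: U_T)
      then show "f x \<in> ?W" using splusI[of "T i y" ?V1 "T i w" ?V2] i(1) yw(3) linD(1)[OF lin_T[OF i(3)]] by simp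
    qed
    ultimately show ?thesis by blast
  qed
  have slid: "T i x \<in> sT a p ` V" if i: "Suc a \<le> i" "i < n" "Suc i \<noteq> Suc a + p" "x \<in> sT a p ` V" for i x
  proof -
    obtain v where v: "v \<in> V" "x = sT a p v" using i(4) by auto
    show ?thesis
    proof (cases "i < a + p")
      case True
      then obtain l where l: "i = Suc l" "a \<le> l" using i by (cases i) auto
      then have "T i x = sT a p (T l v)" using True Suc.prems v by (simp add: sT_slide)
      then show ?thesis using Suc.prems(2)[of l v] l True v i by auto
    next
      case False
      then have "T i x = sT a p (T i v)" using i v by (simp add: sT_far)
      then show ?thesis using Suc.prems(2)[of i v] False v i by auto
    qed
  qed
  \<comment> \<open>The structure statement from a + 1 on splits \<open>x\<close> once more, since
    \<open>T a\<close> commutes only with the generators from a + 2 on.\<close>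
  have Ta1: "T a x \<in> ?W" if x: "x \<in> ?V1" for x
  proof (cases q)
    case 0
    then have "U (Suc a) V = V" using Suc.prems p by (intro U_trivial) auto
    then have "T a x \<in> sT a p ` V" using x p 0 by auto
    then show ?thesis by (intro I2 clo.base)
  next
    case (Suc q')
    have "?V1 \<subseteq> U (Suc (Suc a)) V \<oplus>\<^sub>s U (Suc (Suc a)) (sT (Suc a) q ` V)"
      using Suc.hyps Suc.prems p Suc by (intro Suc.hyps(1)) auto
    from splusD[OF subsetD[OF this x]]
    obtain y y' where y: "y \<in> U (Suc (Suc a)) V" "y' \<in> U (Suc (Suc a)) (sT (Suc a) q ` V)" "x = y + y'"
      by blast
    have "T a y \<in> ?W"
    proof (rule mono[OF U_comm[OF y(1) an]])
      have "T a v \<in> V" if "v \<in> V" for v using Suc.prems(2)[of a v] that an p Suc by simp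
      then show "T a ` V \<subseteq> ?W" by (blast intro: I1 clo.base)
    qed
    moreover have "T a y' \<in> ?W"
    proof (rule mono[OF U_comm[OF y(2) an]])
      have "T a ` sT (Suc a) q ` V = sT a p ` V" by (auto simp: p)
      then show "T a ` sT (Suc a) q ` V \<subseteq> ?W" by (blast intro: I2 clo.base)
    qed
    ultimately show ?thesis using subD(2)[OF W] lin_T[OF an] by (simp add: y linD)
  qed
  \<comment> \<open>The quadratic relation removes the leading \<open>T a\<close> of
    \<open>sT a p\<close>; it is available for vectors fixed by \<open>sm 1\<close>.\<close>
  have TsV: "T a x \<in> ?W" if x: "x \<in> sT a p ` V" for x
  proof -
    obtain v where v: "v \<in> V" "x = sT a p v" using x by auto
    have sub': "sT (Suc a) q v \<in> ?V1"
    proof -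
      have "sT b m v \<in> ?V1" if "Suc a \<le> b" "b + m \<le> n" for b m
        using that v(1)
        by (induction m arbitrary: b) (auto intro: clo.base U_T)
      then show ?thesis using Suc.prems p by auto
    qed
    then have "sm 1 (sT (Suc a) q v) = sT (Suc a) q v" using subD(4)[OF s1] by blast
    then have "T a x = sm w (sT a p v) + sT (Suc a) q v" using v an by (simp add: p T_sq)
    moreover have "sm w (sT a p v) \<in> ?V2" using v subD(3)[OF s2] by (auto intro: clo.base)
    ultimately show ?thesis using I1[OF sub'] I2 subD(2)[OF W] by auto
  qed
  have Ta2: "T a x \<in> ?W" if x: "x \<in> ?V2" for x
  proof (cases "a + p = n")
    case True
    then have "?V2 = sT a p ` V" using slid sV2 by (intro U_trivial) auto
    then show ?thesis using TsV x by auto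
  next
    case False
    have "?V2 \<subseteq> U (Suc (Suc a)) (sT a p ` V) \<oplus>\<^sub>s U (Suc (Suc a)) (sT (Suc a) p ` sT a p ` V)"
      using Suc.hyps(2) Suc.prems False slid by (intro Suc.hyps(1) sV2) auto
    from splusD[OF subsetD[OF this x]]
    obtain y y' where y: "y \<in> U (Suc (Suc a)) (sT a p ` V)"
      "y' \<in> U (Suc (Suc a)) (sT (Suc a) p ` sT a p ` V)" "x = y + y'"
      by blast
    have "T a y \<in> ?W"
      by (rule mono[OF U_comm[OF y(1) an]]) (use TsV in auto)
    \<comment> \<open>\<open>sT_sT\<close> exchanges the two long words and turns the leading
      \<open>T a\<close> into \<open>T (a + p)\<close> next to \<open>v\<close>, a generator that
      preserves \<open>V\<close>.\<close>
    moreover have "T a (sT (Suc a) p (sT a p v)) \<in> ?W" if v: "v \<in> V" for v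
    proof -
      have "T a (sT (Suc a) p (sT a p v)) = sT (Suc a) p (sT a p (T (a + p) v))"
        using sT_sT[of a p v] False Suc.prems by (simp add: sT_last[symmetric] del: sT.simps(2)) (simp)
      moreover have "T (a + p) v \<in> V" using v Suc.prems False by auto
      moreover have "sT b m y \<in> ?V2" if "Suc a \<le> b" "b + m \<le> n" "y \<in> ?V2" for b m y
        using that by (induction m arbitrary: b) (auto intro: U_T)
      ultimately have "sT (Suc a) p (sT a p (T (a + p) v)) \<in> ?V2"
        using False Suc.prems by (simp add: clo.base)
      then show ?thesis using I2 \<open>T a _ = _\<close> by simp
    qed
    then have "T a y' \<in> ?W"
      by (intro mono[OF U_comm[OF y(2) an]]) auto
    ultimately show ?thesis using subD(2)[OF W] lin_T[OF an] by (simp add: y linD)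
  qed
  show ?case
  proof (rule clo_least[OF W])
    show "V \<subseteq> ?W" by (auto intro: I1 clo.base)
  next
    fix f x assume "f \<in> T ` {a..<n}" and x: "x \<in> ?W"
    then obtain i where i: "f = T i" "a \<le> i" "i < n" by auto
    obtain y y' where y: "y \<in> ?V1" "y' \<in> ?V2" "x = y + y'" using splusD[OF x] by blast
    show "f x \<in> ?W"
    proof (cases "i = a")
      case True
      then show ?thesis using Ta1[OF y(1)] Ta2[OF y(2)] subD(2)[OF W] lin_T[OF an] by (simp add: y linD i)
    next
      case False
      then have "T i y \<in> ?V1" "T i y' \<in> ?V2" using i y by (auto intro: U_T)
      then show ?thesis using splusI[of "T i y" ?V1 "T i y'" ?V2] i(1) y(3) linD(1)[OF lin_T[OF i(3)]] by simp
    qed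
  qed
qed

text \<open>Pascal's rule along \<open>U_structure\<close>. In the boundary cases p = 0 and p = n -
  a + 1 no generator is omitted, so \<open>V\<close> is already stable.\<close>

lemma U_fsp:
  assumes "sub V" "\<And>i x. a \<le> i ==> i < n ==> Suc i \<noteq> a + p ==> x \<in> V ==> T i x \<in> V"
    and "a \<le> n" "a + p \<le> Suc n" "fsp N V"
  shows "fsp ((Suc (n - a) choose p) * N) (U a V)"
  using assms
proof (induction "n - a" arbitrary: a p V)
  case 0
  then have "U a V = V" by (intro U_trivial) auto
  moreover have "p = 0 \<or> p = 1" using 0 by auto
  ultimately show ?case using 0 by auto
next
  case (Suc m)
  show ?case
  proof (cases "p = 0 \<or> a + p = Suc n")
    case True
    then have "U a V = V" using Suc.prems by (intro U_trivial) auto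
    moreover have "p = 0 \<or> p = Suc (n - a)" using True Suc.prems by auto
    then have "Suc (n - a) choose p = 1" by auto
    ultimately show ?thesis using Suc.prems by simp
  next
    case False
    then obtain q where p: "p = Suc q" by (cases p) auto
    have ap: "a + p \<le> n" using False Suc.prems by auto
    have st: "U a V \<subseteq> U (Suc a) V \<oplus>\<^sub>s U (Suc a) (sT a p ` V)"
      using Suc.prems False by (intro U_structure) auto
    have lin: "lin (sT a p)" using ap by (rule lin_sT)
    have slid: "T i x \<in> sT a p ` V" if i: "Suc a \<le> i" "i < n" "Suc i \<noteq> Suc a + p" "x \<in> sT a p ` V" for i x
    proof -
      obtain v where v: "v \<in> V" "x = sT a p v" using i(4) by auto
      show ?thesis
      proof (cases "i < a + p")
        case True
        then obtain l where l: "i = Suc l" "a \<le> l" using i by (cases i) auto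
        then have "T i x = sT a p (T l v)" using True ap v by (simp add: sT_slide)
        then show ?thesis using Suc.prems(2)[of l v] l True v i by auto
      next
        case False
        then have "T i x = sT a p (T i v)" using i v by (simp add: sT_far)
        then show ?thesis using Suc.prems(2)[of i v] False v i by auto
      qed
    qed
    have "fsp ((Suc (n - Suc a) choose q) * N) (U (Suc a) V)"
      by (rule Suc.hyps(1)) (use Suc.hyps(2) Suc.prems p in auto)
    moreover have "fsp ((Suc (n - Suc a) choose p) * N) (U (Suc a) (sT a p ` V))"
      by (rule Suc.hyps(1)) (use Suc.hyps(2) Suc.prems ap slid lin in \<open>auto intro: sub_image fsp_image\<close>)
    ultimately have "fsp ((Suc (n - Suc a) choose q) * N + (Suc (n - Suc a) choose p) * N)
        (U (Suc a) V \<oplus>\<^sub>s U (Suc a) (sT a p ` V))" by (rule fsp_splus)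
    moreover have "Suc (n - a) = Suc (Suc (n - Suc a))" using Suc.hyps by simp
    then have "Suc (n - a) choose p = (Suc (n - Suc a) choose q) + (Suc (n - Suc a) choose p)" using p by simp
    ultimately show ?thesis using fsp_subset[OF _ st] by (simp add: distrib_right)
  qed
qed

text \<open>Iterating the maximal parabolic subgroups that omit the first generator gives \<open>n!\<close>.\<close>

lemma U_fsp_fact:
  assumes "sub V" "fsp N V" "a \<le> n"
  shows "fsp (fact (Suc (n - a)) * N) (U a V)"
  using assms(3)
proof (induction "n - a" arbitrary: a)
  case 0
  then have "U a V = V" using assms(1) by (intro U_trivial) auto
  then show ?case using 0 assms by simp
next
  case (Suc m)
  then have IH: "fsp (fact (Suc (n - Suc a)) * N) (U (Suc a) V)" by (intro Suc.hyps(1)) auto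
  have "fsp ((Suc (n - a) choose 1) * (fact (Suc (n - Suc a)) * N)) (U a (U (Suc a) V))"
    by (rule U_fsp[OF _ _ _ _ IH]) (use Suc assms in \<open>auto intro: sub_U U_T\<close>)
  moreover have "U a V \<subseteq> U a (U (Suc a) V)" by (auto intro: clo_mono clo.base)
  moreover have "(Suc (n - a) choose 1) * (fact (Suc (n - Suc a)) * N) = fact (Suc (n - a)) * N"
  proof -
    have "n - a = Suc (n - Suc a)" using Suc.hyps(2) by simp
    then show ?thesis by (simp del: fact_Suc) (simp only: fact_Suc[of "Suc (n - Suc a)"] of_nat_id mult_Suc distrib_right mult.assoc)
  qed
  ultimately show ?case using fsp_subset by metis
qed

end

context kmod begin

lemma clo_into:
  assumes "x \<in> clo F V" "lin g" "sub W" "\<And>x. x \<in> V ==> g x \<in> W"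
    and "\<And>f x. f \<in> F ==> g x \<in> W ==> g (f x) \<in> W"
  shows "g x \<in> W"
  using assms(1)
proof induction
  case (add x y)
  then show ?case using subD(2)[OF assms(3)] by (simp add: linD(1)[OF assms(2)])
next
  case (base x)
  then show ?case by (rule assms(4))
next
  case (op x f)
  then show ?case by (intro assms(5)[of f x])
qed

text \<open>If \<open>W\<close> is the closure under the first n operators, then \<open>W\<close>
  plus its image under \<open>C n\<close> is stable under all n + 1, so each operator doubles the
  bound.\<close>

lemma clifford_fsp:
  fixes n :: nat
  assumes "\<And>i. i < n ==> lin (C i)"
    and "\<And>i x. i < n ==> C i (C i x) = sm \<epsilon> x"
    and "\<And>i j x. i < n ==> j < i ==> C j (C i x) = - C i (C j x)"
    and "sub V" "fsp N V"
  shows "fsp (2 ^ n * N) (clo (C ` {0..<n}) V)"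
  using assms
proof (induction n)
  case 0
  have "clo {} V \<subseteq> V" by (rule clo_least[OF 0(4)]) auto
  then show ?case using fsp_subset[OF 0(5)] by simp
next
  case (Suc n)
  let ?W = "clo (C ` {0..<n}) V"
  have W: "sub ?W" by (rule sub_clo[OF Suc.prems(4)]) (use Suc.prems(1) in auto)
  have lin: "lin (C n)" by (rule Suc.prems(1)) simp
  have WC: "sub (?W \<oplus>\<^sub>s C n ` ?W)" by (intro sub_splus sub_image lin W)
  have "clo (C ` {0..<Suc n}) V \<subseteq> ?W \<oplus>\<^sub>s C n ` ?W"
  proof (rule clo_least[OF WC])
    show "V \<subseteq> ?W \<oplus>\<^sub>s C n ` ?W" 
      using splus_left[OF sub_image[OF lin W], of _ ?W] clo.base[of _ V] by blast
  next
    fix g x assume "g \<in> C ` {0..<Suc n}" "x \<in> ?W \<oplus>\<^sub>s C n ` ?W"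
    then obtain i y y' where i: "g = C i" "i \<le> n" and y: "y \<in> ?W" "y' \<in> ?W" "x = y + C n y'"
      using splusD[of x ?W "C n ` ?W"] by auto
    have lini: "lin (C i)" by (rule Suc.prems(1)) (use i in simp)
    show "g x \<in> ?W \<oplus>\<^sub>s C n ` ?W"
    proof (cases "i = n")
      case True
      then have "g x = sm \<epsilon> y' + C n y" using i y Suc.prems(2)[of n y'] by (simp add: linD[OF lin])
      then show ?thesis using splusI[of "sm \<epsilon> y'" ?W "C n y" "C n ` ?W"] subD(3)[OF W] y by simp
    next
      case False
      then have 1: "C i y \<in> ?W" "C i y' \<in> ?W" using i y clo.op[of _ "C ` {0..<n}" V "C i"] by auto
      have "C n (- C i y') = - C n (C i y')"
        using linD(2)[OF lin, of "- 1" "C i y'"] subD(4)[OF W 1(2)]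
          subD(4)[OF sub_image[OF lin W] imageI[OF 1(2)]] by (simp add: sm_minus)
      then have "g x = C i y + C n (- C i y')"
        using i y False Suc.prems(3)[of n i y'] by (simp add: linD[OF lini])
      then show ?thesis using splusI[of "C i y" ?W _ "C n ` ?W"] 1 sub_uminus[OF W 1(2)] by simp
    qed
  qed
  moreover have "fsp (2 ^ n * N + 2 ^ n * N) (?W \<oplus>\<^sub>s C n ` ?W)"
    by (intro fsp_splus fsp_image lin Suc.IH Suc.prems(4,5)) (use Suc.prems(1-3) in auto)
  ultimately show ?case using fsp_subset by (simp add: mult_2 distrib_right)
qed

end

section \<open>Hecke--Clifford families in a ring\<close>

text \<open>\<kappa> need not send 1 to a unit of the ring: \<open>u\<close> is a central
  idempotent, and the algebra in question is the part fixed by it.\<close>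

locale central_scalars =
  fixes \<kappa> :: "'k::comm_ring_1 => 'a::ring"
  assumes \<kappa>_add: "\<kappa> (p + q) = \<kappa> p + \<kappa> q"
    and \<kappa>_mult: "\<kappa> (p * q) = \<kappa> p * \<kappa> q"
    and \<kappa>_comm: "x * \<kappa> p = \<kappa> p * x"
begin

sublocale kmod "\<lambda>p x. \<kappa> p * x"
  by standard (simp_all add: \<kappa>_add \<kappa>_mult distrib_left distrib_right mult.assoc)

abbreviation u :: 'a where "u \<equiv> \<kappa> 1"

lemma \<kappa>_left_comm: "x * (\<kappa> p * y) = \<kappa> p * (x * y)"
  by (simp add: mult.assoc[symmetric] \<kappa>_comm[of x])

lemma \<kappa>_uminus: "\<kappa> (- p) = - \<kappa> p"
proof -
  have "\<kappa> 0 = 0" using \<kappa>_add[of 0 0] by simp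
  then show ?thesis using \<kappa>_add[of "- p" p] by (simp add: eq_neg_iff_add_eq_0)
qed

lemma \<kappa>_u: "u * \<kappa> p = \<kappa> p" "u * (\<kappa> p * x) = \<kappa> p * x"
  using \<kappa>_mult[of 1 p] by (simp_all add: mult.assoc[symmetric])

lemma lin_left: "lin (\<lambda>x. y * x)" by (simp add: lin_def distrib_left \<kappa>_left_comm)
lemma lin_right: "lin (\<lambda>x. x * y)" by (simp add: lin_def distrib_right mult.assoc)

lemma u_right: "u * x = x ==> x * u = x" by (simp add: \<kappa>_comm)

end

text \<open>The parameters w and \<epsilon> are left open so that upward strands (z and -1) and
  downward strands (-z and 1) are both covered.\<close>

locale hcfam = central_scalars \<kappa> for \<kappa> :: "'k::comm_ring_1 => 'a::ring" +
  fixes n :: nat and w \<epsilon> :: 'k and a c :: "nat => 'a"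
  assumes u_a: "Suc i < n ==> u * a i = a i"
    and u_c: "i < n ==> u * c i = c i"
    and a_sq: "Suc i < n ==> a i * a i = u - \<kappa> w * a i"
    and a_braid: "Suc (Suc i) < n ==> a i * (a (Suc i) * a i) = a (Suc i) * (a i * a (Suc i))"
    and a_far: "Suc i < j ==> Suc j < n ==> a j * a i = a i * a j"
    and c_sq: "i < n ==> c i * c i = \<kappa> \<epsilon>"
    and c_anti: "i < n ==> j < n ==> i \<noteq> j ==> c i * c j = - (c j * c i)"
    and a_slide: "Suc i < n ==> a i * c i = c (Suc i) * a i"
    and a_pass: "Suc i < n ==> j < n ==> j \<noteq> i ==> j \<noteq> Suc i ==> a i * c j = c j * a i"
begin

definition ai :: "nat => 'a" where "ai i = a i + \<kappa> w"

lemma a_ai: "Suc i < n ==> a i * ai i = u" "Suc i < n ==> ai i * a i = u"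
  by (simp_all add: ai_def distrib_left distrib_right a_sq \<kappa>_comm[of "a i"])

lemma c_a: "Suc i < n ==> c i * a i = a i * c (Suc i) + \<kappa> w * c (Suc i) - \<kappa> w * c i"
proof -
  assume i: "Suc i < n"
  have "ai i * (a i * c i) * ai i = ai i * (c (Suc i) * a i) * ai i" using a_slide i by simp
  moreover have "ai i * (a i * c i) = c i" using i by (simp add: mult.assoc[symmetric] a_ai u_c)
  moreover have "(c (Suc i) * a i) * ai i = c (Suc i)" using i by (simp add: mult.assoc a_ai u_right u_c)
  ultimately have "c i * ai i = ai i * c (Suc i)" by (simp add: mult.assoc)
  then show ?thesis by (simp add: ai_def distrib_left distrib_right \<kappa>_comm[of "c _"] algebra_simps)
qed

lemma tails:
  "Suc i < j ==> Suc j < n ==> a j * (a i * x) = a i * (a j * x)"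
  "i < n ==> j < n ==> i \<noteq> j ==> c i * (c j * x) = - (c j * (c i * x))"
  "Suc i < n ==> a i * (c i * x) = c (Suc i) * (a i * x)"
  "Suc i < n ==> j < n ==> j \<noteq> i ==> j \<noteq> Suc i ==> a i * (c j * x) = c j * (a i * x)"
  "Suc i < n ==> c i * (a i * x) = a i * (c (Suc i) * x) + \<kappa> w * (c (Suc i) * x) - \<kappa> w * (c i * x)"
proof -
  show "Suc i < j ==> Suc j < n ==> a j * (a i * x) = a i * (a j * x)"
    using comm_tail[OF a_far[of i j]] .
  show "i < n ==> j < n ==> i \<noteq> j ==> c i * (c j * x) = - (c j * (c i * x))"
    using arg_cong[OF c_anti[of i j], of "\<lambda>y. y * x"] by (simp add: mult.assoc)
  show "Suc i < n ==> a i * (c i * x) = c (Suc i) * (a i * x)"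
    using comm_tail[OF a_slide[of i]] .
  show "Suc i < n ==> j < n ==> j \<noteq> i ==> j \<noteq> Suc i ==> a i * (c j * x) = c j * (a i * x)"
    using comm_tail[OF a_pass[of i j]] .
  show "Suc i < n ==> c i * (a i * x) = a i * (c (Suc i) * x) + \<kappa> w * (c (Suc i) * x) - \<kappa> w * (c i * x)"
    using arg_cong[OF c_a[of i], of "\<lambda>y. y * x"] by (simp add: mult.assoc distrib_right left_diff_distrib)
qed

sublocale L: hecke_ops "\<lambda>p x. \<kappa> p * x" "\<lambda>i x. a i * x" "n - 1" "- w"
proof
  fix i j x
  show "i < n - 1 ==> lin ((*) (a i))" using lin_left .
  show "i < n - 1 ==> u * x = x ==> a i * (a i * x) = \<kappa> (- w) * (a i * x) + x"
    by (simp add: mult.assoc[symmetric] a_sq left_diff_distrib \<kappa>_uminus)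
  show "Suc i < n - 1 ==> a i * (a (Suc i) * (a i * x)) = a (Suc i) * (a i * (a (Suc i) * x))"
    using arg_cong[OF a_braid[of i], of "\<lambda>y. y * x"] by (simp add: mult.assoc)
  show "Suc i < j ==> j < n - 1 ==> a i * (a j * x) = a j * (a i * x)"
    by (simp add: tails(1)[of i j])
qed

sublocale R: hecke_ops "\<lambda>p x. \<kappa> p * x" "\<lambda>i x. x * a i" "n - 1" "- w"
proof
  fix i j x
  show "i < n - 1 ==> lin (\<lambda>x. x * a i)" using lin_right .
  show "i < n - 1 ==> u * x = x ==> x * a i * a i = \<kappa> (- w) * (x * a i) + x"
    by (simp add: mult.assoc a_sq right_diff_distrib \<kappa>_uminus u_right \<kappa>_left_comm)
  show "Suc i < n - 1 ==> x * a i * a (Suc i) * a i = x * a (Suc i) * a i * a (Suc i)"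
    using a_braid[of i] by (simp add: mult.assoc)
  show "Suc i < j ==> j < n - 1 ==> x * a j * a i = x * a i * a j"
    by (simp add: mult.assoc a_far[of i j])
qed

text \<open>Moving a dot through \<open>a i\<close> costs terms without that crossing, and the
  induction covers them.\<close>

lemma L_c_stable:
  assumes "sub V" "\<And>j x. j < n ==> x \<in> V ==> c j * x \<in> V" "x \<in> L.U 0 V" "j < n"
  shows "c j * x \<in> L.U 0 V"
  using assms(3,4)
proof (induction arbitrary: j rule: clo.induct)
  case (op x f)
  note sU = L.sub_U[OF assms(1), of 0]
  obtain i where i: "f = (\<lambda>x. a i * x)" "Suc i < n" using op(2) by auto
  have T: "y \<in> L.U 0 V ==> a i * y \<in> L.U 0 V" for y using L.U_T[of y 0 V i] i by simp
  consider "j = i" | "j = Suc i" | "j \<noteq> i" "j \<noteq> Suc i" by blast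
  then show ?case
  proof cases
    case 1
    then have 1: "a i * (c (Suc i) * x) \<in> L.U 0 V" "c (Suc i) * x \<in> L.U 0 V" "c i * x \<in> L.U 0 V"
      using op.IH[of "Suc i"] op.IH[of i] T[of "c (Suc i) * x"] i by auto
    have "c j * f x = a i * (c (Suc i) * x) + \<kappa> w * (c (Suc i) * x) - \<kappa> w * (c i * x)"
      using 1 i \<open>j = i\<close> by (simp add: tails(5))
    also have "\<dots> \<in> L.U 0 V" by (intro sub_diff[OF sU] subD(2,3)[OF sU] 1)
    finally show ?thesis .
  next
    case 2
    then show ?thesis using op T i by (auto simp: tails(3)[symmetric])
  next
    case 3
    then show ?thesis using op T i by (auto simp: tails(4)[symmetric])
  qed
qed (auto simp: distrib_left intro: clo.base clo.add assms(2))

lemma R_c_stable: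
  assumes "sub V" "\<And>j x. j < n ==> x \<in> V ==> x * c j \<in> V" "x \<in> R.U 0 V" "j < n"
  shows "x * c j \<in> R.U 0 V"
  using assms(3,4)
proof (induction arbitrary: j rule: clo.induct)
  case (op x f)
  note sU = R.sub_U[OF assms(1), of 0]
  obtain i where i: "f = (\<lambda>x. x * a i)" "Suc i < n" using op(2) by auto
  have T: "y \<in> R.U 0 V ==> y * a i \<in> R.U 0 V" for y using R.U_T[of y 0 V i] i by simp
  consider "j = i" | "j = Suc i" | "j \<noteq> i" "j \<noteq> Suc i" by blast
  then show ?case
  proof cases
    case 1
    then have "f x * c j = x * c (Suc i) * a i" using i a_slide by (simp add: mult.assoc)
    then show ?thesis using op T i by auto
  next
    case 2
    have "a i * c (Suc i) = c i * a i - \<kappa> w * c (Suc i) + \<kappa> w * c i" using c_a i by simp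
    then have "f x * c j = x * c i * a i - \<kappa> w * (x * c (Suc i)) + \<kappa> w * (x * c i)"
      using i 2 by (simp add: mult.assoc distrib_left right_diff_distrib \<kappa>_left_comm)
    moreover have 1: "x * c i * a i \<in> R.U 0 V" "x * c (Suc i) \<in> R.U 0 V" "x * c i \<in> R.U 0 V"
      using op.IH[of "Suc i"] op.IH[of i] T[of "x * c i"] i by auto
    have "x * c i * a i - \<kappa> w * (x * c (Suc i)) + \<kappa> w * (x * c i) \<in> R.U 0 V"
      by (intro sub_diff[OF sU] subD(2,3)[OF sU] 1)
    ultimately show ?thesis by metis
  next
    case 3
    then have "f x * c j = x * c j * a i" using i a_pass op by (simp add: mult.assoc)
    then show ?thesis using op T i by auto
  qed
qed (auto simp: distrib_right intro: clo.base clo.add assms(2))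

lemma sT_c: "b + k < n ==> b \<le> i ==> i < b + k ==> c (Suc i) * L.sT b k x = L.sT b k (c i * x)"
proof (induction k arbitrary: b)
  case (Suc k)
  show ?case
  proof (cases "b = i")
    case True
    have far: "c i * L.sT m k x = L.sT m k (c i * x)" if "i < m" "m + k < n" for m k
      using that
    proof (induction k arbitrary: m)
      case (Suc k)
      then show ?case by (simp add: tails(4)[symmetric])
    qed simp
    show ?thesis using True Suc.prems by (simp add: tails(3)[symmetric] far)
  next
    case False
    then show ?thesis using Suc by (simp add: tails(4)[symmetric])
  qed
qed simp

lemma sT_right: "L.sT b k (x * y) = L.sT b k x * y"
  by (induction k arbitrary: b) (simp_all add: mult.assoc)

lemma sT_left:
  assumes "\<And>j. b \<le> j ==> j < b + k ==> a j * y = y * a j"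
  shows "L.sT b k (y * x) = y * L.sT b k x"
  using assms
proof (induction k arbitrary: b)
  case (Suc k)
  have "a b * (y * v) = y * (a b * v)" for v
    using Suc.prems[of b] by (simp add: mult.assoc[symmetric])
  then show ?case using Suc by simp
qed simp

lemma R_sT_left: "R.sT b k (y * x) = y * R.sT b k x"
  by (induction k arbitrary: b) (simp_all add: mult.assoc)

lemma R_sT_right:
  assumes "\<And>j. b \<le> j ==> j < b + k ==> a j * y = y * a j"
  shows "R.sT b k (x * y) = R.sT b k x * y"
  using assms
proof (induction k arbitrary: b)
  case (Suc k)
  then show ?case by (simp add: mult.assoc)
qed simp

end

section \<open>The walled relations in symmetric form\<close>

text \<open>On both sides index 0 is the position next to the wall, and \<open>a i\<close> stands
  for the inverse of a generator t. Then the two sides obey the same relations up to the sign of w,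
  which \<open>swap\<close> exploits. Without a wall \<open>e\<close> is 0.\<close>

locale bcalg = central_scalars \<kappa> + A: hcfam \<kappa> r w \<epsilon> a c + B: hcfam \<kappa> s w' \<epsilon>' d f
  for \<kappa> :: "'k::comm_ring_1 => 'a::ring" and r s w w' \<epsilon> \<epsilon>' a c d f +
  fixes e :: 'a
  assumes w': "w' = - w"
    and u_e: "u * e = e"
    and e_triv: "r = 0 \<or> s = 0 ==> e = 0"
    and ad: "Suc i < r ==> Suc j < s ==> a i * d j = d j * a i"
    and cf: "i < r ==> j < s ==> c i * f j = - (f j * c i)"
    and af: "Suc i < r ==> j < s ==> a i * f j = f j * a i"
    and dc: "i < r ==> Suc j < s ==> d j * c i = c i * d j"
    and ee: "e * e = 0"
    and eae: "Suc 0 < r ==> e * (a 0 * e) = e"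
    and ede: "Suc 0 < s ==> e * (d 0 * e) = e"
    and ea: "0 < i ==> Suc i < r ==> e * a i = a i * e"
    and ed: "0 < i ==> Suc i < s ==> e * d i = d i * e"
    and ce: "c 0 * e = f 0 * e" and ec: "e * c 0 = e * f 0"
    and ec_pass: "0 < i ==> i < r ==> e * c i = c i * e"
    and ef_pass: "0 < i ==> i < s ==> e * f i = f i * e"
    and ece: "e * (c 0 * e) = 0"
    and e_braid: "Suc 0 < r ==> Suc 0 < s ==>
      e * (a 0 * (d 0 * (e * (d 0 * a 0)))) = a 0 * (d 0 * (e * (d 0 * (a 0 * e))))"
begin

lemma swap: "bcalg \<kappa> s r w' w \<epsilon>' \<epsilon> d f a c e"
proof (intro bcalg.intro bcalg_axioms.intro A.hcfam_axioms B.hcfam_axioms)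
  show "Suc 0 < s ==> Suc 0 < r ==>
      e * (d 0 * (a 0 * (e * (a 0 * d 0)))) = d 0 * (a 0 * (e * (a 0 * (d 0 * e))))"
    using e_braid by (simp add: ad comm_tail[OF ad])
  show "e * (f 0 * e) = 0" using ece by (simp add: ce)
  show "s = 0 \<or> r = 0 ==> e = 0" using e_triv by blast
qed (simp_all add: w' u_e ad af dc ee eae ede ea ed ce ec ec_pass ef_pass cf central_scalars_axioms)

lemmas e_tails = comm_tail[OF ea] comm_tail[OF ed] comm_tail[OF ec_pass] comm_tail[OF ef_pass]
lemmas mixed_tails = comm_tail[OF ad] comm_tail[OF af] comm_tail[OF dc]

lemma cf_tail: "i < r ==> j < s ==> c i * (f j * x) = - (f j * (c i * x))"
  using arg_cong[OF cf[of i j], of "\<lambda>y. y * x"] by (simp add: mult.assoc)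

lemma e_simps: "e * (e * x) = 0" "Suc 0 < r ==> e * (a 0 * (e * x)) = e * x"
  "Suc 0 < s ==> e * (d 0 * (e * x)) = e * x" "e * (c 0 * (e * x)) = 0"
  using arg_cong[OF ee, of "\<lambda>y. y * x"] arg_cong[OF eae, of "\<lambda>y. y * x"]
    arg_cong[OF ede, of "\<lambda>y. y * x"] arg_cong[OF ece, of "\<lambda>y. y * x"]
  by (simp_all add: mult.assoc)

abbreviation "SA \<equiv> A.L.sT" abbreviation "SB \<equiv> B.L.sT"
abbreviation "RA \<equiv> A.R.sT" abbreviation "RB \<equiv> B.R.sT"

lemma S_mixed:
  "b + k < r ==> Suc j < s ==> SA b k (d j * x) = d j * SA b k x"
  "b + k < r ==> j < s ==> SA b k (f j * x) = f j * SA b k x"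
  "0 < b ==> b + k < r ==> SA b k (e * x) = e * SA b k x"
  "b + k < s ==> Suc i < r ==> SB b k (a i * x) = a i * SB b k x"
  "b + k < s ==> i < r ==> SB b k (c i * x) = c i * SB b k x"
  "0 < b ==> b + k < s ==> SB b k (e * x) = e * SB b k x"
  "b + k < i ==> i < r ==> SA b k (c i * x) = c i * SA b k x"
  "b + k < i ==> Suc i < r ==> SA b k (a i * x) = a i * SA b k x"
  by (rule A.sT_left B.sT_left; simp add: ad af dc ea ed A.a_pass A.a_far)+

lemma S_comm: "b + k < r ==> b' + k' < s ==> SA b k (SB b' k' x) = SB b' k' (SA b k x)"
  by (induction k' arbitrary: b') (simp_all add: S_mixed)

lemma R_mixed:
  "b + k < s ==> Suc i < r ==> RB b k (x * a i) = RB b k x * a i"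
  "b + k < i ==> Suc i < r ==> RA b k (x * a i) = RA b k x * a i"
  "b + k < r ==> Suc i < s ==> RA b k (x * d i) = RA b k x * d i"
  by (rule A.R_sT_right B.R_sT_right; simp add: ad A.a_far)+

section \<open>Nested turnbacks\<close>

text \<open>The diagram with k cups and k caps: the crossings bring a free strand of each side to
  the wall, where the next \<open>e\<close> joins them.\<close>

primrec D :: "nat => 'a" where
  "D 0 = u"
| "D (Suc k) = e * SA 0 k (SB 0 k (D k))"

lemma u_D: "u * D k = D k"
proof (cases k)
  case (Suc l)
  then show ?thesis by (simp add: mult.assoc[symmetric] u_e)
qed (simp add: \<kappa>_u)

lemma D_swap: "k \<le> r ==> k \<le> s ==> bcalg.D \<kappa> d a e k = D k"
proof (induction k)
  case (Suc k)
  then show ?case by (simp add: bcalg.D.simps[OF swap] S_comm)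
qed (simp add: bcalg.D.simps[OF swap])

lemma D_comm:
  assumes "k \<le> r" "k \<le> s" "k \<le> j"
  shows "Suc j < r ==> a j * D k = D k * a j" "j < r ==> c j * D k = D k * c j"
  using assms
proof (induction k)
  case 0
  { case 1 show ?case using \<kappa>_comm by simp }
  { case 2 show ?case using \<kappa>_comm by simp }
next
  case (Suc k)
  { case 1
    then show ?case
      by (simp add: e_tails(1)[symmetric] S_mixed[symmetric] Suc A.sT_right B.sT_right mult.assoc[of e]) }
  { case 2
    then show ?case
      by (simp add: e_tails(3)[symmetric] S_mixed[symmetric] Suc A.sT_right B.sT_right mult.assoc[of e]) }
qed

lemma D_comm_d:
  assumes "k \<le> r" "k \<le> s" "k \<le> j"
  shows "Suc j < s ==> d j * D k = D k * d j" "j < s ==> f j * D k = D k * f j"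
  using bcalg.D_comm[OF swap, of k j] D_swap assms by auto

text \<open>The mirror image of the recursion, from which left-hand statements about
  \<open>D\<close> get right-hand versions.\<close>

lemma D_Suc_right: "k < r ==> k < s ==> D (Suc k) = RA 0 k (RB 0 k (D k)) * e"
proof (induction k)
  case 0
  then show ?case using \<kappa>_comm[of e 1] by simp
next
  case (Suc k)
  let ?x = "RA 0 k (RB 0 k (D k))"
  have IH: "D (Suc k) = ?x * e" using Suc by simp
  have ad_D: "a k * (d k * D k) = D k * (d k * a k)"
    using D_comm(1)[of k k] D_comm_d(1)[of k k] Suc.prems ad[of k k]
    by (simp add: mult.assoc[symmetric]) (simp add: mult.assoc)
  have "D (Suc (Suc k)) = e * SA 0 (Suc k) (SB 0 (Suc k) (?x * e))"
    by (subst D.simps(2)) (simp only: IH)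
  also have "\<dots> = e * SA 0 k (SB 0 k (a k * (d k * ?x))) * e"
  proof -
    have "SA 0 (Suc k) (SB 0 (Suc k) y) = SA 0 k (SB 0 k (a k * (d k * y)))" for y
      using Suc.prems by (simp add: A.L.sT_last B.L.sT_last S_mixed(4) del: A.L.sT.simps B.L.sT.simps)
    moreover have "a k * (d k * (?x * e)) = a k * (d k * ?x) * e" by (simp only: mult.assoc)
    ultimately show ?thesis by (simp only: A.sT_right B.sT_right mult.assoc)
  qed
  also have "a k * (d k * ?x) = RA 0 k (RB 0 k (a k * (d k * D k)))"
    by (simp add: A.R_sT_left B.R_sT_left)
  also have "e * SA 0 k (SB 0 k \<dots>) = RA 0 k (RB 0 k (D (Suc k) * d k * a k))"
  proof -
    have l: "SA b m (RA b' m' x) = RA b' m' (SA b m x)" "SB b m (RA b' m' x) = RA b' m' (SB b m x)"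
      "SA b m (RB b' m' x) = RB b' m' (SA b m x)" "SB b m (RB b' m' x) = RB b' m' (SB b m x)" for b m b' m' x
      by (induction m arbitrary: b) (simp_all add: A.R_sT_left B.R_sT_left)
    show ?thesis unfolding ad_D
      by (simp add: l A.R_sT_left[symmetric] B.R_sT_left[symmetric] A.sT_right B.sT_right mult.assoc)
  qed
  also have "\<dots> = RA 0 (Suc k) (RB 0 (Suc k) (D (Suc k)))"
    using Suc.prems by (simp add: A.R.sT_last B.R.sT_last R_mixed del: A.R.sT.simps B.R.sT.simps D.simps)
  finally show ?case .
qed

text \<open>The relation \<open>e_braid\<close> says that F and G below agree. Multiplication by
  \<open>e * d 0\<close> fixes F and turns G into \<open>e * (a 0 * (d 0 * e))\<close>, by the
  quadratic relation and because \<open>e * G = e * F = 0\<close>.\<close>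

lemma e_ad_e:
  assumes "Suc 0 < r" "Suc 0 < s"
  shows "a 0 * (d 0 * (e * (a 0 * (d 0 * e)))) = e * (a 0 * (d 0 * e))"
    and "e * (a 0 * (d 0 * (e * (a 0 * d 0)))) = e * (a 0 * (d 0 * e))"
proof -
  let ?F = "e * (a 0 * (d 0 * (e * (a 0 * d 0))))" and ?G = "a 0 * (d 0 * (e * (a 0 * (d 0 * e))))"
  have FG: "?F = ?G" using e_braid assms by (simp add: ad mixed_tails(1))
  have "e * (d 0 * ?F) = ?F" using assms by (simp add: e_simps)
  moreover have "e * (d 0 * ?G) = e * (a 0 * (d 0 * e)) + \<kappa> w' * 0 - \<kappa> w' * (e * ?G)"
  proof -
    have ue: "u * (e * x) = e * x" for x by (simp add: mult.assoc[symmetric] u_e)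
    have "d 0 * (a 0 * (d 0 * x)) = a 0 * x - \<kappa> w' * (a 0 * (d 0 * x))" if "u * x = x" for x
      using that arg_cong[OF B.a_sq[of 0], of "\<lambda>y. a 0 * (y * x)"] assms
      by (simp add: mixed_tails(1)[symmetric] mult.assoc left_diff_distrib right_diff_distrib \<kappa>_left_comm)
    then have "e * (d 0 * ?G) = e * (a 0 * (e * (a 0 * (d 0 * e)))) - \<kappa> w' * (e * ?G)"
      by (simp add: right_diff_distrib \<kappa>_left_comm ue)
    then show ?thesis using assms by (simp add: e_simps)
  qed
  moreover have "e * ?G = 0" unfolding FG[symmetric] by (simp add: e_simps)
  ultimately have "?F = e * (a 0 * (d 0 * e))" using FG by simp
  then show "?G = e * (a 0 * (d 0 * e))" "?F = e * (a 0 * (d 0 * e))" using FG by simp_all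
qed

text \<open>Two neighbouring cups may be crossed on both sides of the wall at once. Next to the wall
  this is \<open>e_ad_e\<close>; further out the crossings slide inward to the smaller
  diagram.\<close>

lemma D_left: "Suc i < k ==> k \<le> r ==> k \<le> s ==> a i * (d i * D k) = D k"
proof (induction k arbitrary: i)
  case (Suc k)
  show ?case
  proof (cases i)
    case 0
    then obtain m where k: "k = Suc m" using Suc by (cases k) auto
    let ?x = "SA 1 m (SB 1 m (SA 0 m (SB 0 m (D m))))"
    have "D (Suc k) = e * (a 0 * (d 0 * (e * ?x)))"
      using Suc.prems by (simp add: k S_mixed)
    moreover have "a 0 * (d 0 * \<dots>) = \<dots>"
      using arg_cong[OF e_ad_e(1), of "\<lambda>y. y * ?x"] Suc.prems k by (simp add: mult.assoc)
    ultimately show ?thesis using 0 by simp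
  next
    case (Suc i')
    then have "a i * (d i * D (Suc k)) = e * (a i * SA 0 k (d i * SB 0 k (D k)))"
      using Suc.prems by (simp add: e_tails[symmetric] S_mixed)
    also have "\<dots> = e * SA 0 k (SB 0 k (a i' * (d i' * D k)))"
      using Suc Suc.prems by (simp add: S_mixed A.L.sT_slide B.L.sT_slide)
    also have "a i' * (d i' * D k) = D k" using Suc Suc.IH[of i'] Suc.prems by simp
    finally show ?thesis by simp
  qed
qed simp

lemma D_right: "Suc i < k ==> k \<le> r ==> k \<le> s ==> D k * a i * d i = D k"
proof (induction k arbitrary: i)
  case (Suc k)
  show ?case
  proof (cases i)
    case 0
    then obtain m where k: "k = Suc m" using Suc by (cases k) auto
    let ?y = "RA 0 m (RB 0 m (D m))"
    have e1: "RA (Suc 0) m (x * e) = RA (Suc 0) m x * e" "RB (Suc 0) m (x * e) = RB (Suc 0) m x * e" for x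
      using Suc.prems k by (auto intro!: A.R_sT_right B.R_sT_right simp: ea ed)
    have "D (Suc k) = RA 0 (Suc m) (RB 0 (Suc m) (D (Suc m))) * e"
      using Suc.prems k by (subst D_Suc_right) auto
    also have "\<dots> = RA 1 m (RB 1 m ?y) * (e * (d 0 * (a 0 * e)))"
    proof -
      have "RA 1 m (x * d 0) = RA 1 m x * d 0" for x
        using Suc.prems k by (intro R_mixed) auto
      then show ?thesis
        using Suc.prems k by (subst D_Suc_right) (simp_all add: e1, simp add: mult.assoc)
    qed
    finally have *: "D (Suc k) = RA 1 m (RB 1 m ?y) * (e * (d 0 * (a 0 * e)))" .
    have "e * (d 0 * (a 0 * e)) * a 0 * d 0 = e * (d 0 * (a 0 * e))"
      using e_ad_e(2) Suc.prems k by (simp add: mult.assoc mixed_tails(1)[symmetric])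
    then show ?thesis unfolding * 0 by (simp add: mult.assoc)
  next
    case (Suc i')
    have k: "k < r" "k < s" "Suc i' < k" using Suc Suc.prems by auto
    have "D (Suc k) * a i * d i = RA 0 k (RB 0 k (D k)) * a i * d i * e"
      using Suc.prems Suc k by (simp add: D_Suc_right ea ed mult.assoc del: D.simps)
    also have "\<dots> = RA 0 k (RB 0 k (D k * a i' * d i')) * e"
    proof -
      have "RA 0 k y * a i = RA 0 k (y * a i')" "RB 0 k y * d i = RB 0 k (y * d i')"
        "RA 0 k (y * d i) = RA 0 k y * d i" "RB 0 k (y * a i') = RB 0 k y * a i'" for y
        using A.R.sT_slide[of 0 i' k y] B.R.sT_slide[of 0 i' k y] k Suc Suc.prems R_mixed by auto
      then show ?thesis by metis
    qed
    also have "D k * a i' * d i' = D k" using Suc.IH[of i'] k by simp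
    also have "RA 0 k (RB 0 k (D k)) * e = D (Suc k)" using k by (simp only: D_Suc_right)
    finally show ?thesis .
  qed
qed simp

lemma D_left_inv:
  assumes "Suc i < k" "k \<le> r" "k \<le> s"
  shows "A.ai i * D k = d i * D k" "B.ai i * D k = a i * D k"
proof -
  have lt: "Suc i < r" "Suc i < s" using assms by auto
  show "A.ai i * D k = d i * D k"
    using D_left[of i k] assms A.a_ai(2)[OF lt(1)]
    by (metis mult.assoc u_D mixed_tails(1) B.u_a lt)
  show "B.ai i * D k = a i * D k"
    using D_left[of i k] assms B.a_ai(2)[OF lt(2)] mixed_tails(1)[of i i "D k"]
    by (metis mult.assoc u_D A.u_a lt)
qed

lemma D_right_inv:
  assumes "Suc i < k" "k \<le> r" "k \<le> s"
  shows "D k * a i = D k * B.ai i" "D k * d i = D k * A.ai i"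
proof -
  have lt: "Suc i < r" "Suc i < s" using assms by auto
  show "D k * a i = D k * B.ai i"
    using arg_cong[OF D_right[of i k], of "\<lambda>y. y * B.ai i"] assms B.a_ai(1)[OF lt(2)]
      u_right[OF A.u_a[OF lt(1)]] by (simp add: mult.assoc)
  show "D k * d i = D k * A.ai i"
    using arg_cong[OF D_right[of i k], of "\<lambda>y. y * A.ai i"] assms A.a_ai(1)[OF lt(1)]
      u_right[OF B.u_a[OF lt(2)]] ad[OF lt] by (simp add: mult.assoc)
qed

lemma Suc_conj:
  shows "Suc i < r ==> c (Suc i) = a i * c i * A.ai i" "Suc i < s ==> f (Suc i) = d i * f i * B.ai i"
  using A.a_slide[of i] A.a_ai(1)[of i] u_right[OF A.u_c[of "Suc i"]]
    B.a_slide[of i] B.a_ai(1)[of i] u_right[OF B.u_c[of "Suc i"]] by (simp_all add: mult.assoc)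

text \<open>A dot passes along a cup: at position 0 by \<open>ce\<close>, further out by writing
  \<open>c (Suc i)\<close> as a conjugate of \<open>c i\<close> by a crossing and moving that
  crossing to the other side as well.\<close>

lemma D_left_c: "i < k ==> k \<le> r ==> k \<le> s ==> c i * D k = f i * D k"
proof (induction i)
  case 0
  then obtain l where "k = Suc l" by (cases k) auto
  then show ?case by (simp add: mult.assoc[symmetric] ce)
next
  case (Suc i)
  have lt: "Suc i < r" "Suc i < s" using Suc by auto
  note inv = D_left_inv[OF Suc.prems]
  have "c (Suc i) * D k = a i * (d i * (c i * D k))"
    using lt by (simp add: Suc_conj mult.assoc inv mixed_tails(3))
  also have "\<dots> = d i * (f i * (a i * D k))"
    using lt Suc by (simp add: mixed_tails)
  also have "\<dots> = f (Suc i) * D k" using lt by (simp add: Suc_conj mult.assoc inv)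
  finally show ?case .
qed

lemma D_right_c: "i < k ==> k \<le> r ==> k \<le> s ==> D k * c i = D k * f i"
proof (induction i)
  case 0
  then obtain l where "k = Suc l" by (cases k) auto
  then show ?case using 0 by (simp add: D_Suc_right mult.assoc ec del: D.simps)
next
  case (Suc i)
  have lt: "Suc i < r" "Suc i < s" using Suc by auto
  note inv = D_right_inv[OF Suc.prems]
  have Bc: "B.ai i * c i = c i * B.ai i" and Af: "A.ai i * f i = f i * A.ai i"
    and AB: "A.ai i * B.ai i = B.ai i * A.ai i"
    using lt by (simp_all add: B.ai_def A.ai_def distrib_left distrib_right dc af ad \<kappa>_comm[of "c _"] \<kappa>_comm[of "f _"] \<kappa>_comm[of "d _"] \<kappa>_comm[of "a _"]
        \<kappa>_mult[symmetric] mult.commute)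
  have "D k * c (Suc i) = D k * B.ai i * c i * A.ai i" using lt by (simp add: Suc_conj mult.assoc[symmetric] inv)
  also have "\<dots> = D k * f i * B.ai i * A.ai i" using Suc Bc by (simp add: mult.assoc) (simp add: mult.assoc[symmetric])
  also have "\<dots> = D k * f (Suc i)"
    using Af AB lt by (simp add: Suc_conj mult.assoc[symmetric] inv) (simp add: mult.assoc)
  finally show ?case .
qed

end

context central_scalars begin

lemma clo_right_mult:
  assumes "x \<in> clo F V" "\<And>x. x \<in> V ==> x * y \<in> V" "\<And>f. f \<in> F ==> \<exists>l. f = (\<lambda>x. l * x)"
  shows "x * y \<in> clo F V"
  using assms(1)
proof induction
  case (op x f)
  then obtain l where "f = (\<lambda>x. l * x)" using assms(3) by blast
  then show ?case using clo.op[OF op.IH op.hyps(2)] by (simp add: mult.assoc)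
qed (auto simp: distrib_right intro: clo.base clo.add assms(2))

lemma clo_left_mult:
  assumes "x \<in> clo F V" "\<And>x. x \<in> V ==> y * x \<in> V" "\<And>f. f \<in> F ==> \<exists>l. f = (\<lambda>x. x * l)"
  shows "y * x \<in> clo F V"
  using assms(1)
proof induction
  case (op x f)
  then obtain l where "f = (\<lambda>x. x * l)" using assms(3) by blast
  then show ?case using clo.op[OF op.IH op.hyps(2)] by (simp add: mult.assoc)
qed (auto simp: distrib_left intro: clo.base clo.add assms(2))

end

section \<open>The layer with k turnbacks\<close>

context bcalg begin

abbreviation "LA \<equiv> (\<lambda>i x. a i * x) ` {0..<r - 1}"
abbreviation "LC \<equiv> (\<lambda>i x. c i * x) ` {0..<r}"
abbreviation "LD \<equiv> (\<lambda>i x. d i * x) ` {0..<s - 1}"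
abbreviation "LF \<equiv> (\<lambda>i x. f i * x) ` {0..<s}"
abbreviation "QA \<equiv> (\<lambda>i x. x * a i) ` {0..<r - 1}"
abbreviation "QC \<equiv> (\<lambda>i x. x * c i) ` {0..<r}"
abbreviation "QD \<equiv> (\<lambda>i x. x * d i) ` {0..<s - 1}"
abbreviation "QF \<equiv> (\<lambda>i x. x * f i) ` {0..<s}"
lemma ops_mem:
  "Suc i < r ==> (\<lambda>x. a i * x) \<in> LA" "i < r ==> (\<lambda>x. c i * x) \<in> LC"
  "Suc i < s ==> (\<lambda>x. d i * x) \<in> LD" "i < s ==> (\<lambda>x. f i * x) \<in> LF"
  "Suc i < r ==> (\<lambda>x. x * a i) \<in> QA" "i < r ==> (\<lambda>x. x * c i) \<in> QC"
  "Suc i < s ==> (\<lambda>x. x * d i) \<in> QD" "i < s ==> (\<lambda>x. x * f i) \<in> QF"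
  by (rule image_eqI[where x = i]; simp)+

lemma ops_dest:
  "g \<in> LA ==> \<exists>i. Suc i < r \<and> g = (\<lambda>x. a i * x)" "g \<in> LC ==> \<exists>i<r. g = (\<lambda>x. c i * x)"
  "g \<in> LD ==> \<exists>i. Suc i < s \<and> g = (\<lambda>x. d i * x)" "g \<in> LF ==> \<exists>i<s. g = (\<lambda>x. f i * x)"
  "g \<in> QA ==> \<exists>i. Suc i < r \<and> g = (\<lambda>x. x * a i)" "g \<in> QC ==> \<exists>i<r. g = (\<lambda>x. x * c i)"
  "g \<in> QD ==> \<exists>i. Suc i < s \<and> g = (\<lambda>x. x * d i)" "g \<in> QF ==> \<exists>i<s. g = (\<lambda>x. x * f i)"
  by (erule imageE, rule exI, rule conjI[rotated], assumption, simp)+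

abbreviation "line k \<equiv> range (\<lambda>p. \<kappa> p * D k)"

lemma sub_line: "sub (line k)"
proof -
  have "0 = \<kappa> 0 * D k" using \<kappa>_add[of 0 0] by simp
  then have "0 \<in> line k" by blast
  then show ?thesis unfolding sub_def
    by (auto simp: distrib_right[symmetric] \<kappa>_add[symmetric] mult.assoc[symmetric] \<kappa>_mult[symmetric])
qed

lemma D_line: "D k \<in> line k"
  using u_D[of k] by (metis rangeI)

lemma fsp_line: "fsp 1 (line k)"
  unfolding fsp_def lspan_def by (intro exI[of _ "[D k]"]) auto

definition bimod :: "'a set => bool" where
  "bimod W \<longleftrightarrow> sub W \<and>
    (\<forall>x\<in>W. \<forall>i. (Suc i < r \<longrightarrow> a i * x \<in> W \<and> x * a i \<in> W) \<and> (i < r \<longrightarrow> c i * x \<in> W \<and> x * c i \<in> W) \<and>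
      (Suc i < s \<longrightarrow> d i * x \<in> W \<and> x * d i \<in> W) \<and> (i < s \<longrightarrow> f i * x \<in> W \<and> x * f i \<in> W))"

definition "P k = clo (LA \<union> LC \<union> LD \<union> LF \<union> QA \<union> QC \<union> QD \<union> QF) (line k)"

lemma P_bimod: "bimod (P k)"
proof -
  let ?F = "LA \<union> LC \<union> LD \<union> LF \<union> QA \<union> QC \<union> QD \<union> QF"
  have "sub (P k)" unfolding P_def by (intro sub_clo sub_line) (auto simp: lin_left lin_right)
  moreover have op: "g \<in> ?F ==> x \<in> P k ==> g x \<in> P k" for g x
    unfolding P_def by (rule clo.op)
  have "(Suc i < r \<longrightarrow> a i * x \<in> P k \<and> x * a i \<in> P k) \<and> (i < r \<longrightarrow> c i * x \<in> P k \<and> x * c i \<in> P k) \<and>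
      (Suc i < s \<longrightarrow> d i * x \<in> P k \<and> x * d i \<in> P k) \<and> (i < s \<longrightarrow> f i * x \<in> P k \<and> x * f i \<in> P k)"
    if x: "x \<in> P k" for x i
    by (intro conjI impI; (rule op[OF _ x, of "\<lambda>x. a i * x"] op[OF _ x, of "\<lambda>x. x * a i"] op[OF _ x, of "\<lambda>x. c i * x"] op[OF _ x, of "\<lambda>x. x * c i"]
      op[OF _ x, of "\<lambda>x. d i * x"] op[OF _ x, of "\<lambda>x. x * d i"] op[OF _ x, of "\<lambda>x. f i * x"] op[OF _ x, of "\<lambda>x. x * f i"]), simp only: Un_iff ops_mem simp_thms)
  ultimately show ?thesis unfolding bimod_def by blast
qed

lemma P_least: "bimod W ==> D k \<in> W ==> P k \<subseteq> W"
  unfolding P_def by (rule clo_least) (auto simp: bimod_def subD(3))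

lemma aD: "Suc i < k ==> k \<le> r ==> k \<le> s ==> a i * D k = d i * D k + \<kappa> w' * D k"
  by (simp add: D_left_inv[symmetric] B.ai_def distrib_right)

lemma dD: "Suc i < k ==> k \<le> r ==> k \<le> s ==> d i * D k = a i * D k + \<kappa> w * D k"
  by (simp add: D_left_inv[symmetric] A.ai_def distrib_right)

lemma Dd: "Suc i < k ==> k \<le> r ==> k \<le> s ==> D k * d i = D k * a i + \<kappa> w * D k"
  by (simp add: D_right_inv(2) A.ai_def distrib_left \<kappa>_comm[of "D k"])

text \<open>Right multiplication by \<open>a\<close>, \<open>c\<close> and left multiplication by
  \<open>d\<close>, \<open>f\<close> give a span \<open>B\<close> of size 2^(r+s) r! s!. The other
  four kinds of generators preserve it, apart from \<open>a\<close> on the left and \<open>d\<close>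
  on the right with index k - 1; these two contribute the binomial coefficients.\<close>

lemma fsp_P:
  assumes k: "k \<le> r" "k \<le> s"
  shows "fsp ((r choose k) * (s choose k) * (2 ^ (r + s) * (fact r * fact s))) (P k)"
proof -
  \<comment> \<open>Dots are applied before crossings: closing under crossings afterwards preserves
    closure under dots by \<open>R_c_stable\<close>.\<close>
  define B1 where "B1 = clo QC (line k)"
  have B1: "sub B1" "fsp (2 ^ r) B1"
    unfolding B1_def
  proof -
    have "fsp (2 ^ r * 1) (clo QC (line k))"
    proof (rule clifford_fsp[where \<epsilon> = \<epsilon>, OF _ _ _ sub_line fsp_line])
      show "x * c i * c i = \<kappa> \<epsilon> * x" if "i < r" for i x
        using that by (simp add: mult.assoc A.c_sq \<kappa>_comm[of x])
      show "x * c i * c j = - (x * c j * c i)" if "i < r" "j < i" for i j x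
        using A.c_anti[of i j] that by (simp add: mult.assoc)
    qed (rule lin_right)
    then show "fsp (2 ^ r) (clo QC (line k))" by simp
  qed (intro sub_clo sub_line, auto simp: lin_right)
  define B2 where "B2 = A.R.U 0 B1"
  have B2: "sub B2" "fsp (fact (Suc (r - 1)) * 2 ^ r) B2"
    unfolding B2_def using A.R.U_fsp_fact[OF B1, of 0] A.R.sub_U[OF B1(1)] by simp_all
  have B2c: "x * c j \<in> B2" if "x \<in> B2" "j < r" for x j
    unfolding B2_def
  proof (rule A.R_c_stable[OF B1(1) _ that[unfolded B2_def]])
    show "x * c j \<in> B1" if "j < r" "x \<in> B1" for j x
      using clo.op[OF that(2)[unfolded B1_def] ops_mem(6)[OF that(1)]] by (simp only: B1_def)
  qed
  have B2a: "x * a j \<in> B2" if "x \<in> B2" "Suc j < r" for x j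
    using A.R.U_T[OF that(1)[unfolded B2_def], of j] that(2) by (simp add: B2_def)
  define B3 where "B3 = clo LF B2"
  have B3: "sub B3" "fsp (2 ^ s * (fact (Suc (r - 1)) * 2 ^ r)) B3"
    unfolding B3_def
  proof -
    show "fsp (2 ^ s * (fact (Suc (r - 1)) * 2 ^ r)) (clo LF B2)"
    proof (rule clifford_fsp[where \<epsilon> = \<epsilon>', OF _ _ _ B2])
      show "f i * (f i * x) = \<kappa> \<epsilon>' * x" if "i < s" for i x
        using that by (simp add: mult.assoc[symmetric] B.c_sq)
      show "f j * (f i * x) = - (f i * (f j * x))" if "i < s" "j < i" for i j x
        using B.tails(2)[of j i x] that by simp
    qed (rule lin_left)
  qed (intro sub_clo B2(1), auto simp: lin_left)
  have B3r: "x * y \<in> B3" if "x \<in> B3" "\<And>x. x \<in> B2 ==> x * y \<in> B2" for x y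
    unfolding B3_def by (rule clo_right_mult[OF that[unfolded B3_def]]) auto
  define B4 where "B4 = B.L.U 0 B3"
  have B4: "sub B4" "fsp (fact (Suc (s - 1)) * (2 ^ s * (fact (Suc (r - 1)) * 2 ^ r))) B4"
    unfolding B4_def using B.L.U_fsp_fact[OF B3, of 0] B.L.sub_U[OF B3(1)] by simp_all
  have B4r: "x * y \<in> B4" if "x \<in> B4" "\<And>x. x \<in> B2 ==> x * y \<in> B2" for x y
    unfolding B4_def by (rule clo_right_mult[OF that(1)[unfolded B4_def] B3r[OF _ that(2)]]) auto
  have B4f: "f j * x \<in> B4" if "x \<in> B4" "j < s" for x j
    unfolding B4_def
  proof (rule B.L_c_stable[OF B3(1) _ that[unfolded B4_def]])
    show "f j * x \<in> B3" if "j < s" "x \<in> B3" for j x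
      using clo.op[OF that(2)[unfolded B3_def] ops_mem(4)[OF that(1)]] by (simp only: B3_def)
  qed
  define B where "B = clo (QC \<union> QA \<union> LF \<union> LD) (line k)"
  have "B \<subseteq> B4" unfolding B_def
  proof (rule clo_least[OF B4(1)])
    show "line k \<subseteq> B4" unfolding B4_def B3_def B2_def B1_def by (blast intro: clo.base)
    fix g x assume x: "x \<in> B4" and "g \<in> QC \<union> QA \<union> LF \<union> LD"
    from this(2) have "(\<exists>i<r. g = (\<lambda>x. x * c i)) \<or> (\<exists>i. Suc i < r \<and> g = (\<lambda>x. x * a i)) \<or>
      (\<exists>i<s. g = (\<lambda>x. f i * x)) \<or> (\<exists>i. Suc i < s \<and> g = (\<lambda>x. d i * x))"
      by - (elim UnE; drule ops_dest; simp)
    then consider i where "i < r" "g = (\<lambda>x. x * c i)" | i where "Suc i < r" "g = (\<lambda>x. x * a i)"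
      | i where "i < s" "g = (\<lambda>x. f i * x)" | i where "Suc i < s" "g = (\<lambda>x. d i * x)"
      by (elim disjE exE conjE) blast+
    then show "g x \<in> B4"
    proof cases
      case 1 then show ?thesis using B4r[OF x B2c] by simp
    next
      case 2 then show ?thesis using B4r[OF x B2a] by simp
    next
      case 3 then show ?thesis using B4f[OF x] by simp
    next
      case (4 i) then show ?thesis using B.L.U_T[OF x[unfolded B4_def], of i] by (simp add: B4_def)
    qed
  qed
  then have fB: "fsp (fact (Suc (s - 1)) * (2 ^ s * (fact (Suc (r - 1)) * 2 ^ r))) B"
    using B4(2) fsp_subset by blast
  have sB: "sub B" unfolding B_def by (intro sub_clo sub_line) (auto simp: lin_left lin_right)
  have DB: "D k \<in> B" unfolding B_def by (rule clo.base[OF D_line])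
  have Bop: "x \<in> B ==> i < r ==> x * c i \<in> B" "x \<in> B ==> Suc i < r ==> x * a i \<in> B"
    "x \<in> B ==> i < s ==> f i * x \<in> B" "x \<in> B ==> Suc i < s ==> d i * x \<in> B" for x i
    unfolding B_def
    by (drule clo.op[where f = "\<lambda>x. x * c i"] clo.op[where f = "\<lambda>x. x * a i"] clo.op[where f = "\<lambda>x. f i * x"] clo.op[where f = "\<lambda>x. d i * x"];
      simp add: ops_mem)+
  have Ba: "a i * x \<in> B" if "x \<in> B" "Suc i < r" "Suc i \<noteq> k" for x i
  proof (rule clo_into[OF that(1)[unfolded B_def] lin_left sB])
    have "a i * D k \<in> B"
      using that Bop[OF DB] k D_comm(1)[of k i] aD[of i k] subD(2,3)[OF sB] DB
      by (cases "Suc i < k") auto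
    then show "a i * x \<in> B" if "x \<in> line k" for x
      using that subD(3)[OF sB] by (auto simp: \<kappa>_left_comm)
    fix g x assume "g \<in> QC \<union> QA \<union> LF \<union> LD" "a i * x \<in> B"
    then show "a i * g x \<in> B" using Bop[OF \<open>a i * x \<in> B\<close>] that
      by (auto simp: mixed_tails mult.assoc[symmetric, of "a i" x])
  qed
  have Bc: "c i * x \<in> B" if "x \<in> B" "i < r" for x i
  proof (rule clo_into[OF that(1)[unfolded B_def] lin_left sB])
    have "c i * D k \<in> B"
      using that Bop[OF DB] k D_comm(2)[of k i] D_left_c[of i k]
      by (cases "i < k") auto
    then show "c i * x \<in> B" if "x \<in> line k" for x
      using that subD(3)[OF sB] by (auto simp: \<kappa>_left_comm)
    fix g x assume "g \<in> QC \<union> QA \<union> LF \<union> LD" "c i * x \<in> B"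
    then show "c i * g x \<in> B" using Bop[OF \<open>c i * x \<in> B\<close>] that
      by (auto simp: mixed_tails(3)[symmetric] cf_tail sub_uminus[OF sB] mult.assoc[symmetric, of "c i" x])
  qed
  have Bd: "x * d i \<in> B" if "x \<in> B" "Suc i < s" "Suc i \<noteq> k" for x i
  proof (rule clo_into[OF that(1)[unfolded B_def] lin_right sB])
    have "D k * d i \<in> B"
      using that Bop[OF DB] k D_comm_d(1)[of k i, symmetric] Dd[of i k] subD(2,3)[OF sB] DB
      by (cases "Suc i < k") auto
    then show "x * d i \<in> B" if "x \<in> line k" for x
      using that subD(3)[OF sB] by (auto simp: mult.assoc)
    fix g x assume "g \<in> QC \<union> QA \<union> LF \<union> LD" "x * d i \<in> B"
    then show "g x * d i \<in> B" using Bop[OF \<open>x * d i \<in> B\<close>] that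
      by (auto simp: mult.assoc ad dc[symmetric])
  qed
  have Bf: "x * f i \<in> B" if "x \<in> B" "i < s" for x i
  proof (rule clo_into[OF that(1)[unfolded B_def] lin_right sB])
    have "D k * f i \<in> B"
      using that Bop[OF DB] k D_comm_d(2)[of k i, symmetric] D_right_c[of i k, symmetric]
      by (cases "i < k") auto
    then show "x * f i \<in> B" if "x \<in> line k" for x
      using that subD(3)[OF sB] by (auto simp: mult.assoc)
    fix g x assume "g \<in> QC \<union> QA \<union> LF \<union> LD" "x * f i \<in> B"
    then show "g x * f i \<in> B" using Bop[OF \<open>x * f i \<in> B\<close>] that
      by (auto simp: mult.assoc af cf sub_uminus[OF sB])
  qed
  define C where "C = A.L.U 0 B"
  have C: "sub C" "fsp ((Suc (r - 1) choose k) * (fact (Suc (s - 1)) * (2 ^ s * (fact (Suc (r - 1)) * 2 ^ r)))) C"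
    unfolding C_def using A.L.U_fsp[OF sB _ _ _ fB, of 0 k] Ba k A.L.sub_U[OF sB] by simp_all
  have Cr: "x * y \<in> C" if "x \<in> C" "\<And>x. x \<in> B ==> x * y \<in> B" for x y
    unfolding C_def by (rule clo_right_mult[OF that[unfolded C_def]]) auto
  have Ca: "a i * x \<in> C" if "x \<in> C" "Suc i < r" for x i
    using A.L.U_T[OF that(1)[unfolded C_def], of i] that(2) by (simp add: C_def)
  have Cc: "c i * x \<in> C" if "x \<in> C" "i < r" for x i
    unfolding C_def by (rule A.L_c_stable[OF sB _ that[unfolded C_def]]) (rule Bc)
  have Cl: "y * x \<in> C" if "x \<in> C" "\<And>x. x \<in> B ==> y * x \<in> B" "\<And>i. Suc i < r ==> y * a i = a i * y" for x y
  proof (rule clo_into[OF that(1)[unfolded C_def] lin_left C(1)])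
    show "y * x \<in> C" if "x \<in> B" for x using \<open>\<And>x. x \<in> B ==> y * x \<in> B\<close>[OF that] unfolding C_def by (rule clo.base)
    fix g x assume "g \<in> LA" "y * x \<in> C"
    then show "y * g x \<in> C" using Ca that(3) by (auto simp: comm_tail[OF that(3)])
  qed
  define E where "E = B.R.U 0 C"
  have E: "sub E" "fsp ((Suc (s - 1) choose k) * ((Suc (r - 1) choose k) * (fact (Suc (s - 1)) * (2 ^ s * (fact (Suc (r - 1)) * 2 ^ r))))) E"
    unfolding E_def using B.R.U_fsp[OF C(1) _ _ _ C(2), of 0 k] Cr[OF _ Bd] k B.R.sub_U[OF C(1)] by simp_all
  have El: "y * x \<in> E" if "x \<in> E" "\<And>x. x \<in> C ==> y * x \<in> C" for x y
    unfolding E_def by (rule clo_left_mult[OF that[unfolded E_def]]) auto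
  have Ed: "x * d i \<in> E" if "x \<in> E" "Suc i < s" for x i
    using B.R.U_T[OF that(1)[unfolded E_def], of i] that(2) by (simp add: E_def)
  have Ef: "x * f i \<in> E" if "x \<in> E" "i < s" for x i
    unfolding E_def by (rule B.R_c_stable[OF C(1) _ that[unfolded E_def]]) (rule Cr[OF _ Bf])
  have Er: "x * y \<in> E" if "x \<in> E" "\<And>x. x \<in> B ==> x * y \<in> B" "\<And>i. Suc i < s ==> y * d i = d i * y" for x y
  proof (rule clo_into[OF that(1)[unfolded E_def] lin_right E(1)])
    show "x * y \<in> E" if "x \<in> C" for x
      unfolding E_def by (rule clo.base, rule Cr[OF that]) (rule \<open>\<And>x. x \<in> B ==> x * y \<in> B\<close>)
    fix g x assume "g \<in> QD" "x * y \<in> E"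
    then show "g x * y \<in> E" using Ed[of "x * y"] that(3) by (auto simp: mult.assoc)
  qed
  have "(Suc i < r \<longrightarrow> a i * x \<in> E \<and> x * a i \<in> E) \<and> (i < r \<longrightarrow> c i * x \<in> E \<and> x * c i \<in> E) \<and>
      (Suc i < s \<longrightarrow> d i * x \<in> E \<and> x * d i \<in> E) \<and> (i < s \<longrightarrow> f i * x \<in> E \<and> x * f i \<in> E)"
    if x: "x \<in> E" for x i
  proof (intro conjI impI)
    show "Suc i < r ==> a i * x \<in> E" by (rule El[OF x Ca])
    show "i < r ==> c i * x \<in> E" by (rule El[OF x Cc])
    show "Suc i < s ==> d i * x \<in> E" by (rule El[OF x Cl[OF _ Bop(4)]]) (simp_all add: ad)
    show "i < s ==> f i * x \<in> E" by (rule El[OF x Cl[OF _ Bop(3)]]) (simp_all add: af)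
    show "Suc i < r ==> x * a i \<in> E" by (rule Er[OF x Bop(2)]) (simp_all add: ad)
    show "i < r ==> x * c i \<in> E" by (rule Er[OF x Bop(1)]) (simp_all add: dc)
    show "Suc i < s ==> x * d i \<in> E" by (rule Ed[OF x])
    show "i < s ==> x * f i \<in> E" by (rule Ef[OF x])
  qed
  then have "bimod E" unfolding bimod_def using E(1) by blast
  moreover have "D k \<in> E" unfolding E_def C_def by (intro clo.base DB)
  ultimately have "P k \<subseteq> E" by (rule P_least)
  then have "fsp ((Suc (s - 1) choose k) * ((Suc (r - 1) choose k) * (fact (Suc (s - 1)) * (2 ^ s * (fact (Suc (r - 1)) * 2 ^ r))))) (P k)"
    using E(2) fsp_subset by blast
  moreover have "Suc (n - 1) choose k = n choose k \<and> fact (Suc (n - 1)) = (fact n :: nat)" if "k \<le> n" for n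
    using that by (cases n) auto
  ultimately show ?thesis using k by (simp add: power_add ac_simps)
qed

end

section \<open>Left multiplication by e on a layer\<close>

context bcalg begin

definition rstable :: "'a set => bool" where
  "rstable W \<longleftrightarrow> sub W \<and> (\<forall>x\<in>W. \<forall>i. (Suc i < r \<longrightarrow> x * a i \<in> W) \<and> (i < r \<longrightarrow> x * c i \<in> W) \<and>
      (Suc i < s \<longrightarrow> x * d i \<in> W) \<and> (i < s \<longrightarrow> x * f i \<in> W))"

lemma bimod_rstable: "bimod W ==> rstable W"
  by (simp add: bimod_def rstable_def)

definition "DR k = clo ((QA \<union> QC) \<union> (QD \<union> QF)) (line k)"

lemma rstable_clo:
  assumes "rstable V" "\<And>f. f \<in> F ==> \<exists>l. f = (\<lambda>x. l * x)"
  shows "rstable (clo F V)"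
proof -
  have V: "sub V" and "\<And>f. f \<in> F ==> lin f"
    using assms lin_left by (auto simp: rstable_def)
  then have "sub (clo F V)" by (rule sub_clo)
  moreover have m: "x * y \<in> clo F V" if "x \<in> clo F V" "\<And>x. x \<in> V ==> x * y \<in> V" for x y
    by (rule clo_right_mult[OF that assms(2)])
  ultimately show ?thesis using assms(1) unfolding rstable_def by (blast intro: m)
qed

lemma DR_rstable: "rstable (DR k)"
proof -
  have "sub (DR k)" unfolding DR_def by (intro sub_clo sub_line) (auto simp: lin_right)
  moreover have op: "g \<in> (QA \<union> QC) \<union> (QD \<union> QF) ==> x \<in> DR k ==> g x \<in> DR k" for g x
    unfolding DR_def by (rule clo.op)
  have "(Suc i < r \<longrightarrow> x * a i \<in> DR k) \<and> (i < r \<longrightarrow> x * c i \<in> DR k) \<and>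
      (Suc i < s \<longrightarrow> x * d i \<in> DR k) \<and> (i < s \<longrightarrow> x * f i \<in> DR k)"
    if x: "x \<in> DR k" for x i
    by (intro conjI impI; (rule op[OF _ x, of "\<lambda>x. x * a i"] op[OF _ x, of "\<lambda>x. x * c i"]
      op[OF _ x, of "\<lambda>x. x * d i"] op[OF _ x, of "\<lambda>x. x * f i"]), simp only: Un_iff ops_mem simp_thms)
  ultimately show ?thesis unfolding rstable_def by blast
qed

lemma D_DR: "D k \<in> DR k"
  unfolding DR_def by (rule clo.base[OF D_line])

lemma DR_into:
  assumes "x \<in> DR k" "rstable W" "lin g" "\<And>x y. g (x * y) = g x * y" "g (D k) \<in> W"
  shows "g x \<in> W"
  using assms(1) unfolding DR_def
proof (rule clo_into)
  show "lin g" "sub W" using assms by (simp_all add: rstable_def)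
  show "g x \<in> W" if "x \<in> line k" for x
    using that assms(2,3,5) by (auto simp: linD rstable_def subD)
  fix h x assume gx: "g x \<in> W" and "h \<in> (QA \<union> QC) \<union> (QD \<union> QF)"
  from this(2) have "(\<exists>i. Suc i < r \<and> h = (\<lambda>x. x * a i)) \<or> (\<exists>i<r. h = (\<lambda>x. x * c i)) \<or>
      (\<exists>i. Suc i < s \<and> h = (\<lambda>x. x * d i)) \<or> (\<exists>i<s. h = (\<lambda>x. x * f i))"
    by - (elim UnE; drule ops_dest; simp)
  then show "g (h x) \<in> W" using assms(2,4) gx by (auto simp: rstable_def)
qed

abbreviation "LAk k \<equiv> (\<lambda>i x. a i * x) ` {0..<k - 1}"
abbreviation "LCk k \<equiv> (\<lambda>i x. c i * x) ` {0..<k}"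

text \<open>By \<open>Z_left\<close> every left generator other than \<open>a (k-1)\<close> and
  \<open>d (k-1)\<close> preserves it, so \<open>P k\<close> is obtained from it by left cosets on
  the two sides.\<close>

definition "Z k = clo (LAk k \<union> LCk k) (DR k)"

lemma Z_rstable: "rstable (Z k)"
  unfolding Z_def by (rule rstable_clo[OF DR_rstable]) auto

lemma sub_Z: "sub (Z k)" using Z_rstable by (simp add: rstable_def)

lemma DR_Z: "x \<in> DR k ==> x \<in> Z k"
  unfolding Z_def by (rule clo.base)

lemma Z_op: "x \<in> Z k ==> Suc i < k ==> a i * x \<in> Z k" "x \<in> Z k ==> i < k ==> c i * x \<in> Z k"
proof -
  have op: "g \<in> LAk k \<union> LCk k ==> x \<in> Z k ==> g x \<in> Z k" for g x
    unfolding Z_def by (rule clo.op)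
  show "x \<in> Z k ==> Suc i < k ==> a i * x \<in> Z k"
    by (rule op[of "\<lambda>x. a i * x"]) (auto intro!: image_eqI[where x = i])
  show "x \<in> Z k ==> i < k ==> c i * x \<in> Z k"
    by (rule op[of "\<lambda>x. c i * x"]) (auto intro!: image_eqI[where x = i])
qed

lemma Z_into:
  assumes "x \<in> Z k" "rstable W" "lin g" "\<And>x y. g (x * y) = g x * y" "g (D k) \<in> W"
    and "\<And>i x. Suc i < k ==> g x \<in> W ==> g (a i * x) \<in> W"
    and "\<And>i x. i < k ==> g x \<in> W ==> g (c i * x) \<in> W"
  shows "g x \<in> W"
  using assms(1) unfolding Z_def
proof (rule clo_into)
  show "lin g" "sub W" using assms by (simp_all add: rstable_def)
  show "g x \<in> W" if "x \<in> DR k" for x by (rule DR_into[OF that assms(2-5)])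
  fix h x assume gx: "g x \<in> W" and "h \<in> LAk k \<union> LCk k"
  from this(2) show "g (h x) \<in> W" using assms(6,7) gx by auto
qed

lemma Z_left:
  assumes k: "k \<le> r" "k \<le> s" and x: "x \<in> Z k"
  shows "Suc i < r ==> Suc i \<noteq> k ==> a i * x \<in> Z k"
    and "i < r ==> c i * x \<in> Z k"
    and "Suc i < s ==> Suc i \<noteq> k ==> d i * x \<in> Z k"
    and "i < s ==> f i * x \<in> Z k"
proof -
  note into = Z_into[OF x Z_rstable lin_left mult.assoc[symmetric]]
  have DZ: "D k \<in> Z k" by (rule DR_Z[OF D_DR])
  have R: "y \<in> Z k ==> Suc i < r ==> y * a i \<in> Z k" "y \<in> Z k ==> i < r ==> y * c i \<in> Z k"
    "y \<in> Z k ==> Suc i < s ==> y * d i \<in> Z k" "y \<in> Z k ==> i < s ==> y * f i \<in> Z k" for y i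
    using Z_rstable by (auto simp: rstable_def)
  show "a i * x \<in> Z k" if i: "Suc i < r" "Suc i \<noteq> k"
  proof (cases "Suc i < k")
    case False
    then have ik: "k \<le> i" using i by simp
    show ?thesis
    proof (rule into)
      show "a i * D k \<in> Z k" using R(1)[OF DZ i(1)] D_comm(1)[OF k ik i(1)] by simp
      show "a i * (a j * x) \<in> Z k" if "Suc j < k" "a i * x \<in> Z k" for j x
        using that ik i Z_op(1)[of "a i * x" k j] by (simp add: A.tails(1)[of j i])
      show "a i * (c j * x) \<in> Z k" if "j < k" "a i * x \<in> Z k" for j x
        using that ik i Z_op(2)[of "a i * x" k j] by (simp add: A.tails(4))
    qed
  qed (use x Z_op in auto)
  show "c i * x \<in> Z k" if i: "i < r"
  proof (cases "i < k")
    case False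
    then have ik: "k \<le> i" using i by simp
    show ?thesis
    proof (rule into)
      show "c i * D k \<in> Z k" using R(2)[OF DZ i(1)] D_comm(2)[OF k ik i(1)] by simp
      show "c i * (a j * x) \<in> Z k" if "Suc j < k" "c i * x \<in> Z k" for j x
        using that ik i k Z_op(1)[of "c i * x" k j] by (simp add: A.tails(4)[symmetric])
      show "c i * (c j * x) \<in> Z k" if "j < k" "c i * x \<in> Z k" for j x
        using that ik i k Z_op(2)[of "c i * x" k j] sub_uminus[OF sub_Z] A.tails(2)[of i j x] by simp
    qed
  qed (use x Z_op in auto)
  show "d i * x \<in> Z k" if i: "Suc i < s" "Suc i \<noteq> k"
  proof (rule into)
    show "d i * D k \<in> Z k"
      using R(3)[OF DZ i(1)] D_comm_d(1)[of k i] i k dD[of i k] Z_op(1)[OF DZ, of i]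
        subD(2,3)[OF sub_Z] DZ by (cases "Suc i < k") auto
    show "d i * (a j * x) \<in> Z k" if "Suc j < k" "d i * x \<in> Z k" for j x
      using that k i Z_op(1)[of "d i * x" k j] by (simp add: mixed_tails(1)[symmetric])
    show "d i * (c j * x) \<in> Z k" if "j < k" "d i * x \<in> Z k" for j x
      using that k i Z_op(2)[of "d i * x" k j] by (simp add: mixed_tails(3))
  qed
  show "f i * x \<in> Z k" if i: "i < s"
  proof (rule into)
    show "f i * D k \<in> Z k"
      using R(4)[OF DZ i(1)] D_comm_d(2)[of k i] i k D_left_c[of i k, symmetric] Z_op(2)[OF DZ, of i]
      by (cases "i < k") auto
    show "f i * (a j * x) \<in> Z k" if "Suc j < k" "f i * x \<in> Z k" for j x
      using that k i Z_op(1)[of "f i * x" k j] by (simp add: mixed_tails(2)[symmetric])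
    show "f i * (c j * x) \<in> Z k" if "j < k" "f i * x \<in> Z k" for j x
      using that k i Z_op(2)[of "f i * x" k j] sub_uminus[OF sub_Z[of k], of "c j * (f i * x)"] cf_tail[of j i x] by simp
  qed
qed

lemma bimodD:
  assumes "bimod W"
  shows "sub W" "x \<in> W ==> Suc i < r ==> a i * x \<in> W" "x \<in> W ==> i < r ==> c i * x \<in> W"
    "x \<in> W ==> Suc i < s ==> d i * x \<in> W" "x \<in> W ==> i < s ==> f i * x \<in> W"
  using assms by (auto simp: bimod_def)

text \<open>\<open>e\<close> meets one end of a cup and a free strand. The bend is straightened by
  \<open>e * (a 0 * e) = e\<close>, and the number of turnbacks stays k.\<close>

lemma e_SA_Z:
  assumes W: "bimod W" "D k \<in> W" and k: "0 < k" "k < r" "k \<le> s" and z: "x \<in> Z k"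
  shows "e * SA 0 k x \<in> W"
proof -
  obtain m where m: "k = Suc m" using k by (cases k) auto
  have lin: "lin (\<lambda>x. e * SA 0 k x)"
    by (rule lin_comp[OF lin_left A.L.lin_sT]) (use k in simp)
  show ?thesis
  proof (rule Z_into[OF z bimod_rstable[OF W(1)] lin])
    show "e * SA 0 k (x * y) = e * SA 0 k x * y" for x y by (simp add: A.sT_right mult.assoc)
    have "e * SA 0 k (D k) = e * (a 0 * (e * SA 1 m (SA 0 m (SB 0 m (D m)))))"
      using k m by (simp add: S_mixed)
    also have "\<dots> = SA 1 m (D k)" using k m by (simp add: e_simps S_mixed)
    also have "SA b j (D k) \<in> W" if "b + j < r" for b j
      using that W by (induction j arbitrary: b) (auto simp: bimodD)
    then have "SA 1 m (D k) \<in> W" using k m by simp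
    finally show "e * SA 0 k (D k) \<in> W" .
    show "e * SA 0 k (a i * x) \<in> W" if "Suc i < k" "e * SA 0 k x \<in> W" for i x
    proof -
      have "e * SA 0 k (a i * x) = a (Suc i) * (e * SA 0 k x)"
        using that k A.L.sT_slide[of 0 i k x, symmetric] by (simp add: e_tails)
      then show ?thesis using that k bimodD(2)[OF W(1)] by simp
    qed
    show "e * SA 0 k (c i * x) \<in> W" if "i < k" "e * SA 0 k x \<in> W" for i x
    proof -
      have "e * SA 0 k (c i * x) = c (Suc i) * (e * SA 0 k x)"
        using that k A.sT_c[of 0 k i x, symmetric] by (simp add: e_tails)
      then show ?thesis using that k bimodD(3)[OF W(1)] by simp
    qed
  qed
qed

text \<open>\<open>e\<close> meets two free strands and creates a further turnback.\<close>

lemma e_SA_SB_Z: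
  assumes W: "bimod W" "D (Suc k) \<in> W" and k: "k < r" "k < s" and z: "x \<in> Z k"
  shows "e * SA 0 k (SB 0 k x) \<in> W"
proof -
  have lin: "lin (\<lambda>x. e * SA 0 k (SB 0 k x))"
    by (rule lin_comp[OF lin_comp[OF lin_left A.L.lin_sT] B.L.lin_sT]) (use k in simp_all)
  show ?thesis
  proof (rule Z_into[OF z bimod_rstable[OF W(1)] lin])
    show "e * SA 0 k (SB 0 k (x * y)) = e * SA 0 k (SB 0 k x) * y" for x y
      by (simp add: A.sT_right B.sT_right mult.assoc)
    show "e * SA 0 k (SB 0 k (D k)) \<in> W" using W(2) by simp
    show "e * SA 0 k (SB 0 k (a i * x)) \<in> W" if "Suc i < k" "e * SA 0 k (SB 0 k x) \<in> W" for i x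
    proof -
      have "e * SA 0 k (SB 0 k (a i * x)) = a (Suc i) * (e * SA 0 k (SB 0 k x))"
        using that k A.L.sT_slide[of 0 i k "SB 0 k x", symmetric] by (simp add: S_mixed e_tails)
      then show ?thesis using that k bimodD(2)[OF W(1)] by simp
    qed
    show "e * SA 0 k (SB 0 k (c i * x)) \<in> W" if "i < k" "e * SA 0 k (SB 0 k x) \<in> W" for i x
    proof -
      have "e * SA 0 k (SB 0 k (c i * x)) = c (Suc i) * (e * SA 0 k (SB 0 k x))"
        using that k A.sT_c[of 0 k i "SB 0 k x", symmetric] by (simp add: S_mixed e_tails)
      then show ?thesis using that k bimodD(3)[OF W(1)] by simp
    qed
  qed
qed

lemma bimod_swap: "bcalg.bimod \<kappa> s r d f a c W = bimod W"
  unfolding bcalg.bimod_def[OF swap] bimod_def by blast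

lemma DR_swap: "k \<le> r ==> k \<le> s ==> bcalg.DR \<kappa> s r d f a c e k = DR k"
  unfolding bcalg.DR_def[OF swap] DR_def by (simp add: D_swap Un_commute)

lemma Z_swap: "k \<le> r ==> k \<le> s ==> x \<in> Z k ==> x \<in> bcalg.Z \<kappa> s r d f a c e k"
proof -
  assume k: "k \<le> r" "k \<le> s" and x: "x \<in> Z k"
  let ?Z = "bcalg.Z \<kappa> s r d f a c e k"
  have "rstable ?Z"
    using bcalg.Z_rstable[OF swap, of k] unfolding bcalg.rstable_def[OF swap] rstable_def by blast
  moreover have "D k \<in> ?Z"
    using bcalg.DR_Z[OF swap, of "D k" k] D_DR by (simp add: DR_swap k)
  moreover have "a i * x \<in> ?Z" if "Suc i < k" "x \<in> ?Z" for i x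
    using bcalg.Z_left(3)[OF swap k(2,1) that(2), of i] that k by simp
  moreover have "c i * x \<in> ?Z" if "i < k" "x \<in> ?Z" for i x
    using bcalg.Z_left(4)[OF swap k(2,1) that(2), of i] that k by simp
  ultimately show "x \<in> ?Z" by (intro Z_into[OF x, of ?Z "\<lambda>x. x"] lin_id) auto
qed

lemma e_SB_Z:
  assumes "bimod W" "D k \<in> W" "0 < k" "k \<le> r" "k < s" "x \<in> Z k"
  shows "e * SB 0 k x \<in> W"
  using bcalg.e_SA_Z[OF swap, of W k x] assms Z_swap[of k x] by (simp add: bimod_swap D_swap)

end

context bcalg begin

text \<open>\<open>e\<close> meets two ends of cups. If they belong to the same cup, a circle with
  or without a dot appears and the product vanishes (\<open>eB\<close>, \<open>ecB\<close>);
  otherwise two cups are joined into one by \<open>e * (a 0 * e) = e\<close>.\<close>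

lemma e_Z:
  assumes W: "bimod W" "D k \<in> W" and k: "0 < k" "k \<le> r" "k \<le> s" and x: "x \<in> Z k"
  shows "e * x \<in> W"
proof -
  note sW = bimodD(1)[OF W(1)]
  interpret K: hcfam \<kappa> k w \<epsilon> a c
    by (intro hcfam.intro hcfam_axioms.intro central_scalars_axioms;
      (rule A.u_a A.u_c A.a_sq A.a_braid A.a_far A.c_sq A.c_anti A.a_slide A.a_pass; use k in simp))
  obtain m where m: "k = Suc m" using k by (cases k) auto
  have Dk: "D k = e * SA 0 m (SB 0 m (D m))" by (simp add: m)
  \<comment> \<open>Index 0 is left out: the remaining generators commute with \<open>e\<close>, and
    with \<open>c 0\<close> up to sign.\<close>
  define B where "B = clo ((\<lambda>i x. a i * x) ` {1..<k - 1} \<union> (\<lambda>i x. c i * x) ` {1..<k}) (DR k)"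
  have rB: "rstable B" unfolding B_def by (rule rstable_clo[OF DR_rstable]) auto
  then have sB: "sub B" by (simp add: rstable_def)
  have B_op: "0 < i ==> Suc i < k ==> y \<in> B ==> a i * y \<in> B" "0 < i ==> i < k ==> y \<in> B ==> c i * y \<in> B" for i y
  proof -
    have op: "g \<in> (\<lambda>i x. a i * x) ` {1..<k - 1} \<union> (\<lambda>i x. c i * x) ` {1..<k} ==> x \<in> B ==> g x \<in> B" for g x
      unfolding B_def by (rule clo.op)
    show "0 < i ==> Suc i < k ==> y \<in> B ==> a i * y \<in> B"
      by (rule op[of "\<lambda>x. a i * x"]) (auto intro!: image_eqI[where x = i])
    show "0 < i ==> i < k ==> y \<in> B ==> c i * y \<in> B"
      by (rule op[of "\<lambda>x. c i * x"]) (auto intro!: image_eqI[where x = i])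
  qed
  have B_into: "g y \<in> V"
    if "y \<in> B" "rstable V" "lin g" "\<And>x y. g (x * y) = g x * y" "g (D k) \<in> V"
      "\<And>i x. 0 < i ==> Suc i < k ==> g x \<in> V ==> g (a i * x) \<in> V"
      "\<And>i x. 0 < i ==> i < k ==> g x \<in> V ==> g (c i * x) \<in> V" for y V g
    using that(1) unfolding B_def
  proof (rule clo_into)
    show "lin g" "sub V" using that by (simp_all add: rstable_def)
    show "g x \<in> V" if "x \<in> DR k" for x by (rule DR_into) fact+
    fix h x assume gx: "g x \<in> V" and "h \<in> (\<lambda>i x. a i * x) ` {1..<k - 1} \<union> (\<lambda>i x. c i * x) ` {1..<k}"
    from this(2) show "g (h x) \<in> V" using that(6,7) gx by auto
  qed
  have r0: "rstable {0}" by (simp add: rstable_def sub_def)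
  have e_a: "e * (a i * y) = a i * (e * y)" if "0 < i" "Suc i < k" for i y
    using that k by (simp add: e_tails)
  have e_c: "e * (c i * y) = c i * (e * y)" if "0 < i" "i < k" for i y
    using that k by (simp add: e_tails)
  have c0_a: "c 0 * (a i * y) = a i * (c 0 * y)" if "0 < i" "Suc i < k" for i y
    using that k A.tails(4)[of i 0 y] by simp
  have c0_c: "c 0 * (c i * y) = - (c i * (c 0 * y))" if "0 < i" "i < k" for i y
    using that k A.tails(2)[of 0 i y] by simp
  have eB: "e * y = 0" if "y \<in> B" for y
    using B_into[OF that r0 lin_left mult.assoc[symmetric]] by (simp add: Dk e_simps e_a e_c)
  have ecB: "e * (c 0 * y) = 0" if "y \<in> B" for y
    using B_into[OF that r0 lin_comp[OF lin_left lin_left], of e "c 0"]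
    by (simp add: Dk e_simps e_a e_c c0_a c0_c mult.assoc)
  have BW: "y \<in> W" if "y \<in> B" for y
    by (rule B_into[OF that bimod_rstable[OF W(1)] lin_id])
      (use k W in \<open>auto simp: bimodD\<close>)
  \<comment> \<open>A leading factor \<open>e\<close> is what the relation
    \<open>e * (a 0 * e) = e\<close> needs on the right of \<open>a 0\<close>.\<close>
  have B_e: "\<exists>y'. y = e * y'" if "y \<in> B" for y
  proof -
    define I where "I = range (\<lambda>x. e * x)"
    have "0 \<in> I" unfolding I_def by (rule range_eqI[of _ _ 0]) simp
    moreover have "x + y \<in> I" if "x \<in> I" "y \<in> I" for x y
      using that by (auto simp: I_def distrib_left[symmetric])
    moreover have "\<kappa> p * x \<in> I" if "x \<in> I" for p x
      using that by (auto simp: I_def \<kappa>_left_comm[symmetric, of _ e])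
    moreover have "u * x = x" if "x \<in> I" for x
      using that by (auto simp: I_def mult.assoc[symmetric] u_e)
    moreover have m: "x * l \<in> I" if "x \<in> I" for x l
      using that by (auto simp: I_def mult.assoc)
    ultimately have "sub I" unfolding sub_def by blast
    then have rI: "rstable I" unfolding rstable_def by (simp add: m)
    have "y \<in> I"
    proof (rule B_into[OF that rI lin_id])
      show "D k \<in> I" unfolding Dk I_def by blast
      show "a i * x \<in> I" if "0 < i" "Suc i < k" "x \<in> I" for i x
        using that(3) by (auto simp: I_def e_a[OF that(1,2), symmetric])
      show "c i * x \<in> I" if "0 < i" "i < k" "x \<in> I" for i x
        using that(3) by (auto simp: I_def e_c[OF that(1,2), symmetric])
    qed simp
    then show ?thesis unfolding I_def by blast
  qed
  define V where "V = B \<oplus>\<^sub>s (\<lambda>x. c 0 * x) ` B"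
  have sV: "sub V" unfolding V_def by (intro sub_splus sub_image lin_left sB)
  have V_E: "\<exists>x\<in>B. \<exists>x'\<in>B. y = x + c 0 * x'" if "y \<in> V" for y
    using that unfolding V_def splus_def by auto
  have V_I: "x + c 0 * x' \<in> V" if "x \<in> B" "x' \<in> B" for x x'
    using that unfolding V_def by (intro splusI) auto
  have Va: "a i * y \<in> V" if i: "0 < i" "Suc i < k" and "y \<in> V" for i y
    using V_E[OF that(3)] i by (auto simp: distrib_left c0_a[symmetric] intro!: V_I B_op)
  have Vc: "c i * y \<in> V" if i: "i < k" and "y \<in> V" for i y
  proof -
    obtain x x' where y: "x \<in> B" "x' \<in> B" "y = x + c 0 * x'" using V_E[OF \<open>y \<in> V\<close>] by blast
    show ?thesis
    proof (cases "i = 0")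
      case True
      have "c i * y = \<kappa> \<epsilon> * x' + c 0 * x"
        using k y True by (simp add: distrib_left mult.assoc[symmetric] A.c_sq)
      then show ?thesis using V_I[of "\<kappa> \<epsilon> * x'" x] y subD(3)[OF sB] by simp
    next
      case False
      then have "c i * y = c i * x + c 0 * (- (c i * x'))"
        using c0_c[of i x'] i y by (simp add: distrib_left)
      then show ?thesis using V_I[of "c i * x" "- (c i * x')"] y B_op False i sub_uminus[OF sB] by simp
    qed
  qed
  have "Z k \<subseteq> K.L.U 0 V" unfolding Z_def
  proof (rule clo_least[OF K.L.sub_U[OF sV]])
    have "y \<in> V" if "y \<in> DR k" for y
    proof -
      have "y \<in> B" unfolding B_def by (rule clo.base[OF that])
      then show ?thesis using V_I[of y 0] subD(1)[OF sB] by simp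
    qed
    then show "DR k \<subseteq> K.L.U 0 V" by (blast intro: clo.base)
    fix h y assume y: "y \<in> K.L.U 0 V" and "h \<in> LAk k \<union> LCk k"
    from this(2) show "h y \<in> K.L.U 0 V"
      using K.L.U_T[OF y] K.L_c_stable[OF sV Vc y] by auto
  qed
  then have xU: "x \<in> K.L.U 0 V" using x by auto
  have eV: "e * y = 0" if "y \<in> V" for y
    using V_E[OF that] by (auto simp: distrib_left eB ecB)
  have "0 \<in> W" using subD(1)[OF sW] .
  show ?thesis
  proof (cases "k = 1")
    case True
    then have "K.L.U 0 V = V" by (intro K.L.U_trivial[OF sV]) auto
    then show ?thesis using xU eV \<open>0 \<in> W\<close> by simp
  next
    case False
    have "K.L.U 0 V \<subseteq> K.L.U (Suc 0) V \<oplus>\<^sub>s K.L.U (Suc 0) (K.L.sT 0 1 ` V)"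
      by (rule K.L.U_structure[OF sV]) (use False k Va in auto)
    moreover have "K.L.U (Suc 0) V = V" by (rule K.L.U_trivial[OF sV]) (use Va in auto)
    moreover have "K.L.sT 0 1 = (\<lambda>x. a 0 * x)" by auto
    ultimately have "x \<in> V \<oplus>\<^sub>s K.L.U (Suc 0) ((\<lambda>x. a 0 * x) ` V)" using xU by auto
    then obtain y y' where y: "y \<in> V" "y' \<in> K.L.U (Suc 0) ((\<lambda>x. a 0 * x) ` V)" "x = y + y'"
      using splusD by blast
    have "e * y' \<in> W"
    proof (rule clo_into[OF y(2) lin_left sW])
      fix v assume "v \<in> (\<lambda>x. a 0 * x) ` V"
      then obtain x x' where v: "x \<in> B" "x' \<in> B" "v = a 0 * (x + c 0 * x')" using V_E by blast
      obtain y y' where e: "x = e * y" "x' = e * y'" using B_e v by metis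
      have "e * v = x + c 1 * x'"
        using False k by (simp add: v(3) distrib_left A.tails(3) e_tails e e_simps)
      also have "\<dots> \<in> W" using v BW False k subD(2)[OF sW] bimodD(3)[OF W(1)] by auto
      finally show "e * v \<in> W" .
    next
      fix g v assume "e * v \<in> W" "g \<in> (\<lambda>i x. a i * x) ` {Suc 0..<k - 1}"
      then show "e * g v \<in> W" using k by (auto simp: e_a bimodD[OF W(1)])
    qed
    then show ?thesis using eV[OF y(1)] by (simp add: y distrib_left)
  qed
qed

text \<open>\<open>U_structure\<close> splits the left cosets of each side by whether the strand at
  the wall is an end of a cup. The four combinations are \<open>e_Z\<close>, \<open>e_SA_Z\<close>,
  \<open>e_SB_Z\<close> and \<open>e_SA_SB_Z\<close>; only the last leaves the layer.\<close>

lemma e_P: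
  assumes W: "bimod W" "D k \<in> W" "k < r ==> k < s ==> D (Suc k) \<in> W"
    and k: "k \<le> r" "k \<le> s" and x: "x \<in> P k"
  shows "e * x \<in> W"
proof -
  note sW = bimodD(1)[OF W(1)]
  note Zl = Z_left[OF k]
  define X where "X = B.L.U 0 (Z k)"
  have sX: "sub X" unfolding X_def by (rule B.L.sub_U[OF sub_Z])
  have Xd: "d i * y \<in> X" if "Suc i < s" "y \<in> X" for i y
    using B.L.U_T[of y 0 "Z k" i] that by (simp add: X_def)
  have Xf: "f i * y \<in> X" if "i < s" "y \<in> X" for i y
    using that unfolding X_def by (intro B.L_c_stable[OF sub_Z]) (rule Zl)
  have Xl: "l * y \<in> X" if "y \<in> X" "\<And>y. y \<in> Z k ==> l * y \<in> Z k" "\<And>i. Suc i < s ==> l * d i = d i * l" for l y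
  proof (rule clo_into[OF that(1)[unfolded X_def] lin_left sX])
    show "l * y \<in> X" if "y \<in> Z k" for y unfolding X_def using \<open>\<And>y. y \<in> Z k ==> l * y \<in> Z k\<close>[OF that] by (rule clo.base)
    fix g y assume "g \<in> LD" "l * y \<in> X"
    then show "l * g y \<in> X" using Xd by (auto simp: comm_tail[OF that(3)])
  qed
  have Xa: "a i * y \<in> X" if "Suc i < r" "Suc i \<noteq> k" "y \<in> X" for i y
    using that by (intro Xl Zl) (auto simp: ad)
  have Xc: "c i * y \<in> X" if "i < r" "y \<in> X" for i y
    using that by (intro Xl Zl) (auto simp: dc)
  have Xr: "rstable X" unfolding X_def by (rule rstable_clo[OF Z_rstable]) auto
  define Y where "Y = A.L.U 0 X"
  have sY: "sub Y" unfolding Y_def by (rule A.L.sub_U[OF sX])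
  have Ya: "a i * y \<in> Y" if "Suc i < r" "y \<in> Y" for i y
    using A.L.U_T[of y 0 X i] that by (simp add: Y_def)
  have Yc: "c i * y \<in> Y" if "i < r" "y \<in> Y" for i y
    using that unfolding Y_def by (intro A.L_c_stable[OF sX]) (rule Xc)
  have Yl: "l * y \<in> Y" if "y \<in> Y" "\<And>y. y \<in> X ==> l * y \<in> X" "\<And>i. Suc i < r ==> l * a i = a i * l" for l y
  proof (rule clo_into[OF that(1)[unfolded Y_def] lin_left sY])
    show "l * y \<in> Y" if "y \<in> X" for y unfolding Y_def using \<open>\<And>y. y \<in> X ==> l * y \<in> X\<close>[OF that] by (rule clo.base)
    fix g y assume "g \<in> LA" "l * y \<in> Y"
    then show "l * g y \<in> Y" using Ya by (auto simp: comm_tail[OF that(3)])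
  qed
  have Yd: "d i * y \<in> Y" if "Suc i < s" "y \<in> Y" for i y
    using that by (intro Yl Xd) (auto simp: ad)
  have Yf: "f i * y \<in> Y" if "i < s" "y \<in> Y" for i y
    using that by (intro Yl Xf) (auto simp: af)
  have Yr: "rstable Y" unfolding Y_def by (rule rstable_clo[OF Xr]) auto
  have "bimod Y" using sY Yr Ya Yc Yd Yf unfolding bimod_def rstable_def by blast
  moreover have "D k \<in> Y" unfolding Y_def X_def by (intro clo.base DR_Z D_DR)
  ultimately have xY: "x \<in> Y" using P_least x by blast
  have sub_eZ: "e * y \<in> W" if "0 < k" "y \<in> Z k" for y
    by (rule e_Z[OF W(1,2) that(1) k that(2)])
  have split_d: "g y \<in> W" if y: "y \<in> X" "lin g" "\<And>i y. 0 < i ==> Suc i < s ==> g (d i * y) = d i * g y"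
    "\<And>y. y \<in> Z k ==> g y \<in> W" "\<And>y. k < s ==> y \<in> Z k ==> g (SB 0 k y) \<in> W" "0 < k" for g y
  proof -
    have into: "g v \<in> W" if "v \<in> B.L.U (Suc 0) V" "\<And>v. v \<in> V ==> g v \<in> W" for v V
    proof (rule clo_into[OF that(1) y(2) sW that(2)])
      fix h v assume "g v \<in> W" "h \<in> (\<lambda>i x. d i * x) ` {Suc 0..<s - 1}"
      then show "g (h v) \<in> W" using y(3) bimodD(4)[OF W(1)] by auto
    qed
    show ?thesis
    proof (cases "k < s")
      case True
      have "X \<subseteq> B.L.U (Suc 0) (Z k) \<oplus>\<^sub>s B.L.U (Suc 0) (SB 0 k ` Z k)" unfolding X_def
        by (rule B.L.U_structure[OF sub_Z]) (use True \<open>0 < k\<close> Zl(3) in auto)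
      then obtain v v' where v: "v \<in> B.L.U (Suc 0) (Z k)" "v' \<in> B.L.U (Suc 0) (SB 0 k ` Z k)" "y = v + v'"
        using splusD y(1) by blast
      have "g v \<in> W" by (rule into[OF v(1) y(4)])
      moreover have "g v' \<in> W" by (rule into[OF v(2)]) (use y(5) True in auto)
      ultimately show ?thesis using subD(2)[OF sW] y(2) by (simp add: v(3) linD)
    next
      case False
      then have "X = Z k" unfolding X_def using Zl(3) k by (intro B.L.U_trivial[OF sub_Z]) auto
      then show ?thesis using y by simp
    qed
  qed
  have split_a: "e * y \<in> W" if y: "y \<in> Y" "0 < k" "\<And>y. y \<in> X ==> e * y \<in> W" "\<And>y. k < r ==> y \<in> X ==> e * SA 0 k y \<in> W" for y
  proof -
    have into: "e * v \<in> W" if "v \<in> A.L.U (Suc 0) V" "\<And>v. v \<in> V ==> e * v \<in> W" for v V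
    proof (rule clo_into[OF that(1) lin_left sW that(2)])
      fix h v assume "e * v \<in> W" "h \<in> (\<lambda>i x. a i * x) ` {Suc 0..<r - 1}"
      then show "e * (h v) \<in> W" using bimodD(2)[OF W(1)] by (auto simp: e_tails)
    qed
    show ?thesis
    proof (cases "k < r")
      case True
      have "Y \<subseteq> A.L.U (Suc 0) X \<oplus>\<^sub>s A.L.U (Suc 0) (SA 0 k ` X)" unfolding Y_def
        by (rule A.L.U_structure[OF sX]) (use True \<open>0 < k\<close> Xa in auto)
      then obtain v v' where v: "v \<in> A.L.U (Suc 0) X" "v' \<in> A.L.U (Suc 0) (SA 0 k ` X)" "y = v + v'"
        using splusD y(1) by blast
      have "e * v \<in> W" by (rule into[OF v(1) y(3)])
      moreover have "e * v' \<in> W" by (rule into[OF v(2)]) (use y(4) True in auto)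
      ultimately show ?thesis using subD(2)[OF sW] by (simp add: v(3) distrib_left)
    next
      case False
      then have "Y = X" unfolding Y_def using Xa k by (intro A.L.U_trivial[OF sX]) auto
      then show ?thesis using y by simp
    qed
  qed
  show ?thesis
  proof (cases "k = 0")
    case True
    have "X = Z k" unfolding X_def using Zl(3) True by (intro B.L.U_trivial[OF sub_Z]) auto
    moreover have "Y = X" unfolding Y_def using Xa True by (intro A.L.U_trivial[OF sX]) auto
    ultimately have "x \<in> Z k" using xY by simp
    then show ?thesis
    proof (rule Z_into[OF _ bimod_rstable[OF W(1)] lin_left mult.assoc[symmetric]])
      show "e * D k \<in> W"
      proof (cases "0 < r \<and> 0 < s")
        case True
        then have "D 1 \<in> W" using W(3) \<open>k = 0\<close> by simp
        moreover have "e * D k = D 1" using \<open>k = 0\<close> by simp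
        ultimately show ?thesis by simp
      next
        case False
        then show ?thesis using e_triv subD(1)[OF sW] by auto
      qed
    qed (use True in auto)
  next
    case False
    then have k0: "0 < k" by simp
    show ?thesis
    proof (rule split_a[OF xY k0])
      show "e * y \<in> W" if "y \<in> X" for y
        by (rule split_d[OF that lin_left _ _ _ k0])
          (use k k0 sub_eZ e_SB_Z[OF W(1,2)] in \<open>auto simp: e_tails\<close>)
      show "e * SA 0 k y \<in> W" if "k < r" "y \<in> X" for y
      proof (rule split_d[OF that(2) lin_comp[OF lin_left A.L.lin_sT] _ _ _ k0])
        show "0 + k \<le> r - 1" using that by simp
        show "e * SA 0 k (d i * y) = d i * (e * SA 0 k y)" if "0 < i" "Suc i < s" for i y
          using that \<open>k < r\<close> by (simp add: S_mixed e_tails)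
        show "e * SA 0 k y \<in> W" if "y \<in> Z k" for y
          by (rule e_SA_Z[OF W(1,2) k0 \<open>k < r\<close> k(2) that])
        show "e * SA 0 k (SB 0 k y) \<in> W" if "k < s" "y \<in> Z k" for y
          using e_SA_SB_Z[OF W(1) W(3) \<open>k < r\<close> that(1) that(2)] \<open>k < r\<close> that by simp
      qed
    qed
  qed
qed

section \<open>The filtration by turnbacks and its size\<close>

primrec Psum :: "nat => 'a set" where
  "Psum 0 = P 0"
| "Psum (Suc k) = Psum k \<oplus>\<^sub>s P (Suc k)"

lemma bimodD_right:
  assumes "bimod W"
  shows "x \<in> W ==> Suc i < r ==> x * a i \<in> W" "x \<in> W ==> i < r ==> x * c i \<in> W"
    "x \<in> W ==> Suc i < s ==> x * d i \<in> W" "x \<in> W ==> i < s ==> x * f i \<in> W"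
  using assms by (auto simp: bimod_def)

lemma Psum_bimod: "bimod (Psum k)"
proof (induction k)
  case (Suc k)
  have "sub (Psum (Suc k))" using Suc P_bimod[of "Suc k"] by (auto simp: bimod_def intro: sub_splus)
  moreover have l: "y * x \<in> Psum (Suc k)" if "x \<in> Psum (Suc k)" "\<And>x. x \<in> Psum k ==> y * x \<in> Psum k"
    "\<And>x. x \<in> P (Suc k) ==> y * x \<in> P (Suc k)" for x y
    using that splusD[of x "Psum k" "P (Suc k)"] by (auto simp: distrib_left intro!: splusI)
  moreover have m: "x * y \<in> Psum (Suc k)" if "x \<in> Psum (Suc k)" "\<And>x. x \<in> Psum k ==> x * y \<in> Psum k"
    "\<And>x. x \<in> P (Suc k) ==> x * y \<in> P (Suc k)" for x y
    using that splusD[of x "Psum k" "P (Suc k)"] by (auto simp: distrib_right intro!: splusI)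
  moreover have "(Suc i < r \<longrightarrow> a i * x \<in> Psum (Suc k) \<and> x * a i \<in> Psum (Suc k)) \<and>
      (i < r \<longrightarrow> c i * x \<in> Psum (Suc k) \<and> x * c i \<in> Psum (Suc k)) \<and>
      (Suc i < s \<longrightarrow> d i * x \<in> Psum (Suc k) \<and> x * d i \<in> Psum (Suc k)) \<and>
      (i < s \<longrightarrow> f i * x \<in> Psum (Suc k) \<and> x * f i \<in> Psum (Suc k))" if "x \<in> Psum (Suc k)" for x i
    by (intro conjI impI l[OF that] m[OF that] bimodD[OF Suc] bimodD[OF P_bimod] bimodD_right[OF Suc] bimodD_right[OF P_bimod])
  ultimately show ?case unfolding bimod_def by blast
qed (simp add: P_bimod)

lemma D_P: "D k \<in> P k" unfolding P_def by (rule clo.base[OF D_line])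

lemma P_Psum: "x \<in> P k ==> k \<le> n ==> x \<in> Psum n"
proof (induction n)
  case (Suc n)
  have "sub (Psum n)" "sub (P (Suc n))" using Psum_bimod P_bimod by (auto simp: bimod_def)
  then show ?case using Suc by (cases "k = Suc n") (auto intro: splus_left splus_right)
qed simp

lemma e_Psum:
  assumes "x \<in> Psum (min r s)" shows "e * x \<in> Psum (min r s)"
proof -
  note bm = Psum_bimod[of "min r s"]
  have eP: "e * y \<in> Psum (min r s)" if "y \<in> P k" "k \<le> min r s" for k y
    by (rule e_P[OF bm]) (use that in \<open>auto intro: P_Psum[OF D_P] simp del: D.simps\<close>)
  have "e * x \<in> Psum (min r s)" if "x \<in> Psum k" "k \<le> min r s" for k
    using that
  proof (induction k arbitrary: x)
    case (Suc k)
    from splusD[OF Suc.prems(1)[unfolded Psum.simps]]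
    obtain y y' where y: "y \<in> Psum k" "y' \<in> P (Suc k)" "x = y + y'" by blast
    then show ?case using Suc.IH[of y] eP[of y' "Suc k"] Suc.prems subD(2)[OF bimodD(1)[OF bm]]
      by (simp add: distrib_left)
  qed (use eP in auto)
  then show ?thesis using assms by blast
qed

text \<open>The products (r choose k)(s choose k) sum to (r + s choose s) by Vandermonde's identity,
  and the factor r! s! completes this to (r + s)!.\<close>

lemma fsp_Psum: "fsp (fact (r + s) * 2 ^ (r + s)) (Psum (min r s))"
proof -
  let ?N = "2 ^ (r + s) * (fact r * fact s) :: nat"
  have "fsp (\<Sum>k\<le>n. (r choose k) * (s choose k) * ?N) (Psum n)" if "n \<le> min r s" for n
    using that
  proof (induction n)
    case 0
    then show ?case using fsp_P[of 0] by simp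
  next
    case (Suc n)
    then have "fsp (\<Sum>k\<le>n. (r choose k) * (s choose k) * ?N) (Psum n)" by simp
    then show ?case using fsp_splus[OF _ fsp_P[of "Suc n"]] Suc.prems
      by (simp only: sum.atMost_Suc Psum.simps)
  qed
  from this[of "min r s"] have "fsp (\<Sum>k\<le>min r s. (r choose k) * (s choose k) * ?N) (Psum (min r s))" by simp
  moreover have "(\<Sum>k\<le>min r s. (r choose k) * (s choose k) * ?N) = fact (r + s) * 2 ^ (r + s)"
  proof -
    have "(\<Sum>k\<le>min r s. (r choose k) * (s choose k)) = (\<Sum>k\<le>s. (r choose k) * (s choose (s - k)))"
      by (rule sum.mono_neutral_cong_left) (auto simp: binomial_symmetric[symmetric])
    also have "\<dots> = (r + s) choose s" by (rule vandermonde)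
    finally have "(\<Sum>k\<le>min r s. (r choose k) * (s choose k) * ?N) = ((r + s) choose s) * ?N"
      by (simp add: sum_distrib_right[symmetric])
    moreover have "fact s * fact (r + s - s) * ((r + s) choose s) = (fact (r + s) :: nat)"
      by (rule binomial_fact_lemma) simp
    ultimately show ?thesis by (simp add: ac_simps)
  qed
  ultimately show ?thesis by simp
qed

end

section \<open>The walled superalgebra inside a ring of sections\<close>

lemma quotient_superalg_ops:
  fixes T E plus0 zero0 times0 one0 scale0 H
  defines "Q \<equiv> quotient_superalg T E plus0 zero0 times0 one0 scale0 H"
  assumes eqv: "equiv T E"
    and ac: "\<And>x x' y y'. (x,x') \<in> E ==> (y,y') \<in> E ==> (plus0 x y, plus0 x' y') \<in> E"
    and mc: "\<And>x x' y y'. (x,x') \<in> E ==> (y,y') \<in> E ==> (times0 x y, times0 x' y') \<in> E"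
    and sc: "\<And>x x' c. (x,x') \<in> E ==> (scale0 c x, scale0 c x') \<in> E"
  shows "x \<in> T ==> y \<in> T ==> E `` {x} \<oplus>\<^bsub>Q\<^esub> E `` {y} = E `` {plus0 x y}"
    and "x \<in> T ==> y \<in> T ==> E `` {x} \<otimes>\<^bsub>Q\<^esub> E `` {y} = E `` {times0 x y}"
    and "x \<in> T ==> scal Q c (E `` {x}) = E `` {scale0 c x}"
proof -
  assume x: "x \<in> T"
  have "(\<Union>a\<in>E `` {x}. E `` {scale0 c a}) = E `` {scale0 c x}"
    by (rule UN_equiv_class[OF eqv _ x])
     (auto simp: congruent_def intro!: equiv_class_eq[OF eqv] sc)
  then show "scal Q c (E `` {x}) = E `` {scale0 c x}" by (simp add: Q_def quotient_superalg_def)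
next
  assume x: "x \<in> T" and y: "y \<in> T"
  have "(\<Union>a\<in>E `` {x}. \<Union>b\<in>E `` {y}. E `` {plus0 a b}) = E `` {plus0 x y}"
    by (rule UN_equiv_class2[OF eqv eqv _ x y])
     (auto simp: congruent2_def intro!: equiv_class_eq[OF eqv] ac)
  then show "E `` {x} \<oplus>\<^bsub>Q\<^esub> E `` {y} = E `` {plus0 x y}" by (simp add: Q_def quotient_superalg_def)
  have "(\<Union>a\<in>E `` {x}. \<Union>b\<in>E `` {y}. E `` {times0 a b}) = E `` {times0 x y}"
    by (rule UN_equiv_class2[OF eqv eqv _ x y])
     (auto simp: congruent2_def intro!: equiv_class_eq[OF eqv] mc)
  then show "E `` {x} \<otimes>\<^bsub>Q\<^esub> E `` {y} = E `` {times0 x y}" by (simp add: Q_def quotient_superalg_def)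
qed

lemma BC_ops:
  assumes "x \<in> bcterms r s" "y \<in> bcterms r s"
  shows "bc_class r s z x \<oplus>\<^bsub>BC r s z\<^esub> bc_class r s z y = bc_class r s z (x \<boxplus> y)"
    and "bc_class r s z x \<otimes>\<^bsub>BC r s z\<^esub> bc_class r s z y = bc_class r s z (x \<cdot> y)"
    and "scal (BC r s z) c (bc_class r s z x) = bc_class r s z (c *\<^sub>a x)"
  unfolding BC_def presented_superalg_def bc_class_def
  by (rule quotient_superalg_ops[OF acong_equiv]; blast intro: acong.add_cong acong.mul_cong acong.scale_cong assms)+

lemma BC_consts:
  "\<zero>\<^bsub>BC r s z\<^esub> = bc_class r s z AZero" "\<one>\<^bsub>BC r s z\<^esub> = bc_class r s z AOne"
  "carrier (BC r s z) = bc_class r s z ` bcterms r s"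
  "part (BC r s z) p = bc_class r s z ` {x \<in> bcterms r s. ahomog bcpar p x}"
  by (auto simp: BC_def presented_superalg_def quotient_superalg_def bc_class_def quotient_def)

lemma bc_class_eq: "x \<in> bcterms r s ==> y \<in> bcterms r s ==>
    bc_class r s z x = bc_class r s z y \<longleftrightarrow> (x, y) \<in> bccong r s z"
  unfolding bc_class_def by (rule eq_equiv_class_iff[OF acong_equiv])

text \<open>All algebras \<open>BC r s z\<close> at once: sections over the parameters \<open>(r, s, z)\<close> form a ring, so that
  type class reasoning applies to each of them.\<close>

typedef (overloaded) 'k bca = "{F :: nat \<times> nat \<times> 'k::comm_ring_1 => 'k bcterm set. \<forall>r s z. F (r, s, z) \<in> carrier (BC r s z)}"
proof -
  have "(\<lambda>(r, s, z). bc_class r s z AZero) \<in> {F :: nat \<times> nat \<times> 'k => 'k bcterm set. \<forall>r s z. F (r, s, z) \<in> carrier (BC r s z)}"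
    by (auto simp: BC_consts)
  then show ?thesis by blast
qed

setup_lifting type_definition_bca

lemma BC_ring: "ring (BC r s z)"
  by (rule superalgebra.axioms(1)[OF BC_superalgebra])

instantiation bca :: (comm_ring_1) "{zero, plus, times, uminus, minus}"
begin
lift_definition zero_bca :: "'a bca" is "\<lambda>(r, s, z). \<zero>\<^bsub>BC r s z\<^esub>" by (simp add: ring.ring_simprules BC_ring)
lift_definition plus_bca :: "'a bca => 'a bca => 'a bca"
  is "\<lambda>F G (r, s, z). F (r, s, z) \<oplus>\<^bsub>BC r s z\<^esub> G (r, s, z)" by (simp add: ring.ring_simprules BC_ring)
lift_definition times_bca :: "'a bca => 'a bca => 'a bca"
  is "\<lambda>F G (r, s, z). F (r, s, z) \<otimes>\<^bsub>BC r s z\<^esub> G (r, s, z)" by (simp add: ring.ring_simprules BC_ring)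
lift_definition uminus_bca :: "'a bca => 'a bca"
  is "\<lambda>F (r, s, z). \<ominus>\<^bsub>BC r s z\<^esub> F (r, s, z)" by (simp add: ring.ring_simprules BC_ring)
definition minus_bca :: "'a bca => 'a bca => 'a bca" where "minus_bca x y = x + - y"
instance ..
end

instance bca :: (comm_ring_1) ring
proof
  fix a b c :: "'a bca"
  note [simp] = ring.ring_simprules[OF BC_ring] fun_eq_iff
  show "a + b + c = a + (b + c)" by transfer simp
  show "a + b = b + a" by transfer (simp add: ring.ring_simprules(10)[OF BC_ring])
  show "0 + a = a" by transfer simp
  show "- a + a = 0" by transfer simp
  show "a - b = a + - b" by (simp add: minus_bca_def)
  show "a * b * c = a * (b * c)" by transfer simp
  show "(a + b) * c = a * c + b * c" by transfer simp
  show "a * (b + c) = a * b + a * c" by transfer simp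
qed

text \<open>The section supported at one triple. In the ring of all sections the class of 1 at that
  triple is only an idempotent, which is why scalars were allowed to be non-unital.\<close>

lift_definition single :: "nat => nat => 'k => 'k::comm_ring_1 bcterm => 'k bca"
  is "\<lambda>r s z t (r', s', z'). if r' = r \<and> s' = s \<and> z' = z \<and> t \<in> bcterms r s
    then bc_class r s z t else \<zero>\<^bsub>BC r' s' z'\<^esub>"
  by (auto simp: BC_consts)

context
  fixes r s :: nat and z :: "'k::comm_ring_1"
begin

abbreviation "terms \<equiv> bcterms r s :: 'k bcterm set"
abbreviation "sg \<equiv> single r s z"

lemma single_eq: "x \<in> terms ==> y \<in> terms ==>
    sg x = sg y \<longleftrightarrow> (x, y) \<in> bccong r s z"
  by (transfer fixing: r s z) (auto simp: fun_eq_iff bc_class_eq[symmetric])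

lemma single_ops:
  "x \<in> terms ==> y \<in> terms ==> sg (x \<cdot> y) = sg x * sg y"
  "x \<in> terms ==> y \<in> terms ==> sg (x \<boxplus> y) = sg x + sg y"
  "sg AZero = 0"
  by (transfer fixing: r s z; auto simp: fun_eq_iff BC_ops ring.ring_simprules BC_ring BC_consts(1)[symmetric])+

definition bk :: "'k => 'k bca" where "bk c = sg (c *\<^sub>a AOne)"

lemma bk_scale: "x \<in> terms ==> sg (c *\<^sub>a x) = bk c * sg x"
proof -
  assume x: "x \<in> terms"
  have "(c *\<^sub>a AOne \<cdot> x, c *\<^sub>a x) \<in> bccong r s z"
    by (rule acong.trans[OF acong.scale_mul]) (simp_all add: x acong.scale_cong acong.one_mul)
  then have "sg (c *\<^sub>a AOne \<cdot> x) = sg (c *\<^sub>a x)" by (simp add: single_eq x)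
  then show ?thesis by (simp add: bk_def single_ops x)
qed

lemma single_one: "sg AOne = bk 1"
proof -
  have "(1 *\<^sub>a AOne, AOne) \<in> bccong r s z" by (intro acong.one_scale) simp
  then show ?thesis by (simp add: bk_def single_eq[symmetric])
qed

lemma bk_central: "central_scalars bk"
proof
  show "bk (p + q) = bk p + bk q" for p q
  proof -
    have "((p + q) *\<^sub>a AOne, p *\<^sub>a AOne \<boxplus> q *\<^sub>a AOne) \<in> bccong r s z"
      by (intro acong.add_scale) simp
    then show ?thesis by (simp add: bk_def single_ops[symmetric] single_eq)
  qed
  show "bk (p * q) = bk p * bk q" for p q
  proof -
    have "(p *\<^sub>a q *\<^sub>a AOne, (p * q) *\<^sub>a AOne) \<in> bccong r s z"
      by (intro acong.scale_scale) simp
    then have "sg (p *\<^sub>a q *\<^sub>a AOne) = bk (p * q)" by (simp add: bk_def single_eq)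
    moreover have "sg (p *\<^sub>a q *\<^sub>a AOne) = bk p * bk q" unfolding bk_def[of q] by (rule bk_scale) simp
    ultimately show ?thesis by simp
  qed
  show "x * bk p = bk p * x" for x p
  proof -
    define F where "F = Rep_bca x"
    have F: "\<forall>r s z. F (r, s, z) \<in> carrier (BC r s z)" using Rep_bca[of x] by (simp add: F_def)
    have "F (r, s, z) \<in> carrier (BC r s z)" using F by blast
    then obtain t where t: "t \<in> terms" "F (r, s, z) = bc_class r s z t" unfolding BC_consts by blast
    have "(t \<cdot> (p *\<^sub>a AOne), p *\<^sub>a t) \<in> bccong r s z"
      by (rule acong.trans[OF acong.mul_scale]) (simp_all add: t acong.scale_cong acong.mul_one)
    moreover have "(p *\<^sub>a t, p *\<^sub>a AOne \<cdot> t) \<in> bccong r s z"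
      by (rule acong.sym, rule acong.trans[OF acong.scale_mul]) (simp_all add: t acong.scale_cong acong.one_mul)
    ultimately have "bc_class r s z (t \<cdot> (p *\<^sub>a AOne)) = bc_class r s z (p *\<^sub>a AOne \<cdot> t)"
      by (simp add: bc_class_eq t) (blast intro: acong.trans)
    then have "Rep_bca (x * bk p) = Rep_bca (bk p * x)"
      using F by (auto simp: fun_eq_iff bk_def times_bca.rep_eq single.rep_eq F_def[symmetric] BC_ops t ring.ring_simprules BC_ring)
    then show ?thesis by (simp only: Rep_bca_inject)
  qed
qed

definition ba :: "nat => 'k bca" where "ba i = sg (bt_inv z (r - 1 - i))"
definition bc :: "nat => 'k bca" where "bc i = sg (bp (r - i))"
definition bd :: "nat => 'k bca" where "bd i = sg (bts (Suc i))"
definition bf :: "nat => 'k bca" where "bf i = sg (bps (Suc i))"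
definition bE :: "'k bca" where "bE = sg (if 0 < r \<and> 0 < s then be else AZero)"

lemma single_rel:
  assumes "(x, y) \<in> bcrels r z" "x \<in> terms" "y \<in> terms"
  shows "sg x = sg y"
  using assms by (simp add: single_eq acong.rel)

interpretation bk: central_scalars bk by (rule bk_central)

lemma bk_sg: "x \<in> terms ==> bk 1 * sg x = sg x"
  using single_ops(1)[of AOne x] single_eq[of "AOne \<cdot> x" x] by (simp add: single_one[symmetric] acong.one_mul)

lemma bk_sg': "x \<in> terms ==> sg x * bk 1 = sg x"
  using bk_sg by (simp add: bk.\<kappa>_comm[of "sg x"])

lemmas sg_simps = single_ops bk_scale single_one

lemma bt_inv_terms: "bt_inv z i \<in> terms \<longleftrightarrow> BT i \<in> bcgens r s"
  by (simp add: bt_inv_def)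

lemma bt_sq: "0 < i ==> i < r ==> sg (bt i) * sg (bt i) = bk z * sg (bt i) + bk 1"
  using single_rel[OF bcrels.intros(1)[of i z r]] by (simp add: sg_simps)

lemma sg_bt_inv: "0 < i ==> i < r ==> sg (bt_inv z i) = sg (bt i) - bk z"
  by (simp add: bt_inv_def sg_simps bk.\<kappa>_uminus bk.\<kappa>_mult[symmetric])

lemma bt_inv:
  assumes "0 < i" "i < r"
  shows "sg (bt i) * sg (bt_inv z i) = bk 1" "sg (bt_inv z i) * sg (bt i) = bk 1"
  using assms by (simp_all add: sg_bt_inv left_diff_distrib right_diff_distrib bt_sq bk.\<kappa>_comm[of "sg _"])

lemma conj_by_inverse:
  assumes "t * t' = bk 1" "t' * t = bk 1" "t * x = y * t" "bk 1 * x = x" "bk 1 * y = y"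
  shows "t' * y = x * t'"
proof -
  have "t' * (t * x) * t' = t' * (y * t) * t'" by (simp add: assms(3))
  moreover have "t' * (t * x) = x" by (simp add: mult.assoc[symmetric] assms(2,4))
  moreover have "y * t * t' = y" by (simp add: mult.assoc assms(1,5) bk.\<kappa>_comm[of y])
  ultimately show ?thesis by (simp add: mult.assoc)
qed

lemma hcfam_up: "hcfam bk r z (- 1) ba bc"
proof (rule hcfam.intro[OF bk_central hcfam_axioms.intro])
  fix i j
  show "Suc i < r ==> bk 1 * ba i = ba i" by (simp add: ba_def bk_sg bt_inv_terms)
  show "i < r ==> bk 1 * bc i = bc i" by (simp add: bc_def bk_sg)
  show "ba i * ba i = bk 1 - bk z * ba i" if "Suc i < r"
  proof -
    have "ba i * sg (bt (r - 1 - i)) = bk 1" using that by (simp add: ba_def bt_inv)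
    then have "ba i * ba i = bk 1 - ba i * bk z"
      using that sg_bt_inv[of "r - 1 - i"] by (simp add: ba_def right_diff_distrib)
    then show ?thesis by (simp only: bk.\<kappa>_comm[of "ba i"])
  qed
  show "ba i * (ba (Suc i) * ba i) = ba (Suc i) * (ba i * ba (Suc i))" if "Suc (Suc i) < r"
  proof -
    define k where "k = r - 2 - i"
    have k: "0 < k" "Suc k < r" "r - 1 - i = Suc k" "r - 1 - Suc i = k" using that by (auto simp: k_def)
    let ?t = "sg (bt k)" and ?t' = "sg (bt (Suc k))"
    have br: "?t * (?t' * ?t) = ?t' * (?t * ?t')"
      using single_rel[OF bcrels.intros(3)[of k r z]] k by (simp add: sg_simps mult.assoc)
    have sq: "?t * ?t = bk z * ?t + bk 1" "?t' * ?t' = bk z * ?t' + bk 1" using bt_sq k by auto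
    have u: "bk 1 * ?t = ?t" "bk 1 * ?t' = ?t'" using k by (simp_all add: bk_sg)
    have z: "bk z * bk 1 = bk z" by (simp add: bk.\<kappa>_mult[symmetric])
    show ?thesis
      using br k by (simp add: ba_def sg_bt_inv right_diff_distrib left_diff_distrib distrib_left distrib_right mult.assoc sq
          bk.\<kappa>_comm[of ?t] bk.\<kappa>_comm[of ?t'] bk.\<kappa>_left_comm[of ?t] bk.\<kappa>_left_comm[of ?t'] u z)
  qed
  show "ba j * ba i = ba i * ba j" if "Suc i < j" "Suc j < r"
  proof -
    define k l where "k = r - 1 - i" and "l = r - 1 - j"
    have kl: "0 < k" "0 < l" "k < r" "l < r" "l + 1 < k" using that by (auto simp: k_def l_def)
    have "sg (bt k) * sg (bt l) = sg (bt l) * sg (bt k)"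
      using single_rel[OF bcrels.intros(5)[of k l r z]] kl by (simp add: sg_simps)
    then show ?thesis using kl unfolding ba_def k_def[symmetric] l_def[symmetric]
      by (simp add: sg_bt_inv left_diff_distrib right_diff_distrib bk.\<kappa>_comm[of "sg _"])
  qed
  show "bc i * bc i = bk (- 1)" if "i < r"
    using that single_rel[OF bcrels.intros(8)[of "r - i" r z]]
    by (simp add: bc_def sg_simps bk.\<kappa>_mult[symmetric])
  show "bc i * bc j = - (bc j * bc i)" if "i < r" "j < r" "i \<noteq> j"
  proof -
    have "r - i \<noteq> r - j" using that by auto
    then show ?thesis
      using that single_rel[OF bcrels.intros(9)[of "r - i" "r - j" r z]]
      by (simp add: bc_def sg_simps bk.\<kappa>_uminus mult.assoc[symmetric] bk_sg)
  qed
  have slide: "sg (bt k) * sg (bp k) = sg (bp (Suc k)) * sg (bt k)" if "0 < k" "k < r" for k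
    using that single_rel[OF bcrels.intros(13)[of k r z]] by (simp add: sg_simps)
  show "ba i * bc i = bc (Suc i) * ba i" if "Suc i < r"
  proof -
    define k where "k = r - 1 - i"
    have k: "0 < k" "k < r" "r - Suc i = k" "r - i = Suc k" using that by (auto simp: k_def)
    show ?thesis unfolding ba_def bc_def k_def[symmetric] k
      by (rule conj_by_inverse[OF bt_inv slide]) (use k in \<open>simp_all add: bk_sg\<close>)
  qed
  show "ba i * bc j = bc j * ba i" if "Suc i < r" "j < r" "j \<noteq> i" "j \<noteq> Suc i"
  proof -
    have "sg (bt (r - 1 - i)) * bc j = bc j * sg (bt (r - 1 - i))"
      using that single_rel[OF bcrels.intros(15)[of "r - j" "r - 1 - i" r z]]
      by (auto simp: bc_def sg_simps)
    then show ?thesis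
      using that by (simp add: ba_def sg_bt_inv left_diff_distrib right_diff_distrib bk.\<kappa>_comm[of "bc _"])
  qed
qed

lemma hcfam_down: "hcfam bk s (- z) 1 bd bf"
proof (rule hcfam.intro[OF bk_central hcfam_axioms.intro])
  fix i j
  show "Suc i < s ==> bk 1 * bd i = bd i" by (simp add: bd_def bk_sg)
  show "i < s ==> bk 1 * bf i = bf i" by (simp add: bf_def bk_sg)
  show "bd i * bd i = bk 1 - bk (- z) * bd i" if "Suc i < s"
    using that single_rel[OF bcrels.intros(2)[of "Suc i" z r]] by (simp add: bd_def sg_simps bk.\<kappa>_uminus)
  show "bd i * (bd (Suc i) * bd i) = bd (Suc i) * (bd i * bd (Suc i))" if "Suc (Suc i) < s"
    using that single_rel[OF bcrels.intros(4)[of "Suc i" r z]] by (simp add: bd_def sg_simps mult.assoc)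
  show "bd j * bd i = bd i * bd j" if "Suc i < j" "Suc j < s"
    using that single_rel[OF bcrels.intros(6)[of "Suc i" "Suc j" r z]] by (simp add: bd_def sg_simps)
  show "bf i * bf i = bk 1" if "i < s"
    using that single_rel[OF bcrels.intros(10)[of "Suc i" r z]] by (simp add: bf_def sg_simps)
  show "bf i * bf j = - (bf j * bf i)" if "i < s" "j < s" "i \<noteq> j"
    using that single_rel[OF bcrels.intros(11)[of "Suc i" "Suc j" r z]]
    by (simp add: bf_def sg_simps bk.\<kappa>_uminus mult.assoc[symmetric] bk_sg)
  show "bd i * bf i = bf (Suc i) * bd i" if "Suc i < s"
    using that single_rel[OF bcrels.intros(14)[of "Suc i" r z]] by (simp add: bd_def bf_def sg_simps)
  show "bd i * bf j = bf j * bd i" if "Suc i < s" "j < s" "j \<noteq> i" "j \<noteq> Suc i"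
    using that single_rel[OF bcrels.intros(16)[of "Suc j" "Suc i" r z]] by (simp add: bd_def bf_def sg_simps)
qed

lemma bcalg_BC: "bcalg bk r s z (- z) (- 1) 1 ba bc bd bf bE"
proof (rule bcalg.intro[OF bk_central hcfam_up hcfam_down bcalg_axioms.intro])
  fix i j
  show "bk 1 * bE = bE" by (simp add: bE_def bk_sg)
  show bE_0: "r = 0 \<or> s = 0 ==> bE = 0" by (auto simp: bE_def single_ops)
  show "ba i * bd j = bd j * ba i" if "Suc i < r" "Suc j < s"
    using that single_rel[OF bcrels.intros(7)[of "r - 1 - i" "Suc j" r z]]
    by (simp add: ba_def bd_def sg_bt_inv left_diff_distrib right_diff_distrib bk.\<kappa>_comm[of "sg _"] sg_simps)
  show "bc i * bf j = - (bf j * bc i)" if "i < r" "j < s"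
    using that single_rel[OF bcrels.intros(12)[of "r - i" "Suc j" r z]]
    by (simp add: bc_def bf_def sg_simps bk.\<kappa>_uminus mult.assoc[symmetric] bk_sg)
  show "ba i * bf j = bf j * ba i" if "Suc i < r" "j < s"
    using that single_rel[OF bcrels.intros(17)[of "r - 1 - i" "Suc j" r z]]
    by (simp add: ba_def bf_def sg_bt_inv left_diff_distrib right_diff_distrib bk.\<kappa>_comm[of "sg _"] sg_simps)
  show "bd j * bc i = bc i * bd j" if "i < r" "Suc j < s"
    using that single_rel[OF bcrels.intros(18)[of "Suc j" "r - i" r z]] by (simp add: bd_def bc_def sg_simps)
  show ee: "bE * bE = 0"
    using single_rel[OF bcrels.intros(19)[of r z]] by (simp add: bE_def sg_simps)
  \<comment> \<open>The inverse crossing is t - z, and the term with z vanishes because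
    \<open>e * e = 0\<close>.\<close>
  show "bE * (ba 0 * bE) = bE" if "Suc 0 < r"
    using that single_rel[OF bcrels.intros(20)[of r z]] ee bE_0
    by (cases "s = 0") (simp_all add: bE_def ba_def sg_simps sg_bt_inv left_diff_distrib right_diff_distrib mult.assoc bk.\<kappa>_left_comm[of "sg _"])
  show "bE * (bd 0 * bE) = bE" if "Suc 0 < s"
    using that single_rel[OF bcrels.intros(22)[of r z]] bE_0 by (cases "r = 0") (simp_all add: bE_def bd_def sg_simps mult.assoc)
  show "bE * ba i = ba i * bE" if "0 < i" "Suc i < r"
    using that single_rel[OF bcrels.intros(21)[of "r - 1 - i" r z]] bE_0
    by (cases "s = 0") (auto simp: bE_def ba_def sg_simps sg_bt_inv left_diff_distrib right_diff_distrib bk.\<kappa>_comm[of "sg _"])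
  show "bE * bd i = bd i * bE" if "0 < i" "Suc i < s"
    using that single_rel[OF bcrels.intros(23)[of "Suc i" r z]] bE_0 by (cases "r = 0") (simp_all add: bE_def bd_def sg_simps)
  show "bc 0 * bE = bf 0 * bE"
    using single_rel[OF bcrels.intros(24)[of r z]] by (simp add: bE_def bc_def bf_def sg_simps)
  show "bE * bc 0 = bE * bf 0"
    using single_rel[OF bcrels.intros(25)[of r z]] by (simp add: bE_def bc_def bf_def sg_simps)
  show "bE * bc i = bc i * bE" if "0 < i" "i < r"
    using that single_rel[OF bcrels.intros(26)[of "r - i" r z]] bE_0
    by (cases "s = 0") (simp_all add: bE_def bc_def sg_simps)
  show "bE * bf i = bf i * bE" if "0 < i" "i < s"
    using that single_rel[OF bcrels.intros(27)[of "Suc i" r z]] bE_0 by (cases "r = 0") (simp_all add: bE_def bf_def sg_simps)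
  show "bE * (bc 0 * bE) = 0"
    using single_rel[OF bcrels.intros(29)[of r z]] by (simp add: bE_def bc_def sg_simps mult.assoc)
  show "bE * (ba 0 * (bd 0 * (bE * (bd 0 * ba 0)))) = ba 0 * (bd 0 * (bE * (bd 0 * (ba 0 * bE))))"
    if "Suc 0 < r" "Suc 0 < s"
    using that single_rel[OF bcrels.intros(28)[of z r]]
    by (simp add: bE_def ba_def bd_def sg_simps bt_inv_terms mult.assoc)
qed simp

lemma bk_1_sg: "\<exists>t\<in>terms. bk 1 * x = sg t"
proof -
  define F where "F = Rep_bca x"
  have F: "\<forall>r s z. F (r, s, z) \<in> carrier (BC r s z)" using Rep_bca[of x] by (simp add: F_def)
  then have "F (r, s, z) \<in> carrier (BC r s z)" by blast
  then obtain t where t: "t \<in> terms" "F (r, s, z) = bc_class r s z t" unfolding BC_consts by blast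
  have "(1 *\<^sub>a AOne \<cdot> t, t) \<in> bccong r s z"
    by (rule acong.trans[OF acong.mul_cong[OF acong.one_scale acong.refl] acong.one_mul]) (simp_all add: t)
  then have "bc_class r s z (1 *\<^sub>a AOne \<cdot> t) = bc_class r s z t" by (simp add: bc_class_eq t)
  then have "Rep_bca (bk 1 * x) = Rep_bca (sg t)"
    using F by (auto simp: fun_eq_iff bk_def times_bca.rep_eq single.rep_eq F_def[symmetric] BC_ops t ring.ring_simprules BC_ring)
  then show ?thesis using t(1) by (auto simp: Rep_bca_inject)
qed

text \<open>\<open>Psum (min r s)\<close> contains 1 and is stable under left multiplication by
  every generator, hence is everything.\<close>

lemma BC_span: "\<exists>ts. length ts = fact (r + s) * 2 ^ (r + s) \<and> set ts \<subseteq> terms \<and>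
   (\<forall>t\<in>terms. \<exists>c. sg t = (\<Sum>i<length ts. bk (c i) * sg (ts ! i)))"
proof -
  interpret b: bcalg bk r s z "- z" "- 1" 1 ba bc bd bf bE by (rule bcalg_BC)
  let ?L = "b.Psum (min r s)"
  note bm = b.Psum_bimod[of "min r s"]
  note sub = bk.subD[OF b.bimodD(1)[OF bm]]
  have gen: "sg (AGen g) * x \<in> ?L" if g: "g \<in> bcgens r s" and x: "x \<in> ?L" for g x
  proof (cases g)
    case (BT k)
    then have k: "0 < k" "k < r" using g by auto
    have "sg (bt k) * x = ba (r - 1 - k) * x + bk z * x"
      using k by (simp add: ba_def sg_bt_inv left_diff_distrib)
    also have "\<dots> \<in> ?L" using k by (intro sub(2,3) b.bimodD(2)[OF bm] x) auto
    finally show ?thesis using BT by simp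
  next
    case (BTs k)
    then show ?thesis using g b.bimodD(4)[OF bm x, of "k - 1"] by (simp add: bd_def)
  next
    case BE
    then show ?thesis using g b.e_Psum[OF x] by (simp add: bE_def)
  next
    case (BP k)
    then show ?thesis using g b.bimodD(3)[OF bm x, of "r - k"] by (simp add: bc_def)
  next
    case (BPs k)
    then have "0 < k" "k - 1 < s" using g by auto
    then show ?thesis using BPs b.bimodD(5)[OF bm x, of "k - 1"] by (simp add: bf_def)
  qed
  have L: "sg t * x \<in> ?L" if "t \<in> terms" "x \<in> ?L" for t x
    using that
  proof (induction t arbitrary: x)
    case (AGen g)
    then show ?case using gen by simp
  qed (auto simp: sg_simps mult.assoc distrib_right intro: sub)
  have "bk 1 \<in> ?L" using b.P_Psum[OF b.D_P[of 0]] by simp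
  then have tL: "sg t \<in> ?L" if "t \<in> terms" for t
    using L[OF that] bk_sg'[OF that] by metis
  obtain xs where xs: "length xs = fact (r + s) * 2 ^ (r + s)" "?L \<subseteq> bk.lspan xs"
    using b.fsp_Psum unfolding bk.fsp_def by blast
  \<comment> \<open>The spanning list may lie outside the algebra; multiplication by the idempotent
    \<open>bk 1\<close> moves it inside.\<close>
  obtain h where h: "h x \<in> terms \<and> bk 1 * x = sg (h x)" for x using bk_1_sg by metis
  show ?thesis
  proof (intro exI[of _ "map h xs"] conjI ballI)
    fix t assume t: "t \<in> terms"
    then obtain c where c: "sg t = (\<Sum>i<length xs. bk (c i) * xs ! i)"
      using tL xs(2) unfolding bk.lspan_def by blast
    have "sg t = bk 1 * sg t" using bk_sg[OF t] by simp
    also have "\<dots> = (\<Sum>i<length xs. bk (c i) * (bk 1 * xs ! i))"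
      unfolding c by (simp add: sum_distrib_left bk.\<kappa>_left_comm[of "bk 1"])
    finally show "\<exists>c. sg t = (\<Sum>i<length (map h xs). bk (c i) * sg (map h xs ! i))"
      using h by auto
  qed (use xs h in auto)
qed

end

section \<open>A basis of the subalgebra on n strands\<close>

text \<open>Coset representatives multiplied along the chain of shifted subalgebras: one pair of a
  position and a dot per strand.\<close>

primrec hb :: "(nat \<times> bool) list => 'k::comm_ring_1 hcl" where
  "hb [] = 1"
| "hb (p # l) = sh (hb l) * (hr (fst p) * (if snd p then hc (fst p) else 1))"

primrec coords :: "(nat \<times> bool) list => 'k::comm_ring_1 hcl => 'k hcl" where
  "coords [] x = x"
| "coords (p # l) x = coords l (coord (fst p) (snd p) x)"

primrec hidx :: "nat => (nat \<times> bool) list list" where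
  "hidx 0 = [[]]"
| "hidx (Suc n) = [p # l. p \<leftarrow> List.product [0..<Suc n] [False, True], l \<leftarrow> hidx n]"

lemma coords_add: "coords l (x + y) = coords l x + coords l y"
  by (induction l arbitrary: x y) (simp_all add: coord_add)

lemma coord_0: "coord j e 0 = 0"
  using coord_add[of j e 0 0] by simp

lemma coords_0: "coords l 0 = 0"
  by (induction l) (simp_all add: coord_0)

lemma coord_sc: "coord j e (sc a * x) = sc a * coord j e x"
  using coord_sh[of j e "sc a" x] by (simp add: shift.hom_sc)

lemma coords_sc: "coords l (sc a * x) = sc a * coords l x"
  by (induction l arbitrary: x) (simp_all add: coord_sc)

lemma coords_hb: "length l = length l' ==> coords l (hb l') = (if l = l' then 1 else 0 :: 'k::comm_ring_1 hcl)"
proof (induction l arbitrary: l')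
  case (Cons p l)
  then obtain p' m where l': "l' = p' # m" "length l = length m" by (cases l') auto
  have "coord (fst p) (snd p) (hb l') = (if p = p' then hb m else 0 :: 'k hcl)"
    by (auto simp: l' coord_sh coord_hr prod_eq_iff)
  then show ?case using Cons.IH[OF l'(2)] l' by (auto simp: coords_0)
qed simp

lemma length_hidx: "length (hidx n) = fact n * 2 ^ n"
  by (induction n) (simp_all add: length_concat o_def sum_list_triv algebra_simps)

lemma hidx_length: "l \<in> set (hidx n) ==> length l = n"
  by (induction n arbitrary: l) auto

lemma distinct_hidx: "distinct (hidx n)"
proof (induction n)
  case (Suc n)
  have "hidx (Suc n) = map (\<lambda>(p, l). p # l) (List.product (List.product [0..<Suc n] [False, True]) (hidx n))"
    by (simp add: product_concat_map map_concat o_def del: upt_Suc)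
  then show ?case
    by (simp add: distinct_map distinct_product Suc inj_on_def del: upt_Suc hidx.simps)
qed simp

lemma hidx_hsub: "l \<in> set (hidx n) ==> hb l \<in> hsub n"
proof (induction n arbitrary: l)
  case (Suc n)
  then obtain p m where l: "l = p # m" "p \<in> set (List.product [0..<Suc n] [False, True])" "m \<in> set (hidx n)"
    by (auto simp del: set_product upt_Suc)
  then have "fst p < Suc n" by auto
  with l have l: "l = p # m" "fst p < Suc n" "m \<in> set (hidx n)" by auto
  then show ?case using Suc.IH[of m] hr_hsub[of "fst p" n]
    by (auto intro!: hsub.mult hsub_sh hsub_1 hsub.hc)
qed (auto simp: hsub_1)

text \<open>The vacuum coefficient in the spin module, without its q part. Iterated coordinates
  still lie in \<open>H\<close>; this functional, with value 1 at 1, makes scalars of them.\<close>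

definition aug :: "'k::comm_ring_1 hcl => 'k => 'k"
  where "aug x = fst (spin.act x (\<lambda>a. if a = (\<lambda>_. False) then (1, 0) else 0) (\<lambda>_. False))"

lemma aug_simps: "aug (x + y) = aug x + aug y" "aug (sc a * x) = a * aug x" "aug 1 = 1" "aug 0 = 0"
  unfolding aug_def spin.act_plus spin.act_mult spin.act_sc spin.act_1 spin.act_0
  by (simp_all add: pscale_def)

definition hfun :: "'k => (nat \<times> bool) list => 'k::comm_ring_1 hcl => 'k"
  where "hfun z l x = aug (coords l x) z"

lemma hfun_simps: "hfun z l (x + y) = hfun z l x + hfun z l y" "hfun z l (ksc c * x) = c * hfun z l x"
  "hfun z l 0 = 0"
  by (simp_all add: hfun_def coords_add coords_sc coords_0 aug_simps)

lemma hfun_hb: "length l = length l' ==> hfun z l (heps z * hb l') = (if l = l' then 1 else 0)"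
  by (simp add: hfun_def heps_def coords_sc coords_hb) (simp add: aug_simps aug_simps(2)[of _ 1, simplified])

section \<open>Faithfulness on the vacuum\<close>

text \<open>The matrix \<open>det B\<close> times the adjugate of \<open>A\<close> is a left inverse
  of \<open>A\<close>, because the determinants are inverse to each other, and a left inverse agrees
  with the right inverse \<open>B\<close>.\<close>

lemma mat_inverse_comm:
  fixes A B :: "'a::comm_ring_1 mat"
  assumes A: "A \<in> carrier_mat n n" and B: "B \<in> carrier_mat n n" and AB: "A * B = 1\<^sub>m n"
  shows "B * A = 1\<^sub>m n"
proof -
  have d: "det B * det A = 1" using det_mult[OF A B] AB by (simp add: mult.commute)
  define C where "C = det B \<cdot>\<^sub>m adj_mat A"
  have C: "C \<in> carrier_mat n n" using adj_mat(1)[OF A] by (simp add: C_def)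
  have "C * A = det B \<cdot>\<^sub>m (det A \<cdot>\<^sub>m 1\<^sub>m n)"
    using adj_mat(1,3)[OF A] A by (simp add: C_def mult_smult_assoc_mat[of _ n n _ n])
  also have "\<dots> = 1\<^sub>m n"
    by (rule eq_matI) (simp_all add: mult.assoc[symmetric] d)
  finally have CA: "C * A = 1\<^sub>m n" .
  have "C = C * (A * B)" using AB C by simp
  also have "\<dots> = B" using CA A B C by (simp add: assoc_mult_mat[OF C A B, symmetric])
  finally show ?thesis using CA by simp
qed

primrec tsum :: "(nat => 'k) => 'k bcterm list => nat => 'k bcterm" where
  "tsum c ts 0 = AZero"
| "tsum c ts (Suc i) = tsum c ts i \<boxplus> c i *\<^sub>a (ts ! i)"

lemma tsum_terms: "set ts \<subseteq> aterms G ==> i \<le> length ts ==> tsum c ts i \<in> aterms G"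
  by (induction i) auto

lemma tsum_single:
  assumes "set ts \<subseteq> bcterms r s" "i \<le> length ts"
  shows "single r s z (tsum c ts i) = (\<Sum>j<i. bk r s z (c j) * single r s z (ts ! j))"
  using assms(2)
proof (induction i)
  case (Suc i)
  have "ts ! i \<in> bcterms r s" using assms(1) Suc.prems by auto
  then show ?case using Suc tsum_terms[OF assms(1), of i c] by (simp add: single_ops bk_scale)
qed (simp add: single_ops)

lemma tsum_bcact: "bcact r (tsum c ts i) m = (\<Sum>j<i. ksc (c j) * bcact r (ts ! j) m)"
  by (induction i) simp_all

lemma hfun_sum: "hfun z l (\<Sum>j<(i::nat). ksc (c j) * m j) = (\<Sum>j<i. c j * hfun z l (m j))"
  by (induction i) (simp_all add: hfun_simps)

text \<open>Q lists the coordinates of the values of a spanning list \<open>ts\<close>, and Y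
  expresses in \<open>ts\<close> the elements \<open>t i\<close> whose values form the basis. Both
  are square of size N = (r + s)! 2^(r+s), so Y Q = 1 implies Q Y = 1, and a combination c of
  \<open>ts\<close> with c Q = 0 is trivial.\<close>

theorem bcact_faithful_0:
  fixes z :: "'k::comm_ring_1"
  assumes x: "x \<in> bcterms r s" and 0: "bcact r x (vacuum r s z) = 0"
  shows "(x, AZero) \<in> bccong r s z"
proof -
  let ?T = "bcterms r s :: 'k bcterm set" and ?v = "vacuum r s z" and ?sg = "single r s z"
  define N :: nat where "N = fact (r + s) * 2 ^ (r + s)"
  obtain ts where ts: "length ts = N" "set ts \<subseteq> ?T"
    "\<And>t. t \<in> ?T ==> \<exists>c. ?sg t = (\<Sum>i<N. bk r s z (c i) * ?sg (ts ! i))"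
    using BC_span[of r s z] unfolding N_def by metis
  have expand: "bcact r t ?v = (\<Sum>j<N. ksc (c j) * bcact r (ts ! j) ?v)"
    if "t \<in> ?T" "?sg t = (\<Sum>i<N. bk r s z (c i) * ?sg (ts ! i))" for t c
  proof -
    have "?sg t = ?sg (tsum c ts N)" using that tsum_single[OF ts(2), of N z c] ts(1) by simp
    then have "(t, tsum c ts N) \<in> bccong r s z"
      using that tsum_terms[OF ts(2), of N c] ts(1) by (simp add: single_eq)
    from bcact_acong[OF this vacuum_corner[of r s z]] show ?thesis by (simp add: tsum_bcact)
  qed
  let ?L = "hidx (r + s)"
  have L: "length ?L = N" by (simp add: length_hidx N_def)
  have "\<exists>t. i < N \<longrightarrow> t \<in> ?T \<and> heps z * hb (?L ! i) = bcact r t ?v" for i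
    using hsub_orbit[OF hidx_hsub, of "?L ! i" r s z] L by (auto simp: orbit_def)
  then have "\<forall>i. \<exists>t. i < N \<longrightarrow> t \<in> ?T \<and> heps z * hb (?L ! i) = bcact r t ?v" by blast
  from choice[OF this] obtain t where t: "\<And>i. i < N ==> t i \<in> ?T"
    "\<And>i. i < N ==> heps z * hb (?L ! i) = bcact r (t i) ?v" by blast
  have "\<forall>i. \<exists>c. i < N \<longrightarrow> ?sg (t i) = (\<Sum>j<N. bk r s z (c j) * ?sg (ts ! j))"
    using ts(3) t(1) by blast
  from choice[OF this] obtain Y where Y: "\<And>i. i < N ==> ?sg (t i) = (\<Sum>j<N. bk r s z (Y i j) * ?sg (ts ! j))"
    by blast
  define Q where "Q j l = hfun z (?L ! l) (bcact r (ts ! j) ?v)" for j l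
  have YQ: "(\<Sum>j<N. Y i j * Q j l) = (if i = l then 1 else 0)" if "i < N" "l < N" for i l
  proof -
    have "(\<Sum>j<N. Y i j * Q j l) = hfun z (?L ! l) (heps z * hb (?L ! i))"
      using that t Y by (simp add: expand[OF _ Y] hfun_sum Q_def)
    also have "\<dots> = (if ?L ! l = ?L ! i then 1 else 0)"
      using that L hidx_length[of _ "r + s"] by (intro hfun_hb) simp
    also have "?L ! l = ?L ! i \<longleftrightarrow> i = l"
      using that L distinct_hidx[of "r + s"] by (auto simp: nth_eq_iff_index_eq)
    finally show ?thesis .
  qed
  let ?Y = "mat N N (\<lambda>(i, j). Y i j)" and ?Q = "mat N N (\<lambda>(i, j). Q i j)"
  have "?Y * ?Q = 1\<^sub>m N"
    by (rule eq_matI) (simp_all add: scalar_prod_def YQ lessThan_atLeast0[symmetric])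
  then have QY: "?Q * ?Y = 1\<^sub>m N" by (rule mat_inverse_comm[rotated 2]) simp_all
  obtain c where c: "?sg x = (\<Sum>i<N. bk r s z (c i) * ?sg (ts ! i))" using ts(3)[OF x] by blast
  have cQ: "(\<Sum>j<N. c j * Q j l) = 0" if "l < N" for l
    using arg_cong[OF expand[OF x c], of "hfun z (?L ! l)"]
    unfolding 0 hfun_sum hfun_simps(3) Q_def by simp
  have "c i = 0" if "i < N" for i
  proof -
    have QY': "(\<Sum>l<N. Q j l * Y l i) = (if j = i then 1 else 0)" if "j < N" for j
      using arg_cong[OF QY, of "\<lambda>M. M $$ (j, i)"] that \<open>i < N\<close>
      by (simp add: scalar_prod_def lessThan_atLeast0[symmetric])
    have "c i = (\<Sum>j<N. c j * (if j = i then 1 else 0))"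
      using that by (simp add: if_distrib[of "\<lambda>x. c _ * x"] cong: if_cong)
    also have "\<dots> = (\<Sum>j<N. \<Sum>l<N. c j * Q j l * Y l i)"
      by (rule sum.cong) (simp_all add: QY'[symmetric] sum_distrib_left mult.assoc del: if_split)
    also have "\<dots> = (\<Sum>l<N. (\<Sum>j<N. c j * Q j l) * Y l i)"
      by (subst sum.swap) (simp add: sum_distrib_right)
    finally show ?thesis by (simp add: cQ)
  qed
  then have "?sg x = (\<Sum>i<N. bk r s z 0 * ?sg (ts ! i))" using c by simp
  also have "\<dots> = ?sg AZero"
    using central_scalars.\<kappa>_add[OF bk_central, of r s z 0 0] by (simp add: single_ops)
  finally show ?thesis using x by (simp add: single_eq)
qed

theorem bcact_faithful:
  assumes x: "x \<in> bcterms r s" and y: "y \<in> bcterms r s"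
    and eq: "bcact r x (vacuum r s z) = bcact r y (vacuum r s z)"
  shows "(x, y) \<in> bccong r s z"
proof -
  have "(x \<boxplus> (- 1) *\<^sub>a y, AZero) \<in> bccong r s z"
    by (rule bcact_faithful_0) (use x y in \<open>simp_all add: eq ksc_simps\<close>)
  then have "single r s z x + bk r s z (- 1) * single r s z y = 0"
    using x y by (simp add: single_eq[symmetric] single_ops bk_scale)
  moreover have "bk r s z (- 1) * single r s z y = - single r s z y"
    using central_scalars.\<kappa>_uminus[OF bk_central, of r s z 1] bk_sg[OF y] by simp
  ultimately show ?thesis using x y by (simp add: single_eq[symmetric])
qed

section \<open>The action of the supercategory\<close>

lemma hr_hk: "hr i \<in> hk (Suc i)"
  by (induction i) (auto intro!: hk.mult hk_hs hk_1 elim: hk_mono)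

lemma hli_hr: "hli i = hr i" by (induction i) simp_all

lemma hr_hl: "hr i * hl i = 1" "hl i * hr i = 1" "hr i * (hl i * x) = x" "hl i * (hr i * x) = x"
  using hli_hl[of i] by (simp_all add: hli_hr)

lemma hr_hsub_slide: "w \<in> hsub j ==> hr j * w = sh w * hr j"
proof (induction rule: hsub.induct)
  case (mult x y)
  show ?case by (simp only: shift.hom_mult mult.assoc[symmetric] mult(3)) (simp only: mult.assoc mult(4))
qed (simp_all add: hr_hs hr_hc shift.hom_simps sc_comm distrib_left distrib_right)

lemma ha_Suc_right: "ha (Suc q) = ha q * ht q"
proof (induction q)
  case (Suc q)
  have "ha (Suc (Suc q)) = ht 0 * sh (ha (Suc q) :: 'a hcl)" by (rule ha.simps(2))
  also have "\<dots> = ht 0 * sh (ha q) * ht (Suc q)" by (simp only: Suc shift.hom_mult sh_gens mult.assoc)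
  finally show ?case by simp
qed (simp add: shift.hom_1)

lemma ha_ht_far: "n < k ==> ha n * ht k = ht k * ha n"
proof (induction n)
  case (Suc n)
  then show ?case by (simp add: ha_Suc_right mult.assoc ht_far[of n k, symmetric] comm_tail[OF Suc.IH] del: ha.simps(2))
qed simp

lemma ha_ht: "Suc k < n ==> ha n * ht k = ht (Suc k) * ha n"
proof (induction n)
  case (Suc n)
  show ?case
  proof (cases "Suc k = n")
    case True
    have "ha (Suc n) * ht k = ha k * (ht k * (ht (Suc k) * ht k))"
      using True by (auto simp: ha_Suc_right mult.assoc simp del: ha.simps(2))
    also have "\<dots> = ht (Suc k) * (ha k * (ht k * ht (Suc k)))"
      by (simp add: ht_braid comm_tail[OF ha_ht_far])
    finally show ?thesis using True by (auto simp: ha_Suc_right mult.assoc simp del: ha.simps(2))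
  next
    case False
    then show ?thesis using Suc
      by (simp add: ha_Suc_right mult.assoc ht_far[of k n] comm_tail[OF Suc.IH] del: ha.simps(2))
  qed
qed simp

lemma ha_hk_slide: "w \<in> hk n ==> ha n * w = sh w * ha n"
proof (induction rule: hk.induct)
  case (mult x y)
  show ?case by (simp only: shift.hom_mult mult.assoc[symmetric] mult(3)) (simp only: mult.assoc mult(4))
qed (simp_all add: ha_ht shift.hom_simps sc_comm distrib_left distrib_right)

lemma ha_hai_1: "ha n * hai n = (1 :: 'k::comm_ring_1 hcl)"
proof (induction n)
  case (Suc n)
  have "ha (Suc n) * hai (Suc n) = ht 0 * sh (ha n * hai n) * (hs 0 :: 'k hcl)"
    by (simp add: shift.hom_mult mult.assoc)
  also have "\<dots> = 1" by (simp only: Suc shift.hom_1 mult_1_right hs_ht)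
  finally show ?case .
qed simp

lemma ha_hai: "ha n * hai n = 1" "hai n * (ha n * x) = x" "ha n * (hai n * x) = x"
  by (simp_all add: mult.assoc[symmetric] hai_ha ha_hai_1)

lemma hai_hk_slide: "w \<in> hk n ==> hai n * sh w = w * hai n"
proof -
  assume "w \<in> hk n"
  then have "hai n * (ha n * w) * hai n = hai n * (sh w * ha n) * hai n" by (simp add: ha_hk_slide)
  then show ?thesis by (simp add: mult.assoc ha_hai)
qed

text \<open>All eight are instances of sliding an element of \<open>hk\<close> along a long
  crossing; they compare the factors of two cups or caps in the two possible orders.\<close>

lemma crossings:
  assumes "i \<le> (m :: nat)"
  shows "sh (hr i) * hr (Suc m) = hs 0 * (sh (hr m) * hr i)"
    and "hr (Suc m) * hl i = sh (hl i) * (hs 0 * sh (hr m))"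
    and "hr i * hl (Suc m) = sh (hl m) * (ht 0 * sh (hr i))"
    and "hl (Suc m) * sh (hl i) = hl i * (sh (hl m) * ht 0)"
    and "hai (Suc m) * sh (hai i) = hai i * (sh (hai m) * hs 0)"
    and "ha (Suc m) * hai i = sh (hai i) * (ht 0 * sh (ha m))"
    and "ha i * hai (Suc m) = sh (hai m) * (hs 0 * sh (ha i))"
    and "sh (ha i) * ha (Suc m) = ht 0 * (sh (ha m) * ha i)"
proof -
  have k: "hr i \<in> hk (Suc m)" "hl i \<in> hk (Suc m)" "ha i \<in> hk (Suc m)" "hai i \<in> hk (Suc m)"
    using hr_hk[of i] hl_hk(1)[of i] ha_hk[of i] assms by (auto elim: hk_mono)
  show "sh (hr i) * hr (Suc m) = hs 0 * (sh (hr m) * hr i)" "hr (Suc m) * hl i = sh (hl i) * (hs 0 * sh (hr m))"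
    using hr_hsub_slide[OF hk_hsub[OF k(1)], symmetric] hr_hsub_slide[OF hk_hsub[OF k(2)]]
    by (simp_all add: hr_Suc_left mult.assoc del: hr.simps)
  show "hr i * hl (Suc m) = sh (hl m) * (ht 0 * sh (hr i))" "hl (Suc m) * sh (hl i) = hl i * (sh (hl m) * ht 0)"
    using hl_sh_hk[OF k(1), symmetric] hl_sh_hk[OF k(2)] by (simp_all add: hl_Suc_right mult.assoc del: hl.simps)
  show "hai (Suc m) * sh (hai i) = hai i * (sh (hai m) * hs 0)" "ha i * hai (Suc m) = sh (hai m) * (hs 0 * sh (ha i))"
    using hai_hk_slide[OF k(4)] hai_hk_slide[OF k(3), symmetric] by (simp_all add: mult.assoc)
  show "ha (Suc m) * hai i = sh (hai i) * (ht 0 * sh (ha m))" "sh (ha i) * ha (Suc m) = ht 0 * (sh (ha m) * ha i)"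
    using ha_hk_slide[OF k(4)] ha_hk_slide[OF k(3), symmetric] by (simp_all add: mult.assoc)
qed

section \<open>Operators of the generators and the interchange law\<close>

abbreviation "ups X \<equiv> count_list X \<up>"
abbreviation "dns X \<equiv> count_list X \<down>"

text \<open>\<open>i\<close> is the number of \<open>\<up>\<close> to the right and \<open>j\<close> the number of \<open>\<down>\<close> to the left of the generator.\<close>

fun gact :: "qgen => nat => nat => 'k::comm_ring_1 hcl => 'k hcl" where
  "gact UPlus i j x = ht i * x"
| "gact UMinus i j x = hs i * x"
| "gact RMinus i j x = x"
| "gact Clif i j x = hc i * x"
| "gact CapL i j x = hE (hr i * (x * hai j))"
| "gact CupL i j x = hl i * (sh x * ha j)"

text \<open>A tensor product is read as \<open>f\<close> after \<open>g\<close>: thus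
  \<open>f\<close> has the codomain of \<open>g\<close> on its right, and \<open>g\<close> has the
  domain of \<open>f\<close> on its left.\<close>

primrec mact :: "'k::comm_ring_1 qterm => nat => nat => 'k hcl => 'k hcl" where
  "mact (MGen g) i j x = gact g i j x"
| "mact (MId X) i j x = x"
| "mact (MZero X Y) i j x = 0"
| "mact (f \<bullet> g) i j x = mact f i j (mact g i j x)"
| "mact (f \<boxtimes> g) i j x = mact f (i + ups (mcod g)) j (mact g i (j + dns (mdom f)) x)"
| "mact (f \<uplus> g) i j x = mact f i j x + mact g i j x"
| "mact (c *\<^sub>m f) i j x = ksc c * mact f i j x"

lemma gact_lin: "gact g i j (x + y) = gact g i j x + gact g i j y"
  "gact g i j (sc a * x) = sc a * gact g i j x"
  by (cases g; simp add: distrib_left distrib_right shift.hom_simps hE_simps mult.assoc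
      sc_left_comm[of "hc _"] sc_left_comm[of "hs _"] sc_left_comm[of "ht _"] sc_left_comm[of "hr _"] sc_left_comm[of "hl _"])+

lemma mact_lin: "mact f i j (x + y) = mact f i j x + mact f i j y"
  "mact f i j (sc a * x) = sc a * mact f i j x"
  by (induction f arbitrary: i j x y) (simp_all add: gact_lin distrib_left sc_left_comm[of "ksc _"])

lemma mact_0: "mact f i j 0 = 0"
  using mact_lin(1)[of f i j 0 0] by simp

lemma mact_corner: "x \<in> corner z ==> mact f i j x \<in> corner z"
proof (induction f arbitrary: i j x)
  case (MGen g)
  then show ?case by (cases g) (simp_all add: corner_closed)
qed (simp_all add: corner_closed corner_add)

lemma hr_ht: "Suc i < j ==> hr j * ht i = ht (Suc i) * hr j"
  by (simp add: ht_def distrib_left distrib_right hr_hs hz_comm[of "hr _"])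

lemma hr_comm_ht: "j < i ==> hr j * ht i = ht i * hr j"
  by (simp add: ht_def distrib_left distrib_right hr_comm_hs hz_comm[of "hr _"])

lemma hl_hs: "Suc k < i ==> hs k * hl i = hl i * hs (Suc k)"
  using hl_ht[of k i] by (simp add: ht_def distrib_left distrib_right hz_comm[of "hl _"])

lemma hl_hs_far: "i < k ==> hs k * hl i = hl i * hs k"
  using hl_ht_far[of i k] by (simp add: ht_def distrib_left distrib_right hz_comm[of "hl _"])

lemma far_mixed: "Suc i < j ==> ht j * (hs i * x) = hs i * (ht j * x)"
  "Suc i < j ==> hs j * (ht i * x) = ht i * (hs j * x)"
  by (simp_all add: ht_def distrib_left distrib_right hs_far' hgen_hz)

lemma hE_hc_Suc: "hE (hc (Suc i) * x) = hc i * hE x"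
  using hE_left[of "hc i" x] by simp

lemma ksc_koszul: "ksc (koszul_sign p q) * x = (if p = 1 \<and> q = 1 then - x else x)"
  by (simp add: koszul_sign_def ksc_simps)

text \<open>The substantial cases are the pairs of cups and caps: two caps give
  \<open>hE_hE_conj\<close>, a cap and a cup \<open>hE_conj\<close> or \<open>hE_conj'\<close>, and
  two cups the commutation of \<open>ht 0\<close> with a double shift.\<close>

lemma gact_interchange:
  "gact b i (j + dns (qcod a) + y) (gact a (i + ups (qdom b) + x) j v) =
    ksc (koszul_sign (spar qsig a) (spar qsig b)) *
      gact a (i + ups (qcod b) + x) j (gact b i (j + dns (qdom a) + y) v)"
proof (cases a; cases b)
  assume ab: "a = CapL" "b = CapL"
  let ?y = "sh (hr (i + x)) * (hr i * (v * (hai j * (sh (hai (j + y)) * hs 0))))"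
  have "hE (hr i * (hE (hr (Suc (i + x)) * (v * hai j)) * hai (j + y))) =
      hE (hE (sh (hr i) * (hr (Suc (i + x)) * (v * (hai j * sh (hai (j + y)))))))"
    using hE_mid[of "hr i" "hr (Suc (i + x)) * (v * hai j)" "hai (j + y)"] by (simp add: mult.assoc del: hr.simps)
  also have "sh (hr i) * (hr (Suc (i + x)) * (v * (hai j * sh (hai (j + y))))) = hs 0 * (?y * ht 0)"
    by (simp add: comm_tail[OF crossings(1)] mult.assoc hs_ht del: hr.simps)
  also have "hE (hE \<dots>) = hE (hE ?y)" by (rule hE_hE_conj)
  also have "?y = sh (hr (i + x)) * (hr i * (v * (hai (Suc (j + y)) * sh (hai j))))"
    by (simp add: crossings(5)[of j "j + y", symmetric] mult.assoc)
  also have "hE (hE \<dots>) = hE (hr (i + x) * (hE (hr i * (v * hai (Suc (j + y)))) * hai j))"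
    using hE_mid[of "hr (i + x)" "hr i * (v * hai (Suc (j + y)))" "hai j"] by (simp add: mult.assoc del: hai.simps)
  finally show ?thesis using ab by (simp add: ksc_koszul qsig_def mult.assoc del: hr.simps hai.simps)
next
  assume ab: "a = CapL" "b = CupL"
  have "hE (hr (Suc (i + x)) * (hl i * (sh v * ha (Suc (j + y))) * hai j)) =
      hE (sh (hl i) * (hs 0 * (sh (hr (i + x) * (v * hai j)) * ht 0) * sh (ha (j + y))))"
    by (simp add: comm_tail[OF crossings(2)] crossings(6)[of j "j + y"] shift.hom_mult mult.assoc del: hr.simps ha.simps)
  also have "\<dots> = hl i * (sh (hE (hr (i + x) * (v * hai j))) * ha (j + y))"
    by (simp only: hE_mid hE_conj)
  finally show ?thesis using ab by (simp add: ksc_koszul qsig_def mult.assoc del: hr.simps ha.simps)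
next
  assume ab: "a = CupL" "b = CapL"
  have "hE (hr i * (hl (Suc (i + x)) * (sh v * ha j) * hai (Suc (j + y)))) =
      hE (sh (hl (i + x)) * (ht 0 * (sh (hr i * (v * hai (j + y))) * hs 0) * sh (ha j)))"
    by (simp add: comm_tail[OF crossings(3)] crossings(7)[of j "j + y"] shift.hom_mult mult.assoc del: hl.simps hai.simps)
  also have "\<dots> = hl (i + x) * (sh (hE (hr i * (v * hai (j + y)))) * ha j)"
    by (simp only: hE_mid hE_conj')
  finally show ?thesis using ab by (simp add: ksc_koszul qsig_def mult.assoc del: hl.simps hai.simps)
next
  assume ab: "a = CupL" "b = CupL"
  have "hl (Suc (i + x)) * (sh (hl i * (sh v * ha (j + y))) * ha j) =
      hl i * (sh (hl (i + x)) * (sh (sh v) * (ht 0 * (sh (ha (j + y)) * ha j))))"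
    by (simp add: comm_tail[OF crossings(4)] shift.hom_mult mult.assoc hs_sh2 del: hl.simps)
  also have "\<dots> = hl i * (sh (hl (i + x) * (sh v * ha j)) * ha (Suc (j + y)))"
    by (simp add: crossings(8)[of j "j + y", symmetric] shift.hom_mult mult.assoc del: ha.simps)
  finally show ?thesis using ab by (simp add: ksc_koszul qsig_def del: hl.simps ha.simps)
qed (simp_all add: ksc_koszul qsig_def shift.hom_mult mult.assoc hE_left' hE_hc_Suc ht_far' hs_far' far_mixed
    ht_pass' hs_pass' hc_anti' comm_tail[OF hr_comm_ht] comm_tail[OF hr_comm_hs] comm_tail[OF hr_comm_hc]
    comm_tail[OF hr_ht] comm_tail[OF hr_hs] comm_tail[OF hr_hc] comm_tail[OF hl_ht[symmetric]]
    comm_tail[OF hl_ht_far[symmetric]] comm_tail[OF hl_hs[symmetric]] comm_tail[OF hl_hs_far[symmetric]]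
    comm_tail[OF hl_hc[symmetric]] comm_tail[OF hl_hc_far[symmetric]] del: hr.simps hl.simps ha.simps hai.simps)

lemma typed_dom: "typed qsig f X Y ==> mdom f = X \<and> mcod f = Y"
  by (induction rule: typed.induct) (auto simp: qsig_def)

lemma typed_iff:
  "typed S (MGen a) X Y \<longleftrightarrow> X = sdom S a \<and> Y = scod S a"
  "typed S (MId W) X Y \<longleftrightarrow> X = W \<and> Y = W"
  "typed S (MZero W W') X Y \<longleftrightarrow> X = W \<and> Y = W'"
  "typed S (f \<bullet> g) X Y \<longleftrightarrow> (\<exists>W. typed S f W Y \<and> typed S g X W)"
  "typed S (f \<boxtimes> g) X Y \<longleftrightarrow> (\<exists>X1 X2 Y1 Y2. X = X1 @ X2 \<and> Y = Y1 @ Y2 \<and> typed S f X1 Y1 \<and> typed S g X2 Y2)"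
  "typed S (f \<uplus> g) X Y \<longleftrightarrow> typed S f X Y \<and> typed S g X Y"
  "typed S (c *\<^sub>m f) X Y \<longleftrightarrow> typed S f X Y"
  by (subst typed.simps, fastforce)+

lemma koszul_add: "ksc (koszul_sign (p + p') q) * x = ksc (koszul_sign p q) * (ksc (koszul_sign p' q) * x)"
  "ksc (koszul_sign p (q + q')) * x = ksc (koszul_sign p q) * (ksc (koszul_sign p q') * x)"
  by (cases p; cases p'; cases q; simp add: ksc_koszul) (cases p; cases q'; cases q; simp add: ksc_koszul)

lemma ksc_ksc_commute: "ksc c * (ksc d * x) = ksc d * (ksc c * x)"
  by (rule ksc_left_comm)

text \<open>\<open>x\<close> and \<open>y\<close> count the upward and downward strands between the
  two morphisms; the induction over tensor products needs them.\<close>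

lemma mact_gact_interchange:
  assumes "mhomog qsig q g" "typed qsig g X Y"
  shows "mact g i (j + dns (qcod a) + y) (gact a (i + ups X + x) j v) =
    ksc (koszul_sign (spar qsig a) q) * gact a (i + ups Y + x) j (mact g i (j + dns (qdom a) + y) v)"
  using assms
proof (induction arbitrary: X Y i j x y v rule: mhomog.induct)
  case (1 b)
  then show ?case using gact_interchange[of b i j a y x v] by (simp add: typed_iff) (simp add: qsig_def)
next
  case (4 p f q g)
  then obtain W where "typed qsig f W Y" "typed qsig g X W" by (auto simp: typed_iff)
  then show ?case unfolding koszul_add using 4 by (simp add: mact_lin ksc_ksc_commute[of "koszul_sign _ p"])
next
  case (5 p f q g)
  then obtain X1 X2 Y1 Y2 where t: "X = X1 @ X2" "Y = Y1 @ Y2" "typed qsig f X1 Y1" "typed qsig g X2 Y2"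
    by (auto simp: typed_iff)
  have "mact g i (j + dns (qcod a) + (y + dns X1)) (gact a (i + ups X2 + (ups X1 + x)) j v) =
    ksc (koszul_sign (spar qsig a) q) * gact a (i + ups Y2 + (ups X1 + x)) j (mact g i (j + dns (qdom a) + (y + dns X1)) v)"
    by (rule 5(4)[OF t(4)])
  moreover have "mact f (i + ups Y2) (j + dns (qcod a) + y) (gact a (i + ups Y2 + ups X1 + x) j w) =
    ksc (koszul_sign (spar qsig a) p) * gact a (i + ups Y2 + ups Y1 + x) j (mact f (i + ups Y2) (j + dns (qdom a) + y) w)" for w
    by (rule 5(3)[OF t(3)])
  ultimately show ?case unfolding koszul_add using typed_dom[OF t(3)] typed_dom[OF t(4)]
    by (simp add: t mact_lin ac_simps ksc_ksc_commute[of "koszul_sign _ p"])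
next
  case (6 p f g)
  then have "typed qsig f X Y" "typed qsig g X Y" by (simp_all add: typed_iff)
  with 6 show ?case by (simp add: gact_lin distrib_left)
next
  case (7 p f c)
  then show ?case by (simp add: typed_iff gact_lin ksc_ksc_commute[of c])
qed (auto simp: typed_iff ksc_koszul mact_0 gact_lin(2)[of _ _ _ 0 0, simplified sc_0 mult_zero_left])

lemma mact_interchange:
  assumes "mhomog qsig p f" "typed qsig f X Y" "mhomog qsig q g" "typed qsig g X' Y'"
  shows "mact g i (j + dns Y + y) (mact f (i + ups X' + x) j v) =
    ksc (koszul_sign p q) * mact f (i + ups Y' + x) j (mact g i (j + dns X + y) v)"
  using assms(1,2)
proof (induction arbitrary: X Y i j x y v rule: mhomog.induct)
  case (1 a)
  then show ?case using mact_gact_interchange[OF assms(3,4), of i j a y x v]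
    by (simp add: typed_iff) (simp add: qsig_def)
next
  case (4 p f1 p' f2)
  then obtain W where "typed qsig f1 W Y" "typed qsig f2 X W" by (auto simp: typed_iff)
  then show ?case unfolding koszul_add using 4 by (simp add: mact_lin)
next
  case (5 p f1 p' f2)
  then obtain X1 X2 Y1 Y2 where t: "X = X1 @ X2" "Y = Y1 @ Y2" "typed qsig f1 X1 Y1" "typed qsig f2 X2 Y2"
    by (auto simp: typed_iff)
  have "mact g i (j + dns Y1 + (y + dns Y2)) (mact f1 (i + ups X' + (ups Y2 + x)) j w) =
    ksc (koszul_sign p q) * mact f1 (i + ups Y' + (ups Y2 + x)) j (mact g i (j + dns X1 + (y + dns Y2)) w)" for w
    by (rule 5(3)[OF t(3)])
  moreover have "mact g i (j + dns X1 + dns Y2 + y) (mact f2 (i + ups X' + x) (j + dns X1) w) =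
    ksc (koszul_sign p' q) * mact f2 (i + ups Y' + x) (j + dns X1) (mact g i (j + dns X1 + dns X2 + y) w)" for w
    by (rule 5(4)[OF t(4)])
  ultimately show ?case unfolding koszul_add using typed_dom[OF t(3)] typed_dom[OF t(4)]
    by (simp add: t mact_lin ac_simps)
next
  case (6 p f1 f2)
  then have "typed qsig f1 X Y" "typed qsig f2 X Y" by (simp_all add: typed_iff)
  with 6 show ?case by (simp add: mact_lin distrib_left)
next
  case (7 p f1 c)
  then show ?case by (simp add: typed_iff mact_lin ksc_ksc_commute[of c])
qed (auto simp: typed_iff ksc_koszul mact_0)

section \<open>Operators of derived morphisms and the defining relations\<close>

text \<open>The zigzag of a downward strand that has j downward strands on its left.\<close>

lemma hE_ha_hai: "hE (sh x * (ha (Suc j) * hai j)) = x"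
proof -
  have "sh x * (ha (Suc j) * hai j) = sh (x * hai j) * (ht 0 * sh (ha j))"
    by (simp add: crossings(6)[of j j] shift.hom_mult mult.assoc del: ha.simps)
  then show ?thesis by (simp only: hE_left hE_hs_sh mult.assoc hai_ha mult_1_right)
qed

text \<open>This is what entitles its inverse \<open>r_minus\<close> to act as the identity.\<close>

lemma mact_l_plus: "mact l_plus i j x = x"
  by (simp add: l_plus_def rot_def mult.assoc hs_ht' hr_hl hE_ha_hai del: ha.simps)

lemma hai_ht_far: "n < k ==> ht k * hai n = hai n * ht k"
proof -
  assume "n < k"
  then have "hai n * (ha n * ht k) * hai n = hai n * (ht k * ha n) * hai n" by (simp add: ha_ht_far)
  then show ?thesis by (simp add: mult.assoc ha_hai)
qed

lemma mact_d_plus: "mact d_plus i j x = x * ht j"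
proof -
  have "hr i * (hl i * (sh x * ha (Suc (Suc j))) * hai j) = sh x * (ha (Suc j) * hai j) * sh (ht j)"
    by (simp add: mult.assoc hr_hl ha_Suc_right hai_ht_far del: ha.simps)
  then have "hE (hr i * (hl i * (sh x * ha (Suc (Suc j))) * hai j)) = x * ht j"
    by (simp only: hE_right hE_ha_hai)
  then show ?thesis by (simp add: d_plus_def rot_def mult.assoc mact_l_plus del: ha.simps)
qed

lemma hai_hc_ha: "hai j * (hc 0 * ha j) = (hc j :: 'k::comm_ring_1 hcl)"
proof (induction j)
  case (Suc j)
  have "hs 0 * (hc 0 * (ht 0 * x)) = hc (Suc 0) * (x :: 'k hcl)" for x
    by (simp add: hs_slide' hs_ht')
  then have "hai (Suc j) * (hc 0 * ha (Suc j)) = sh (hai j * (hc 0 * ha j) :: 'k hcl)"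
    by (simp add: shift.hom_mult mult.assoc)
  then show ?case by (simp add: Suc)
qed simp

text \<open>The case i = 0 is the one for the images of the generators \<open>BPs\<close>, which
  have no upward strand to their right.\<close>

lemma mact_clif_down: "mact clif_down 0 j x = hat x * hc j"
proof -
  have "hc 0 * (sh x * (ha (Suc j) * hai j)) = sh (hat x * hai j) * (hc 0 * (ht 0 * sh (ha j)))"
    by (simp add: crossings(6)[of j j] hc_sh' shift.hom_mult mult.assoc hk_hat[OF ha_hk(2)] del: ha.simps)
  also have "hc 0 * (ht 0 * sh (ha j)) = ht 0 * sh (hc 0 * ha j)"
    using comm_tail[OF ht_slide[of 0, symmetric]] by (simp add: shift.hom_mult)
  finally have "hE (hc 0 * (sh x * (ha (Suc j) * hai j))) = hat x * hc j"
    by (simp only: hE_left hE_hs_sh mult.assoc hai_hc_ha)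
  then show ?thesis by (simp add: clif_down_def rot_def mult.assoc del: ha.simps)
qed

text \<open>A dotted circle to the left of i strands: \<open>hE_conj\<close> removes the strands one
  by one.\<close>

lemma hE_hr_hc_hl: "hE (hr i * (hc i * hl i)) = (0 :: 'k::comm_ring_1 hcl)"
proof (induction i)
  case 0 show ?case by (simp add: hE_hc0)
next
  case (Suc i)
  have "hr (Suc i) * (hc (Suc i) * hl (Suc i)) = hs 0 * (sh (hr i * (hc i * hl i)) * (ht 0 :: 'k hcl))"
    by (simp add: hr_Suc_left hl_Suc_right shift.hom_mult mult.assoc del: hr.simps hl.simps)
  then show ?case by (simp only: hE_conj Suc shift.hom_0)
qed

lemma mact_rel:
  assumes "(f, g) \<in> qrels z" "v \<in> corner z"
  shows "mact f i j v = mact g i j v"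
  using assms(1) unfolding qrels_def
proof (elim insertE emptyE, goal_cases)
  case 5
  then show ?case by (simp add: ht_braid')
next
  case 6
  then show ?case using corner_hz[OF assms(2)] by (simp add: ht_def distrib_right ksc_simps)
next
  case 8
  then show ?case by (simp add: comm_tail[OF ht_slide])
next
  case 9
  have "hr i * (hc i * (hl i * (sh v * ha j)) * hai j) = hr i * (hc i * hl i) * sh v"
    by (simp add: mult.assoc ha_hai)
  then have "hE (hr i * (hc i * (hl i * (sh v * ha j)) * hai j)) = 0"
    by (simp only: hE_right hE_hr_hc_hl mult_zero_left)
  with 9 show ?case by (simp add: cap_R_def mult.assoc)
next
  case 11
  have "hr i * (hl (Suc i) * (sh v * ha j) * hai j) = sh (hl i) * (ht 0 * sh (hr i * v))"
    by (simp add: comm_tail[OF crossings(3)[of i i]] shift.hom_mult mult.assoc ha_hai del: hl.simps)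
  then have "hE (hr i * (hl (Suc i) * (sh v * ha j) * hai j)) = v"
    by (simp only: hE_left hE_hs_sh hr_hl)
  with 11 show ?case by (simp add: mult.assoc del: hl.simps)
qed (simp_all add: hs_ht' mact_l_plus hc_sq' ksc_simps cap_R_def mult.assoc hr_hl ha_hai hE_sh hE_ha_hai del: ha.simps)

theorem mact_mcong:
  assumes "mcong qsig (qrels z) X Y f g" "v \<in> corner z"
  shows "mact f i j v = mact g i j v"
  using assms
proof (induction arbitrary: i j v rule: mcong.induct)
  case (rel f g X Y)
  then show ?case using mact_rel by blast
next
  case (tens_cong X Y f f' X' Y' g g')
  then show ?case
    using mcong_typed[OF tens_cong(1)] mcong_typed[OF tens_cong(2)] by (auto dest!: typed_dom simp: mact_corner)
next
  case (interchange f' Y W f X g Y' W' g' X' p q)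
  then show ?case
    using mact_interchange[OF interchange(5,2,6,3), where x = 0 and y = 0 and i = i and j = j]
    by (auto dest!: typed_dom simp: mact_lin)
qed (auto dest!: typed_dom simp: mact_lin mact_corner ksc_simps distrib_left distrib_right mult.assoc ac_simps)

section \<open>Families of morphisms\<close>

text \<open>Composites of morphisms that do not match are zero, which makes associativity and whiskering
  unconditional.\<close>

datatype 'k qraw = QRaw (rdom: "updown list") (rcod: "updown list") (rfam: "'k => 'k qterm")

definition qeq :: "'k::comm_ring_1 qraw => 'k qraw => bool" where
  "qeq a b \<longleftrightarrow> rdom a = rdom b \<and> rcod a = rcod b \<and>
    (\<forall>z. mcong qsig (qrels z) (rdom a) (rcod a) (rfam a z) (rfam b z))"

abbreviation qt :: "'k qterm => updown list => updown list => bool" where "qt \<equiv> typed qsig"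
abbreviation qc :: "'k::comm_ring_1 => updown list => updown list => 'k qterm => 'k qterm => bool"
  where "qc z \<equiv> mcong qsig (qrels z)"

lemma qeq_self: "qeq a a \<longleftrightarrow> (\<forall>z. qt (rfam a z) (rdom a) (rcod a))"
  unfolding qeq_def using mcong_typed mcong.refl by blast

quotient_type (overloaded) 'k qm = "'k::comm_ring_1 qraw" / partial: qeq
proof (rule part_equivpI)
  show "\<exists>x. qeq x x"
    by (rule exI[of _ "QRaw [] [] (\<lambda>_. MId [])"]) (simp add: qeq_self typed.intros)
  show "symp qeq" by (auto simp: symp_def qeq_def intro: mcong.sym)
  show "transp qeq" unfolding transp_def qeq_def by (metis mcong.trans)
qed

lemma qc_comp_zero: "qt h X Y ==> qc z X W (MZero Y W \<bullet> h) (MZero X W)"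
  "qt h Y W ==> qc z X W (h \<bullet> MZero X Y) (MZero X W)"
proof -
  have 0: "qc z A B (MZero A B) (0 *\<^sub>m MZero A B)" for A B
    by (intro mcong.sym[OF mcong.zero_scale] typed.intros)
  show "qc z X W (MZero Y W \<bullet> h) (MZero X W)" if h: "qt h X Y"
    by (rule mcong.trans[OF mcong.comp_cong[OF 0 mcong.refl[OF h]] mcong.trans[OF mcong.scale_comp mcong.zero_scale]])
      (auto simp: typed_iff intro!: h)
  show "qc z X W (h \<bullet> MZero X Y) (MZero X W)" if h: "qt h Y W"
    by (rule mcong.trans[OF mcong.comp_cong[OF mcong.refl[OF h] 0] mcong.trans[OF mcong.comp_scale mcong.zero_scale]])
      (auto simp: typed_iff intro!: h)
qed

lemma qc_tens_zero: "qt h A B ==> qc z (X @ A) (Y @ B) (MZero X Y \<boxtimes> h) (MZero (X @ A) (Y @ B))"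
  "qt h A B ==> qc z (A @ X) (B @ Y) (h \<boxtimes> MZero X Y) (MZero (A @ X) (B @ Y))"
proof -
  have 0: "qc z A B (MZero A B) (0 *\<^sub>m MZero A B)" for A B
    by (intro mcong.sym[OF mcong.zero_scale] typed.intros)
  show "qc z (X @ A) (Y @ B) (MZero X Y \<boxtimes> h) (MZero (X @ A) (Y @ B))" if h: "qt h A B"
    by (rule mcong.trans[OF mcong.tens_cong[OF 0 mcong.refl[OF h]] mcong.trans[OF mcong.scale_tens mcong.zero_scale]])
      (auto intro!: h typed.intros)
  show "qc z (A @ X) (B @ Y) (h \<boxtimes> MZero X Y) (MZero (A @ X) (B @ Y))" if h: "qt h A B"
    by (rule mcong.trans[OF mcong.tens_cong[OF mcong.refl[OF h] 0] mcong.trans[OF mcong.tens_scale mcong.zero_scale]])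
      (auto intro!: h typed.intros)
qed

lift_definition dm :: "'k::comm_ring_1 qm => updown list" is rdom by (simp add: qeq_def)
lift_definition cd :: "'k::comm_ring_1 qm => updown list" is rcod by (simp add: qeq_def)

lift_definition cmp :: "'k::comm_ring_1 qm => 'k qm => 'k qm"  (infixl \<open>\<star>\<close> 68)
  is "\<lambda>a b. QRaw (rdom b) (rcod a) (\<lambda>z. if rdom a = rcod b then rfam a z \<bullet> rfam b z else MZero (rdom b) (rcod a))"
  subgoal for a a' b b'
    by (cases "rdom a = rcod b")
      (auto simp: qeq_def intro: mcong.comp_cong[where Y = "rcod b"] mcong.refl typed.intros)
  done

lift_definition tns :: "'k::comm_ring_1 qm => 'k qm => 'k qm"  (infixl \<open>\<otimes>\<^sub>q\<close> 70)
  is "\<lambda>a b. QRaw (rdom a @ rdom b) (rcod a @ rcod b) (\<lambda>z. rfam a z \<boxtimes> rfam b z)"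
  by (auto simp: qeq_def intro: mcong.tens_cong)

lift_definition pls :: "'k::comm_ring_1 qm => 'k qm => 'k qm"  (infixl \<open>\<oplus>\<^sub>q\<close> 65)
  is "\<lambda>a b. if rdom a = rdom b \<and> rcod a = rcod b then QRaw (rdom a) (rcod a) (\<lambda>z. rfam a z \<uplus> rfam b z) else a"
  by (auto simp: qeq_def intro: mcong.add_cong)

lift_definition scl :: "('k => 'k) => 'k::comm_ring_1 qm => 'k qm"  (infixr \<open>*\<^sub>q\<close> 75)
  is "\<lambda>c a. QRaw (rdom a) (rcod a) (\<lambda>z. c z *\<^sub>m rfam a z)"
  by (auto simp: qeq_def intro: mcong.scale_cong)

lift_definition idq :: "updown list => 'k::comm_ring_1 qm" is "\<lambda>X. QRaw X X (\<lambda>_. MId X)"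
  by (auto simp: qeq_def intro: mcong.refl typed.intros)

lift_definition zrq :: "updown list => updown list => 'k::comm_ring_1 qm" is "\<lambda>X Y. QRaw X Y (\<lambda>_. MZero X Y)"
  by (auto simp: qeq_def intro: mcong.refl typed.intros)

lift_definition gnq :: "qgen => 'k::comm_ring_1 qm" is "\<lambda>g. QRaw (qdom g) (qcod g) (\<lambda>_. MGen g)"
  by (auto simp: qeq_self typed_iff) (auto simp: qsig_def)

lemma dm_simps [simp]: "dm (f \<star> g) = dm g" "dm (f \<otimes>\<^sub>q g) = dm f @ dm g" "dm (f \<oplus>\<^sub>q g) = dm f"
  "dm (c *\<^sub>q f) = dm f" "dm (idq X) = X" "dm (zrq X Y) = X" "dm (gnq a) = qdom a"
  by (transfer; simp)+

lemma cd_simps [simp]: "cd (f \<star> g) = cd f" "cd (f \<otimes>\<^sub>q g) = cd f @ cd g" "cd (f \<oplus>\<^sub>q g) = cd f"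
  "cd (c *\<^sub>q f) = cd f" "cd (idq X) = X" "cd (zrq X Y) = Y" "cd (gnq a) = qcod a"
  by (transfer; simp)+

lemma cmp_assoc: "f \<star> g \<star> h = f \<star> (g \<star> h)"
  apply (transfer, unfold qeq_self)
  subgoal for f g h
    by (auto simp: qeq_def intro: mcong.refl typed.intros
        mcong.comp_assoc[where W = "rcod g" and Y = "rcod h"] qc_comp_zero mcong.sym[OF qc_comp_zero(2)])
  done

lemma idq_cmp [simp]: "idq (cd f) \<star> f = f" "f \<star> idq (dm f) = f"
  by (transfer; auto simp: qeq_self; auto simp: qeq_def intro: mcong.id_comp mcong.comp_id)+

lemma idq_cmp': "X = cd f ==> idq X \<star> f = f" "X = dm f ==> f \<star> idq X = f"
  by simp_all

lemma tns_assoc: "f \<otimes>\<^sub>q g \<otimes>\<^sub>q h = f \<otimes>\<^sub>q (g \<otimes>\<^sub>q h)"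
  by transfer (auto simp: qeq_self, auto simp: qeq_def intro: mcong.tens_assoc)

lemma tns_unit [simp]: "idq [] \<otimes>\<^sub>q f = f" "f \<otimes>\<^sub>q idq [] = f"
  by (transfer; auto simp: qeq_self; auto simp: qeq_def intro: mcong.unit_tens mcong.tens_unit)+

lemma idq_tns: "idq X \<otimes>\<^sub>q idq Y = idq (X @ Y)"
  by transfer (auto simp: qeq_def intro: mcong.id_tens_id)

section \<open>Parity of families\<close>

definition hmq :: "bit => 'k::comm_ring_1 qm => bool" where
  "hmq p f \<longleftrightarrow> (\<exists>a. qeq a a \<and> f = abs_qm a \<and> (\<forall>z. mhomog qsig p (rfam a z)))"

lemma qc_zero_self: "qc z X Y (c *\<^sub>m MZero X Y) (MZero X Y)" "qc z X Y (MZero X Y) (c *\<^sub>m MZero X Y)"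
  "qc z X Y (MZero X Y \<uplus> MZero X Y) (MZero X Y)" "qc z X Y (MZero X Y) (MZero X Y \<uplus> MZero X Y)"
proof -
  have t: "qt (MZero X Y) X Y" by (rule typed.intros)
  have 0: "qc z X Y (MZero X Y) (0 *\<^sub>m MZero X Y)" by (rule mcong.sym[OF mcong.zero_scale[OF t]])
  have "qc z X Y (c *\<^sub>m MZero X Y) (c *\<^sub>m 0 *\<^sub>m MZero X Y)" by (rule mcong.scale_cong[OF 0])
  then have "qc z X Y (c *\<^sub>m MZero X Y) ((c * 0) *\<^sub>m MZero X Y)" by (rule mcong.trans) (rule mcong.scale_scale[OF t])
  then show a: "qc z X Y (c *\<^sub>m MZero X Y) (MZero X Y)" using mcong.trans[OF _ mcong.zero_scale[OF t]] by simp
  show b: "qc z X Y (MZero X Y \<uplus> MZero X Y) (MZero X Y)" by (rule mcong.add_zero[OF t])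
  show "qc z X Y (MZero X Y) (c *\<^sub>m MZero X Y)" "qc z X Y (MZero X Y) (MZero X Y \<uplus> MZero X Y)"
    by (rule mcong.sym[OF a] mcong.sym[OF b])+
qed

lemma pls_cmp: "dm f = dm f' ==> cd f = cd f' ==> (f \<oplus>\<^sub>q f') \<star> g = f \<star> g \<oplus>\<^sub>q f' \<star> g"
  apply (transfer, unfold qeq_self)
  subgoal for f f' g
    by (auto simp: qeq_def intro: qc_zero_self mcong.add_comp[where Y = "rcod g"])
  done

lemma cmp_pls: "dm f = dm f' ==> cd f = cd f' ==> g \<star> (f \<oplus>\<^sub>q f') = g \<star> f \<oplus>\<^sub>q g \<star> f'"
  apply (transfer, unfold qeq_self)
  subgoal for f f' g
    by (auto simp: qeq_def intro: qc_zero_self mcong.comp_add[where Y = "rcod f'"])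
  done

lemma scl_cmp [simp]: "(c *\<^sub>q f) \<star> g = c *\<^sub>q (f \<star> g)"
  apply (transfer, unfold qeq_self)
  subgoal for c f g
    by (auto simp: qeq_def intro: qc_zero_self mcong.scale_comp[where Y = "rcod g"])
  done

lemma cmp_scl [simp]: "f \<star> (c *\<^sub>q g) = c *\<^sub>q (f \<star> g)"
  apply (transfer, unfold qeq_self)
  subgoal for f c g
    by (auto simp: qeq_def intro: qc_zero_self mcong.comp_scale[where Y = "rcod g"])
  done

lemma pls_tns: "dm f = dm f' ==> cd f = cd f' ==> (f \<oplus>\<^sub>q f') \<otimes>\<^sub>q g = f \<otimes>\<^sub>q g \<oplus>\<^sub>q f' \<otimes>\<^sub>q g"
  by (transfer, unfold qeq_self) (auto simp: qeq_def intro: mcong.add_tens)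

lemma tns_pls: "dm f = dm f' ==> cd f = cd f' ==> g \<otimes>\<^sub>q (f \<oplus>\<^sub>q f') = g \<otimes>\<^sub>q f \<oplus>\<^sub>q g \<otimes>\<^sub>q f'"
  by (transfer, unfold qeq_self) (auto simp: qeq_def intro: mcong.tens_add)

lemma scl_tns [simp]: "(c *\<^sub>q f) \<otimes>\<^sub>q g = c *\<^sub>q (f \<otimes>\<^sub>q g)"
  by (transfer, unfold qeq_self) (auto simp: qeq_def intro: mcong.scale_tens)

lemma tns_scl [simp]: "f \<otimes>\<^sub>q (c *\<^sub>q g) = c *\<^sub>q (f \<otimes>\<^sub>q g)"
  by (transfer, unfold qeq_self) (auto simp: qeq_def intro: mcong.tens_scale)

lemma pls_assoc: "dm f = dm g ==> cd f = cd g ==> dm g = dm h ==> cd g = cd h ==> f \<oplus>\<^sub>q g \<oplus>\<^sub>q h = f \<oplus>\<^sub>q (g \<oplus>\<^sub>q h)"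
  by (transfer, unfold qeq_self) (auto simp: qeq_def intro: mcong.add_assoc)

lemma pls_comm: "dm f = dm g ==> cd f = cd g ==> f \<oplus>\<^sub>q g = g \<oplus>\<^sub>q f"
  by (transfer, unfold qeq_self) (auto simp: qeq_def intro: mcong.add_comm)

lemma pls_zrq: "dm f = X ==> cd f = Y ==> f \<oplus>\<^sub>q zrq X Y = f"
  by (transfer, unfold qeq_self) (auto simp: qeq_def intro: mcong.add_zero)

lemma scl_zero: "(\<lambda>_. 0) *\<^sub>q f = zrq (dm f) (cd f)"
  by (transfer, unfold qeq_self) (auto simp: qeq_def intro: mcong.zero_scale)

lemma scl_one [simp]: "(\<lambda>_. 1) *\<^sub>q f = f"
  by (transfer, unfold qeq_self) (auto simp: qeq_def intro: mcong.one_scale)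

lemma scl_scl [simp]: "c *\<^sub>q d *\<^sub>q f = (\<lambda>z. c z * d z) *\<^sub>q f"
  by (transfer, unfold qeq_self) (auto simp: qeq_def intro: mcong.scale_scale)

lemma scl_pls: "dm f = dm g ==> cd f = cd g ==> c *\<^sub>q (f \<oplus>\<^sub>q g) = c *\<^sub>q f \<oplus>\<^sub>q c *\<^sub>q g"
  by (transfer, unfold qeq_self) (auto simp: qeq_def intro: mcong.scale_add)

lemma pls_scl: "(\<lambda>z. c z + d z) *\<^sub>q f = c *\<^sub>q f \<oplus>\<^sub>q d *\<^sub>q f"
  by (transfer, unfold qeq_self) (auto simp: qeq_def intro: mcong.add_scale)

lemma zrq_cmp [simp]: "zrq Y W \<star> f = zrq (dm f) W" "f \<star> zrq X Y = zrq X (cd f)"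
  by ((transfer, unfold qeq_self), auto simp: qeq_def intro: qc_comp_zero mcong.refl typed.intros)+

lemma zrq_tns [simp]: "zrq X Y \<otimes>\<^sub>q f = zrq (X @ dm f) (Y @ cd f)" "f \<otimes>\<^sub>q zrq X Y = zrq (dm f @ X) (cd f @ Y)"
  by ((transfer, unfold qeq_self), auto simp: qeq_def intro: qc_tens_zero)+

lemma scl_zrq [simp]: "c *\<^sub>q zrq X Y = zrq X Y"
  by transfer (auto simp: qeq_def intro: qc_zero_self)

lemma cmp_mismatch: "dm f \<noteq> cd g ==> f \<star> g = zrq (dm g) (cd f)"
  by (transfer, unfold qeq_self) (auto simp: qeq_def intro: mcong.refl typed.intros)

definition qf :: "updown list => updown list => ('k::comm_ring_1 => 'k qterm) => 'k qm" where
  "qf X Y F = abs_qm (QRaw X Y F)"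

lemma qf_eq: "(\<And>z. qt (F z) X Y) ==> (\<And>z. qt (G z) X Y) ==> qf X Y F = qf X Y G \<longleftrightarrow> (\<forall>z. qc z X Y (F z) (G z))"
  using Quotient_rel[OF Quotient_qm, of "QRaw X Y F" "QRaw X Y G"]
  by (auto simp: qf_def qeq_self) (auto simp: qeq_def)

lemma qf_terms: "\<exists>F. (\<forall>z. qt (F z) (dm f) (cd f)) \<and> f = qf (dm f) (cd f) F"
proof -
  have r: "qeq (rep_qm f) (rep_qm f)" by (rule Quotient_rep_reflp[OF Quotient_qm])
  have a: "f = abs_qm (rep_qm f)" by (simp add: Quotient_abs_rep[OF Quotient_qm])
  have d: "dm f = rdom (rep_qm f)" "cd f = rcod (rep_qm f)"
    using r by (subst a, simp add: dm.abs_eq cd.abs_eq)+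
  show ?thesis using r a by (intro exI[of _ "rfam (rep_qm f)"]) (simp add: qeq_self d qf_def)
qed

lemma qf_typ: "(\<And>z. qt (F z) X Y) ==> dm (qf X Y F) = X" "(\<And>z. qt (F z) X Y) ==> cd (qf X Y F) = Y"
  by (simp_all add: qf_def dm.abs_eq cd.abs_eq qeq_self)

lemma qf_cmp: "(\<And>z. qt (F z) Y W) ==> (\<And>z. qt (G z) X Y) ==> qf Y W F \<star> qf X Y G = qf X W (\<lambda>z. F z \<bullet> G z)"
  by (simp add: qf_def cmp.abs_eq qeq_self)

lemma qf_tns: "(\<And>z. qt (F z) X Y) ==> (\<And>z. qt (G z) X' Y') ==> qf X Y F \<otimes>\<^sub>q qf X' Y' G = qf (X @ X') (Y @ Y') (\<lambda>z. F z \<boxtimes> G z)"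
  by (simp add: qf_def tns.abs_eq qeq_self)

lemma qf_pls: "(\<And>z. qt (F z) X Y) ==> (\<And>z. qt (G z) X Y) ==> qf X Y F \<oplus>\<^sub>q qf X Y G = qf X Y (\<lambda>z. F z \<uplus> G z)"
  by (simp add: qf_def pls.abs_eq qeq_self)

lemma qf_scl: "(\<And>z. qt (F z) X Y) ==> c *\<^sub>q qf X Y F = qf X Y (\<lambda>z. c z *\<^sub>m F z)"
  by (simp add: qf_def scl.abs_eq qeq_self)

lemma qf_basic: "qf X X (\<lambda>_. MId X) = idq X" "qf X Y (\<lambda>_. MZero X Y) = zrq X Y" "qf (qdom a) (qcod a) (\<lambda>_. MGen a) = gnq a"
  by (simp_all add: qf_def idq.abs_eq zrq.abs_eq gnq.abs_eq)

lemma hmq_qf: "hmq p (qf X Y F)" if "\<And>z. qt (F z) X Y" "\<And>z. mhomog qsig p (F z)"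
  unfolding hmq_def qf_def using that by (intro exI[of _ "QRaw X Y F"]) (simp add: qeq_self)

lemma hmq_terms:
  assumes "hmq p f"
  shows "\<exists>F. (\<forall>z. qt (F z) (dm f) (cd f)) \<and> f = qf (dm f) (cd f) F \<and> (\<forall>z. mhomog qsig p (F z))"
proof -
  obtain a where a: "qeq a a" "f = abs_qm a" "\<And>z. mhomog qsig p (rfam a z)" using assms by (auto simp: hmq_def)
  then have "dm f = rdom a" "cd f = rcod a" by (simp_all add: dm.abs_eq cd.abs_eq)
  then show ?thesis using a by (intro exI[of _ "rfam a"]) (simp add: qeq_self qf_def)
qed

lemma qf_interchange:
  assumes f: "\<And>z. qt (F z) X Y" and g: "\<And>z. qt (G z) Y' W'" and f': "\<And>z. qt (F' z) Y W" and g': "\<And>z. qt (G' z) X' Y'"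
    and h: "\<And>z. mhomog qsig p (F z)" "\<And>z. mhomog qsig q (G z)"
  shows "(qf Y W F' \<otimes>\<^sub>q qf Y' W' G) \<star> (qf X Y F \<otimes>\<^sub>q qf X' Y' G') =
    (\<lambda>_. koszul_sign p q) *\<^sub>q ((qf Y W F' \<star> qf X Y F) \<otimes>\<^sub>q (qf Y' W' G \<star> qf X' Y' G'))"
  unfolding qf_tns[OF f' g] qf_tns[OF f g'] qf_cmp[OF f' f] qf_cmp[OF g g']
    qf_cmp[OF typed.intros(5)[OF f' g] typed.intros(5)[OF f g']]
    qf_tns[OF typed.intros(4)[OF f' f] typed.intros(4)[OF g g']]
    qf_scl[OF typed.intros(5)[OF typed.intros(4)[OF f' f] typed.intros(4)[OF g g']]]
  by (rule qf_eq[THEN iffD2]) (rule typed.intros f g f' g' allI mcong.interchange h)+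

lemma cmp_tns:
  assumes "hmq p f" "hmq q g" "dm f' = cd f" "dm g = cd g'"
  shows "(f' \<otimes>\<^sub>q g) \<star> (f \<otimes>\<^sub>q g') = (\<lambda>_. koszul_sign p q) *\<^sub>q ((f' \<star> f) \<otimes>\<^sub>q (g \<star> g'))"
proof -
  obtain F where F: "\<And>z. qt (F z) (dm f) (cd f)" "f = qf (dm f) (cd f) F" "\<And>z. mhomog qsig p (F z)"
    using hmq_terms[OF assms(1)] by blast
  obtain G where G: "\<And>z. qt (G z) (cd g') (cd g)" "g = qf (cd g') (cd g) G" "\<And>z. mhomog qsig q (G z)"
    using hmq_terms[OF assms(2)] unfolding assms(4) by blast
  obtain F' where F': "\<And>z. qt (F' z) (cd f) (cd f')" "f' = qf (cd f) (cd f') F'"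
    using qf_terms[of f'] unfolding assms(3) by blast
  obtain G' where G': "\<And>z. qt (G' z) (dm g') (cd g')" "g' = qf (dm g') (cd g') G'" using qf_terms[of g'] by blast
  show ?thesis using qf_interchange[where F = F and G = G and F' = F' and G' = G', OF F(1) G(1) F'(1) G'(1) F(3) G(3)]
    unfolding F(2)[symmetric] G(2)[symmetric] F'(2)[symmetric] G'(2)[symmetric] .
qed

lemma hmq_cmp: "hmq p f ==> hmq q g ==> hmq (p + q) (f \<star> g)"
proof (cases "dm f = cd g")
  case False
  then show ?thesis using hmq_qf[of "\<lambda>_. MZero (dm g) (cd f)" "dm g" "cd f" "p + q"]
    by (simp add: cmp_mismatch qf_basic typed.intros mhomog.intros)
next
  case True
  assume f: "hmq p f" and g: "hmq q g"
  obtain F where F: "\<And>z. qt (F z) (dm f) (cd f)" "f = qf (dm f) (cd f) F" "\<And>z. mhomog qsig p (F z)" using hmq_terms[OF f] by blast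
  obtain G where G: "\<And>z. qt (G z) (dm g) (cd g)" "g = qf (dm g) (cd g) G" "\<And>z. mhomog qsig q (G z)" using hmq_terms[OF g] by blast
  have "f \<star> g = qf (dm g) (cd f) (\<lambda>z. F z \<bullet> G z)"
    by (subst F(2), subst G(2), subst True, rule qf_cmp) (use F G True in auto)
  moreover have "hmq (p + q) (qf (dm g) (cd f) (\<lambda>z. F z \<bullet> G z))"
    by (rule hmq_qf[OF typed.intros(4) mhomog.intros(4)[OF F(3) G(3)]]) (rule F(1)[unfolded True] G(1))+
  ultimately show ?thesis by simp
qed

lemma hmq_tns: "hmq p f ==> hmq q g ==> hmq (p + q) (f \<otimes>\<^sub>q g)"
proof -
  assume f: "hmq p f" and g: "hmq q g"
  obtain F where F: "\<And>z. qt (F z) (dm f) (cd f)" "f = qf (dm f) (cd f) F" "\<And>z. mhomog qsig p (F z)" using hmq_terms[OF f] by blast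
  obtain G where G: "\<And>z. qt (G z) (dm g) (cd g)" "g = qf (dm g) (cd g) G" "\<And>z. mhomog qsig q (G z)" using hmq_terms[OF g] by blast
  have "f \<otimes>\<^sub>q g = qf (dm f @ dm g) (cd f @ cd g) (\<lambda>z. F z \<boxtimes> G z)"
    by (subst F(2), subst G(2), rule qf_tns) (use F G in auto)
  moreover have "hmq (p + q) (qf (dm f @ dm g) (cd f @ cd g) (\<lambda>z. F z \<boxtimes> G z))"
    by (rule hmq_qf[OF typed.intros(5)[OF F(1) G(1)] mhomog.intros(5)[OF F(3) G(3)]])
  ultimately show ?thesis by simp
qed

lemma hmq_pls: "hmq p f ==> hmq p g ==> dm f = dm g ==> cd f = cd g ==> hmq p (f \<oplus>\<^sub>q g)"
proof -
  assume f: "hmq p f" and g: "hmq p g" and e: "dm f = dm g" "cd f = cd g"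
  obtain F where F: "\<And>z. qt (F z) (dm f) (cd f)" "f = qf (dm f) (cd f) F" "\<And>z. mhomog qsig p (F z)" using hmq_terms[OF f] by blast
  obtain G where G: "\<And>z. qt (G z) (dm g) (cd g)" "g = qf (dm g) (cd g) G" "\<And>z. mhomog qsig p (G z)" using hmq_terms[OF g] by blast
  have "f \<oplus>\<^sub>q g = qf (dm g) (cd g) (\<lambda>z. F z \<uplus> G z)"
    by (subst F(2), subst G(2), unfold e, rule qf_pls) (use F G e in auto)
  then show ?thesis using F G e by (auto intro!: hmq_qf intro: typed.intros mhomog.intros)
qed

lemma hmq_scl: "hmq p f ==> hmq p (c *\<^sub>q f)"
proof -
  assume f: "hmq p f"
  obtain F where F: "\<And>z. qt (F z) (dm f) (cd f)" "f = qf (dm f) (cd f) F" "\<And>z. mhomog qsig p (F z)" using hmq_terms[OF f] by blast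
  have "c *\<^sub>q f = qf (dm f) (cd f) (\<lambda>z. c z *\<^sub>m F z)"
    by (subst F(2), rule qf_scl) (use F in auto)
  then show ?thesis using F by (auto intro!: hmq_qf intro: typed.intros mhomog.intros)
qed

lemma hmq_basic: "hmq 0 (idq X)" "hmq p (zrq X Y)" "hmq (if a = Clif then 1 else 0) (gnq a)"
proof -
  show "hmq 0 (idq X)" "hmq p (zrq X Y)" using hmq_qf[of "\<lambda>_. MId X" X X 0] hmq_qf[of "\<lambda>_. MZero X Y" X Y p]
    by (simp_all add: qf_basic typed.intros mhomog.intros)
  show "hmq (if a = Clif then 1 else 0) (gnq a)"
  proof -
    have s: "sdom qsig a = qdom a" "scod qsig a = qcod a" "spar qsig a = (if a = Clif then 1 else 0)"
      by (simp_all add: qsig_def)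
    show ?thesis using hmq_qf[OF typed.intros(1)[of qsig a] mhomog.intros(1)[of qsig a]] by (simp only: s qf_basic)
  qed
qed

definition evn :: "'k::comm_ring_1 qm => bool" where "evn f = hmq 0 f"

lemma evn_simps [simp]: "evn (idq X)" "evn (zrq X Y)" "evn f ==> evn g ==> evn (f \<star> g)"
  "evn f ==> evn g ==> evn (f \<otimes>\<^sub>q g)" "a \<noteq> Clif ==> evn (gnq a)" "evn f ==> evn (c *\<^sub>q f)"
  "evn f ==> evn g ==> dm f = dm g ==> cd f = cd g ==> evn (f \<oplus>\<^sub>q g)"
  using hmq_cmp[of 0 f 0 g] hmq_tns[of 0 f 0 g] hmq_basic(3)[of a] by (auto simp: evn_def hmq_basic hmq_scl hmq_pls)

text \<open>The interchange law is available for homogeneous families; splitting into an even and an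
  odd part extends it to all others in \<open>bifunct\<close>.\<close>

definition graded :: "'k::comm_ring_1 qm => bool" where
  "graded f \<longleftrightarrow> (\<exists>f0 f1. hmq 0 f0 \<and> hmq 1 f1 \<and> dm f0 = dm f \<and> dm f1 = dm f \<and> cd f0 = cd f \<and> cd f1 = cd f \<and> f = f0 \<oplus>\<^sub>q f1)"

lemma graded_hmq: "hmq p f ==> graded f"
proof (cases "p = 0")
  case True assume "hmq p f" then show ?thesis using True unfolding graded_def
    by (intro exI[of _ f] exI[of _ "zrq (dm f) (cd f)"]) (simp add: hmq_basic pls_zrq)
next
  case False assume "hmq p f" then show ?thesis using False unfolding graded_def
    by (intro exI[of _ "zrq (dm f) (cd f)"] exI[of _ f]) (simp add: hmq_basic pls_zrq pls_comm[of "zrq _ _"])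
qed

lemma pls_left_comm: "dm f = dm g ==> cd f = cd g ==> dm g = dm h ==> cd g = cd h ==> f \<oplus>\<^sub>q (g \<oplus>\<^sub>q h) = g \<oplus>\<^sub>q (f \<oplus>\<^sub>q h)"
  by (simp add: pls_assoc[symmetric] pls_comm[of f g])

lemma graded_ops: "graded f ==> graded g ==> graded (f \<star> g)"
  "graded f ==> graded g ==> graded (f \<otimes>\<^sub>q g)"
  "graded f ==> graded g ==> dm f = dm g ==> cd f = cd g ==> graded (f \<oplus>\<^sub>q g)"
  "graded f ==> graded (c *\<^sub>q f)"
proof -
  assume f: "graded f"
  then obtain f0 f1 where F: "hmq 0 f0" "hmq 1 f1" "dm f0 = dm f" "dm f1 = dm f" "cd f0 = cd f" "cd f1 = cd f" "f = f0 \<oplus>\<^sub>q f1"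
    unfolding graded_def by blast
  show "graded (c *\<^sub>q f)" unfolding graded_def
    by (rule exI[of _ "c *\<^sub>q f0"], rule exI[of _ "c *\<^sub>q f1"]) (use F in \<open>simp add: hmq_scl scl_pls\<close>)
  assume g: "graded g"
  then obtain g0 g1 where G: "hmq 0 g0" "hmq 1 g1" "dm g0 = dm g" "dm g1 = dm g" "cd g0 = cd g" "cd g1 = cd g" "g = g0 \<oplus>\<^sub>q g1"
    unfolding graded_def by blast
  have h: "hmq 0 (f0 \<otimes>\<^sub>q g0)" "hmq 0 (f1 \<otimes>\<^sub>q g1)" "hmq 1 (f0 \<otimes>\<^sub>q g1)" "hmq 1 (f1 \<otimes>\<^sub>q g0)"
     "hmq 0 (f0 \<star> g0)" "hmq 0 (f1 \<star> g1)" "hmq 1 (f0 \<star> g1)" "hmq 1 (f1 \<star> g0)"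
    using hmq_tns[OF F(1) G(1)] hmq_tns[OF F(2) G(2)] hmq_tns[OF F(1) G(2)] hmq_tns[OF F(2) G(1)]
      hmq_cmp[OF F(1) G(1)] hmq_cmp[OF F(2) G(2)] hmq_cmp[OF F(1) G(2)] hmq_cmp[OF F(2) G(1)] by simp_all
  have "f \<otimes>\<^sub>q g = (f0 \<otimes>\<^sub>q g0 \<oplus>\<^sub>q f1 \<otimes>\<^sub>q g1) \<oplus>\<^sub>q (f0 \<otimes>\<^sub>q g1 \<oplus>\<^sub>q f1 \<otimes>\<^sub>q g0)"
    unfolding F(7) G(7) using F(1-6) G(1-6)
    by (simp add: pls_tns tns_pls pls_assoc pls_comm[of "f1 \<otimes>\<^sub>q g1"] pls_left_comm[of "f1 \<otimes>\<^sub>q g0" "f0 \<otimes>\<^sub>q g1"])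
  then show "graded (f \<otimes>\<^sub>q g)" unfolding graded_def using F(1-6) G(1-6) h(1-4)
    by (intro exI[of _ "f0 \<otimes>\<^sub>q g0 \<oplus>\<^sub>q f1 \<otimes>\<^sub>q g1"] exI[of _ "f0 \<otimes>\<^sub>q g1 \<oplus>\<^sub>q f1 \<otimes>\<^sub>q g0"]) (simp add: hmq_pls)
  have "f \<star> g = (f0 \<star> g0 \<oplus>\<^sub>q f1 \<star> g1) \<oplus>\<^sub>q (f0 \<star> g1 \<oplus>\<^sub>q f1 \<star> g0)"
    unfolding F(7) G(7) using F(1-6) G(1-6)
    by (simp add: pls_cmp cmp_pls pls_assoc pls_comm[of "f1 \<star> g1"] pls_left_comm[of "f1 \<star> g0" "f0 \<star> g1"])
  then show "graded (f \<star> g)" unfolding graded_def using F(1-6) G(1-6) h(5-8)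
    by (intro exI[of _ "f0 \<star> g0 \<oplus>\<^sub>q f1 \<star> g1"] exI[of _ "f0 \<star> g1 \<oplus>\<^sub>q f1 \<star> g0"]) (simp add: hmq_pls)
  show "graded (f \<oplus>\<^sub>q g)" if t: "dm f = dm g" "cd f = cd g"
  proof -
    note F' = F(3-6)[unfolded t]
    have "f \<oplus>\<^sub>q g = (f0 \<oplus>\<^sub>q g0) \<oplus>\<^sub>q (f1 \<oplus>\<^sub>q g1)"
      unfolding F(7) G(7) using F' G(3-6) by (simp add: pls_assoc pls_left_comm[of f1 g0])
    then show ?thesis unfolding graded_def using F(1,2) F' G(1-6) t
      by (intro exI[of _ "f0 \<oplus>\<^sub>q g0"] exI[of _ "f1 \<oplus>\<^sub>q g1"]) (simp add: hmq_pls)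
  qed
qed

lemma graded_qt: "qt f X Y ==> graded (qf X Y (\<lambda>_. f) :: 'k::comm_ring_1 qm)"
proof (induction rule: typed.induct)
  case (1 a)
  then show ?case using graded_hmq[OF hmq_basic(3)[of a]] by (simp add: qsig_def qf_basic)
next
  case (4 f Y W g X)
  show ?case using graded_ops(1)[OF 4(3,4)] 4(1,2) by (simp add: qf_typ qf_cmp)
next
  case (5 f X Y g X' Y')
  show ?case using graded_ops(2)[OF 5(3,4)] 5(1,2) by (simp add: qf_typ qf_tns)
next
  case (6 f X Y g)
  show ?case using graded_ops(3)[OF 6(3,4)] 6(1,2) by (simp add: qf_typ qf_pls)
next
  case (7 f X Y c)
  show ?case using graded_ops(4)[OF 7(2), of "\<lambda>_. c"] 7(1) by (simp add: qf_scl)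
qed (simp_all add: qf_basic graded_hmq[OF hmq_basic(1)] graded_hmq[OF hmq_basic(2)])

text \<open>The splitting of a single term is carried out for each parameter separately, and the
  choices are collected into two families.\<close>

lemma graded_all: "graded (f :: 'k::comm_ring_1 qm)"
proof -
  obtain F where F: "\<And>z. qt (F z) (dm f) (cd f)" "f = qf (dm f) (cd f) F" using qf_terms[of f] by blast
  have "\<exists>a. qt (fst a) (dm f) (cd f) \<and> qt (snd a) (dm f) (cd f) \<and> mhomog qsig 0 (fst a) \<and> mhomog qsig 1 (snd a) \<and>
     qc z (dm f) (cd f) (F z) (fst a \<uplus> snd a)" for z
  proof -
    let ?h = "qf (dm f) (cd f) (\<lambda>_. F z)"
    have d: "dm ?h = dm f" "cd ?h = cd f" using F(1) by (simp_all add: qf_typ)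
    obtain h0 h1 where H: "hmq 0 h0" "hmq 1 h1" "dm h0 = dm f" "dm h1 = dm f" "cd h0 = cd f" "cd h1 = cd f" "?h = h0 \<oplus>\<^sub>q h1"
      using graded_qt[OF F(1)[of z]] unfolding graded_def d by blast
    obtain A where A: "\<And>z. qt (A z) (dm h0) (cd h0)" "h0 = qf (dm h0) (cd h0) A" "\<And>z. mhomog qsig 0 (A z)" using hmq_terms[OF H(1)] by blast
    obtain B where B: "\<And>z. qt (B z) (dm h1) (cd h1)" "h1 = qf (dm h1) (cd h1) B" "\<And>z. mhomog qsig 1 (B z)" using hmq_terms[OF H(2)] by blast
    note A' = A(1)[unfolded H] A(2)[unfolded H] and B' = B(1)[unfolded H] B(2)[unfolded H]
    have "?h = qf (dm f) (cd f) (\<lambda>z. A z \<uplus> B z)" using H(7) A' B' by (metis qf_pls)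
    then have "qc z (dm f) (cd f) (F z) (A z \<uplus> B z)" using qf_eq[of "\<lambda>_. F z" "dm f" "cd f" "\<lambda>z. A z \<uplus> B z"] F A' B'
      by (auto intro: typed.intros)
    then show ?thesis using A B A' B' by (intro exI[of _ "(A z, B z)"]) simp
  qed
  then have "\<forall>z. \<exists>a. qt (fst a) (dm f) (cd f) \<and> qt (snd a) (dm f) (cd f) \<and> mhomog qsig 0 (fst a) \<and> mhomog qsig 1 (snd a) \<and>
     qc z (dm f) (cd f) (F z) (fst a \<uplus> snd a)" by blast
  from choice[OF this] obtain a where a: "\<And>z. qt (fst (a z)) (dm f) (cd f)" "\<And>z. qt (snd (a z)) (dm f) (cd f)"
    "\<And>z. mhomog qsig 0 (fst (a z))" "\<And>z. mhomog qsig 1 (snd (a z))"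
    "\<And>z. qc z (dm f) (cd f) (F z) (fst (a z) \<uplus> snd (a z))" by blast
  let ?a = "qf (dm f) (cd f) (\<lambda>z. fst (a z))" and ?b = "qf (dm f) (cd f) (\<lambda>z. snd (a z))"
  have "f = ?a \<oplus>\<^sub>q ?b"
  proof -
    have "qf (dm f) (cd f) F = qf (dm f) (cd f) (\<lambda>z. fst (a z) \<uplus> snd (a z))"
      by (rule qf_eq[THEN iffD2]) (simp_all add: F(1) a typed.intros)
    then show ?thesis unfolding qf_pls[of "\<lambda>z. fst (a z)", OF a(1,2)] by (rule HOL.trans[OF F(2)])
  qed
  then show ?thesis unfolding graded_def using a
    by (intro exI[of _ ?a] exI[of _ ?b]) (simp add: hmq_qf qf_typ)
qed

text \<open>If one of the two factors is even, the sign is 1 for both homogeneous parts of the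
  other.\<close>

lemma bifunct: 
  assumes e: "evn f \<or> evn g" and t: "dm f' = cd f" "dm g = cd g'"
  shows "(f' \<otimes>\<^sub>q g) \<star> (f \<otimes>\<^sub>q g') = (f' \<star> f) \<otimes>\<^sub>q (g \<star> g')"
  using e
proof
  assume f: "evn f"
  obtain g0 g1 where G: "hmq 0 g0" "hmq 1 g1" "dm g0 = dm g" "dm g1 = dm g" "cd g0 = cd g" "cd g1 = cd g" "g = g0 \<oplus>\<^sub>q g1"
    using graded_all[of g] unfolding graded_def by blast
  have d: "dm g0 = cd g'" "dm g1 = cd g'" using G t by simp_all
  show ?thesis unfolding G(7) using f[unfolded evn_def] G(1,2,5,6) d t(1)
    by (simp add: tns_pls pls_cmp cmp_tns[of 0] koszul_sign_def)
next
  assume g: "evn g"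
  obtain g0 g1 where G: "hmq 0 g0" "hmq 1 g1" "dm g0 = dm f" "dm g1 = dm f" "cd g0 = cd f" "cd g1 = cd f" "f = g0 \<oplus>\<^sub>q g1"
    using graded_all[of f] unfolding graded_def by blast
  have d: "cd g0 = dm f'" "cd g1 = dm f'" using G t by simp_all
  show ?thesis unfolding G(7) using g[unfolded evn_def] G(1-4) d t(2)
    by (simp add: cmp_pls pls_tns cmp_tns[of _ _ 0] koszul_sign_def)
qed

definition dlt :: "'k => 'k => 'k::comm_ring_1" where "dlt z = (\<lambda>x. if x = z then 1 else 0)"

lemma dlt_qf: "(\<And>z. qt (F z) X Y) ==> (\<And>z. qt (G z) X Y) ==> dlt z *\<^sub>q qf X Y F = dlt z *\<^sub>q qf X Y G \<longleftrightarrow> qc z X Y (F z) (G z)"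
proof -
  assume F: "\<And>z. qt (F z) X Y" and G: "\<And>z. qt (G z) X Y"
  have 0: "qc x X Y (0 *\<^sub>m F x) (0 *\<^sub>m G x)" for x
    by (rule mcong.trans[OF mcong.zero_scale[OF F] mcong.sym[OF mcong.zero_scale[OF G]]])
  have 1: "qc z X Y (1 *\<^sub>m F z) (1 *\<^sub>m G z) \<longleftrightarrow> qc z X Y (F z) (G z)"
    by (rule iffI; (rule mcong.trans[OF mcong.sym[OF mcong.one_scale[OF F]] mcong.trans[OF _ mcong.one_scale[OF G]]] |
        rule mcong.trans[OF mcong.one_scale[OF F] mcong.trans[OF _ mcong.sym[OF mcong.one_scale[OF G]]]]))
  have "dlt z *\<^sub>q qf X Y F = dlt z *\<^sub>q qf X Y G \<longleftrightarrow> (\<forall>x. qc x X Y (dlt z x *\<^sub>m F x) (dlt z x *\<^sub>m G x))"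
    unfolding qf_scl[of F, OF F] qf_scl[of G, OF G] by (rule qf_eq) (rule typed.intros F G)+
  also have "\<dots> \<longleftrightarrow> qc z X Y (F z) (G z)" using 0 1 by (auto simp: dlt_def)
  finally show ?thesis .
qed

lemma qm_eqI: "dm f = dm g ==> cd f = cd g ==> (\<And>z. dlt z *\<^sub>q f = dlt z *\<^sub>q g) ==> f = g"
proof -
  assume d: "dm f = dm g" "cd f = cd g" and e: "\<And>z. dlt z *\<^sub>q f = dlt z *\<^sub>q g"
  obtain F where F: "\<And>z. qt (F z) (dm f) (cd f)" "f = qf (dm f) (cd f) F" using qf_terms[of f] by blast
  obtain G where G: "\<And>z. qt (G z) (dm f) (cd f)" "g = qf (dm f) (cd f) G" using qf_terms[of g] unfolding d by blast
  have e': "qc z (dm f) (cd f) (F z) (G z)" for z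
  proof (rule dlt_qf[THEN iffD1])
    show "dlt z *\<^sub>q qf (dm f) (cd f) F = dlt z *\<^sub>q qf (dm f) (cd f) G"
      unfolding F(2)[symmetric] G(2)[symmetric] by (rule e)
  qed (rule F(1) G(1))+
  have "qf (dm f) (cd f) F = qf (dm f) (cd f) G"
    by (rule qf_eq[THEN iffD2]) (simp_all add: F(1) G(1) e')
  then show "f = g" unfolding F(2)[symmetric] G(2)[symmetric] .
qed

section \<open>Relations between diagrams\<close>

primrec ev :: "'k::comm_ring_1 qterm => 'k qm" where
  "ev (MGen a) = gnq a"
| "ev (MId X) = idq X"
| "ev (MZero X Y) = zrq X Y"
| "ev (f \<bullet> g) = ev f \<star> ev g"
| "ev (f \<boxtimes> g) = ev f \<otimes>\<^sub>q ev g"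
| "ev (f \<uplus> g) = ev f \<oplus>\<^sub>q ev g"
| "ev (c *\<^sub>m f) = (\<lambda>_. c) *\<^sub>q ev f"

lemma ev_qf: "qt f X Y ==> ev f = qf X Y (\<lambda>_. f)"
proof (induction rule: typed.induct)
  case (1 a)
  then show ?case by (simp add: qsig_def qf_basic(3))
next
  case (4 f Y W g X)
  then show ?case by (simp add: qf_cmp)
qed (simp_all add: qf_basic qf_tns qf_pls qf_scl)

lemma ev_dm: "qt f X Y ==> dm (ev f) = X" "qt f X Y ==> cd (ev f) = Y"
  by (simp_all add: ev_qf qf_typ)

lemma ev_qc: "qt f X Y ==> qt g X Y ==> dlt z *\<^sub>q ev f = dlt z *\<^sub>q ev g \<longleftrightarrow> qc z X Y f g"
  by (simp add: ev_qf dlt_qf)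

lemma ev_rel: "(\<And>z. (f, g) \<in> qrels (z :: 'k::comm_ring_1)) ==> ev f = ev g"
proof -
  assume r: "\<And>z :: 'k. (f, g) \<in> qrels z"
  obtain X Y where t: "qt f X Y" "qt g X Y" using qrels_typed[OF r[of 0]] by blast
  show ?thesis unfolding ev_qf[OF t(1)] ev_qf[OF t(2)]
    by (rule qf_eq[THEN iffD2]) (auto intro: t mcong.rel[OF r])
qed

section \<open>Whiskering\<close>

definition wh :: "updown list => 'k::comm_ring_1 qm => updown list => 'k qm" where
  "wh A f B = idq A \<otimes>\<^sub>q (f \<otimes>\<^sub>q idq B)"

lemma wh_typ [simp]: "dm (wh A f B) = A @ dm f @ B" "cd (wh A f B) = A @ cd f @ B"
  by (simp_all add: wh_def)

lemma wh_triv [simp]: "wh [] f [] = f" "wh A (idq X) B = idq (A @ X @ B)"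
  by (simp_all add: wh_def idq_tns)

lemma evn_wh [simp]: "evn f ==> evn (wh A f B)" by (simp add: wh_def)

lemma idq_tns_idq: "idq A \<otimes>\<^sub>q (idq B \<otimes>\<^sub>q f) = idq (A @ B) \<otimes>\<^sub>q f"
  by (simp add: tns_assoc[symmetric] idq_tns)

lemma wh_wh [simp]: "wh A (wh A' f B') B = wh (A @ A') f (B' @ B)"
  by (simp add: wh_def tns_assoc idq_tns idq_tns_idq)

lemma wh_cmp [simp]: "wh A (f \<star> g) B = wh A f B \<star> wh A g B"
proof (cases "dm f = cd g")
  case True
  have "idq A \<otimes>\<^sub>q ((f \<star> g) \<otimes>\<^sub>q idq B) = (idq A \<star> idq A) \<otimes>\<^sub>q ((f \<star> g) \<otimes>\<^sub>q (idq B \<star> idq B))"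
    by (simp add: idq_cmp')
  also have "\<dots> = (idq A \<star> idq A) \<otimes>\<^sub>q ((f \<otimes>\<^sub>q idq B) \<star> (g \<otimes>\<^sub>q idq B))"
    using True by (subst bifunct) simp_all
  also have "\<dots> = (idq A \<otimes>\<^sub>q (f \<otimes>\<^sub>q idq B)) \<star> (idq A \<otimes>\<^sub>q (g \<otimes>\<^sub>q idq B))"
    using True by (subst bifunct[symmetric]) simp_all
  finally show ?thesis by (simp add: wh_def)
next
  case False
  then show ?thesis by (simp add: cmp_mismatch wh_def)
qed

lemma wh_lin: "dm f = dm g ==> cd f = cd g ==> wh A (f \<oplus>\<^sub>q g) B = wh A f B \<oplus>\<^sub>q wh A g B"
  "wh A (c *\<^sub>q f) B = c *\<^sub>q wh A f B" "wh A (zrq X Y) B = zrq (A @ X @ B) (A @ Y @ B)"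
  by (simp_all add: wh_def pls_tns tns_pls)

lemma tns_wh: "f \<otimes>\<^sub>q g = wh [] f (cd g) \<star> wh (dm f) g []"
  by (simp add: wh_def bifunct idq_cmp')

lemma wh_far:
  assumes e: "evn f \<or> evn g"
  shows "wh (A @ cd f @ C) g B \<star> wh A f (C @ dm g @ B) = wh A f (C @ cd g @ B) \<star> wh (A @ dm f @ C) g B"
proof -
  have "(idq (cd f) \<otimes>\<^sub>q (idq C \<otimes>\<^sub>q g)) \<star> (f \<otimes>\<^sub>q (idq (C @ dm g))) = (f \<otimes>\<^sub>q idq (C @ cd g)) \<star> (idq (dm f) \<otimes>\<^sub>q (idq C \<otimes>\<^sub>q g))"
    using e by (subst (1 2) bifunct) (auto simp: idq_tns idq_cmp' evn_simps)
  then have "wh A ((idq (cd f) \<otimes>\<^sub>q (idq C \<otimes>\<^sub>q g)) \<star> (f \<otimes>\<^sub>q (idq (C @ dm g)))) B =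
     wh A ((f \<otimes>\<^sub>q idq (C @ cd g)) \<star> (idq (dm f) \<otimes>\<^sub>q (idq C \<otimes>\<^sub>q g))) B" by simp
  then show ?thesis by (simp only: wh_cmp) (simp add: wh_def tns_assoc idq_tns idq_tns_idq)
qed

text \<open>The contexts are matched up to provable equality, since lists built from
  \<open>replicate\<close> rarely agree syntactically.\<close>

lemma far:
  assumes "evn f \<or> evn g" "A2 = A @ cd f @ C" "B1 = C @ dm g @ B" "B2 = C @ cd g @ B" "A3 = A @ dm f @ C"
  shows "wh A2 g B \<star> wh A f B1 = wh A f B2 \<star> wh A3 g B"
  unfolding assms(2-5) by (rule wh_far[OF assms(1)])

text \<open>This and the next three rules rewrite inside composites that are associated to the
  right.\<close>

lemma ctail: "f \<star> g = h \<star> k ==> f \<star> (g \<star> x) = h \<star> (k \<star> x)"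
  by (simp add: cmp_assoc[symmetric])

lemma ctail1: "f \<star> g = idq X ==> cd x = X ==> f \<star> (g \<star> x) = x"
  by (simp add: cmp_assoc[symmetric] idq_cmp')

lemma ctail3: "f \<star> g = h ==> f \<star> (g \<star> x) = h \<star> x"
  by (simp add: cmp_assoc[symmetric])

lemma ctail2: "f \<star> (g \<star> k) = h ==> f \<star> (g \<star> (k \<star> x)) = h \<star> x"
  by (simp add: cmp_assoc[symmetric])

abbreviation "uq \<equiv> gnq UPlus"
abbreviation "vq \<equiv> gnq UMinus"
abbreviation "rq \<equiv> gnq RMinus"
abbreviation "capq \<equiv> gnq CapL"
abbreviation "cupq \<equiv> gnq CupL"
abbreviation "cq \<equiv> gnq Clif"

section \<open>Rotation and the derived crossings\<close>

definition rotq :: "updown list => updown list => 'k::comm_ring_1 qm => 'k qm" where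
  "rotq X Y f = wh [] capq (Y @ [\<down>]) \<star> (wh [\<down>] f [\<down>] \<star> wh (\<down> # X) cupq [])"

lemma ev_rot: "ev (rot X Y f) = rotq X Y (ev f)"
  by (simp add: rot_def rotq_def wh_def cmp_assoc tns_assoc)

lemma rotq_typ [simp]: "dm (rotq X Y f) = \<down> # X" "cd (rotq X Y f) = Y @ [\<down>]"
  by (simp_all add: rotq_def)

lemma evn_rotq [simp]: "evn f ==> evn (rotq X Y f)" by (simp add: rotq_def)

definition lq :: "'k::comm_ring_1 qm" where "lq = rotq [\<up>] [\<up>] uq"
definition dq :: "'k::comm_ring_1 qm" where "dq = rotq [\<down>] [\<down>] lq"
definition dqi :: "'k::comm_ring_1 qm" where "dqi = rotq [\<down>] [\<down>] (rotq [\<up>] [\<up>] vq)"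
definition capRq :: "'k::comm_ring_1 qm" where "capRq = capq \<star> rq"

lemma ev_defs: "ev l_plus = lq" "ev d_plus = dq" "ev cap_R = capRq"
  by (simp_all add: l_plus_def d_plus_def cap_R_def lq_def dq_def capRq_def ev_rot)

lemma q_typ [simp]: "dm lq = [\<down>, \<up>]" "cd lq = [\<up>, \<down>]" "dm dq = [\<down>, \<down>]" "cd dq = [\<down>, \<down>]" "dm dqi = [\<down>, \<down>]" "cd dqi = [\<down>, \<down>]"
  "dm capRq = [\<up>, \<down>]" "cd capRq = []" "evn lq" "evn dq" "evn dqi" "evn capRq"
  by (simp_all add: lq_def dq_def dqi_def capRq_def)

lemma q_rels:
  "vq \<star> uq = idq [\<up>, \<up>]" "uq \<star> vq = idq [\<up>, \<up>]" "lq \<star> rq = idq [\<up>, \<down>]" "rq \<star> lq = idq [\<down>, \<up>]"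
  "wh [] uq [\<up>] \<star> (wh [\<up>] uq [] \<star> wh [] uq [\<up>]) = wh [\<up>] uq [] \<star> (wh [] uq [\<up>] \<star> wh [\<up>] uq [])"
  "cq \<star> cq = (\<lambda>_. - 1) *\<^sub>q idq [\<up>]"
  "uq \<star> wh [] cq [\<up>] = wh [\<up>] cq [] \<star> uq"
  "capRq \<star> (wh [] cq [\<down>] \<star> cupq) = zrq [] []" "capRq \<star> cupq = zrq [] []"
  "wh [\<up>] capq [] \<star> wh [] cupq [\<up>] = idq [\<up>]" "wh [] capq [\<down>] \<star> wh [\<down>] cupq [] = idq [\<down>]"
  using ev_rel[of "u_minus \<bullet> u_plus" "MId [\<up>, \<up>]"] ev_rel[of "u_plus \<bullet> u_minus" "MId [\<up>, \<up>]"]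
    ev_rel[of "l_plus \<bullet> r_minus" "MId [\<up>, \<down>]"] ev_rel[of "r_minus \<bullet> l_plus" "MId [\<down>, \<up>]"]
    ev_rel[of "(u_plus \<boxtimes> MId [\<up>]) \<bullet> (MId [\<up>] \<boxtimes> u_plus) \<bullet> (u_plus \<boxtimes> MId [\<up>])"
      "(MId [\<up>] \<boxtimes> u_plus) \<bullet> (u_plus \<boxtimes> MId [\<up>]) \<bullet> (MId [\<up>] \<boxtimes> u_plus)"]
    ev_rel[of "clif \<bullet> clif" "(- 1) *\<^sub>m MId [\<up>]"] ev_rel[of "u_plus \<bullet> (clif \<boxtimes> MId [\<up>])" "(MId [\<up>] \<boxtimes> clif) \<bullet> u_plus"]
    ev_rel[of "cap_R \<bullet> (clif \<boxtimes> MId [\<down>]) \<bullet> cup_L" "MZero [] []"] ev_rel[of "cap_R \<bullet> cup_L" "MZero [] []"]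
    ev_rel[of "(MId [\<up>] \<boxtimes> cap_L) \<bullet> (cup_L \<boxtimes> MId [\<up>])" "MId [\<up>]"] ev_rel[of "(cap_L \<boxtimes> MId [\<down>]) \<bullet> (MId [\<down>] \<boxtimes> cup_L)" "MId [\<down>]"]
  by (simp_all add: qrels_def wh_def ev_defs cmp_assoc)

text \<open>The relation mentions z, so its right-hand side is not one term for all parameters.
  Restricted to a single z the coefficient function becomes constant and the relation
  applies.\<close>

lemma q_skein: "uq \<oplus>\<^sub>q (\<lambda>_. - 1) *\<^sub>q vq = (\<lambda>z. z) *\<^sub>q idq [\<up>, \<up>]"
proof (rule qm_eqI)
  fix z :: 'a
  have "dlt z *\<^sub>q ev (u_plus \<uplus> (- 1) *\<^sub>m u_minus) = dlt z *\<^sub>q ev (z *\<^sub>m MId [\<up>, \<up>])"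
  proof (rule ev_qc[THEN iffD2])
    show "qc z [\<up>, \<up>] [\<up>, \<up>] (u_plus \<uplus> - 1 *\<^sub>m u_minus) (z *\<^sub>m MId [\<up>, \<up>])"
      by (rule mcong.rel) (simp_all add: qrels_def typed_iff, simp_all add: qsig_def)
  qed (simp_all add: typed_iff, simp_all add: qsig_def)
  moreover have "(\<lambda>za. dlt z za * z) = (\<lambda>za. dlt z za * za)" by (auto simp: dlt_def)
  ultimately show "dlt z *\<^sub>q (uq \<oplus>\<^sub>q (\<lambda>_. - 1) *\<^sub>q vq) = dlt z *\<^sub>q (\<lambda>z. z) *\<^sub>q idq [\<up>, \<up>]" by simp
qed simp_all

lemma zig: "A' = A @ [\<up>] ==> B' = \<up> # B ==> wh A' capq B \<star> wh A cupq B' = idq (A @ \<up> # B)"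
  "B' = \<down> # B ==> A' = A @ [\<down>] ==> wh A capq B' \<star> wh A' cupq B = idq (A @ \<down> # B)"
  using arg_cong[OF q_rels(10), of "\<lambda>f. wh A f B"] arg_cong[OF q_rels(11), of "\<lambda>f. wh A f B"] by simp_all

text \<open>A zigzag. The property determines the rotation (\<open>rot_uniq\<close>), as caps can be
  cancelled.\<close>

lemma rot_cap: 
  assumes "dm f = X @ [\<up>]" "cd f = \<up> # Y"
  shows "wh Y capq [] \<star> wh [] (rotq X Y f) [\<up>] = wh [] capq Y \<star> wh [\<down>] f []"
proof -
  have 1: "wh Y capq [] \<star> wh [] capq (Y @ [\<down>, \<up>]) = wh [] capq Y \<star> wh (\<down> # \<up> # Y) capq []"
    by (rule far[where C = Y]) simp_all
  have 2: "wh (\<down> # \<up> # Y) capq [] \<star> wh [\<down>] f [\<down>, \<up>] = wh [\<down>] f [] \<star> wh (\<down> # X @ [\<up>]) capq []"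
    by (rule far[where C = "[]"]) (simp_all add: assms)
  have 3: "wh (\<down> # X @ [\<up>]) capq [] \<star> wh (\<down> # X) cupq [\<up>] = idq (\<down> # X @ [\<up>])"
    by (subst zig) simp_all
  show ?thesis unfolding rotq_def by (simp add: cmp_assoc ctail[OF 1] ctail[OF 2] 3 idq_cmp' assms)
qed

lemma rot_cup: 
  assumes "dm f = X @ [\<up>]" "cd f = \<up> # Y"
  shows "wh [\<up>] (rotq X Y f) [] \<star> wh [] cupq X = wh [] f [\<down>] \<star> wh X cupq []"
proof -
  have 1: "wh (\<up> # \<down> # X) cupq [] \<star> wh [] cupq X = wh [] cupq (X @ [\<up>, \<down>]) \<star> wh X cupq []"
    by (rule far[where C = X]) simp_all
  have 2: "wh [\<up>, \<down>] f [\<down>] \<star> wh [] cupq (X @ [\<up>, \<down>]) = wh [] cupq (\<up> # Y @ [\<down>]) \<star> wh [] f [\<down>]"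
    by (rule far[where C = "[]"]) (simp_all add: assms)
  have 3: "wh [\<up>] capq (Y @ [\<down>]) \<star> wh [] cupq (\<up> # Y @ [\<down>]) = idq (\<up> # Y @ [\<down>])"
    by (subst zig) simp_all
  show ?thesis unfolding rotq_def by (simp add: cmp_assoc 1 ctail[OF 2] ctail1[OF 3] assms)
qed

text \<open>A cup bends the capped strand back and so recovers the morphism.\<close>

lemma cap_cancel:
  assumes e: "wh Y capq [] \<star> wh [] g [\<up>] = wh Y capq [] \<star> wh [] g' [\<up>]"
    and t: "cd g = Y @ [\<down>]" "cd g' = Y @ [\<down>]" "dm g = dm g'"
  shows "g = g'"
proof -
  have *: "wh [] (wh Y capq [] \<star> wh [] h [\<up>]) [\<down>] \<star> wh (dm h) cupq [] = h" if "cd h = Y @ [\<down>]" for h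
  proof -
    have 1: "wh [] h [\<up>, \<down>] \<star> wh (dm h) cupq [] = wh (Y @ [\<down>]) cupq [] \<star> wh [] h []"
      by (rule far[where C = "[]", symmetric]) (simp_all add: that)
    have 2: "wh Y capq [\<down>] \<star> wh (Y @ [\<down>]) cupq [] = idq (Y @ [\<down>])" by (subst zig) simp_all
    show ?thesis by (simp add: cmp_assoc 1 ctail1[OF 2] that)
  qed
  show ?thesis using *[OF t(1)] *[OF t(2)] e t(3) by simp
qed

lemma rot_uniq:
  assumes "dm f = X @ [\<up>]" "cd f = \<up> # Y" "dm g = \<down> # X" "cd g = Y @ [\<down>]"
    and "wh Y capq [] \<star> wh [] g [\<up>] = wh [] capq Y \<star> wh [\<down>] f []"
  shows "rotq X Y f = g"
  by (rule cap_cancel[of Y]) (simp_all add: assms rot_cap)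

text \<open>One upward strand runs through \<open>f'\<close> and then \<open>f\<close>; bending it
  down rotates the two separately. Applied to both sides of a braid relation this produces the
  rotated relations \<open>lq_braid\<close> and \<open>dq_slide\<close>.\<close>

lemma rot_H:
  assumes t: "dm f = X @ [\<up>]" "cd f = \<up> # Y" "dm f' = X' @ [\<up>]" "cd f' = \<up> # Y'" and e: "evn f \<or> evn f'"
  shows "rotq (X @ X') (Y @ Y') (wh [] f Y' \<star> wh X f' []) = wh Y (rotq X' Y' f') [] \<star> wh [] (rotq X Y f) X'"
proof (rule rot_uniq)
  have 1: "wh (Y @ Y') capq [] \<star> wh Y (rotq X' Y' f') [\<up>] = wh Y capq Y' \<star> wh (Y @ [\<down>]) f' []"
    using arg_cong[OF rot_cap[OF t(3,4)], of "\<lambda>h. wh Y h []"] by simp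
  have 2: "wh Y capq Y' \<star> wh [] (rotq X Y f) (\<up> # Y') = wh [] capq (Y @ Y') \<star> wh [\<down>] f Y'"
    using arg_cong[OF rot_cap[OF t(1,2)], of "\<lambda>h. wh [] h Y'"] by simp
  have 3: "wh (Y @ [\<down>]) f' [] \<star> wh [] (rotq X Y f) (X' @ [\<up>]) = wh [] (rotq X Y f) (\<up> # Y') \<star> wh (\<down> # X) f' []"
    by (rule far[where C = "[]"]) (use e in \<open>auto simp: t\<close>)
  show "wh (Y @ Y') capq [] \<star> wh [] (wh Y (rotq X' Y' f') [] \<star> wh [] (rotq X Y f) X') [\<up>] =
    wh [] capq (Y @ Y') \<star> wh [\<down>] (wh [] f Y' \<star> wh X f' []) []"
    by (simp add: ctail[OF 1] 3 ctail[OF 2])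
qed (simp_all add: t)

lemma rot_left: 
  assumes "cd b = Y'" "dm f = X @ [\<up>]" "cd f = \<up> # dm b"
  shows "rotq X Y' (wh [\<up>] b [] \<star> f) = wh [] b [\<down>] \<star> rotq X (dm b) f"
proof -
  have "wh [] capq (cd b @ [\<down>]) \<star> wh [\<down>, \<up>] b [\<down>] = wh [] b [\<down>] \<star> wh [] capq (dm b @ [\<down>])"
    by (rule far[where C = "[]", symmetric]) simp_all
  from ctail[OF this] show ?thesis by (simp add: rotq_def assms cmp_assoc)
qed

lemma rot_right: 
  assumes "dm a = X'" "dm f = cd a @ [\<up>]" "cd f = \<up> # Y"
  shows "rotq X' Y (f \<star> wh [] a [\<up>]) = rotq (cd a) Y f \<star> wh [\<down>] a []"
proof -
  have "wh [\<down>] a [\<up>, \<down>] \<star> wh (\<down> # dm a) cupq [] = wh (\<down> # cd a) cupq [] \<star> wh [\<down>] a []"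
    by (rule far[where C = "[]", symmetric]) simp_all
  then show ?thesis by (simp add: rotq_def assms cmp_assoc)
qed

lemma rot_lin: "dm f = dm g ==> cd f = cd g ==> rotq X Y (f \<oplus>\<^sub>q g) = rotq X Y f \<oplus>\<^sub>q rotq X Y g"
  "rotq X Y (c *\<^sub>q f) = c *\<^sub>q rotq X Y f"
  by (simp_all add: rotq_def wh_lin pls_cmp cmp_pls)

lemma lq_cq: "lq \<star> wh [\<down>] cq [] = wh [] cq [\<down>] \<star> lq"
  using rot_right[of "cq :: 'a qm" "[\<up>]" uq "[\<up>]"] rot_left[of "cq :: 'a qm" "[\<up>]" uq "[\<up>]"] by (simp add: lq_def q_rels(7))

lemma lq_braid: "wh [] uq [\<down>] \<star> (wh [\<up>] lq [] \<star> wh [] lq [\<up>]) = wh [\<up>] lq [] \<star> (wh [] lq [\<up>] \<star> wh [\<down>] uq [])"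
proof -
  let ?f = "wh [] uq [\<up>] \<star> wh [\<up>] uq [] :: 'a qm"
  have H: "rotq [\<up>, \<up>] [\<up>, \<up>] ?f = wh [\<up>] lq [] \<star> wh [] lq [\<up>]"
    using rot_H[of "uq :: 'a qm" "[\<up>]" "[\<up>]" uq "[\<up>]" "[\<up>]"] by (simp add: lq_def)
  have "?f \<star> wh [] uq [\<up>] = wh [\<up>] uq [] \<star> ?f" by (simp add: cmp_assoc q_rels(5))
  from arg_cong[OF this, of "rotq [\<up>, \<up>] [\<up>, \<up>]"] show ?thesis
    by (subst (asm) rot_right, simp, simp, simp, subst (asm) rot_left, simp, simp, simp) (simp add: H cmp_assoc)
qed

lemma dq_slide: "wh [\<up>] dq [] \<star> (wh [] lq [\<down>] \<star> wh [\<down>] lq []) = wh [] lq [\<down>] \<star> (wh [\<down>] lq [] \<star> wh [] dq [\<up>])"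
proof -
  let ?f = "wh [] uq [\<down>] \<star> wh [\<up>] lq [] :: 'a qm" and ?g = "wh [] lq [\<up>] \<star> wh [\<down>] uq [] :: 'a qm"
  have H: "rotq [\<up>, \<down>] [\<up>, \<down>] ?f = wh [\<up>] dq [] \<star> wh [] lq [\<down>]"
    using rot_H[of "uq :: 'a qm" "[\<up>]" "[\<up>]" lq "[\<down>]" "[\<down>]"] by (simp add: lq_def[symmetric] dq_def[symmetric])
  have H': "rotq [\<down>, \<up>] [\<down>, \<up>] ?g = wh [\<down>] lq [] \<star> wh [] dq [\<up>]"
    using rot_H[of "lq :: 'a qm" "[\<down>]" "[\<down>]" uq "[\<up>]" "[\<up>]"] by (simp add: lq_def[symmetric] dq_def[symmetric])
  have "?f \<star> wh [] lq [\<up>] = wh [\<up>] lq [] \<star> ?g" by (simp add: lq_braid cmp_assoc)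
  from arg_cong[OF this, of "rotq [\<down>, \<up>] [\<up>, \<down>]"] show ?thesis
    by (subst (asm) rot_right, simp, simp, simp, subst (asm) rot_left, simp, simp, simp) (simp add: H H' cmp_assoc)
qed

lemma cap2:
  assumes "dm f = [\<up>, \<up>]" "cd f = [\<up>, \<up>]"
  shows "capq \<star> (wh [\<down>] capq [\<up>] \<star> wh [] (rotq [\<down>] [\<down>] (rotq [\<up>] [\<up>] f)) [\<up>, \<up>]) =
    capq \<star> (wh [\<down>] capq [\<up>] \<star> wh [\<down>, \<down>] f [])"
proof -
  let ?l = "rotq [\<up>] [\<up>] f"
  have 1: "wh [\<down>] capq [\<up>] \<star> wh [] (rotq [\<down>] [\<down>] ?l) [\<up>, \<up>] = wh [] capq [\<down>, \<up>] \<star> wh [\<down>] ?l [\<up>]"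
    using arg_cong[OF rot_cap[of ?l "[\<down>]" "[\<down>]"], of "\<lambda>h. wh [] h [\<up>]"] by simp
  have 2: "capq \<star> wh [] capq [\<down>, \<up>] = capq \<star> wh [\<down>, \<up>] capq []"
    using wh_far[of capq capq "[]" "[]" "[]"] by simp
  have 3: "wh [\<down>, \<up>] capq [] \<star> wh [\<down>] ?l [\<up>] = wh [\<down>] capq [\<up>] \<star> wh [\<down>, \<down>] f []"
    using arg_cong[OF rot_cap[of f "[\<up>]" "[\<up>]"], of "\<lambda>h. wh [\<down>] h []"] assms by simp
  show ?thesis by (simp add: 1 ctail[OF 2] 3)
qed

text \<open>Under two nested caps the doubly rotated crossings become \<open>uq\<close> and
  \<open>vq\<close> by \<open>cap2\<close>, and these cancel.\<close>

lemma dq_dqi: "dq \<star> dqi = idq [\<down>, \<down>]"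
proof -
  let ?c = "wh [\<down>] capq [\<up>] :: 'a qm"
  have d: "capq \<star> (?c \<star> wh [] dq [\<up>, \<up>]) = capq \<star> (?c \<star> wh [\<down>, \<down>] uq [])"
    "capq \<star> (?c \<star> wh [] dqi [\<up>, \<up>]) = capq \<star> (?c \<star> wh [\<down>, \<down>] vq [])"
    using cap2[of "uq :: 'a qm"] cap2[of "vq :: 'a qm"] by (simp_all add: dq_def dqi_def lq_def)
  have f: "wh [\<down>, \<down>] uq [] \<star> wh [] dqi [\<up>, \<up>] = wh [] dqi [\<up>, \<up>] \<star> wh [\<down>, \<down>] uq []"
    by (rule far[where C = "[]"]) simp_all
  have v: "wh [\<down>, \<down>] vq [] \<star> wh [\<down>, \<down>] uq [] = idq [\<down>, \<down>, \<up>, \<up>]"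
    using arg_cong[OF q_rels(1), of "\<lambda>h. wh [\<down>, \<down>] h []"] by simp
  have "capq \<star> (?c \<star> wh [] (dq \<star> dqi) [\<up>, \<up>]) = capq \<star> (?c \<star> wh [] (idq [\<down>, \<down>]) [\<up>, \<up>])"
    by (simp add: ctail2[OF d(1)] cmp_assoc f ctail2[OF d(2)] v idq_cmp')
  then have "wh [\<down>] (capq :: 'a qm) [] \<star> wh [] (dq \<star> dqi) [\<up>] = wh [\<down>] capq [] \<star> wh [] (idq [\<down>, \<down>]) [\<up>]"
    by - (rule cap_cancel[of "[]"], simp_all add: idq_cmp')
  then show ?thesis by (rule cap_cancel) simp_all
qed

lemma rot_rot_id: "rotq [\<down>] [\<down>] (rotq [\<up>] [\<up>] (idq [\<up>, \<up>])) = idq [\<down>, \<down>]"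
proof -
  have "capq \<star> (wh [\<down>] capq [\<up>] \<star> wh [] (rotq [\<down>] [\<down>] (rotq [\<up>] [\<up>] (idq [\<up>, \<up>]))) [\<up>, \<up>]) =
    (capq :: 'a qm) \<star> (wh [\<down>] capq [\<up>] \<star> wh [] (idq [\<down>, \<down>]) [\<up>, \<up>])"
    using cap2[of "idq [\<up>, \<up>] :: 'a qm"] by simp
  then have "wh [\<down>] (capq :: 'a qm) [] \<star> wh [] (rotq [\<down>] [\<down>] (rotq [\<up>] [\<up>] (idq [\<up>, \<up>]))) [\<up>] = wh [\<down>] capq [] \<star> wh [] (idq [\<down>, \<down>]) [\<up>]"
    by - (rule cap_cancel[of "[]"], simp_all add: idq_cmp')
  then show ?thesis by (rule cap_cancel) simp_all
qed

lemma vq_eq: "vq = uq \<oplus>\<^sub>q (\<lambda>z. - z) *\<^sub>q idq [\<up>, \<up>]"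
proof -
  have "uq \<oplus>\<^sub>q (\<lambda>z. - z) *\<^sub>q idq [\<up>, \<up>] = (uq :: 'a qm) \<oplus>\<^sub>q (\<lambda>_. - 1) *\<^sub>q ((\<lambda>z. z) *\<^sub>q idq [\<up>, \<up>])" by simp
  also have "\<dots> = uq \<oplus>\<^sub>q ((\<lambda>_. - 1) *\<^sub>q uq \<oplus>\<^sub>q vq)"
    by (simp only: q_skein[symmetric]) (simp add: scl_pls)
  also have "\<dots> = ((\<lambda>_. 1) *\<^sub>q uq \<oplus>\<^sub>q (\<lambda>_. - 1) *\<^sub>q uq) \<oplus>\<^sub>q vq" by (simp add: pls_assoc)
  also have "\<dots> = vq" by (simp only: pls_scl[symmetric]) (simp add: scl_zero pls_comm[of _ vq] pls_zrq)
  finally show ?thesis by simp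
qed

text \<open>Rotation is linear and its double fixes the identity, so the skein relation can be
  rotated.\<close>

lemma dqi_eq: "dqi = dq \<oplus>\<^sub>q (\<lambda>z. - z) *\<^sub>q idq [\<down>, \<down>]"
  by (simp add: dqi_def dq_def lq_def vq_eq rot_lin rot_rot_id)

lemma lr [simp]: "A' = A ==> B' = B ==> wh A lq B \<star> wh A' rq B' = idq (A @ \<up> # \<down> # B)"
  "A' = A ==> B' = B ==> wh A rq B \<star> wh A' lq B' = idq (A @ \<down> # \<up> # B)"
  "A' = A ==> B' = B ==> wh A uq B \<star> wh A' vq B' = idq (A @ \<up> # \<up> # B)"
  "A' = A ==> B' = B ==> wh A vq B \<star> wh A' uq B' = idq (A @ \<up> # \<up> # B)"
  using arg_cong[OF q_rels(3), of "\<lambda>f. wh A f B"] arg_cong[OF q_rels(4), of "\<lambda>f. wh A f B"]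
    arg_cong[OF q_rels(1), of "\<lambda>f. wh A f B"] arg_cong[OF q_rels(2), of "\<lambda>f. wh A f B"] by simp_all

lemma capRl: "wh A capRq B \<star> wh A lq B = wh A capq B"
proof -
  have "capRq \<star> lq = (capq :: 'a qm)" by (simp add: capRq_def cmp_assoc q_rels idq_cmp')
  from arg_cong[OF this, of "\<lambda>f. wh A f B"] show ?thesis by simp
qed

lemma kappa2: "wh [\<up>, \<up>] dq [] \<star> (wh [\<up>] cupq [\<down>] \<star> cupq) = wh [] uq [\<down>, \<down>] \<star> (wh [\<up>] cupq [\<down>] \<star> cupq)"
proof -
  have 1: "wh [\<up>, \<up>] dq [] \<star> wh [\<up>] cupq [\<down>] = wh [\<up>] lq [\<down>] \<star> wh [\<up>, \<down>] (cupq :: 'a qm) []"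
    using arg_cong[OF rot_cup[of "lq :: 'a qm" "[\<down>]" "[\<down>]"], of "\<lambda>h. wh [\<up>] h []"] by (simp add: dq_def[symmetric])
  have 2: "wh [\<up>, \<down>] cupq [] \<star> cupq = wh [] cupq [\<up>, \<down>] \<star> (cupq :: 'a qm)"
    using wh_far[of "cupq :: 'a qm" cupq "[]" "[]" "[]"] by simp
  have 3: "wh [\<up>] lq [\<down>] \<star> wh [] cupq [\<up>, \<down>] = wh [] uq [\<down>, \<down>] \<star> wh [\<up>] (cupq :: 'a qm) [\<down>]"
    using arg_cong[OF rot_cup[of "uq :: 'a qm" "[\<up>]" "[\<up>]"], of "\<lambda>h. wh [] h [\<down>]"] by (simp add: lq_def[symmetric])
  show ?thesis by (simp add: ctail[OF 1] 2 ctail[OF 3])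
qed

lemma lq_cup: "wh [\<up>] lq [] \<star> wh [] cupq [\<up>] = wh [] uq [\<down>] \<star> wh [\<up>] cupq []"
  using rot_cup[of "uq :: 'a qm" "[\<up>]" "[\<up>]"] by (simp add: lq_def)

lemma dq_cup: "wh [\<up>] dq [] \<star> wh [] cupq [\<down>] = wh [] lq [\<down>] \<star> wh [\<down>] cupq []"
  using rot_cup[of "lq :: 'a qm" "[\<down>]" "[\<down>]"] by (simp add: dq_def)

lemma curl: "wh [\<up>] capRq [] \<star> (wh [] uq [\<down>] \<star> wh [\<up>] cupq []) = idq [\<up>]"
  unfolding lq_cup[symmetric] by (simp add: ctail2[of _ _ "idq _"] cmp_assoc[symmetric] capRl q_rels(10))

text \<open>Caps have to be brought to the wall between upward and downward strands: this moves one
  past an upward strand, \<open>capR_down\<close> past a downward one.\<close>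

lemma capR_up: "wh [] capRq [\<up>] = wh [\<up>] capRq [] \<star> (wh [] vq [\<down>] \<star> wh [\<up>] lq [])"
proof -
  have 1: "wh [\<up>] rq [] \<star> (wh [] vq [\<down>] \<star> wh [\<up>] lq []) = wh [] lq [\<up>] \<star> (wh [\<down>] vq [] \<star> wh [] (rq :: 'a qm) [\<up>])"
  proof -
    have "wh [\<up>] rq [] \<star> (wh [] vq [\<down>] \<star> ((wh [] uq [\<down>] \<star> (wh [\<up>] lq [] \<star> wh [] lq [\<up>])) \<star> (wh [\<down>] vq [] \<star> wh [] rq [\<up>]))) =
      wh [] lq [\<up>] \<star> (wh [\<down>] vq [] \<star> wh [] (rq :: 'a qm) [\<up>])"
      by (simp add: cmp_assoc ctail1[OF lr(2)] ctail1[OF lr(4)] idq_cmp')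
    then show ?thesis unfolding lq_braid by (simp add: cmp_assoc ctail1[OF lr(3)] idq_cmp')
  qed
  have 2: "wh [\<up>] capq [] \<star> wh [] lq [\<up>] = wh [] capq [\<up>] \<star> wh [\<down>] (uq :: 'a qm) []"
    using rot_cap[of "uq :: 'a qm" "[\<up>]" "[\<up>]"] by (simp add: lq_def)
  show ?thesis by (simp add: capRq_def cmp_assoc 1 ctail[OF 2] ctail1[OF lr(3)])
qed

lemma dqi_slide: "wh [\<up>] dqi [] \<star> (wh [] lq [\<down>] \<star> wh [\<down>] lq []) = wh [] lq [\<down>] \<star> (wh [\<down>] lq [] \<star> wh [] dqi [\<up>])"
  by (simp add: dqi_eq wh_lin pls_cmp cmp_pls dq_slide idq_cmp')

lemma capR_down: "wh [\<down>] capRq [] = wh [] capRq [\<down>] \<star> (wh [\<up>] dqi [] \<star> wh [] lq [\<down>])"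
proof -
  have 1: "wh [] capq [\<down>] \<star> wh [\<down>] lq [] = wh [\<down>] capq [] \<star> wh [] (dq :: 'a qm) [\<up>]"
    using rot_cap[of "lq :: 'a qm" "[\<down>]" "[\<down>]"] by (simp add: dq_def)
  have 2: "wh [] dq [\<up>] \<star> wh [] dqi [\<up>] = idq [\<down>, \<down>, \<up>]"
    using arg_cong[OF dq_dqi, of "\<lambda>h. wh [] h [\<up>]"] by simp
  have "wh [] capRq [\<down>] \<star> ((wh [\<up>] dqi [] \<star> (wh [] lq [\<down>] \<star> wh [\<down>] lq [])) \<star> wh [\<down>] rq []) = wh [\<down>] (capRq :: 'a qm) []"
    unfolding dqi_slide by (simp add: cmp_assoc ctail3[OF capRl] ctail[OF 1] ctail1[OF 2]) (simp add: capRq_def)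
  then show ?thesis by (simp add: cmp_assoc idq_cmp')
qed

section \<open>Straightening\<close>

abbreviation "Us n \<equiv> replicate n \<up>"
abbreviation "Ds n \<equiv> replicate n \<down>"

lemmas rep_simps [simp] = replicate_append_same replicate_app_Cons_same replicate_add

text \<open>The straightening of one upward strand past q downward ones.\<close>

primrec lam :: "nat => 'k::comm_ring_1 qm" where
  "lam 0 = idq [\<up>]"
| "lam (Suc q) = wh [] lq (Ds q) \<star> wh [\<down>] (lam q) []"

lemma lam_typ [simp]: "dm (lam q) = Ds q @ [\<up>]" "cd (lam q) = \<up> # Ds q" "evn (lam q)"
  by (induction q) simp_all

lemma lam_right: "(lam (Suc q) :: 'k::comm_ring_1 qm) = wh [] (lam q) [\<down>] \<star> wh (Ds q) lq []"
proof (induction q)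
  case (Suc q)
  have "(lam (Suc (Suc q)) :: 'k qm) = wh [] lq (Ds (Suc q)) \<star> wh [\<down>] (wh [] (lam q) [\<down>] \<star> wh (Ds q) lq []) ([] :: updown list)"
    by (simp only: lam.simps(2)[of "Suc q"] Suc)
  then show ?case by (simp add: cmp_assoc)
qed (simp add: idq_cmp')

primrec lami :: "nat => 'k::comm_ring_1 qm" where
  "lami 0 = idq [\<up>]"
| "lami (Suc q) = wh [\<down>] (lami q) [] \<star> wh [] rq (Ds q)"

lemma lami_typ [simp]: "dm (lami q) = \<up> # Ds q" "cd (lami q) = Ds q @ [\<up>]" "evn (lami q)"
  by (induction q) simp_all

lemma lam_lami: "lam q \<star> lami q = (idq (\<up> # Ds q) :: 'k::comm_ring_1 qm)" "lami q \<star> lam q = (idq (Ds q @ [\<up>]) :: 'k qm)"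
proof (induction q)
  case (Suc q)
  { case 1
    have "wh [\<down>] (lam q) [] \<star> wh [\<down>] (lami q) [] = (idq (\<down> # \<up> # Ds q) :: 'k qm)"
      using arg_cong[OF Suc(1), of "\<lambda>h. wh [\<down>] h []"] by simp
    from ctail1[OF this] show ?case by (simp add: cmp_assoc) }
  { case 2
    have "wh [\<down>] (lami q) [] \<star> wh [\<down>] (lam q) [] = (idq (\<down> # Ds q @ [\<up>]) :: 'k qm)"
      using arg_cong[OF Suc(2), of "\<lambda>h. wh [\<down>] h []"] by simp
    then show ?case by (simp add: cmp_assoc ctail1[OF lr(2)]) }
qed (simp_all add: idq_cmp')

lemma lam_c: "lam q \<star> wh (Ds q) cq [] = wh [] cq (Ds q) \<star> (lam q)"
proof (induction q)
  case (Suc q)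
  have 1: "wh [\<down>] (lam q) [] \<star> wh (\<down> # Ds q) cq [] = wh [\<down>] cq (Ds q) \<star> wh [\<down>] (lam q :: 'a qm) []"
    using arg_cong[OF Suc, of "\<lambda>h. wh [\<down>] h []"] by simp
  have 2: "wh [] lq (Ds q) \<star> wh [\<down>] cq (Ds q) = wh [] cq (\<down> # Ds q) \<star> wh [] (lq :: 'a qm) (Ds q)"
    using arg_cong[OF lq_cq, of "\<lambda>h. wh [] h (Ds q)"] by simp
  show ?case by (simp add: cmp_assoc 1 ctail[OF 2])
qed (simp add: idq_cmp')

lemma lam_u: "wh [\<up>] (lam q) [] \<star> (wh [] (lam q) [\<up>] \<star> wh (Ds q) uq []) =
  wh [] uq (Ds q) \<star> (wh [\<up>] (lam q) [] \<star> wh [] (lam q) [\<up>])"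
proof (induction q)
  case (Suc q)
  have 1: "wh [\<up>, \<down>] (lam q) [] \<star> wh [] lq (Ds q @ [\<up>]) = wh [] lq (\<up> # Ds q) \<star> wh [\<down>, \<up>] (lam q :: 'a qm) []"
    by (rule far[where C = "[]"]) simp_all
  have 2: "wh [\<down>, \<up>] (lam q) [] \<star> (wh [\<down>] (lam q) [\<up>] \<star> wh (\<down> # Ds q) uq []) =
    wh [\<down>] uq (Ds q) \<star> (wh [\<down>, \<up>] (lam q) [] \<star> wh [\<down>] (lam q :: 'a qm) [\<up>])"
    using arg_cong[OF Suc, of "\<lambda>h. wh [\<down>] h []"] by simp
  have 3: "wh [\<up>] lq (Ds q) \<star> (wh [] lq (\<up> # Ds q) \<star> wh [\<down>] uq (Ds q)) =
    wh [] uq (\<down> # Ds q) \<star> (wh [\<up>] lq (Ds q) \<star> wh [] (lq :: 'a qm) (\<up> # Ds q))"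
    using arg_cong[OF lq_braid[symmetric], of "\<lambda>h. wh [] h (Ds q)"] by simp
  show ?case by (simp add: cmp_assoc ctail[OF 1] 2 ctail2[OF 3])
qed (simp add: idq_cmp')

lemma lam_d: "lam (Suc (Suc (i + j))) \<star> wh (Ds i) dq (Ds j @ [\<up>]) = wh (\<up> # Ds i) dq (Ds j) \<star> (lam (Suc (Suc (i + j))) :: 'k::comm_ring_1 qm)"
proof (induction i)
  case 0
  have 1: "wh [\<down>, \<down>] (lam j) [] \<star> wh [] dq (Ds j @ [\<up>]) = wh [] dq (\<up> # Ds j) \<star> wh [\<down>, \<down>] (lam j :: 'k qm) []"
    by (rule far[where C = "[]"]) simp_all
  have 2: "wh [] lq (\<down> # Ds j) \<star> (wh [\<down>] lq (Ds j) \<star> wh [] dq (\<up> # Ds j)) = 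
    wh [\<up>] dq (Ds j) \<star> (wh [] lq (\<down> # Ds j) \<star> wh [\<down>] (lq :: 'k qm) (Ds j))"
    using arg_cong[OF dq_slide[symmetric], of "\<lambda>h. wh [] h (Ds j)"] by simp
  show ?case by (simp add: cmp_assoc 1 ctail2[OF 2])
next
  case (Suc i)
  let ?n = "Suc (Suc (i + j))"
  have 1: "wh [\<down>] (lam ?n) [] \<star> wh (\<down> # Ds i) dq (Ds j @ [\<up>]) = wh (\<down> # \<up> # Ds i) dq (Ds j) \<star> wh [\<down>] (lam ?n :: 'k qm) []"
    using arg_cong[OF Suc, of "\<lambda>h. wh [\<down>] h []"] by (simp del: lam.simps)
  have 2: "wh [] lq (Ds ?n) \<star> wh (\<down> # \<up> # Ds i) dq (Ds j) = wh (\<up> # \<down> # Ds i) dq (Ds j) \<star> wh [] (lq :: 'k qm) (Ds ?n)"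
    by (rule far[where C = "Ds i", symmetric]) simp_all
  have 3: "lam (Suc (Suc (Suc i + j))) = wh [] lq (Ds ?n) \<star> wh [\<down>] (lam ?n :: 'k qm) []" by simp
  show ?case unfolding 3 using 1 ctail[OF 2, of "wh [\<down>] (lam ?n) []"] by (simp add: cmp_assoc del: lam.simps replicate.simps)
      (simp add: replicate.simps)
qed

text \<open>The crossings that a cup, or for \<open>dcap\<close> a cap, leaves behind when it is
  moved across q downward strands to the wall, see \<open>lam_cup\<close> and
  \<open>lam_cap\<close>.\<close>

primrec dcup :: "nat => 'k::comm_ring_1 qm" where
  "dcup 0 = idq [\<down>]"
| "dcup (Suc q) = wh [\<down>] (dcup q) [] \<star> wh [] dq (Ds q)"

primrec dcap :: "nat => 'k::comm_ring_1 qm" where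
  "dcap 0 = idq [\<down>]"
| "dcap (Suc q) = wh [] dqi (Ds q) \<star> wh [\<down>] (dcap q) []"

lemma dcup_typ [simp]: "dm (dcup q) = \<down> # Ds q" "cd (dcup q) = \<down> # Ds q" "evn (dcup q)"
    "dm (dcap q) = \<down> # Ds q" "cd (dcap q) = \<down> # Ds q" "evn (dcap q)"
  by (induction q) simp_all

lemma lam_cup: "wh [] (lam q) [\<down>] \<star> wh (Ds q) cupq [] = wh [\<up>] (dcup q) [] \<star> wh [] cupq (Ds q)"
proof (induction q)
  case (Suc q)
  have 1: "wh [\<down>] (lam q) [\<down>] \<star> wh (\<down> # Ds q) cupq [] = wh [\<down>, \<up>] (dcup q) [] \<star> wh [\<down>] (cupq :: 'a qm) (Ds q)"
    using arg_cong[OF Suc, of "\<lambda>h. wh [\<down>] h []"] by simp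
  have 2: "wh [] lq (\<down> # Ds q) \<star> wh [\<down>, \<up>] (dcup q) [] = wh [\<up>, \<down>] (dcup q) [] \<star> wh [] (lq :: 'a qm) (\<down> # Ds q)"
    by (rule far[where C = "[]", symmetric]) simp_all
  have 3: "wh [] lq (\<down> # Ds q) \<star> wh [\<down>] cupq (Ds q) = wh [\<up>] dq (Ds q) \<star> wh [] (cupq :: 'a qm) (\<down> # Ds q)"
    using arg_cong[OF dq_cup[symmetric], of "\<lambda>h. wh [] h (Ds q)"] by simp
  show ?case by (simp add: cmp_assoc 1 ctail[OF 2] 3)
qed (simp add: idq_cmp')

lemma lam_cap: "wh (Ds q) capq [] = wh [] capRq (Ds q) \<star> (wh [\<up>] (dcap q) [] \<star> (lam (Suc q) :: 'k::comm_ring_1 qm))"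
proof (induction q)
  case (Suc q)
  have 1: "wh [\<down>] capRq (Ds q) = wh [] capRq (\<down> # Ds q) \<star> (wh [\<up>] dqi (Ds q) \<star> wh [] (lq :: 'k qm) (\<down> # Ds q))"
    using arg_cong[OF capR_down, of "\<lambda>h. wh [] h (Ds q)"] by simp
  have 2: "wh [] lq (\<down> # Ds q) \<star> wh [\<down>, \<up>] (dcap q) [] = wh [\<up>, \<down>] (dcap q) [] \<star> wh [] (lq :: 'k qm) (\<down> # Ds q)"
    by (rule far[where C = "[]", symmetric]) simp_all
  have "wh (\<down> # Ds q) capq [] = wh [\<down>] capRq (Ds q) \<star> (wh [\<down>, \<up>] (dcap q) [] \<star> wh [\<down>] (lam (Suc q) :: 'k qm) [])"
    using arg_cong[OF Suc, of "\<lambda>h. wh [\<down>] h []"] by (simp del: lam.simps)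
  then show ?case unfolding 1 by (simp add: cmp_assoc ctail[OF 2])
qed (simp add: idq_cmp' capRl[of "[]" "[]", simplified])

text \<open>The isomorphism \<open>srt Y\<close> moves all \<open>\<up>\<close> of \<open>Y\<close> to the left of all \<open>\<down>\<close>; \<open>srtr\<close> reads \<open>Y\<close> from the right.\<close>

primrec srtr :: "updown list => 'k::comm_ring_1 qm" where
  "srtr [] = idq []"
| "srtr (a # Y) = (case a of Up => wh (Us (ups Y)) (lam (dns Y)) [] \<star> wh [] (srtr Y) [\<up>] | Down => wh [] (srtr Y) [\<down>])"

definition srt :: "updown list => 'k::comm_ring_1 qm" where "srt Y = srtr (rev Y)"

lemma srt_simps: "srt [] = (idq [] :: 'k::comm_ring_1 qm)" "srt (Y @ [\<up>]) = wh (Us (ups Y)) (lam (dns Y)) [] \<star> wh [] (srt Y :: 'k qm) [\<up>]"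
  "srt (Y @ [\<down>]) = wh [] (srt Y) [\<down>]"
  by (simp_all add: srt_def)

lemma srt_typ [simp]: "dm (srt Y) = Y \<and> cd (srt Y) = Us (ups Y) @ Ds (dns Y) \<and> evn (srt Y)"
proof (induction Y rule: rev_induct)
  case (snoc a Y)
  then show ?case by (cases a) (simp_all add: srt_simps)
qed (simp add: srt_simps)

lemma count_list_reps [simp]: "count_list (replicate n x) y = (if x = y then n else 0)"
  by (induction n) auto

lemma srt_sorted: "srt (Us p @ Ds q) = (idq (Us p @ Ds q) :: 'k::comm_ring_1 qm)"
proof (induction q)
  case 0
  show ?case
  proof (induction p)
    case (Suc p)
    then show ?case using srt_simps(2)[of "Us p", where 'k = 'k] by (simp add: idq_cmp')
  qed (simp add: srt_simps)
next
  case (Suc q)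
  have "Us p @ Ds (Suc q) = (Us p @ Ds q) @ [\<down>]" by simp
  with Suc show ?case by (simp only: srt_simps) simp
qed

section \<open>Walled diagrams\<close>

text \<open>Diagrams between sorted words whose cups and caps all sit at the wall. The cap there is
  \<open>capRq\<close>; mixed crossings have disappeared into the sorting isomorphisms.\<close>

inductive walled :: "nat => nat => nat => nat => 'k::comm_ring_1 qm => bool" where
  gu: "p = Suc (Suc (i + j)) ==> walled p q p q (wh (Us i) uq (Us j @ Ds q))"
| gc: "p = Suc (i + j) ==> walled p q p q (wh (Us i) cq (Us j @ Ds q))"
| gd: "q = Suc (Suc (i + j)) ==> walled p q p q (wh (Us p @ Ds i) dq (Ds j))"
| gcup: "walled p q (Suc p) (Suc q) (wh (Us p) cupq (Ds q))"
| gcap: "walled (Suc p) (Suc q) p q (wh (Us p) capRq (Ds q))"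
| gid: "walled p q p q (idq (Us p @ Ds q))"
| gzr: "walled p q p' q' (zrq (Us p @ Ds q) (Us p' @ Ds q'))"
| gcmp: "walled p' q' p'' q'' F ==> walled p q p' q' G ==> walled p q p'' q'' (F \<star> G)"
| gpls: "walled p q p' q' F ==> walled p q p' q' G ==> walled p q p' q' (F \<oplus>\<^sub>q G)"
| gscl: "walled p q p' q' F ==> walled p q p' q' (c *\<^sub>q F)"

lemma walled_typ: "walled p q p' q' G ==> dm G = Us p @ Ds q \<and> cd G = Us p' @ Ds q'"
  by (induction rule: walled.induct) simp_all

lemma walled_v: "p = Suc (Suc (i + j)) ==> walled p q p q (wh (Us i) vq (Us j @ Ds q))"
  using gpls[OF gu gscl[OF gid[of p q], of "\<lambda>z. - z"], of i j] by (simp add: vq_eq wh_lin)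

lemma walled_di: "q = Suc (Suc (i + j)) ==> walled p q p q (wh (Us p @ Ds i) dqi (Ds j))"
  using gpls[OF gd gscl[OF gid[of p q], of "\<lambda>z. - z"], of i j] by (simp add: dqi_eq wh_lin)

lemma walled_dcup: "q = Suc (i + j) ==> walled p q p q (wh (Us p @ Ds i) (dcup j) [] :: 'k::comm_ring_1 qm)"
proof (induction j arbitrary: i)
  case 0
  then show ?case using gid[of p q] by simp
next
  case (Suc j)
  from Suc(1)[of "Suc i"] Suc(2) have 1: "walled p q p q (wh (Us p @ Ds (Suc i)) (dcup j) [] :: 'k qm)" by simp
  have 2: "walled p q p q (wh (Us p @ Ds i) dq (Ds j) :: 'k qm)" using gd[of q i j p] Suc(2) by simp
  show ?case using gcmp[OF 1 2] by simp
qed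

lemma walled_dcap: "q = Suc (i + j) ==> walled p q p q (wh (Us p @ Ds i) (dcap j) [] :: 'k::comm_ring_1 qm)"
proof (induction j arbitrary: i)
  case 0
  then show ?case using gid[of p q] by simp
next
  case (Suc j)
  from Suc(1)[of "Suc i"] Suc(2) have 1: "walled p q p q (wh (Us p @ Ds (Suc i)) (dcap j) [] :: 'k qm)" by simp
  have 2: "walled p q p q (wh (Us p @ Ds i) dqi (Ds j) :: 'k qm)" using walled_di[of q i j p] Suc(2) by simp
  show ?case using gcmp[OF 2 1] by simp
qed

lemma walled_down: "walled p q p' q' G ==> walled p (Suc q) p' (Suc q') (wh [] G [\<down>])"
proof (induction rule: walled.induct)
  case (gu p i j q) then show ?case using walled.gu[of p i j "Suc q"] by simp
next
  case (gc p i j q) then show ?case using walled.gc[of p i j "Suc q"] by simp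
next
  case (gd q i j p) then show ?case using walled.gd[of "Suc q" i "Suc j" p] by simp
next
  case (gcup p q) then show ?case using walled.gcup[of p "Suc q"] by simp
next
  case (gcap p q) then show ?case using walled.gcap[of p "Suc q"] by simp
next
  case (gid p q) then show ?case using walled.gid[of p "Suc q"] by simp
next
  case (gzr p q p' q') then show ?case using walled.gzr[of p "Suc q" p' "Suc q'"] by (simp add: wh_lin)
next
  case (gcmp p' q' p'' q'' F p q G) then show ?case by (simp add: walled.gcmp)
next
  case (gpls p q p' q' F G) then show ?case by (simp add: walled.gpls walled_typ wh_lin)
next
  case (gscl p q p' q' F c) then show ?case by (simp add: walled.gscl wh_lin)
qed

text \<open>An upward strand added on the right is out of order, so it is carried to the wall
  through the whole diagram. Each generator lets it pass and remains in walled form.\<close>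

lemma walled_up: "walled p q p' q' G ==>
  \<exists>G'. walled (Suc p) q (Suc p') q' G' \<and> wh (Us p') (lam q') [] \<star> wh [] G [\<up>] = G' \<star> wh (Us p) (lam q) []"
proof (induction rule: walled.induct)
  case (gu p i j q)
  have "wh (Us p) (lam q) [] \<star> wh (Us i) uq (Us j @ Ds q @ [\<up>]) = wh (Us i) uq (\<up> # Us j @ Ds q) \<star> wh (Us p) (lam q :: 'a qm) []"
    by (rule far[where C = "Us j"]) (simp_all add: gu)
  then show ?case using walled.gu[of "Suc p" i "Suc j" q] gu by auto
next
  case (gc p i j q)
  have "wh (Us p) (lam q) [] \<star> wh (Us i) cq (Us j @ Ds q @ [\<up>]) = wh (Us i) cq (\<up> # Us j @ Ds q) \<star> wh (Us p) (lam q :: 'a qm) []"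
    by (rule far[where C = "Us j"]) (simp_all add: gc)
  then show ?case using walled.gc[of "Suc p" i "Suc j" q] gc by auto
next
  case (gd q i j p)
  have "wh (Us p) (lam q) [] \<star> wh (Us p @ Ds i) dq (Ds j @ [\<up>]) = wh (Us (Suc p) @ Ds i) dq (Ds j) \<star> wh (Us p) (lam q :: 'a qm) []"
    using arg_cong[OF lam_d[of i j], of "\<lambda>h. wh (Us p) h []"] gd by (simp del: lam.simps)
  then show ?case using walled.gd[of q i j "Suc p"] gd by auto
next
  case (gcup p q)
  have 1: "wh (Us p @ [\<up>, \<down>]) (lam q) [] \<star> wh (Us p) cupq (Ds q @ [\<up>]) = wh (Us p) cupq (\<up> # Ds q) \<star> wh (Us p) (lam q :: 'a qm) []"
    by (rule far[where C = "[]"]) simp_all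
  have 2: "wh (Us p @ [\<up>]) lq (Ds q) \<star> wh (Us p) cupq (\<up> # Ds q) = wh (Us p) uq (\<down> # Ds q) \<star> wh (Us p @ [\<up>]) (cupq :: 'a qm) (Ds q)"
    using arg_cong[OF lq_cup, of "\<lambda>h. wh (Us p) h (Ds q)"] by simp
  have "walled (Suc p) q (Suc (Suc p)) (Suc q) (wh (Us p) uq (\<down> # Ds q) \<star> wh (Us p @ [\<up>]) (cupq :: 'a qm) (Ds q))"
    by (rule walled.gcmp[of "Suc (Suc p)" "Suc q"]) (use walled.gu[of "Suc (Suc p)" p 0 "Suc q"] walled.gcup[of "Suc p" q] in simp_all)
  moreover have "wh (Us (Suc p)) (lam (Suc q)) [] \<star> wh [] (wh (Us p) cupq (Ds q)) [\<up>] =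
     (wh (Us p) uq (\<down> # Ds q) \<star> wh (Us p @ [\<up>]) cupq (Ds q)) \<star> wh (Us p) (lam q :: 'a qm) []"
    using 1 ctail[OF 2] by (simp add: cmp_assoc)
  ultimately show ?case by blast
next
  case (gcap p q)
  have 1: "wh (Us p) (lam q) [] \<star> wh (Us p) capRq (Ds q @ [\<up>]) = wh (Us p) capRq (\<up> # Ds q) \<star> wh (Us p @ [\<up>, \<down>]) (lam q :: 'a qm) []"
    by (rule far[where C = "[]"]) simp_all
  have 2: "wh (Us p) capRq (\<up> # Ds q) = wh (Us p @ [\<up>]) capRq (Ds q) \<star> (wh (Us p) vq (\<down> # Ds q) \<star> wh (Us p @ [\<up>]) (lq :: 'a qm) (Ds q))"
    using arg_cong[OF capR_up, of "\<lambda>h. wh (Us p) h (Ds q)"] by simp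
  have "walled (Suc (Suc p)) (Suc q) (Suc p) q (wh (Us p @ [\<up>]) capRq (Ds q) \<star> wh (Us p) (vq :: 'a qm) (\<down> # Ds q))"
    by (rule walled.gcmp[of "Suc (Suc p)" "Suc q"]) (use walled_v[of "Suc (Suc p)" p 0 "Suc q"] walled.gcap[of "Suc p" q] in simp_all)
  moreover have "wh (Us p) (lam q) [] \<star> wh [] (wh (Us p) capRq (Ds q)) [\<up>] =
     (wh (Us p @ [\<up>]) capRq (Ds q) \<star> wh (Us p) vq (\<down> # Ds q)) \<star> wh (Us (Suc p)) (lam (Suc q) :: 'a qm) []"
    using 1 2 by (simp add: cmp_assoc)
  ultimately show ?case by blast
next
  case (gid p q)
  then show ?case by (intro exI[of _ "idq (Us (Suc p) @ Ds q)"]) (simp add: walled.gid[of "Suc p", simplified] idq_cmp')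
next
  case (gzr p q p' q')
  then show ?case by (intro exI[of _ "zrq (Us (Suc p) @ Ds q) (Us (Suc p') @ Ds q')"]) (use walled.gzr[of "Suc p" q "Suc p'" q'] in \<open>simp add: wh_lin\<close>)
next
  case (gcmp p' q' p'' q'' F p q G)
  then obtain F' G' where h: "walled (Suc p') q' (Suc p'') q'' F'" "walled (Suc p) q (Suc p') q' G'"
    "wh (Us p'') (lam q'') [] \<star> wh [] F [\<up>] = F' \<star> wh (Us p') (lam q') []"
    "wh (Us p') (lam q') [] \<star> wh [] G [\<up>] = G' \<star> wh (Us p) (lam q) []" by blast
  show ?case by (rule exI[of _ "F' \<star> G'"]) (simp add: cmp_assoc walled.gcmp[OF h(1,2)] ctail[OF h(3)] h(4))
next
  case (gpls p q p' q' F G)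
  then obtain F' G' where h: "walled (Suc p) q (Suc p') q' F'" "walled (Suc p) q (Suc p') q' G'"
    "wh (Us p') (lam q') [] \<star> wh [] F [\<up>] = F' \<star> wh (Us p) (lam q) []"
    "wh (Us p') (lam q') [] \<star> wh [] G [\<up>] = G' \<star> wh (Us p) (lam q) []" by blast
  show ?case by (rule exI[of _ "F' \<oplus>\<^sub>q G'"])
      (use walled_typ[OF h(1)] walled_typ[OF h(2)] walled_typ[OF gpls(1)] walled_typ[OF gpls(2)] in \<open>simp add: walled.gpls[OF h(1,2)] wh_lin cmp_pls pls_cmp h(3,4)\<close>)
next
  case (gscl p q p' q' F c)
  then obtain F' where h: "walled (Suc p) q (Suc p') q' F'"
    "wh (Us p') (lam q') [] \<star> wh [] F [\<up>] = F' \<star> wh (Us p) (lam q) []" by blast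
  show ?case by (rule exI[of _ "c *\<^sub>q F'"]) (simp add: walled.gscl[OF h(1)] wh_lin h(2))
qed

text \<open>Contexts on both sides are part of the notion, because a tensor product places each
  factor in one.\<close>

definition straight :: "'k::comm_ring_1 qm => updown list => updown list => bool" where
  "straight f A B \<longleftrightarrow> (\<exists>G. walled (ups (A @ dm f @ B)) (dns (A @ dm f @ B)) (ups (A @ cd f @ B)) (dns (A @ cd f @ B)) G \<and>
    srt (A @ cd f @ B) \<star> wh A f B = G \<star> srt (A @ dm f @ B))"

text \<open>\<open>srt\<close> grows by letters on the right, and \<open>walled_down\<close> and
  \<open>walled_up\<close> follow it; so generators only have to be treated with an empty right
  context.\<close>

lemma straight_context:
  assumes "straight f A []"
  shows "straight f A B"
proof (induction B rule: rev_induct)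
  case (snoc a B)
  let ?X = "A @ dm f @ B" and ?Y = "A @ cd f @ B"
  obtain G where G: "walled (ups ?X) (dns ?X) (ups ?Y) (dns ?Y) G" "srt ?Y \<star> wh A f B = G \<star> srt ?X"
    using snoc unfolding straight_def by blast
  show ?case
  proof (cases a)
    case Down
    have "srt (?Y @ [\<down>]) \<star> wh A f (B @ [\<down>]) = wh [] G [\<down>] \<star> srt (?X @ [\<down>])"
      using arg_cong[OF G(2), of "\<lambda>h. wh [] h [\<down>]"] unfolding srt_simps by simp
    then show ?thesis unfolding straight_def using walled_down[OF G(1)] Down
      by (intro exI[of _ "wh [] G [\<down>]"]) simp
  next
    case Up
    obtain G' where G': "walled (Suc (ups ?X)) (dns ?X) (Suc (ups ?Y)) (dns ?Y) G'"
      "wh (Us (ups ?Y)) (lam (dns ?Y)) [] \<star> wh [] G [\<up>] = G' \<star> wh (Us (ups ?X)) (lam (dns ?X)) []"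
      using walled_up[OF G(1)] by blast
    have 1: "wh [] (srt ?Y) [\<up>] \<star> wh A f (B @ [\<up>]) = wh [] G [\<up>] \<star> wh [] (srt ?X) [\<up>]"
      using arg_cong[OF G(2), of "\<lambda>h. wh [] h [\<up>]"] by simp
    have "srt (?Y @ [\<up>]) \<star> wh A f (B @ [\<up>]) = G' \<star> srt (?X @ [\<up>])"
      unfolding srt_simps cmp_assoc 1 using ctail[OF G'(2)] by simp
    then show ?thesis unfolding straight_def using G'(1) Up
      by (intro exI[of _ G']) simp
  qed
qed (rule assms)

lemma straight_pls: "straight f A B ==> straight g A B ==> dm f = dm g ==> cd f = cd g ==> straight (f \<oplus>\<^sub>q g) A B"
proof -
  assume t: "dm f = dm g" "cd f = cd g" and "straight f A B" "straight g A B"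
  then obtain F G where F: "walled (ups (A @ dm g @ B)) (dns (A @ dm g @ B)) (ups (A @ cd g @ B)) (dns (A @ cd g @ B)) F"
    "srt (A @ cd g @ B) \<star> wh A f B = F \<star> srt (A @ dm g @ B)"
    "walled (ups (A @ dm g @ B)) (dns (A @ dm g @ B)) (ups (A @ cd g @ B)) (dns (A @ cd g @ B)) G"
    "srt (A @ cd g @ B) \<star> wh A g B = G \<star> srt (A @ dm g @ B)" unfolding straight_def t by blast
  show ?thesis unfolding straight_def using t gpls[OF F(1,3)]
    by (intro exI[of _ "F \<oplus>\<^sub>q G"]) (use walled_typ[OF F(1)] walled_typ[OF F(3)] in \<open>simp add: wh_lin cmp_pls pls_cmp F(2,4)\<close>)
qed

lemma straight_scl: "straight f A B ==> straight (c *\<^sub>q f) A B"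
proof -
  assume "straight f A B"
  then obtain G where "walled (ups (A @ dm f @ B)) (dns (A @ dm f @ B)) (ups (A @ cd f @ B)) (dns (A @ cd f @ B)) G"
    "srt (A @ cd f @ B) \<star> wh A f B = G \<star> srt (A @ dm f @ B)" unfolding straight_def by blast
  then show ?thesis unfolding straight_def
    by (intro exI[of _ "c *\<^sub>q G"]) (auto simp: wh_lin intro: gscl)
qed

lemma straight_cmp: "straight f A B ==> straight g A B ==> dm f = cd g ==> straight (f \<star> g) A B"
proof -
  assume t: "dm f = cd g" and "straight f A B" "straight g A B"
  then obtain F G where F: "walled (ups (A @ cd g @ B)) (dns (A @ cd g @ B)) (ups (A @ cd f @ B)) (dns (A @ cd f @ B)) F"
    "srt (A @ cd f @ B) \<star> wh A f B = F \<star> srt (A @ cd g @ B)"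
    "walled (ups (A @ dm g @ B)) (dns (A @ dm g @ B)) (ups (A @ cd g @ B)) (dns (A @ cd g @ B)) G"
    "srt (A @ cd g @ B) \<star> wh A g B = G \<star> srt (A @ dm g @ B)" unfolding straight_def t by blast
  show ?thesis unfolding straight_def using gcmp[OF F(1,3)]
    by (intro exI[of _ "F \<star> G"]) (simp add: cmp_assoc F(4) ctail[OF F(2)])
qed

lemma straight_id: "straight (idq X) A B"
  unfolding straight_def using gid[of "ups (A @ X @ B)" "dns (A @ X @ B)"]
  by (intro exI[of _ "idq (Us (ups (A @ X @ B)) @ Ds (dns (A @ X @ B)))"]) (simp add: idq_cmp')

lemma srt_append2: "srt (A @ [\<up>, \<up>]) = wh (Us (ups A) @ [\<up>]) (lam (dns A)) [] \<star> (wh (Us (ups A)) (lam (dns A)) [\<up>] \<star> wh [] (srt A) [\<up>, \<up>])"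
  "srt (A @ [\<up>, \<down>]) = wh (Us (ups A)) (lam (dns A)) [\<down>] \<star> wh [] (srt A) [\<up>, \<down>]"
  "srt (A @ [\<down>, \<up>]) = wh (Us (ups A)) (lam (Suc (dns A))) [] \<star> wh [] (srt A) [\<down>, \<up>]"
  using srt_simps(2)[of "A @ [\<up>]"] srt_simps(3)[of "A @ [\<up>]"] srt_simps(2)[of "A @ [\<down>]"]
  by (simp_all add: srt_simps del: lam.simps)

lemma srt_far: "evn g \<or> evn f ==> wh [] (srt A) (cd f) \<star> wh A f [] = wh (Us (ups A) @ Ds (dns A)) f [] \<star> wh [] (srt A) (dm f)"
  by (rule far[where C = "[]", symmetric]) simp_all

lemma straight_u: "straight uq A []" 
proof -
  let ?p = "ups A" and ?q = "dns A"
  have 1: "wh [] (srt A) [\<up>, \<up>] \<star> wh A uq [] = wh (Us ?p @ Ds ?q) uq [] \<star> wh [] (srt A) [\<up>, \<up>]"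
    using srt_far[of "uq :: 'a qm" uq A] by simp
  have 2: "wh (\<up> # Us ?p) (lam ?q) [] \<star> (wh (Us ?p) (lam ?q) [\<up>] \<star> wh (Us ?p @ Ds ?q) uq []) =
    wh (Us ?p) uq (Ds ?q) \<star> (wh (\<up> # Us ?p) (lam ?q) [] \<star> wh (Us ?p) (lam ?q) [\<up>])"
    using arg_cong[OF lam_u, of "\<lambda>h. wh (Us ?p) h []"] by simp
  show ?thesis unfolding straight_def using gu[of "Suc (Suc ?p)" ?p 0 ?q]
    by (intro exI[of _ "wh (Us ?p) uq (Ds ?q)"]) (simp add: srt_append2 cmp_assoc 1 ctail2[OF 2])
qed

lemma straight_c: "straight cq A []" 
proof -
  let ?p = "ups A" and ?q = "dns A"
  have 1: "wh [] (srt A) [\<up>] \<star> wh A cq [] = wh (Us ?p @ Ds ?q) cq [] \<star> wh [] (srt A) [\<up>]"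
    by (rule far[where C = "[]", symmetric]) simp_all
  have 2: "wh (Us ?p) (lam ?q) [] \<star> wh (Us ?p @ Ds ?q) cq [] = wh (Us ?p) cq (Ds ?q) \<star> wh (Us ?p) (lam ?q) []"
    using arg_cong[OF lam_c, of "\<lambda>h. wh (Us ?p) h []"] by simp
  show ?thesis unfolding straight_def using gc[of "Suc ?p" ?p 0 ?q]
    by (intro exI[of _ "wh (Us ?p) cq (Ds ?q)"]) (simp add: srt_simps cmp_assoc 1 ctail[OF 2])
qed

lemma straight_r: "straight rq A []" 
proof -
  let ?p = "ups A" and ?q = "dns A"
  have 1: "wh [] (srt A) [\<down>, \<up>] \<star> wh A rq [] = wh (Us ?p @ Ds ?q) rq [] \<star> wh [] (srt A) [\<up>, \<down>]"
    using srt_far[of "rq :: 'a qm" rq A] by simp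
  have 2: "wh (Us ?p @ Ds ?q) lq [] \<star> wh (Us ?p @ Ds ?q) rq [] = idq (Us ?p @ Ds ?q @ [\<up>, \<down>])"
    by simp
  show ?thesis unfolding straight_def using gid[of "Suc ?p" "Suc ?q"]
    by (intro exI[of _ "idq (Us (Suc ?p) @ Ds (Suc ?q))"]) (simp add: srt_append2 lam_right cmp_assoc 1 ctail1[OF 2] idq_cmp' del: lam.simps)
qed

lemma straight_cup: "straight cupq A []" 
proof -
  let ?p = "ups A" and ?q = "dns A"
  have 1: "wh [] (srt A) [\<up>, \<down>] \<star> wh A cupq [] = wh (Us ?p @ Ds ?q) cupq [] \<star> srt A"
    using srt_far[of "cupq :: 'a qm" cupq A] by simp
  have 2: "wh (Us ?p) (lam ?q) [\<down>] \<star> wh (Us ?p @ Ds ?q) cupq [] = wh (Us ?p @ [\<up>]) (dcup ?q) [] \<star> wh (Us ?p) cupq (Ds ?q)"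
    using arg_cong[OF lam_cup, of "\<lambda>h. wh (Us ?p) h []"] by simp
  have "walled ?p ?q (Suc ?p) (Suc ?q) (wh (Us ?p @ [\<up>]) (dcup ?q) [] \<star> wh (Us ?p) (cupq :: 'a qm) (Ds ?q))"
    by (rule gcmp[OF _ gcup]) (use walled_dcup[of "Suc ?q" 0 ?q "Suc ?p"] in simp)
  then show ?thesis unfolding straight_def 
    by (intro exI[of _ "wh (Us ?p @ [\<up>]) (dcup ?q) [] \<star> wh (Us ?p) cupq (Ds ?q)"]) (simp add: srt_append2 cmp_assoc 1 ctail[OF 2])
qed

lemma straight_cap: "straight capq A []" 
proof -
  let ?p = "ups A" and ?q = "dns A"
  have 1: "srt A \<star> wh A capq [] = wh (Us ?p @ Ds ?q) capq [] \<star> wh [] (srt A) [\<down>, \<up>]"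
    using srt_far[of "capq :: 'a qm" capq A] by simp
  have 2: "wh (Us ?p @ Ds ?q) capq [] = wh (Us ?p) capRq (Ds ?q) \<star> (wh (Us ?p @ [\<up>]) (dcap ?q) [] \<star> wh (Us ?p) (lam (Suc ?q)) [])"
    using arg_cong[OF lam_cap, of "\<lambda>h. wh (Us ?p) h []"] by (simp del: lam.simps)
  have "walled (Suc ?p) (Suc ?q) ?p ?q (wh (Us ?p) (capRq :: 'a qm) (Ds ?q) \<star> wh (Us ?p @ [\<up>]) (dcap ?q) [])"
    by (rule gcmp[OF gcap]) (use walled_dcap[of "Suc ?q" 0 ?q "Suc ?p"] in simp)
  then show ?thesis unfolding straight_def 
    by (intro exI[of _ "wh (Us ?p) capRq (Ds ?q) \<star> wh (Us ?p @ [\<up>]) (dcap ?q) []"]) (simp add: srt_append2 cmp_assoc 1 2 del: lam.simps)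
qed

lemma straight_gen: "straight (gnq a) A B"
proof (rule straight_context, cases a)
  case UMinus
  then show "straight (gnq a) A []" using straight_pls[OF straight_u straight_scl[OF straight_id[of "[\<up>, \<up>]"]]] by (simp add: vq_eq)
qed (simp_all add: straight_u straight_c straight_r straight_cup straight_cap)

theorem straight_ev: "qt f X Y ==> straight (ev f) A B"
proof (induction arbitrary: A B rule: typed.induct)
  case (1 a) then show ?case by (simp add: straight_gen)
next
  case (2 X) then show ?case by (simp add: straight_id)
next
  case (3 X Y A B) 
  then show ?case using gzr[of "ups (A @ X @ B)" "dns (A @ X @ B)" "ups (A @ Y @ B)" "dns (A @ Y @ B)"]
    unfolding straight_def by (intro exI[of _ "zrq (Us (ups (A @ X @ B)) @ Ds (dns (A @ X @ B))) (Us (ups (A @ Y @ B)) @ Ds (dns (A @ Y @ B)))"]) (simp add: wh_lin)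
next
  case (4 f Y W g X) then show ?case by (simp add: straight_cmp ev_dm)
next
  case (5 f X Y g X' Y' A B)
  have c: "wh A (ev f \<otimes>\<^sub>q ev g) B = wh A (ev f) (Y' @ B) \<star> wh (A @ X) (ev g) B"
    by (subst tns_wh) (simp add: ev_dm[OF 5(1)] ev_dm[OF 5(2)])
  have "straight (wh [] (ev f) Y' \<star> wh X (ev g) []) A B"
    by (rule straight_cmp) (use 5(3)[of A "Y' @ B"] 5(4)[of "A @ X" B] in \<open>simp_all add: straight_def ev_dm[OF 5(1)] ev_dm[OF 5(2)]\<close>)
  then show ?case by (simp add: tns_wh[of "ev f"] ev_dm[OF 5(1)] ev_dm[OF 5(2)])
next
  case (6 f X Y g) then show ?case by (simp add: straight_pls ev_dm)
next
  case (7 f X Y c) then show ?case by (simp add: straight_scl)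
qed

section \<open>Morphisms from upward strands\<close>

fun fgen :: "nat => nat => bcgen => 'k qterm" where
  "fgen r s (BT i) = id_up (i - 1) \<boxtimes> u_plus \<boxtimes> id_up (r - i - 1) \<boxtimes> id_down s"
| "fgen r s (BTs i) = id_up r \<boxtimes> id_down (i - 1) \<boxtimes> d_plus \<boxtimes> id_down (s - i - 1)"
| "fgen r s BE = id_up (r - 1) \<boxtimes> (MComp cup_L cap_R) \<boxtimes> id_down (s - 1)"
| "fgen r s (BP i) = id_up (i - 1) \<boxtimes> clif \<boxtimes> id_up (r - i) \<boxtimes> id_down s"
| "fgen r s (BPs i) = id_up r \<boxtimes> id_down (i - 1) \<boxtimes> clif_down \<boxtimes> id_down (s - i)"

primrec fterm :: "nat => nat => 'k bcterm => 'k qterm" where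
  "fterm r s (AGen g) = fgen r s g"
| "fterm r s AOne = MId (Us r @ Ds s)"
| "fterm r s AZero = MZero (Us r @ Ds s) (Us r @ Ds s)"
| "fterm r s (x \<cdot> y) = MComp (fterm r s x) (fterm r s y)"
| "fterm r s (x \<boxplus> y) = fterm r s x \<uplus> fterm r s y"
| "fterm r s (c *\<^sub>a x) = c *\<^sub>m fterm r s x"

lemma qt_mwt: "mwt f ==> mdom f = X ==> mcod f = Y ==> qt f X Y"
  using mwt_typed by blast

lemma split_gen: "1 \<le> i ==> i < r ==> \<exists>a b. i = Suc a \<and> r = Suc (Suc (a + b))"
  "1 \<le> i ==> i \<le> r ==> \<exists>a b. i = Suc a \<and> r = Suc (a + b)"
  using exI[of "\<lambda>a. \<exists>b. i = Suc a \<and> r = Suc (Suc (a + b))" "i - 1"] exI[of "\<lambda>b. r = Suc (Suc (i - 1 + b))" "r - i - 1"]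
    exI[of "\<lambda>a. \<exists>b. i = Suc a \<and> r = Suc (a + b)" "i - 1"] exI[of "\<lambda>b. r = Suc (i - 1 + b)" "r - i"] by auto

lemma fgen_typed: "g \<in> bcgens r s ==> qt (fgen r s g) (Us r @ Ds s) (Us r @ Ds s)"
proof -
  have m: "mwt d_plus" "mdom d_plus = [\<down>, \<down>]" "mcod d_plus = [\<down>, \<down>]" "mwt cap_R" "mdom cap_R = [\<up>, \<down>]" "mcod cap_R = []"
    "mwt clif_down" "mdom clif_down = [\<down>]" "mcod clif_down = [\<down>]"
    by (simp_all add: d_plus_def l_plus_def rot_def cap_R_def clif_down_def)
  assume g: "g \<in> bcgens r s"
  show ?thesis
  proof (cases g)
    case (BT i)
    then obtain a b where "i = Suc a" "r = Suc (Suc (a + b))" using g split_gen(1)[of i r] by (auto simp: bcgens_def split: if_splits)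
    then show ?thesis using BT by (intro qt_mwt) simp_all
  next
    case (BTs i)
    then obtain a b where "i = Suc a" "s = Suc (Suc (a + b))" using g split_gen(1)[of i s] by (auto simp: bcgens_def split: if_splits)
    then show ?thesis using BTs by (intro qt_mwt) (simp_all add: m)
  next
    case BE
    then obtain a b where "r = Suc a" "s = Suc b" using g by (cases r; cases s) (auto simp: bcgens_def)
    then show ?thesis using BE by (intro qt_mwt) (simp_all add: m)
  next
    case (BP i)
    then obtain a b where "i = Suc a" "r = Suc (a + b)" using g split_gen(2)[of i r] by (auto simp: bcgens_def split: if_splits)
    then show ?thesis using BP by (intro qt_mwt) simp_all
  next
    case (BPs i)
    then obtain a b where "i = Suc a" "s = Suc (a + b)" using g split_gen(2)[of i s] by (auto simp: bcgens_def split: if_splits)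
    then show ?thesis using BPs by (intro qt_mwt) (simp_all add: m)
  qed
qed

lemma fterm_typed: "x \<in> bcterms r s ==> qt (fterm r s x) (Us r @ Ds s) (Us r @ Ds s)"
  by (induction x) (auto intro: fgen_typed typed.intros)

definition fq :: "nat => 'k::comm_ring_1 bcterm => 'k qm" where "fq p x = ev (fterm p 0 x)"

lemma fq_simps [simp]: "fq p (x \<cdot> y) = fq p x \<star> fq p y" "fq p (x \<boxplus> y) = fq p x \<oplus>\<^sub>q fq p y"
  "fq p (c *\<^sub>a x) = (\<lambda>_. c) *\<^sub>q fq p x" "fq p AOne = idq (Us p)" "fq p AZero = zrq (Us p) (Us p)"
  "fq p (bt i) = wh (Us (i - 1)) uq (Us (p - i - 1))" "fq p (bp i) = wh (Us (i - 1)) cq (Us (p - i))"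
  by (simp_all add: fq_def wh_def tns_assoc)

lemma fq_typ [simp]: "x \<in> bcterms p 0 ==> dm (fq p x) = Us p" "x \<in> bcterms p 0 ==> cd (fq p x) = Us p"
  using fterm_typed[of x p 0] by (simp_all add: fq_def ev_dm)

lemma bcgens_0: "g \<in> bcgens p 0 \<longleftrightarrow> (\<exists>i. 1 \<le> i \<and> i < p \<and> g = BT i) \<or> (\<exists>i. 1 \<le> i \<and> i \<le> p \<and> g = BP i)"
  by (auto simp: bcgens_def)

lemma wh_far_odd:
  assumes "hmq 1 f" "hmq 1 g"
  shows "wh (A @ cd f @ C) g B \<star> wh A f (C @ dm g @ B) = (\<lambda>_. - 1) *\<^sub>q (wh A f (C @ cd g @ B) \<star> wh (A @ dm f @ C) g B)"
proof -
  have h: "hmq 1 (idq C \<otimes>\<^sub>q g)" using hmq_tns[OF hmq_basic(1) assms(2)] by simp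
  have "(idq (cd f) \<otimes>\<^sub>q (idq C \<otimes>\<^sub>q g)) \<star> (f \<otimes>\<^sub>q (idq (C @ dm g))) =
    (\<lambda>_. - 1) *\<^sub>q ((f \<otimes>\<^sub>q idq (C @ cd g)) \<star> (idq (dm f) \<otimes>\<^sub>q (idq C \<otimes>\<^sub>q g)))"
    using cmp_tns[OF assms(1) h, of "idq (cd f)" "idq (C @ dm g)"]
    by (subst bifunct) (auto simp: idq_tns idq_cmp' koszul_sign_def)
  then have "wh A ((idq (cd f) \<otimes>\<^sub>q (idq C \<otimes>\<^sub>q g)) \<star> (f \<otimes>\<^sub>q (idq (C @ dm g)))) B =
     wh A ((\<lambda>_. - 1) *\<^sub>q ((f \<otimes>\<^sub>q idq (C @ cd g)) \<star> (idq (dm f) \<otimes>\<^sub>q (idq C \<otimes>\<^sub>q g)))) B" by simp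
  then show ?thesis by (simp only: wh_cmp wh_lin) (simp add: wh_def tns_assoc idq_tns idq_tns_idq)
qed

lemma cq_cq_far: "wh (Us a @ \<up> # Us b) cq (Us c) \<star> wh (Us a) cq (Us b @ \<up> # Us c) =
  (\<lambda>_. - 1) *\<^sub>q (wh (Us a) cq (Us b @ \<up> # Us c) \<star> wh (Us a @ \<up> # Us b) cq (Us c))"
  using wh_far_odd[of cq cq "Us a" "Us b" "Us c"] hmq_basic(3)[of Clif] by simp

lemma uq_sq: "uq \<star> uq = (\<lambda>z. z) *\<^sub>q uq \<oplus>\<^sub>q (idq [\<up>, \<up>])"
proof -
  have "idq [\<up>, \<up>] = uq \<star> (vq :: 'a qm)" by (rule q_rels(2)[symmetric])
  then have "idq [\<up>, \<up>] = uq \<star> uq \<oplus>\<^sub>q (\<lambda>z. - z) *\<^sub>q (uq :: 'a qm)"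
    by (simp add: vq_eq cmp_pls idq_cmp')
  then have "(\<lambda>z. z) *\<^sub>q uq \<oplus>\<^sub>q idq [\<up>, \<up>] = uq \<star> uq \<oplus>\<^sub>q ((\<lambda>z. z) *\<^sub>q uq \<oplus>\<^sub>q (\<lambda>z. - z) *\<^sub>q (uq :: 'a qm))"
    by (simp add: pls_left_comm[of "(\<lambda>z. z) *\<^sub>q uq"])
  then show ?thesis by (simp only: pls_scl[symmetric]) (simp add: scl_zero pls_zrq)
qed

lemma fq_tt_far:
  assumes "1 \<le> i" "Suc i < j" "j < p"
  shows "fq p (bt j \<cdot> bt i) = (fq p (bt i \<cdot> bt j) :: 'k::comm_ring_1 qm)"
proof -
  define a b c where "a = i - 1" and "b = j - i - 2" and "c = p - j - 1"
  then have "i = Suc a" "j = Suc (Suc (Suc (a + b)))" "p = Suc (Suc (Suc (Suc (a + b + c))))" using assms by auto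
  then show ?thesis by (simp, intro far[where C = "Us b"]) simp_all
qed

lemma fq_tc_far:
  assumes "1 \<le> i" "i < p" "1 \<le> j" "j \<le> p" "j \<noteq> i" "j \<noteq> Suc i"
  shows "fq p (bt i \<cdot> bp j) = (fq p (bp j \<cdot> bt i) :: 'k::comm_ring_1 qm)"
proof (cases "j < i")
  case True
  define a b c where "a = j - 1" and "b = i - j - 1" and "c = p - i - 1"
  then have "j = Suc a" "i = Suc (Suc (a + b))" "p = Suc (Suc (Suc (a + b + c)))" using assms True by auto
  then show ?thesis by (simp, intro far[where C = "Us b"]) simp_all
next
  case False
  define a b c where "a = i - 1" and "b = j - i - 2" and "c = p - j"
  then have "i = Suc a" "j = Suc (Suc (Suc (a + b)))" "p = Suc (Suc (Suc (a + b + c)))" using assms False by auto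
  then show ?thesis by (simp, intro far[where C = "Us b", symmetric]) simp_all
qed

lemma fq_cc:
  assumes "1 \<le> i" "i < j" "j \<le> p"
  shows "fq p (bp j \<cdot> bp i) = (\<lambda>_. - 1) *\<^sub>q (fq p (bp i \<cdot> bp j) :: 'k::comm_ring_1 qm)"
proof -
  define a b c where "a = i - 1" and "b = j - i - 1" and "c = p - j"
  then have "i = Suc a" "j = Suc (Suc (a + b))" "p = Suc (Suc (a + b + c))" using assms by auto
  then show ?thesis using cq_cq_far[of a b c] by simp
qed

text \<open>For s = 0 the relations are those of the supercategory up to interchange and can be
  checked by diagrams; for s > 0 they follow later by comparing values on the vacuum.\<close>

lemma fq_rel:
  fixes z :: "'k::comm_ring_1"
  assumes "(x, y) \<in> bcrels p z" "x \<in> bcterms p 0" "y \<in> bcterms p 0"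
  shows "dlt z *\<^sub>q fq p x = dlt z *\<^sub>q fq p y"
  using assms(1)
proof cases
  case (1 i)
  define a b where "a = i - 1" and "b = p - i - 1"
  then have "i = Suc a" "p = Suc (Suc (a + b))" using 1 assms by (auto simp: bcgens_0)
  moreover have "wh (Us a) uq (Us b) \<star> wh (Us a) uq (Us b) = (\<lambda>z. z) *\<^sub>q wh (Us a) uq (Us b) \<oplus>\<^sub>q (idq (Us p) :: 'k qm)"
    using arg_cong[OF uq_sq, of "\<lambda>h. wh (Us a) (h :: 'k qm) (Us b)"] calculation by (simp add: wh_lin)
  moreover have "(\<lambda>za. dlt z za * za) = (\<lambda>za. dlt z za * z)" by (auto simp: dlt_def)
  ultimately show ?thesis using 1 by (simp add: scl_pls)
next
  case (3 i)
  define a b where "a = i - 1" and "b = p - i - 2"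
  then have i: "i = Suc a" "p = Suc (Suc (Suc (a + b)))" using 3 assms by (auto simp: bcgens_0)
  then show ?thesis using 3 arg_cong[OF q_rels(5), of "\<lambda>h. wh (Us a) (h :: 'k qm) (Us b)"] by (simp add: cmp_assoc)
next
  case (5 i j)
  then show ?thesis using assms fq_tt_far[of i j p, where 'k = 'k] fq_tt_far[of j i p, where 'k = 'k] by (auto simp: bcgens_0)
next
  case (8 i)
  define a b where "a = i - 1" and "b = p - i"
  then have i: "i = Suc a" "p = Suc (a + b)" using 8 assms by (auto simp: bcgens_0)
  then show ?thesis using 8 arg_cong[OF q_rels(6), of "\<lambda>h. wh (Us a) (h :: 'k qm) (Us b)"] by (simp add: wh_lin)
next
  case (9 i j)
  then have r: "1 \<le> i" "i \<le> p" "1 \<le> j" "j \<le> p" using assms by (auto simp: bcgens_0)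
  show ?thesis
  proof (cases "i < j")
    case True
    have "fq p x = (\<lambda>_. - 1) *\<^sub>q ((\<lambda>_. - 1) *\<^sub>q fq p (bp i \<cdot> bp j) :: 'k qm)" using 9 by simp
    also have "\<dots> = fq p y" using 9 True r by (simp only: fq_cc[symmetric] fq_simps(3))
    finally show ?thesis by simp
  next
    case False
    then show ?thesis using 9 r fq_cc[of j i p, where 'k = 'k] by simp
  qed
next
  case (13 i)
  define a b where "a = i - 1" and "b = p - i - 1"
  then have "i = Suc a" "p = Suc (Suc (a + b))" using 13 assms by (auto simp: bcgens_0)
  then show ?thesis using 13 arg_cong[OF q_rels(7), of "\<lambda>h. wh (Us a) (h :: 'k qm) (Us b)"] by simp
next
  case (15 j i)
  then show ?thesis using assms fq_tc_far[of i p j, where 'k = 'k] by (auto simp: bcgens_0)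
qed (use assms in \<open>auto simp: bcgens_0\<close>)

lemma fterm_acong:
  assumes "(x, y) \<in> bccong p 0 z"
  shows "qc z (Us p) (Us p) (fterm p 0 x) (fterm p 0 y) \<and> x \<in> bcterms p 0 \<and> y \<in> bcterms p 0"
proof -
  have t: "qt (fterm p 0 x) (Us p) (Us p)" if "x \<in> bcterms p 0" for x :: "'a bcterm"
    using fterm_typed[OF that] by simp
  show ?thesis using assms
  proof (induction rule: acong.induct)
    case (rel x y)
    then show ?case using ev_qc[OF t t, THEN iffD1, OF rel(2,3) fq_rel[OF rel, unfolded fq_def]] by simp
  next
    case trans then show ?case by (blast intro: mcong.trans)
  next
    case sym then show ?case by (blast intro: mcong.sym)
  next
    case mul_cong then show ?case by (auto intro: mcong.comp_cong)
  next
    case add_cong then show ?case by (auto intro: mcong.add_cong)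
  next
    case scale_cong then show ?case by (auto intro: mcong.scale_cong)
  next
    case add_mul then show ?case by (auto intro!: mcong.add_comp t)
  next
    case mul_add then show ?case by (auto intro!: mcong.comp_add t)
  next
    case scale_mul then show ?case by (auto intro!: mcong.scale_comp t)
  next
    case mul_scale then show ?case by (auto intro!: mcong.comp_scale t)
  next
    case mul_assoc then show ?case by (auto intro!: mcong.comp_assoc t)
  next
    case one_mul then show ?case by (auto intro!: mcong.id_comp t)
  next
    case mul_one then show ?case by (auto intro!: mcong.comp_id t)
  qed (auto intro!: t mcong.refl mcong.add_assoc mcong.add_comm mcong.add_zero mcong.zero_scale mcong.one_scale
     mcong.scale_scale mcong.scale_add mcong.add_scale)
qed

lemma fq_acong: "(x, y) \<in> bccong p 0 z ==> dlt z *\<^sub>q fq p x = dlt z *\<^sub>q fq p y"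
  using fterm_acong[of x y p z] fterm_typed[of x p 0] fterm_typed[of y p 0] by (simp add: fq_def ev_qc)

lemma aterms_up: "x \<in> bcterms p 0 ==> x \<in> bcterms (Suc p) 0"
  by (auto simp: aterms_def bcgens_def)

lemma fq_up: "x \<in> bcterms p 0 ==> fq (Suc p) x = wh [] (fq p x) [\<up>]"
proof (induction x)
  case (AGen g)
  then consider (t) i where "g = BT i" "1 \<le> i" "i < p" | (c) i where "g = BP i" "1 \<le> i" "i \<le> p"
    by (auto simp: bcgens_0)
  then show ?case
  proof cases
    case t then have "Suc p - i - 1 = Suc (p - i - 1)" by simp
    with t show ?thesis by simp
  next
    case c then have "Suc p - i = Suc (p - i)" by simp
    with c show ?thesis by simp
  qed
qed (simp_all add: wh_lin)

section \<open>Closing the last strand of a Hecke--Clifford word\<close>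

definition ptr :: "nat => 'k::comm_ring_1 qm => 'k qm" where
  "ptr p f = wh (Us p) capRq [] \<star> (wh [] f [\<down>] \<star> wh (Us p) cupq [])"

lemma ptr_left: "dm F = Us p ==> cd F = Us p ==> ptr p (wh [] F [\<up>] \<star> f) = F \<star> ptr p f"
proof -
  assume F: "dm F = Us p" "cd F = Us p"
  have 1: "wh (Us p) capRq [] \<star> wh [] F [\<up>, \<down>] = wh [] F [] \<star> wh (Us p) capRq []"
    by (rule far[where C = "[]"]) (simp_all add: F)
  show ?thesis using ctail[OF 1] by (simp add: ptr_def cmp_assoc)
qed

lemma ptr_right: "dm F = Us p ==> cd F = Us p ==> ptr p (f \<star> wh [] F [\<up>]) = ptr p f \<star> F"
proof -
  assume F: "dm F = Us p" "cd F = Us p"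
  have 1: "wh [] F [\<up>, \<down>] \<star> wh (Us p) cupq [] = wh (Us p) cupq [] \<star> wh [] F []"
    by (rule far[where C = "[]", symmetric]) (simp_all add: F)
  show ?thesis using 1 by (simp add: ptr_def cmp_assoc)
qed

lemma ptr_lin: "dm f = dm g ==> cd f = cd g ==> ptr p (f \<oplus>\<^sub>q g) = ptr p f \<oplus>\<^sub>q ptr p g" "ptr p (c *\<^sub>q f) = c *\<^sub>q ptr p f"
  by (simp_all add: ptr_def wh_lin cmp_pls pls_cmp)

lemma ptr_id: "ptr p (idq (Us (Suc p))) = zrq (Us p) (Us p)"
  using arg_cong[OF q_rels(9), of "\<lambda>h. wh (Us p) h []"] by (simp add: ptr_def wh_lin idq_cmp')

lemma ptr_c: "ptr p (wh (Us p) cq []) = zrq (Us p) (Us p)"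
  using arg_cong[OF q_rels(8), of "\<lambda>h. wh (Us p) h []"] by (simp add: ptr_def wh_lin)

lemma ptr_u: "ptr (Suc p) (wh (Us p) uq []) = idq (Us (Suc p))"
  using arg_cong[OF curl, of "\<lambda>h. wh (Us p) h []"] by (simp add: ptr_def)

lemma bcact_left: "x \<in> bcterms p 0 ==> bcact p x v = bcact p x 1 * v"
proof (induction x arbitrary: v)
  case (AMul x y)
  have m: "x \<in> bcterms p 0" "y \<in> bcterms p 0" using AMul.prems by simp_all
  note x = AMul.IH(1)[OF m(1)] and y = AMul.IH(2)[OF m(2)]
  have "bcact p (x \<cdot> y) v = bcact p x 1 * (bcact p y 1 * v)"
    using x[of "bcact p y v"] y[of v] by simp
  moreover have "bcact p (x \<cdot> y) 1 = bcact p x 1 * bcact p y 1" using x[of "bcact p y 1"] by simp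
  ultimately show ?case by (simp add: mult.assoc)
next
  case (AAdd x y)
  have m: "x \<in> bcterms p 0" "y \<in> bcterms p 0" using AAdd.prems by simp_all
  note x = AAdd.IH(1)[OF m(1)] and y = AAdd.IH(2)[OF m(2)]
  show ?case using x[of v] y[of v] by (simp add: distrib_right)
next
  case (AScale c x)
  have m: "x \<in> bcterms p 0" using AScale.prems by simp
  note x = AScale.IH[OF m]
  show ?case using x[of v] by (simp add: mult.assoc)
qed (auto simp: bcgens_0)

lemma bcact_up: "x \<in> bcterms p 0 ==> bcact (Suc p) x 1 = sh (bcact p x 1)"
proof (induction x)
  case (AGen g)
  then consider (t) i where "g = BT i" "1 \<le> i" "i < p" | (c) i where "g = BP i" "1 \<le> i" "i \<le> p"
    by (auto simp: bcgens_0)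
  then show ?case
  proof cases
    case t then have "Suc p - 1 - i = Suc (p - 1 - i)" by simp
    with t show ?thesis by simp
  next
    case c then have "Suc p - i = Suc (p - i)" by simp
    with c show ?thesis by simp
  qed
next
  case (AMul x y)
  then show ?case using bcact_left[OF aterms_up, of x p "bcact (Suc p) y 1"] bcact_left[of x p "bcact p y 1"]
    by (simp add: shift.hom_mult)
qed (simp_all add: shift.hom_simps)

lemma bcact_hsub: "x \<in> bcterms p 0 ==> bcact p x 1 \<in> hsub p"
proof (induction x)
  case (AGen g)
  then show ?case by (auto simp: bcgens_0 intro!: hsub_ht hsub.hc)
next
  case (AMul x y)
  then show ?case using bcact_left[of x p "bcact p y 1"] by (simp add: hsub.mult)
next
  case (AAdd x y)
  then show ?case by (simp add: hsub.add)
next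
  case (AScale c x)
  then show ?case by (simp add: hsub.mult hsub.sc)
qed (simp_all add: hsub_1 hsub_0)

lemma heps_comm: "x * heps z = heps z * x" "sh (heps z) = heps z"
proof -
  show "x * heps z = heps z * x" unfolding heps_def by (rule sc_comm[symmetric] sc_comm)
qed (simp add: heps_def shift.hom_simps)

lemma vacuum_0: "vacuum p 0 z = heps z" by (simp add: vacuum_def)

lemma hsub_bcact_0: "a \<in> hsub p ==> \<exists>A \<in> bcterms p 0. bcact p A 1 * heps z = heps z * a"
proof -
  assume "a \<in> hsub p"
  then obtain A where A: "A \<in> bcterms p 0" "heps z * a = bcact p A (heps z)"
    using hsub_orbit[of a p 0 z] by (auto simp: orbit_def vacuum_0)
  then show ?thesis using bcact_left[OF A(1), of "heps z"] by auto
qed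

text \<open>Speaks of some word with value \<open>heps z * v\<close> whose closure is again a word;
  by faithfulness for s = 0 the choice among such words is immaterial.\<close>

definition trace_ok :: "nat => 'k => 'k::comm_ring_1 hcl => bool" where
  "trace_ok p z v \<longleftrightarrow> (\<exists>x \<in> bcterms (Suc p) 0. bcact (Suc p) x (heps z) = heps z * v \<and>
    (\<exists>y \<in> bcterms p 0. dlt z *\<^sub>q ptr p (fq (Suc p) x) = dlt z *\<^sub>q fq p y))"

text \<open>For the three Mackey forms the closed strand is a circle, a dotted circle and a curl,
  each with factors on fewer strands that slide out of the trace.\<close>

lemma trace_ok_hsub: "v \<in> hsub (Suc p) ==> trace_ok p z (v :: 'k::comm_ring_1 hcl)"
proof (induction rule: hsub_mackey_induct)
  case (sh a)
  obtain A where A: "A \<in> bcterms p 0" "bcact p A 1 * heps z = heps z * a" using hsub_bcact_0[OF sh] by blast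
  have "bcact (Suc p) A (heps z) = sh (bcact p A 1 * heps z)"
    using bcact_left[OF aterms_up[OF A(1)], of "heps z"] bcact_up[OF A(1)] by (simp add: heps_comm(2) shift.hom_mult)
  then have b: "bcact (Suc p) A (heps z) = heps z * sh a" by (simp add: A heps_comm(2) shift.hom_mult)
  have "ptr p (fq (Suc p) A) = fq p A \<star> ptr p (idq (Us (Suc p)))"
    using ptr_left[of "fq p A" p "idq (Us (Suc p))"] A by (simp add: fq_up idq_cmp')
  then have "ptr p (fq (Suc p) A) = fq p AZero" using A(1) unfolding ptr_id by simp
  then have "AZero \<in> bcterms p 0 \<and> dlt z *\<^sub>q ptr p (fq (Suc p) A) = dlt z *\<^sub>q fq p AZero" by simp
  then show ?case unfolding trace_ok_def using b aterms_up[OF A(1)] by blast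
next
  case (hc a)
  obtain A where A: "A \<in> bcterms p 0" "bcact p A 1 * heps z = heps z * a" using hsub_bcact_0[OF hc] by blast
  have "bcact (Suc p) (A \<cdot> bp (Suc p)) (heps z) = sh (bcact p A 1 * heps z) * hc 0"
    using bcact_left[OF aterms_up[OF A(1)], of "hc 0 * heps z"] bcact_up[OF A(1)]
    by (simp add: heps_comm(1)[of "hc 0"] heps_comm(2) shift.hom_mult mult.assoc)
  then have b: "bcact (Suc p) (A \<cdot> bp (Suc p)) (heps z) = heps z * (sh a * hc 0)"
    by (simp add: A heps_comm(2) shift.hom_mult mult.assoc)
  have "ptr p (fq (Suc p) (A \<cdot> bp (Suc p))) = fq p A \<star> ptr p (wh (Us p) cq [])"
    using ptr_left[of "fq p A" p "wh (Us p) cq []"] A by (simp add: fq_up)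
  then have "ptr p (fq (Suc p) (A \<cdot> bp (Suc p))) = fq p AZero" using A(1) unfolding ptr_c by simp
  then have "AZero \<in> bcterms p 0 \<and> dlt z *\<^sub>q ptr p (fq (Suc p) (A \<cdot> bp (Suc p))) = dlt z *\<^sub>q fq p AZero" by simp
  moreover have "A \<cdot> bp (Suc p) \<in> bcterms (Suc p) 0" using aterms_up[OF A(1)] by (simp add: bcgens_0)
  ultimately show ?case unfolding trace_ok_def using b by blast
next
  case (hs a b)
  then obtain p' where p: "p = Suc p'" by (cases p) auto
  obtain A where A: "A \<in> bcterms p 0" "bcact p A 1 * heps z = heps z * a" using hsub_bcact_0[OF hs(1)] by blast
  obtain B where B: "B \<in> bcterms p 0" "bcact p B 1 * heps z = heps z * b" using hsub_bcact_0[OF hs(2)] by blast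
  let ?x = "A \<cdot> bt_inv z p \<cdot> B"
  have b0: "bcact (Suc p) B (heps z) = sh (bcact p B 1 * heps z)"
    using bcact_left[OF aterms_up[OF B(1)], of "heps z"] bcact_up[OF B(1)] by (simp add: heps_comm(2) shift.hom_mult)
  have b1: "bcact (Suc p) B (heps z) = heps z * sh b" unfolding b0 B by (simp add: heps_comm(2) shift.hom_mult)
  have cor: "heps z * sh b \<in> corner z" by (rule corner_closed[OF corner_eps])
  have "bcact (Suc p) (bt_inv z p) (heps z * sh b) = hs 0 * (heps z * sh b)"
    using corner_hz[OF cor] by (simp add: bt_inv_def ht_def distrib_right ksc_simps)
  then have "bcact (Suc p) ?x (heps z) = sh (bcact p A 1) * (hs 0 * (heps z * sh b))"
    using bcact_left[OF aterms_up[OF A(1)], of "hs 0 * (heps z * sh b)"] bcact_up[OF A(1)] by (simp add: b1)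
  also have "\<dots> = sh (bcact p A 1) * (heps z * (hs 0 * sh b))"
    by (simp add: mult.assoc[symmetric] heps_comm(1)[of "hs 0"])
  also have "\<dots> = sh (bcact p A 1 * heps z) * (hs 0 * sh b)" by (simp add: shift.hom_mult heps_comm(2) mult.assoc)
  also have "\<dots> = heps z * (sh a * (hs 0 * sh b))" unfolding A by (simp add: shift.hom_mult heps_comm(2) mult.assoc)
  finally have b2: "bcact (Suc p) ?x (heps z) = heps z * (sh a * (hs 0 * sh b))" .
  have m: "ptr p (fq (Suc p) (bt_inv z p)) = idq (Us p)"
  proof -
    have "fq (Suc p) (bt_inv z p) = wh (Us p') uq [] \<oplus>\<^sub>q (\<lambda>_. - z) *\<^sub>q idq (Us (Suc p))"
      by (simp add: bt_inv_def p)
    then have "ptr p (fq (Suc p) (bt_inv z p)) = ptr p (wh (Us p') uq []) \<oplus>\<^sub>q (\<lambda>_. - z) *\<^sub>q ptr p (idq (Us (Suc p)))"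
      by (simp only:) (simp add: ptr_lin p)
    then show ?thesis unfolding ptr_id unfolding p ptr_u by (simp add: pls_zrq)
  qed
  have "ptr p (fq (Suc p) ?x) = fq p A \<star> ptr p (fq (Suc p) (bt_inv z p)) \<star> fq p B"
    using ptr_left[of "fq p A" p "fq (Suc p) (bt_inv z p) \<star> wh [] (fq p B) [\<up>]"] ptr_right[of "fq p B" p "fq (Suc p) (bt_inv z p)"] A B
    by (simp add: fq_up cmp_assoc)
  then have "ptr p (fq (Suc p) ?x) = fq p (A \<cdot> B)" using A B by (simp add: m idq_cmp')
  then have "A \<cdot> B \<in> bcterms p 0 \<and> dlt z *\<^sub>q ptr p (fq (Suc p) ?x) = dlt z *\<^sub>q fq p (A \<cdot> B)" using A B by simp
  moreover have "?x \<in> bcterms (Suc p) 0" using aterms_up[OF A(1)] aterms_up[OF B(1)] p by (simp add: bcgens_0 bt_inv_def)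
  ultimately show ?case unfolding trace_ok_def using b2 by blast
next
  case (add v w)
  then obtain x y x' y' where h: "x \<in> bcterms (Suc p) 0" "bcact (Suc p) x (heps z) = heps z * v"
    "y \<in> bcterms p 0" "dlt z *\<^sub>q ptr p (fq (Suc p) x) = dlt z *\<^sub>q fq p y"
    "x' \<in> bcterms (Suc p) 0" "bcact (Suc p) x' (heps z) = heps z * w"
    "y' \<in> bcterms p 0" "dlt z *\<^sub>q ptr p (fq (Suc p) x') = dlt z *\<^sub>q fq p y'" unfolding trace_ok_def by blast
  have "dlt z *\<^sub>q ptr p (fq (Suc p) (x \<boxplus> x')) = dlt z *\<^sub>q fq p (y \<boxplus> y')"
    using h by (simp add: ptr_lin scl_pls ptr_def[of p "fq _ _"] del: scl_scl)
  then have "y \<boxplus> y' \<in> bcterms p 0 \<and> dlt z *\<^sub>q ptr p (fq (Suc p) (x \<boxplus> x')) = dlt z *\<^sub>q fq p (y \<boxplus> y')" using h by simp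
  moreover have "bcact (Suc p) (x \<boxplus> x') (heps z) = heps z * (v + w)" using h by (simp add: distrib_left)
  moreover have "x \<boxplus> x' \<in> bcterms (Suc p) 0" using h by simp
  ultimately show ?case unfolding trace_ok_def by blast
qed

text \<open>The word \<open>x\<close> and the word \<open>x'\<close> assembled from Mackey forms
  have the same value on the vacuum, hence agree in the algebra and therefore in the
  supercategory.\<close>

theorem ptr_fq:
  assumes x: "x \<in> bcterms (Suc p) 0"
  shows "\<exists>y \<in> bcterms p 0. dlt z *\<^sub>q ptr p (fq (Suc p) x) = dlt z *\<^sub>q fq p y"
proof -
  obtain x' y where h: "x' \<in> bcterms (Suc p) 0" "bcact (Suc p) x' (heps z) = heps z * bcact (Suc p) x 1"
    "y \<in> bcterms p 0" "dlt z *\<^sub>q ptr p (fq (Suc p) x') = dlt z *\<^sub>q fq p y"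
    using trace_ok_hsub[OF bcact_hsub[OF x], of z] unfolding trace_ok_def by blast
  have "bcact (Suc p) x (vacuum (Suc p) 0 z) = bcact (Suc p) x' (vacuum (Suc p) 0 z)"
    using h(2) bcact_left[OF x, of "heps z"] heps_comm(1)[of "bcact (Suc p) x 1" z] by (simp add: vacuum_0)
  from fq_acong[OF bcact_faithful[OF x h(1) this]]
  have e: "dlt z *\<^sub>q fq (Suc p) x = dlt z *\<^sub>q fq (Suc p) x'" .
  have "dlt z *\<^sub>q ptr p (fq (Suc p) x) = ptr p (dlt z *\<^sub>q fq (Suc p) x)" by (simp add: ptr_lin)
  also have "\<dots> = dlt z *\<^sub>q ptr p (fq (Suc p) x')" unfolding e by (simp add: ptr_lin)
  finally show ?thesis using h by auto
qed

section \<open>Nested cups and standard forms\<close>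

primrec kap :: "nat => 'k::comm_ring_1 qm" where
  "kap 0 = idq []"
| "kap (Suc q) = wh (Us q) cupq (Ds q) \<star> kap q"

lemma kap_typ [simp]: "dm (kap q) = []" "cd (kap q) = Us q @ Ds q"
  by (induction q) simp_all

lemma replicate_swap: "replicate i x @ replicate j x = replicate j x @ replicate i x"
  by (simp only: replicate_add[symmetric] add.commute)

text \<open>A crossing travels along the cups from their downward to their upward ends; thus
  \<open>dq\<close> needs no place of its own in a standard form.\<close>

lemma kap_d: "wh (Us (Suc (Suc (i + j))) @ Ds i) dq (Ds j) \<star> kap (Suc (Suc (i + j))) =
  wh (Us j) uq (Us i @ Ds (Suc (Suc (i + j)))) \<star> (kap (Suc (Suc (i + j))) :: 'k::comm_ring_1 qm)"
proof (induction i)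
  case 0
  have "wh (\<up> # \<up> # Us j) dq (Ds j) \<star> (wh (\<up> # Us j) cupq (\<down> # Ds j) \<star> wh (Us j) cupq (Ds j)) =
    wh (Us j) uq (\<down> # \<down> # Ds j) \<star> (wh (\<up> # Us j) cupq (\<down> # Ds j) \<star> wh (Us j) (cupq :: 'k qm) (Ds j))"
    using arg_cong[OF kappa2, of "\<lambda>h. wh (Us j) h (Ds j)"] by simp
  from ctail2[OF this] show ?case by (simp add: cmp_assoc)
next
  case (Suc i)
  let ?q = "Suc (Suc (i + j))"
  have 1: "wh (Us (Suc ?q) @ Ds (Suc i)) dq (Ds j) \<star> wh (Us ?q) cupq (Ds ?q) = wh (Us ?q) cupq (Ds ?q) \<star> wh (Us ?q @ Ds i) (dq :: 'k qm) (Ds j)"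
    by (rule far[where C = "Ds i"]) simp_all
  have 2: "wh (Us ?q) cupq (Ds ?q) \<star> wh (Us j) uq (Us i @ Ds ?q) = wh (Us j) uq (Us (Suc i) @ Ds (Suc ?q)) \<star> wh (Us ?q) (cupq :: 'k qm) (Ds ?q)"
    by (rule far[where C = "Us i"]) (simp_all add: replicate_swap[of i \<up> j])
  have "wh (Us (Suc ?q) @ Ds (Suc i)) dq (Ds j) \<star> (wh (Us ?q) cupq (Ds ?q) \<star> kap ?q) =
    wh (Us j) uq (Us (Suc i) @ Ds (Suc ?q)) \<star> (wh (Us ?q) cupq (Ds ?q) \<star> (kap ?q :: 'k qm))"
    unfolding ctail[OF 1] Suc ctail[OF 2] by simp
  then show ?case unfolding kap.simps(2)[of ?q, symmetric] by simp
qed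

definition std :: "nat => nat => nat => 'k::comm_ring_1 bcterm => 'k qm" where
  "std m p q x = wh [] (fq p x) (Ds q) \<star> wh (Us m) (kap q) []"

text \<open>Walled diagrams include zero morphisms between words of any shape, so the balance p = m
  + q belongs to the second alternative only.\<close>

definition standard :: "'k => nat => nat => nat => 'k::comm_ring_1 qm => bool" where
  "standard z m p q f \<longleftrightarrow> dlt z *\<^sub>q f = zrq (Us m) (Us p @ Ds q) \<or>
    (p = m + q \<and> (\<exists>x \<in> bcterms p 0. dlt z *\<^sub>q f = dlt z *\<^sub>q std m p q x))"

lemma standardD: "standard z m (m + q) q f ==> \<exists>x \<in> bcterms (m + q) 0. dlt z *\<^sub>q f = dlt z *\<^sub>q std m (m + q) q x"
  unfolding standard_def
proof (elim disjE)
  assume "dlt z *\<^sub>q f = zrq (Us m) (Us (m + q) @ Ds q)"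
  then show ?thesis by (intro bexI[of _ AZero]) (simp_all add: std_def wh_lin)
qed simp

lemma dlt_cmp: "dlt z *\<^sub>q f = dlt z *\<^sub>q f' ==> dlt z *\<^sub>q (G \<star> f) = dlt z *\<^sub>q (G \<star> f')"
  "dlt z *\<^sub>q f = dlt z *\<^sub>q f' ==> dlt z *\<^sub>q (f \<star> G) = dlt z *\<^sub>q (f' \<star> G)"
  "dlt z *\<^sub>q f = dlt z *\<^sub>q f' ==> dlt z *\<^sub>q wh A f B = dlt z *\<^sub>q wh A f' B"
  by (simp only: cmp_scl[symmetric], simp only: scl_cmp[symmetric], simp only: wh_lin[symmetric])

lemma standardI: "p = m + q ==> x \<in> bcterms p 0 ==> dlt z *\<^sub>q f = dlt z *\<^sub>q std m p q x ==> standard z m p q f"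
  unfolding standard_def by blast

lemma standard_cmp:
  assumes t: "dm G = Us p @ Ds q" "cd G = Us p' @ Ds q'" and f: "standard z m p q f" 
    and g: "\<And>x. p = m + q ==> x \<in> bcterms p 0 ==>
      p' = m + q' \<and> (\<exists>y \<in> bcterms p' 0. dlt z *\<^sub>q (G \<star> std m p q x) = dlt z *\<^sub>q std m p' q' y)"
  shows "standard z m p' q' (G \<star> f)"
  using f unfolding standard_def[of z m p q]
proof (elim disjE conjE bexE)
  assume "dlt z *\<^sub>q f = zrq (Us m) (Us p @ Ds q)"
  then have "dlt z *\<^sub>q (G \<star> f) = zrq (Us m) (Us p' @ Ds q')"
    by (simp only: cmp_scl[symmetric]) (simp add: t)
  then show ?thesis by (simp add: standard_def)
next
  fix x assume x: "p = m + q" "x \<in> bcterms p 0" "dlt z *\<^sub>q f = dlt z *\<^sub>q std m p q x"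
  then show ?thesis using g[OF x(1,2)] dlt_cmp(1)[OF x(3), of G] by (auto intro: standardI)
qed

lemma standard_pls: "standard z m p q f ==> standard z m p q g ==> dm f = Us m ==> dm g = Us m ==> cd f = Us p @ Ds q ==> cd g = Us p @ Ds q ==> standard z m p q (f \<oplus>\<^sub>q g)"
proof -
  assume t: "dm f = Us m" "dm g = Us m" "cd f = Us p @ Ds q" "cd g = Us p @ Ds q" and T: "standard z m p q f" "standard z m p q g"
  show ?thesis
  proof (cases "p = m + q")
    case True
    obtain x y where h: "x \<in> bcterms p 0" "y \<in> bcterms p 0" "dlt z *\<^sub>q f = dlt z *\<^sub>q std m p q x" "dlt z *\<^sub>q g = dlt z *\<^sub>q std m p q y"
      using standardD T unfolding True by metis
    have "dlt z *\<^sub>q (f \<oplus>\<^sub>q g) = dlt z *\<^sub>q std m p q (x \<boxplus> y)"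
      using h t by (simp add: scl_pls std_def wh_lin pls_cmp True)
    then show ?thesis using h True by (intro standardI[of p m q "x \<boxplus> y"]) auto
  next
    case False
    then show ?thesis using T t by (simp add: standard_def scl_pls pls_zrq)
  qed
qed

lemma standard_scl: "standard z m p q f ==> standard z m p q (c *\<^sub>q f)"
proof -
  assume T: "standard z m p q f"
  have c: "dlt z *\<^sub>q c *\<^sub>q g = (\<lambda>_. c z) *\<^sub>q dlt z *\<^sub>q g" for g
  proof -
    have "(\<lambda>w. dlt z w * c w) = (\<lambda>w. c z * dlt z w)" by (auto simp: dlt_def)
    then show ?thesis by simp
  qed
  show ?thesis using T unfolding standard_def[of z m p q f]
  proof (elim disjE conjE bexE)
    assume "dlt z *\<^sub>q f = zrq (Us m) (Us p @ Ds q)"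
    then show ?thesis unfolding standard_def c by simp
  next
    fix x assume x: "p = m + q" "x \<in> bcterms p 0" "dlt z *\<^sub>q f = dlt z *\<^sub>q std m p q x"
    then show ?thesis unfolding c
      by (intro standardI[of p m q "c z *\<^sub>a x"]) (simp_all add: c x(3) std_def wh_lin mult.commute del: scl_scl, simp add: mult.commute)
  qed
qed

lemma standard_u: "standard z m p q f ==> p = Suc (Suc (i + j)) ==> standard z m p q (wh (Us i) uq (Us j @ Ds q) \<star> f)"
proof (rule standard_cmp[of _ p q])
  assume p: "p = Suc (Suc (i + j))"
  fix x :: "'a bcterm" assume x: "p = m + q" "x \<in> bcterms p 0"
  have "wh (Us i) uq (Us j @ Ds q) \<star> std m p q x = std m p q (bt (Suc i) \<cdot> x)"
    unfolding p by (simp add: std_def cmp_assoc)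
  moreover have "bt (Suc i) \<cdot> x \<in> bcterms p 0" using x p by (simp add: bcgens_0)
  ultimately show "p = m + q \<and> (\<exists>y \<in> bcterms p 0. dlt z *\<^sub>q (wh (Us i) uq (Us j @ Ds q) \<star> std m p q x) = dlt z *\<^sub>q std m p q y)"
    using x by auto
qed simp_all

lemma standard_c: "standard z m p q f ==> p = Suc (i + j) ==> standard z m p q (wh (Us i) cq (Us j @ Ds q) \<star> f)"
proof (rule standard_cmp[of _ p q])
  assume p: "p = Suc (i + j)"
  fix x :: "'a bcterm" assume x: "p = m + q" "x \<in> bcterms p 0"
  have "wh (Us i) cq (Us j @ Ds q) \<star> std m p q x = std m p q (bp (Suc i) \<cdot> x)"
    unfolding p by (simp add: std_def cmp_assoc)
  moreover have "bp (Suc i) \<cdot> x \<in> bcterms p 0" using x p by (simp add: bcgens_0)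
  ultimately show "p = m + q \<and> (\<exists>y \<in> bcterms p 0. dlt z *\<^sub>q (wh (Us i) cq (Us j @ Ds q) \<star> std m p q x) = dlt z *\<^sub>q std m p q y)"
    using x by auto
qed simp_all

lemma standard_d: "standard z m p q f ==> q = Suc (Suc (i + j)) ==> standard z m p q (wh (Us p @ Ds i) dq (Ds j) \<star> f)"
proof (rule standard_cmp[of _ p q])
  assume q: "q = Suc (Suc (i + j))"
  fix x :: "'a bcterm" assume x: "p = m + q" "x \<in> bcterms p 0"
  have 1: "wh (Us p @ Ds i) dq (Ds j) \<star> wh [] (fq p x) (Ds q) = wh [] (fq p x) (Ds q) \<star> wh (Us p @ Ds i) dq (Ds j)"
    by (rule far[where C = "Ds i"]) (use x q in simp_all)
  have 2: "wh (Us p @ Ds i) dq (Ds j) \<star> wh (Us m) (kap q) [] = wh (Us (m + j)) uq (Us i @ Ds q) \<star> wh (Us m) (kap q :: 'a qm) []"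
    using arg_cong[OF kap_d[of i j], of "\<lambda>h. wh (Us m) (h :: 'a qm) []"] unfolding q[symmetric] x(1) by (simp del: kap.simps)
  have g: "bt (Suc (m + j)) \<in> bcterms p 0" using x q by (simp add: bcgens_0)
  have "fq p (bt (Suc (m + j))) = wh (Us (m + j)) (uq :: 'a qm) (Us i)" using x(1) q by (simp add: add.commute)
  then have "wh (Us p @ Ds i) dq (Ds j) \<star> std m p q x = std m p q (x \<cdot> bt (Suc (m + j)))"
    unfolding std_def by (simp add: ctail[OF 1] 2 cmp_assoc del: fq_simps(6))
  then show "p = m + q \<and> (\<exists>y \<in> bcterms p 0. dlt z *\<^sub>q (wh (Us p @ Ds i) dq (Ds j) \<star> std m p q x) = dlt z *\<^sub>q std m p q y)"
    using x g by (intro conjI bexI[of _ "x \<cdot> bt (Suc (m + j))"]) simp_all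
qed simp_all

lemma standard_cup: "standard z m p q f ==> standard z m (Suc p) (Suc q) (wh (Us p) cupq (Ds q) \<star> f)"
proof (rule standard_cmp[of _ p q])
  fix x :: "'a bcterm" assume x: "p = m + q" "x \<in> bcterms p 0"
  have 1: "wh (Us p) cupq (Ds q) \<star> wh [] (fq p x) (Ds q) = wh [] (fq p x) (\<up> # \<down> # Ds q) \<star> wh (Us p) cupq (Ds q)"
    by (rule far[where C = "[]"]) (use x in simp_all)
  have 2: "wh (Us m) (kap (Suc q)) [] = wh (Us p) cupq (Ds q) \<star> wh (Us m) (kap q :: 'a qm) []" using x(1) by simp
  have "wh (Us p) cupq (Ds q) \<star> std m p q x = std m (Suc p) (Suc q) x"
    unfolding std_def 2 ctail[OF 1] using fq_up[OF x(2)] by simp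
  then show "Suc p = m + Suc q \<and> (\<exists>y \<in> bcterms (Suc p) 0. dlt z *\<^sub>q (wh (Us p) cupq (Ds q) \<star> std m p q x) = dlt z *\<^sub>q std m (Suc p) (Suc q) y)"
    using x(1) aterms_up[OF x(2)] by auto
qed simp_all

text \<open>The cap and the innermost cup close the last strand of the word, and
  \<open>ptr_fq\<close> evaluates the result.\<close>

lemma standard_cap: "standard z m (Suc p) (Suc q) f ==> standard z m p q (wh (Us p) capRq (Ds q) \<star> f)"
proof (rule standard_cmp[of _ "Suc p" "Suc q"])
  fix x :: "'a bcterm" assume x: "Suc p = m + Suc q" "x \<in> bcterms (Suc p) 0"
  obtain y where y: "y \<in> bcterms p 0" "dlt z *\<^sub>q ptr p (fq (Suc p) x) = dlt z *\<^sub>q fq p y" using ptr_fq[OF x(2)] by blast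
  have p: "p = m + q" using x(1) by simp
  have 2: "wh (Us m) (kap (Suc q)) [] = wh (Us p) cupq (Ds q) \<star> wh (Us m) (kap q :: 'a qm) []" using p by simp
  have "wh (Us p) capRq (Ds q) \<star> std m (Suc p) (Suc q) x = wh [] (ptr p (fq (Suc p) x)) (Ds q) \<star> wh (Us m) (kap q) []"
    unfolding std_def 2 ptr_def by (simp add: cmp_assoc)
  then have "dlt z *\<^sub>q (wh (Us p) capRq (Ds q) \<star> std m (Suc p) (Suc q) x) = dlt z *\<^sub>q std m p q y"
    unfolding std_def[of m p q] using dlt_cmp(2)[OF dlt_cmp(3)[OF y(2)]] by simp
  then show "p = m + q \<and> (\<exists>y \<in> bcterms p 0. dlt z *\<^sub>q (wh (Us p) capRq (Ds q) \<star> std m (Suc p) (Suc q) x) = dlt z *\<^sub>q std m p q y)"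
    using p y(1) by blast
qed simp_all

lemma standard_gg: "walled p q p' q' G ==> dm f = Us m ==> cd f = Us p @ Ds q ==> standard z m p q f ==> standard z m p' q' (G \<star> f)"
proof (induction arbitrary: f rule: walled.induct)
  case (gzr p q p' q')
  then show ?case by (simp add: standard_def)
next
  case (gcmp p' q' p'' q'' F p q G)
  have "standard z m p'' q'' (F \<star> (G \<star> f))"
    by (rule gcmp.IH(1)) (use gcmp walled_typ[OF gcmp(2)] in auto)
  then show ?case by (simp add: cmp_assoc)
next
  case (gpls p q p' q' F G)
  then show ?case using walled_typ[OF gpls(1)] walled_typ[OF gpls(2)] by (simp add: pls_cmp standard_pls)
qed (simp_all add: idq_cmp' standard_u standard_c standard_d standard_cup standard_cap standard_scl)

theorem ev_std:
  assumes "qt f (Us m) (Us (m + q) @ Ds q)"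
  shows "\<exists>x \<in> bcterms (m + q) 0. dlt z *\<^sub>q ev f = dlt z *\<^sub>q std m (m + q) q x"
proof -
  have t: "dm (ev f) = Us m" "cd (ev f) = Us (m + q) @ Ds q" using ev_dm[OF assms] by auto
  have s: "srt (Us m) = (idq (Us m) :: 'a qm)" using srt_sorted[of m 0] by simp
  obtain G where G: "walled m 0 (m + q) q G" "srt (Us (m + q) @ Ds q) \<star> ev f = G \<star> srt (Us m)"
    using straight_ev[OF assms, of "[]" "[]"] unfolding straight_def t by (auto simp: t simp del: rep_simps)
  have "ev f = G" using G(2) walled_typ[OF G(1)] unfolding srt_sorted s by (simp add: idq_cmp' t del: rep_simps)
  moreover have "standard z m m 0 (idq (Us m))" by (rule standardI[of _ _ _ AOne]) (simp_all add: std_def idq_cmp')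
  then have "standard z m (m + q) q (G \<star> idq (Us m))" by (rule standard_gg[OF G(1), rotated 2]) simp_all
  ultimately have "standard z m (m + q) q (ev f)" using walled_typ[OF G(1)] by (simp add: idq_cmp')
  then show ?thesis by (rule standardD)
qed

section \<open>Comparison of the two actions\<close>

lemma mdom_defs [simp]: "mdom d_plus = [\<down>, \<down>]" "mcod d_plus = [\<down>, \<down>]" "mdom cap_R = [\<up>, \<down>]" "mcod cap_R = []"
    "mdom clif_down = [\<down>]" "mcod clif_down = [\<down>]" "mdom l_plus = [\<down>, \<up>]" "mcod l_plus = [\<up>, \<down>]"
  by (simp_all add: d_plus_def l_plus_def rot_def cap_R_def clif_down_def)

text \<open>The operators \<open>bcop\<close> are those of the images of the generators, in the
  position i = j = 0.\<close>

lemma mact_fterm: "x \<in> bcterms r s ==> mact (fterm r s x) 0 0 v = bcact r x v"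
proof (induction x arbitrary: v)
  case (AGen g)
  show ?case
  proof (cases g)
    case (BT i)
    then have "r - Suc i = r - Suc 0 - i" by simp
    then show ?thesis using BT by simp
  qed (simp_all add: mact_d_plus mact_clif_down cap_R_def)
qed simp_all

primrec kapt :: "nat => 'k qterm" where
  "kapt 0 = MId []"
| "kapt (Suc q) = MComp (MId (Us q) \<boxtimes> (cup_L \<boxtimes> MId (Ds q))) (kapt q)"

definition stdt :: "nat => nat => nat => 'k bcterm => 'k qterm" where
  "stdt m p q x = MComp (fterm p 0 x \<boxtimes> MId (Ds q)) (MId (Us m) \<boxtimes> kapt q)"

lemma ev_stdt: "ev (stdt m p q x) = std m p q x"
proof -
  have "ev (kapt q) = (kap q :: 'a qm)" by (induction q) (simp_all add: wh_def)
  then show ?thesis by (simp add: stdt_def std_def fq_def wh_def)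
qed

lemma stdt_typed: "x \<in> bcterms (m + q) 0 ==> qt (stdt m (m + q) q x) (Us m) (Us (m + q) @ Ds q)"
proof -
  assume x: "x \<in> bcterms (m + q) 0"
  have k: "qt (kapt q) [] (Us q @ Ds q)"
  proof (induction q)
    case (Suc q)
    have "qt (MId (Us q) \<boxtimes> (cup_L \<boxtimes> MId (Ds q))) (Us q @ Ds q) (Us (Suc q) @ Ds (Suc q))" by (intro qt_mwt) simp_all
    then show ?case using Suc typed.intros(4) by fastforce
  qed (simp add: typed.intros)
  have "qt (MId (Us m) \<boxtimes> kapt q) (Us m @ []) (Us m @ Us q @ Ds q)" by (intro typed.intros k)
  moreover have "qt (fterm (m + q) 0 x \<boxtimes> MId (Ds q)) (Us (m + q) @ Ds q) (Us (m + q) @ Ds q)"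
    using typed.intros(5)[OF fterm_typed[OF x] typed.intros(2)[of qsig "Ds q"]] by (simp del: rep_simps)
  ultimately show ?thesis unfolding stdt_def using typed.intros(4) by fastforce
qed

lemma mact_stdt: "x \<in> bcterms p 0 ==> mact (stdt m p q x) 0 0 (heps z) = bcact p x (heps z)"
proof -
  assume x: "x \<in> bcterms p 0"
  have "mact (kapt q) 0 0 (heps z) = heps z" by (induction q) (simp_all add: heps_comm(2))
  then show ?thesis by (simp add: stdt_def mact_fterm[OF x])
qed

lemma mact_ev:
  assumes "qt f X Y" "qt g X Y" "dlt z *\<^sub>q ev f = dlt z *\<^sub>q ev g" "v \<in> corner z"
  shows "mact f i j v = mact g i j v"
  using mact_mcong[OF ev_qc[OF assms(1,2), THEN iffD1, OF assms(3)] assms(4)] .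

lemma inj_ups:
  assumes f: "qt f (Us m) (Us (m + q) @ Ds q)" and g: "qt g (Us m) (Us (m + q) @ Ds q)"
    and eq: "mact f 0 0 (heps z) = mact g 0 0 (heps z)"
  shows "dlt z *\<^sub>q ev f = dlt z *\<^sub>q ev g"
proof -
  obtain x where x: "x \<in> bcterms (m + q) 0" "dlt z *\<^sub>q ev f = dlt z *\<^sub>q std m (m + q) q x" using ev_std[OF f] by blast
  obtain y where y: "y \<in> bcterms (m + q) 0" "dlt z *\<^sub>q ev g = dlt z *\<^sub>q std m (m + q) q y" using ev_std[OF g] by blast
  have "bcact (m + q) x (vacuum (m + q) 0 z) = bcact (m + q) y (vacuum (m + q) 0 z)"
    using mact_ev[OF f stdt_typed[OF x(1)] x(2)[folded ev_stdt] corner_eps, of 0 0]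
      mact_ev[OF g stdt_typed[OF y(1)] y(2)[folded ev_stdt] corner_eps, of 0 0] eq
    by (simp only: mact_stdt[OF x(1)] mact_stdt[OF y(1)] vacuum_0)
  from fq_acong[OF bcact_faithful[OF x(1) y(1) this]]
  have "dlt z *\<^sub>q fq (m + q) x = dlt z *\<^sub>q fq (m + q) y" .
  from dlt_cmp(2)[OF dlt_cmp(3)[OF this]] show ?thesis unfolding x(2) y(2) std_def .
qed

text \<open>The bijection \<open>Hom(\<down> \<otimes> W, Z) \<cong> Hom(W, \<up> \<otimes> Z)\<close>, iterated.\<close>

primrec bend :: "nat => nat => 'k qterm => 'k qterm" where
  "bend r 0 f = f"
| "bend r (Suc s) f = bend r s (MComp (MId [\<up>] \<boxtimes> f) (cup_L \<boxtimes> MId (Ds s @ Us r)))"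

lemma bend_step_typed: "qt f (Ds (Suc s) @ Us r) Z ==> qt (MComp (MId [\<up>] \<boxtimes> f) (cup_L \<boxtimes> MId (Ds s @ Us r))) (Ds s @ Us r) (\<up> # Z)"
proof -
  assume f: "qt f (Ds (Suc s) @ Us r) Z"
  have "qt (MId [\<up>] \<boxtimes> f) ([\<up>] @ Ds (Suc s) @ Us r) ([\<up>] @ Z)" by (intro typed.intros f)
  moreover have "qt (cup_L \<boxtimes> MId (Ds s @ Us r)) (Ds s @ Us r) ([\<up>] @ Ds (Suc s) @ Us r)" by (intro qt_mwt) simp_all
  ultimately show ?thesis using typed.intros(4) by fastforce
qed

lemma bend_typed: "qt f (Ds s @ Us r) Z ==> qt (bend r s f) (Us r) (Us s @ Z)"
proof (induction s arbitrary: f Z)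
  case (Suc s)
  from Suc.IH[OF bend_step_typed[OF Suc.prems]] show ?case by simp
qed simp

lemma mact_bend: "mact (bend r s f) 0 0 (heps z) = mact f 0 0 (vacuum r s z)"
proof (induction s arbitrary: f)
  case (Suc s)
  have "hl r * sh (vacuum r s z) = vacuum r (Suc s) z"
    by (simp add: vacuum_def shift.hom_mult heps_comm(2) mult.assoc[symmetric] heps_comm(1)[of "hl r"])
  then show ?case by (simp add: Suc)
qed (simp add: vacuum_0)

lemma bend_inj:
  assumes "qt f (Ds s @ Us r) Z" "qt g (Ds s @ Us r) Z" "dlt z *\<^sub>q ev (bend r s f) = dlt z *\<^sub>q ev (bend r s g)"
  shows "dlt z *\<^sub>q ev f = dlt z *\<^sub>q ev (g :: 'k::comm_ring_1 qterm)"
  using assms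
proof (induction s arbitrary: f g Z)
  case (Suc s)
  let ?b = "\<lambda>h. MComp (MId [\<up>] \<boxtimes> h) (cup_L \<boxtimes> MId (Ds s @ Us r)) :: 'k qterm"
  \<comment> \<open>A zigzag undoes one bend.\<close>
  have unbend: "wh [] capq Z \<star> wh [\<down>] (ev (?b h)) [] = ev h" if h: "qt h (Ds (Suc s) @ Us r) Z" for h
  proof -
    note t = ev_dm[OF h]
    have e: "ev (?b h) = wh [\<up>] (ev h) [] \<star> wh [] cupq (Ds s @ Us r)" by (simp add: wh_def idq_tns)
    have 1: "wh [] capq Z \<star> wh [\<down>, \<up>] (ev h) [] = wh [] (ev h) [] \<star> wh [] capq (Ds (Suc s) @ Us r)"
      using wh_far[of capq "ev h" "[]" "[]" "[]"] by (simp add: t)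
    have 2: "wh [] capq (Ds (Suc s) @ Us r) \<star> wh [\<down>] cupq (Ds s @ Us r) = (idq (Ds (Suc s) @ Us r) :: 'k qm)"
      by (subst zig) simp_all
    show ?thesis unfolding e using ctail[OF 1] 2 by (simp add: t idq_cmp')
  qed
  have "dlt z *\<^sub>q ev (?b f) = dlt z *\<^sub>q ev (?b g)"
    by (rule Suc.IH[OF bend_step_typed[OF Suc.prems(1)] bend_step_typed[OF Suc.prems(2)]]) (use Suc.prems(3) in simp)
  from dlt_cmp(1)[OF dlt_cmp(3)[OF this], of "wh [] capq Z" "[\<down>]" "[]"] show ?case
    unfolding unbend[OF Suc.prems(1)] unbend[OF Suc.prems(2)] .
qed simp

primrec lamt :: "nat => 'k qterm" where
  "lamt 0 = MId [\<up>]"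
| "lamt (Suc q) = MComp (l_plus \<boxtimes> MId (Ds q)) (MId [\<down>] \<boxtimes> lamt q)"

text \<open>Puts the downward strands of the domain first, as \<open>bend\<close> expects. It is
  built from \<open>l_plus\<close> and so acts as the identity on \<open>H\<close>.\<close>

primrec swt :: "nat => nat => 'k qterm" where
  "swt s 0 = MId (Ds s)"
| "swt s (Suc r) = MComp (MId [\<up>] \<boxtimes> swt s r) (lamt s \<boxtimes> MId (Us r))"

lemma lamt_wt: "mwt (lamt q :: 'k qterm) \<and> mdom (lamt q :: 'k qterm) = Ds q @ [\<up>] \<and> mcod (lamt q :: 'k qterm) = \<up> # Ds q"
proof (induction q)
  case (Suc q)
  have "mwt (l_plus :: 'k qterm)" by (simp add: l_plus_def rot_def)
  with Suc show ?case by simp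
qed simp

lemma swt_wt: "mwt (swt s r :: 'k qterm) \<and> mdom (swt s r :: 'k qterm) = Ds s @ Us r \<and> mcod (swt s r :: 'k qterm) = Us r @ Ds s"
proof (induction r)
  case (Suc r)
  then show ?case using lamt_wt[of s, where 'k = 'k] by simp
qed simp

lemma mact_swt: "mact (swt s r) i j v = v"
proof -
  have "mact (lamt q) i j v = v" for q i j and v :: "'a hcl" by (induction q arbitrary: i j) (simp_all add: mact_l_plus)
  then show ?thesis by (induction r arbitrary: i j) simp_all
qed

lemma ev_lamt: "ev (lamt q) = lam q"
  by (induction q) (simp_all add: wh_def ev_defs)

text \<open>A right inverse is enough, since \<open>swt\<close> is to be cancelled on the right of a
  composite.\<close>

lemma swt_inv: "\<exists>K. dm K = Us r @ Ds s \<and> cd K = Ds s @ Us r \<and> ev (swt s r) \<star> K = (idq (Us r @ Ds s) :: 'k::comm_ring_1 qm)"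
proof (induction r)
  case 0
  then show ?case by (intro exI[of _ "idq (Ds s)"]) (simp add: idq_cmp')
next
  case (Suc r)
  then obtain K where K: "dm K = Us r @ Ds s" "cd K = Ds s @ Us r" "ev (swt s r) \<star> K = (idq (Us r @ Ds s) :: 'k qm)" by blast
  have 1: "wh [] (lam s) (Us r) \<star> wh [] (lami s) (Us r) = (idq (\<up> # Ds s @ Us r) :: 'k qm)"
    using arg_cong[OF lam_lami(1), of "\<lambda>h. wh [] (h :: 'k qm) (Us r)"] by simp
  have 2: "wh [\<up>] (ev (swt s r)) [] \<star> wh [\<up>] K [] = (idq (\<up> # Us r @ Ds s) :: 'k qm)"
    using arg_cong[OF K(3), of "\<lambda>h. wh [\<up>] (h :: 'k qm) []"] by simp
  have e: "ev (swt s (Suc r)) = wh [\<up>] (ev (swt s r)) [] \<star> wh [] (lam s) (Us r)" by (simp add: wh_def ev_lamt)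
  show ?case unfolding e
    by (intro exI[of _ "wh [] (lami s) (Us r) \<star> wh [\<up>] K []"]) (simp add: K cmp_assoc ctail1[OF 1] 2)
qed

theorem mact_inj:
  assumes f: "qt f (Us r @ Ds s) (Us r @ Ds s)" and g: "qt g (Us r @ Ds s) (Us r @ Ds s)"
    and eq: "mact f 0 0 (vacuum r s z) = mact g 0 0 (vacuum r s z)"
  shows "qc (z :: 'k::comm_ring_1) (Us r @ Ds s) (Us r @ Ds s) f g"
proof -
  let ?f = "MComp f (swt s r)" and ?g = "MComp g (swt s r)"
  have w: "qt (swt s r :: 'k qterm) (Ds s @ Us r) (Us r @ Ds s)" using swt_wt[of s r, where 'k = 'k] by (intro qt_mwt) simp_all
  have t: "qt ?f (Ds s @ Us r) (Us r @ Ds s)" "qt ?g (Ds s @ Us r) (Us r @ Ds s)"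
    by (rule typed.intros(4)[OF f w] typed.intros(4)[OF g w])+
  have b: "qt (bend r s ?f) (Us r) (Us (r + s) @ Ds s)" "qt (bend r s ?g) (Us r) (Us (r + s) @ Ds s)"
    using bend_typed[OF t(1)] bend_typed[OF t(2)] by (simp_all add: replicate_swap[of s \<up> r, symmetric] append_assoc[symmetric] del: append_assoc)
  have "dlt z *\<^sub>q ev (bend r s ?f) = dlt z *\<^sub>q ev (bend r s ?g)"
    by (rule inj_ups[OF b]) (simp add: mact_bend mact_swt eq)
  from bend_inj[OF t this] have e: "dlt z *\<^sub>q (ev f \<star> ev (swt s r)) = dlt z *\<^sub>q (ev g \<star> ev (swt s r))" by simp
  obtain K where K: "ev (swt s r) \<star> K = (idq (Us r @ Ds s) :: 'k qm)" using swt_inv by blast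
  have "dlt z *\<^sub>q (ev f \<star> ev (swt s r) \<star> K) = dlt z *\<^sub>q (ev g \<star> ev (swt s r) \<star> K)"
    by (rule dlt_cmp(2)[OF e])
  then have "dlt z *\<^sub>q ev f = dlt z *\<^sub>q ev g"
    unfolding cmp_assoc K by (simp add: idq_cmp' ev_dm[OF f] ev_dm[OF g])
  then show ?thesis by (rule ev_qc[OF f g, THEN iffD1])
qed

section \<open>The isomorphism\<close>

text \<open>The bent morphism is a word on r + s upward strands applied to nested cups. So the value
  of \<open>f\<close> on the vacuum lies in \<open>heps z\<close> times the subalgebra on r + s
  strands, which the orbit contains.\<close>

lemma q_full:
  assumes f: "qt f (Us r @ Ds s) (Us r @ Ds s)"
  shows "\<exists>x \<in> bcterms r s. qc (z :: 'k::comm_ring_1) (Us r @ Ds s) (Us r @ Ds s) (fterm r s x) f"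
proof -
  let ?f = "bend r s (MComp f (swt s r))"
  have "qt (MComp f (swt s r)) (Ds s @ Us r) (Us r @ Ds s)"
    using swt_wt[of s r, where 'k = 'k] by (intro typed.intros(4)[OF f] qt_mwt) simp_all
  from bend_typed[OF this] have b: "qt ?f (Us r) (Us (r + s) @ Ds s)"
    by (simp add: replicate_swap[of s \<up> r, symmetric] append_assoc[symmetric] del: append_assoc)
  obtain y where y: "y \<in> bcterms (r + s) 0" "dlt z *\<^sub>q ev ?f = dlt z *\<^sub>q std r (r + s) s y" using ev_std[OF b] by blast
  have "mact f 0 0 (vacuum r s z) = mact ?f 0 0 (heps z)" by (simp add: mact_bend mact_swt)
  also have "\<dots> = bcact (r + s) y (heps z)"
    using mact_ev[OF b stdt_typed[OF y(1)] y(2)[folded ev_stdt] corner_eps] by (simp add: mact_stdt[OF y(1)])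
  also have "\<dots> = heps z * bcact (r + s) y 1"
    by (subst bcact_left[OF y(1)]) (rule heps_comm(1))
  also have "\<dots> \<in> orbit r s z" by (rule hsub_orbit[OF bcact_hsub[OF y(1)]])
  finally obtain x where x: "x \<in> bcterms r s" "mact f 0 0 (vacuum r s z) = bcact r x (vacuum r s z)"
    unfolding orbit_def by blast
  have "qc z (Us r @ Ds s) (Us r @ Ds s) (fterm r s x) f"
    by (rule mact_inj[OF fterm_typed[OF x(1)] f]) (simp add: mact_fterm[OF x(1)] x(2))
  with x(1) show ?thesis by blast
qed

lemma fterm_faithful:
  assumes x: "x \<in> bcterms r s" and y: "y \<in> bcterms r s"
  shows "qc z (Us r @ Ds s) (Us r @ Ds s) (fterm r s x) (fterm r s y) \<longleftrightarrow> (x, y) \<in> bccong r s z"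
proof
  assume "qc z (Us r @ Ds s) (Us r @ Ds s) (fterm r s x) (fterm r s y)"
  from mact_mcong[OF this vacuum_corner[of r s z], of 0 0]
  show "(x, y) \<in> bccong r s z"
    by (intro bcact_faithful[OF x y]) (simp add: mact_fterm x y)
next
  assume "(x, y) \<in> bccong r s z"
  from bcact_acong[OF this vacuum_corner[of r s z]]
  show "qc z (Us r @ Ds s) (Us r @ Ds s) (fterm r s x) (fterm r s y)"
    by (intro mact_inj fterm_typed x y) (simp add: mact_fterm x y)
qed

lemma fterm_homog: "ahomog bcpar p x ==> mhomog qsig p (fterm r s (x :: 'k bcterm))"
proof (induction rule: ahomog.induct)
  case (1 g)
  have "mhomog_ok qsig (fgen r s g :: 'k qterm) \<and> mdeg qsig (fgen r s g :: 'k qterm) = bcpar g"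
    by (cases g) (simp_all add: d_plus_def l_plus_def cap_R_def clif_down_def rot_def, simp_all add: qsig_def)
  then show ?case using mhomog_ok[of qsig "fgen r s g :: 'k qterm"] by simp
next
  case (4 p x q y)
  then show ?case unfolding fterm.simps by (intro mhomog.intros(4))
qed (simp_all add: mhomog.intros)

lemma q_equiv: "equiv {f. qt f X X} {(f, g). qc z X X f g}"
  by (rule equivI) (auto simp: refl_on_def sym_def trans_def dest: mcong_typed intro: mcong.refl mcong.sym mcong.trans)

lemma End_Q_ops:
  assumes "qt f X X" "qt g X X"
  shows "q_class z X f \<oplus>\<^bsub>End_Q z X\<^esub> q_class z X g = q_class z X (f \<uplus> g)"
    and "q_class z X f \<otimes>\<^bsub>End_Q z X\<^esub> q_class z X g = q_class z X (MComp f g)"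
    and "scal (End_Q z X) c (q_class z X f) = q_class z X (c *\<^sub>m f)"
  unfolding End_Q_def end_superalg_def q_class_def
  by (rule quotient_superalg_ops[OF q_equiv]; use assms in \<open>auto intro: mcong.add_cong mcong.comp_cong mcong.scale_cong\<close>)+

lemma End_Q_consts:
  "\<zero>\<^bsub>End_Q z X\<^esub> = q_class z X (MZero X X)" "\<one>\<^bsub>End_Q z X\<^esub> = q_class z X (MId X)"
  "carrier (End_Q z X) = q_class z X ` {f. qt f X X}"
  "part (End_Q z X) p = q_class z X ` {f. qt f X X \<and> mhomog qsig p f}"
  by (auto simp: End_Q_def end_superalg_def quotient_superalg_def q_class_def quotient_def)

lemma q_class_eq: "qt f X X ==> qt g X X ==> q_class z X f = q_class z X g \<longleftrightarrow> qc z X X f g"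
  unfolding q_class_def using eq_equiv_class_iff[OF q_equiv, of f X g z] by simp

theorem corollary4p8:
  fixes z :: "'k::comm_ring_1" and r s :: nat
  assumes "CHAR('k) \<noteq> 2"
  defines "X \<equiv> replicate r \<up> @ replicate s \<down>"
  shows "\<exists>\<phi> \<in> superalgebra_iso (BC r s z) (End_Q z X).
    (\<forall>i\<in>{1..<r}. \<phi> (bc_class r s z (bt i)) =
      q_class z X (id_up (i - 1) \<boxtimes> u_plus \<boxtimes> id_up (r - i - 1) \<boxtimes> id_down s)) \<and>
    (\<forall>i\<in>{1..<s}. \<phi> (bc_class r s z (bts i)) =
      q_class z X (id_up r \<boxtimes> id_down (i - 1) \<boxtimes> d_plus \<boxtimes> id_down (s - i - 1))) \<and>
    (r > 0 \<and> s > 0 \<longrightarrow> \<phi> (bc_class r s z be) =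
      q_class z X (id_up (r - 1) \<boxtimes> (cup_L \<bullet> cap_R) \<boxtimes> id_down (s - 1))) \<and>
    (\<forall>i\<in>{1..r}. \<phi> (bc_class r s z (bp i)) =
      q_class z X (id_up (i - 1) \<boxtimes> clif \<boxtimes> id_up (r - i) \<boxtimes> id_down s)) \<and>
    (\<forall>i\<in>{1..s}. \<phi> (bc_class r s z (bps i)) =
      q_class z X (id_up r \<boxtimes> id_down (i - 1) \<boxtimes> clif_down \<boxtimes> id_down (s - i)))"
proof -
  let ?A = "BC r s z" and ?B = "End_Q z X" and ?T = "bcterms r s :: 'k bcterm set"
  let ?a = "bc_class r s z" and ?b = "\<lambda>x. q_class z X (fterm r s x)"
  define \<phi> where "\<phi> C = ?b (SOME x. x \<in> ?T \<and> C = ?a x)" for C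
  have typed: "qt (fterm r s x) X X" if "x \<in> ?T" for x
    using fterm_typed[OF that] by (simp add: X_def)
  have iff: "?b x = ?b y \<longleftrightarrow> ?a x = ?a y" if "x \<in> ?T" "y \<in> ?T" for x y
    unfolding q_class_eq[OF typed[OF that(1)] typed[OF that(2)]] bc_class_eq[OF that]
    using fterm_faithful[OF that, of z] by (simp only: X_def)
  have \<phi>: "\<phi> (?a x) = ?b x" if x: "x \<in> ?T" for x
  proof -
    have "(SOME y. y \<in> ?T \<and> ?a x = ?a y) \<in> ?T \<and> ?a x = ?a (SOME y. y \<in> ?T \<and> ?a x = ?a y)"
      by (rule someI[of _ x]) (simp add: x)
    then show ?thesis using iff x unfolding \<phi>_def by metis
  qed
  have full: "\<exists>x \<in> ?T. q_class z X f = ?b x" if "qt f X X" for f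
    using q_full[of f r s z] that typed q_class_eq[of _ X f z] by (fastforce simp: X_def)
  have hom: "\<phi> \<in> Ring.ring_hom ?A ?B"
    by (rule ring_hom_memI) (auto simp: BC_consts End_Q_consts BC_ops \<phi> End_Q_ops typed X_def[symmetric])
  have inj: "inj_on \<phi> (carrier ?A)"
    by (auto simp: inj_on_def BC_consts \<phi> iff)
  have surj: "\<phi> ` carrier ?A = carrier ?B"
  proof
    show "\<phi> ` carrier ?A \<subseteq> carrier ?B" by (auto simp: BC_consts End_Q_consts \<phi> typed)
    show "carrier ?B \<subseteq> \<phi> ` carrier ?A"
    proof
      fix y assume "y \<in> carrier ?B"
      then obtain x where "x \<in> ?T" "y = ?b x" using full by (auto simp: End_Q_consts)
      then show "y \<in> \<phi> ` carrier ?A" by (auto simp: BC_consts \<phi>[symmetric])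
    qed
  qed
  have scal: "\<phi> (scal ?A c x) = scal ?B c (\<phi> x)" if xA: "x \<in> carrier ?A" for c x
  proof -
    obtain t where t: "t \<in> ?T" "x = ?a t" using xA by (auto simp: BC_consts)
    show ?thesis using t(1) unfolding t(2) BC_ops(3)[OF t(1) t(1)] by (simp add: \<phi> End_Q_ops(3)[OF typed typed])
  qed
  have sub: "\<phi> ` part ?A p \<subseteq> part ?B p" for p
    by (auto simp: BC_consts End_Q_consts \<phi> typed intro!: imageI fterm_homog)
  interpret A: superalgebra ?A by (rule BC_superalgebra)
  interpret B: superalgebra ?B by (rule End_Q_superalgebra)
  \<comment> \<open>A bijection that preserves parity also reflects it, because the decomposition
    into even and odd parts is unique in the target.\<close>
  have sup: "part ?B p \<subseteq> \<phi> ` part ?A p" for p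
  proof
    fix y assume y: "y \<in> part ?B p"
    then have yc: "y \<in> carrier ?B" using B.part_carrier by blast
    then obtain x where x: "x \<in> carrier ?A" "y = \<phi> x" using surj by blast
    then obtain a b where ab: "a \<in> part ?A 0" "b \<in> part ?A 1" "x = a \<oplus>\<^bsub>?A\<^esub> b" using A.part_decomp[OF x(1)] by auto
    have c: "a \<in> carrier ?A" "b \<in> carrier ?A" using ab A.part_carrier by blast+
    have d: "\<phi> a \<in> part ?B 0" "\<phi> b \<in> part ?B 1" "y = \<phi> a \<oplus>\<^bsub>?B\<^esub> \<phi> b"
      using ab sub ring_hom_add[OF hom c] x by auto
    have u: "u = u' \<and> v = v'" if "u \<in> part ?B 0" "v \<in> part ?B 1" "y = u \<oplus>\<^bsub>?B\<^esub> v"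
      "u' \<in> part ?B 0" "v' \<in> part ?B 1" "y = u' \<oplus>\<^bsub>?B\<^esub> v'" for u v u' v'
    proof -
      obtain w where w: "\<And>w'. (case w' of (a, b) \<Rightarrow> a \<in> part ?B 0 \<and> b \<in> part ?B 1 \<and> y = a \<oplus>\<^bsub>?B\<^esub> b) \<Longrightarrow> w' = w"
        using B.part_decomp[OF yc] by (elim ex1E) blast
      have "(u, v) = w" "(u', v') = w" using that by (intro w; simp)+
      then show ?thesis by auto
    qed
    show "y \<in> \<phi> ` part ?A p"
    proof (cases "p = 0")
      case True
      have "\<phi> a = y \<and> \<phi> b = \<zero>\<^bsub>?B\<^esub>" by (rule u[OF d]) (use y yc True B.part_zero in auto)
      then show ?thesis using ab True by auto
    next
      case False
      then have p: "p = 1" by simp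
      have "\<phi> a = \<zero>\<^bsub>?B\<^esub> \<and> \<phi> b = y" by (rule u[OF d]) (use y yc p B.part_zero in auto)
      then show ?thesis using ab p by auto
    qed
  qed
  have "\<phi> ` part ?A p = part ?B p" for p using sub sup by (rule equalityI)
  then have iso: "\<phi> \<in> superalgebra_iso ?A ?B"
    unfolding superalgebra_iso_def ring_iso_def bij_betw_def mem_Collect_eq
    by (intro conjI allI ballI hom inj surj scal A.superalgebra_axioms B.superalgebra_axioms)
  have gen: "\<phi> (?a (AGen g)) = q_class z X (fgen r s g)" if "g \<in> bcgens r s" for g
    using \<phi>[of "AGen g"] that by simp
  show ?thesis
    by (rule bexI[OF _ iso], intro conjI ballI impI; subst gen) (auto simp: bcgens_def)
qed

end
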